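(* Let $L>0$ and let $\gamma\in M_L$. Then there exists a family $(u_\varepsilon)_{\varepsilon>0}$ of smooth phase fields $u_\varepsilon:B_1(0)\to[-1,1]$ such that, as $\varepsilon\to0$, the diffuse interface measures $\mu_\varepsilon$ associated with $u_\varepsilon$ converge as Radon measures to $\mathcal{H}^1\lfloor\gamma([0,L])$, and such that for all $\varepsilon>0$ $$L_\varepsilon(u_\varepsilon)=L+R^{(L)}_\varepsilon,\qquad T_\varepsilon(u_\varepsilon)=2\pi+R^{(T)}_\varepsilon,\qquad \mathcal{B}_\varepsilon(u_\varepsilon)=\mathcal{B}(\gamma)+R^{(B)}_\varepsilon,$$ where $R^{(L)}_\varepsilon$ and $R^{(T)}_\varepsilon$ are exponentially small in $\varepsilon$ and $R^{(B)}_\varepsilon=O(\varepsilon^2)$ as $\varepsilon\to0$. In particular, $\mathcal{F}_\varepsilon(u_\varepsilon)\to\mathcal{B}(\gamma)$ as $\varepsilon\to0$ for any choice of exponents $\alpha,\beta>0$ in the definition of $\mathcal{F}_\varepsilon$.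
   Context: $B_1(0)\subset\mathbb{R}^2$ is the open unit disk. For $L>0$, $M_L$ is the set of closed and simple $C^2$-curves $\gamma:[0,L]\to B_1(0)$ with $|\gamma'|=1$ (closed meaning that $\gamma$ extends to an $L$-periodic $C^2$ map; simple meaning injective on $[0,L)$). Euler's elastica energy is $\mathcal{B}(\gamma)=\int_0^L|\gamma''(s)|^2\,ds$. $\mathcal{H}^1$ is one-dimensional Hausdorff measure. Let $W(r)=\frac14(1-r^2)^2$ and $c_0=\int_{-1}^1\sqrt{2W(s)}\,ds$. For $\varepsilon>0$, $\alpha,\beta>0$ and a phase field $u:B_1(0)\to\mathbb{R}$ set $$L_\varepsilon(u)=\frac1{c_0}\int_{B_1(0)}\Big(\frac\varepsilon2|\nabla u|^2+\frac1\varepsilon W(u)\Big)dx,$$ $$\mathcal{B}_\varepsilon(u)=\frac1{c_0}\int_{B_1(0)}\frac1\varepsilon\Big(-\varepsilon\Delta u+\frac1\varepsilon W'(u)\Big)^2dx,$$ $$T_\varepsilon(u)=\frac1{c_0}\int_{B_1(0)}\Big(-\varepsilon\Delta u+\frac1\varepsilon W'(u)\Big)|\nabla u|\,dx,$$ $$\mathcal{F}_\varepsilon(u)=\mathcal{B}_\varepsilon(u)+\varepsilon^{-\alpha}\big(L_\varepsilon(u)-L\big)^2+\varepsilon^{-\beta}\big(T_\varepsilon(u)-2\pi\big)^2.$$ The diffuse interface measure associated with $u_\varepsilon$ is $\mu_\varepsilon=\frac1{c_0}\big(\frac\varepsilon2|\nabla u_\varepsilon|^2+\frac1\varepsilon W(u_\varepsilon)\big)dx$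 on $B_1(0)$, extended by zero to $\mathbb{R}^2$. A quantity $R_\varepsilon$ is exponentially small in $\varepsilon$ if there are constants $C,c>0$ independent of $\varepsilon$ with $|R_\varepsilon|\le Ce^{-c/\varepsilon}$ for all sufficiently small $\varepsilon>0$. *)

theory Defs
  imports "HOL-Analysis.Analysis" "HOL-Library.Landau_Symbols"
begin

section \<open>Smooth functions, gradient and Laplacian\<close>

definition partial_deriv :: "'n::finite \<Rightarrow> (real^'n \<Rightarrow> real) \<Rightarrow> real^'n \<Rightarrow> real"
  where "partial_deriv i f x = deriv (\<lambda>t. f (x + t *\<^sub>R axis i 1)) 0"

definition grad :: "(real^'n::finite \<Rightarrow> real) \<Rightarrow> real^'n \<Rightarrow> real^'n"
  where "grad f x = (\<chi> i. partial_deriv i f x)"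

definition laplacian :: "(real^'n::finite \<Rightarrow> real) \<Rightarrow> real^'n \<Rightarrow> real"
  where "laplacian f x = (\<Sum>i\<in>UNIV. partial_deriv i (partial_deriv i f) x)"

text \<open>Intended for open \<open>S\<close> only: then the partial derivatives at a point of \<open>S\<close> are
  determined by the values of \<open>f\<close> on \<open>S\<close>.\<close>

primrec Ck_on :: "nat \<Rightarrow> (real^'n::finite) set \<Rightarrow> (real^'n \<Rightarrow> real) \<Rightarrow> bool"
  where
    "Ck_on 0 S f \<longleftrightarrow> continuous_on S f"
  | "Ck_on (Suc k) S f \<longleftrightarrow> f differentiable_on S \<and> (\<forall>i. Ck_on k S (partial_deriv i f))"

definition smooth_on :: "(real^'n::finite) set \<Rightarrow> (real^'n \<Rightarrow> real) \<Rightarrow> bool"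
  where "smooth_on S f \<longleftrightarrow> (\<forall>k. Ck_on k S f)"

section \<open>Closed simple curves and the elastica energy\<close>

definition C2_curve :: "(real \<Rightarrow> real^2) \<Rightarrow> bool"
  where "C2_curve g \<longleftrightarrow> (\<exists>g' g''.
    (\<forall>t. (g has_vector_derivative g' t) (at t)) \<and>
    (\<forall>t. (g' has_vector_derivative g'' t) (at t)) \<and>
    continuous_on UNIV g'')"

definition closed_C2_curve :: "real \<Rightarrow> (real \<Rightarrow> real^2) \<Rightarrow> bool"
  where "closed_C2_curve L \<gamma> \<longleftrightarrow>
    (\<exists>g. C2_curve g \<and> (\<forall>t. g (t + L) = g t) \<and> (\<forall>t\<in>{0..L}. g t = \<gamma> t))"

text \<open>Curves are functions on \<open>[0,L]\<close>: the values of \<open>\<gamma>\<close> elsewhere are irrelevant, so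
  derivatives are taken within \<open>[0,L]\<close> (one-sided at the end points).\<close>

definition curve_deriv :: "real \<Rightarrow> (real \<Rightarrow> real^2) \<Rightarrow> real \<Rightarrow> real^2"
  where "curve_deriv L \<gamma> s = vector_derivative \<gamma> (at s within {0..L})"

definition M_curves :: "real \<Rightarrow> (real \<Rightarrow> real^2) set"
  where "M_curves L = {\<gamma>. \<gamma> ` {0..L} \<subseteq> ball 0 1 \<and> closed_C2_curve L \<gamma> \<and>
    inj_on \<gamma> {0..<L} \<and> (\<forall>s\<in>{0..L}. norm (curve_deriv L \<gamma> s) = 1)}"

definition elastica_energy :: "real \<Rightarrow> (real \<Rightarrow> real^2) \<Rightarrow> real"
  where "elastica_energy L \<gamma> =
    (LINT s:{0..L}|lborel. (norm (curve_deriv L (curve_deriv L \<gamma>) s))\<^sup>2)"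

section \<open>Diffuse interface energies\<close>

definition W :: "real \<Rightarrow> real"
  where "W r = 1/4 * (1 - r\<^sup>2)\<^sup>2"

definition c0 :: real
  where "c0 = (LINT s:{-1..1}|lborel. sqrt (2 * W s))"

definition interface_density :: "real \<Rightarrow> (real^2 \<Rightarrow> real) \<Rightarrow> real^2 \<Rightarrow> real"
  where "interface_density \<epsilon> u x = \<epsilon>/2 * (norm (grad u x))\<^sup>2 + 1/\<epsilon> * W (u x)"

definition chem_pot :: "real \<Rightarrow> (real^2 \<Rightarrow> real) \<Rightarrow> real^2 \<Rightarrow> real"
  where "chem_pot \<epsilon> u x = - \<epsilon> * laplacian u x + 1/\<epsilon> * deriv W (u x)"

definition bending_density :: "real \<Rightarrow> (real^2 \<Rightarrow> real) \<Rightarrow> real^2 \<Rightarrow> real"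
  where "bending_density \<epsilon> u x = 1/\<epsilon> * (chem_pot \<epsilon> u x)\<^sup>2"

definition turning_density :: "real \<Rightarrow> (real^2 \<Rightarrow> real) \<Rightarrow> real^2 \<Rightarrow> real"
  where "turning_density \<epsilon> u x = chem_pot \<epsilon> u x * norm (grad u x)"

definition L_eps :: "real \<Rightarrow> (real^2 \<Rightarrow> real) \<Rightarrow> real"
  where "L_eps \<epsilon> u = 1/c0 * (LINT x:ball 0 1|lborel. interface_density \<epsilon> u x)"

definition B_eps :: "real \<Rightarrow> (real^2 \<Rightarrow> real) \<Rightarrow> real"
  where "B_eps \<epsilon> u = 1/c0 * (LINT x:ball 0 1|lborel. bending_density \<epsilon> u x)"

definition T_eps :: "real \<Rightarrow> (real^2 \<Rightarrow> real) \<Rightarrow> real"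
  where "T_eps \<epsilon> u = 1/c0 * (LINT x:ball 0 1|lborel. turning_density \<epsilon> u x)"

text \<open>The Bochner integral of a non-integrable function is \<open>0\<close>, so finiteness of the
  energies has to be recorded separately.\<close>

definition finite_energies :: "real \<Rightarrow> (real^2 \<Rightarrow> real) \<Rightarrow> bool"
  where "finite_energies \<epsilon> u \<longleftrightarrow>
    set_integrable lborel (ball 0 1) (interface_density \<epsilon> u) \<and>
    set_integrable lborel (ball 0 1) (bending_density \<epsilon> u) \<and>
    set_integrable lborel (ball 0 1) (turning_density \<epsilon> u)"

definition F_eps :: "real \<Rightarrow> real \<Rightarrow> real \<Rightarrow> real \<Rightarrow> (real^2 \<Rightarrow> real) \<Rightarrow> real"
  where "F_eps \<alpha> \<beta> L \<epsilon> u = B_eps \<epsilon> u + \<epsilon> powr (-\<alpha>) * (L_eps \<epsilon> u - L)\<^sup>2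
    + \<epsilon> powr (-\<beta>) * (T_eps \<epsilon> u - 2 * pi)\<^sup>2"

definition interface_measure :: "real \<Rightarrow> (real^2 \<Rightarrow> real) \<Rightarrow> (real^2) measure"
  where "interface_measure \<epsilon> u =
    density lborel (\<lambda>x. ennreal (indicator (ball 0 1) x * (1/c0 * interface_density \<epsilon> u x)))"

section \<open>One-dimensional Hausdorff measure and convergence of Radon measures\<close>

text \<open>\<open>diameter\<close> is only meaningful for bounded sets.\<close>

definition hausdorff1_content :: "real \<Rightarrow> 'a::metric_space set \<Rightarrow> ennreal"
  where "hausdorff1_content \<delta> A =
    (INF C\<in>{C :: nat \<Rightarrow> 'a set. A \<subseteq> (\<Union>i. C i) \<and> (\<forall>i. bounded (C i) \<and> diameter (C i) \<le> \<delta>)}.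
      \<Sum>i. ennreal (diameter (C i)))"

definition hausdorff1_outer :: "'a::metric_space set \<Rightarrow> ennreal"
  where "hausdorff1_outer A = (SUP \<delta>\<in>{0<..}. hausdorff1_content \<delta> A)"

text \<open>As a metric outer measure, \<^const>\<open>hausdorff1_outer\<close> is countably additive on the Borel
  sets, so \<^const>\<open>measure_of\<close> does not fall back to the null measure here.\<close>

definition hausdorff1 :: "'a::metric_space measure"
  where "hausdorff1 = measure_of UNIV (sets borel) hausdorff1_outer"

definition restrict_measure :: "'a measure \<Rightarrow> 'a set \<Rightarrow> 'a measure"
  where "restrict_measure M A = density M (indicator A)"

text \<open>On a locally compact separable metric space, every locally finite Borel measure is
  Radon.\<close>

definition radon_measure :: "'a::{heine_borel} measure \<Rightarrow> bool"
  where "radon_measure M \<longleftrightarrow>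
    sets M = sets borel \<and> (\<forall>K. compact K \<longrightarrow> emeasure M K < \<infinity>)"

definition radon_converges ::
    "('b \<Rightarrow> 'a::{heine_borel} measure) \<Rightarrow> 'a measure \<Rightarrow> 'b filter \<Rightarrow> bool"
  where "radon_converges \<mu> M F \<longleftrightarrow>
    (\<forall>\<^sub>F \<epsilon> in F. radon_measure (\<mu> \<epsilon>)) \<and> radon_measure M \<and>
    (\<forall>f :: 'a \<Rightarrow> real. continuous_on UNIV f \<and> compact (closure {x. f x \<noteq> 0}) \<longrightarrow>
      ((\<lambda>\<epsilon>. \<integral>x. f x \<partial>(\<mu> \<epsilon>)) \<longlongrightarrow> (\<integral>x. f x \<partial>M)) F)"

definition exponentially_small :: "(real \<Rightarrow> real) \<Rightarrow> bool"
  where "exponentially_small R \<longleftrightarrow>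
    (\<exists>C>0. \<exists>c>0. \<forall>\<^sub>F \<epsilon> in at_right 0. \<bar>R \<epsilon>\<bar> \<le> C * exp (- c / \<epsilon>))"

end

theory Submission
  imports Defs "HOL-Complex_Analysis.Complex_Analysis" "HOL-Real_Asymp.Real_Asymp"
begin

no_notation fps_nth (infixl "$" 75)

text \<open>Let \<open>d\<close> be the signed distance to the curve and let \<open>q\<close> be the profile \<open>tanh (r / (\<surd>2 \<epsilon>))\<close>, cut off
  so that it equals \<open>\<plusminus>1\<close> away from \<open>0\<close>, which costs exponentially small errors only. In the tubular
  coordinates \<open>(s, r)\<close>, whose Jacobian is \<open>1 - \<kappa>(s) r\<close>, the three energies of \<open>q(d)\<close> become iterated
  one-dimensional integrals. As the profile is odd, the terms of first order in \<open>r\<close> vanish: length and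
  turning are exact up to the profile errors, where \<open>\<integral> \<kappa> = \<plusminus>2\<pi>\<close> by Hopf's Umlaufsatz fixes the sign with
  which \<open>q\<close> is used, and the bending energy is off by a second moment of the profile, which is of
  order \<open>\<epsilon>\<^sup>2\<close>. Since \<open>\<gamma>\<close> is \<open>C\<^sup>2\<close> only, so is \<open>q(d)\<close>. Convolution with the polynomial Landau kernels
  yields polynomials whose derivatives up to order two converge boundedly and pointwise on the disk, so one
  of them has the same energies up to \<open>exp (- 1 / \<epsilon>)\<close>. The limit measure is the arc length, which is
  identified with the Hausdorff measure of the curve.\<close>

section \<open>The Umlaufsatz\<close>

text \<open>Only the turning energy sees the orientation: its density contains the unsigned slope
  \<open>norm (grad u)\<close>, so the profile enters as \<open>q' * |q'|\<close>; length and
  bending are even in \<open>q\<close>. The curvature enters the chemical potential as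
  \<open>\<epsilon> q' \<kappa> / (1 - \<kappa> r)\<close>. The turning energy contains this once,
  and the Jacobian cancels the denominator exactly. The bending energy contains its square, one
  denominator survives, and its expansion leaves the error of order \<open>\<epsilon>^2\<close>. The
  tubular map is only C^1, since the normal is, so inverting it does not by itself make
  \<open>d\<close> a C^2 function. The missing derivative comes from the gradient of
  \<open>d\<close> being the normal at the foot point, again C^1 in tubular coordinates. The two
  sides of the curve must be told apart globally, so that the constants 1 and -1 fit together away
  from the tube. One side contains the complement of the disk; after subtraction of a constant the
  field vanishes there, and this makes the convolutions polynomial on the disk. At each fixed
  \<open>\<epsilon>\<close> the smoothing tolerance is free, so bounded pointwise convergence
  suffices.\<close>

lemma has_vector_derivative_periodic:
  fixes f :: "real \<Rightarrow> 'a::real_normed_vector"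
  assumes d: "\<And>t. (f has_vector_derivative f' t) (at t)" and per: "\<And>t. f (t + L) = f t"
  shows "f' (t + L) = f' t"
proof -
  have "((\<lambda>t. t + L) has_vector_derivative 1) (at t)" by (auto intro!: derivative_eq_intros)
  from vector_diff_chain_at[OF this d[of "t + L"]]
  have "(f has_vector_derivative f' (t + L)) (at t)" by (simp add: o_def per)
  then show ?thesis using d vector_derivative_unique_at by blast
qed

lemma periodic_int:
  fixes L :: real
  assumes "\<And>t. f (t + L) = f t" shows "f (t + of_int k * L) = f t"
proof -
  have nat: "f (t + of_nat n * L) = f t" for t n
  proof (induction n)
    case (Suc n)
    then show ?case using assms[of "t + of_nat n * L"] by (simp add: algebra_simps)
  qed simp
  show ?thesis
  proof (cases "k \<ge> 0")
    case True
    then show ?thesis using nat[of t "nat k"] by simp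
  next
    case False
    then show ?thesis using nat[of "t + of_int k * L" "nat (- k)"] by simp
  qed
qed

lemma shift_into_period:
  fixes L :: real
  assumes "L > 0"
  obtains k :: int where "a \<le> t + of_int k * L" "t + of_int k * L < a + L"
proof
  define k where "k = - \<lfloor>(t - a) / L\<rfloor>"
  have "of_int (- k) \<le> (t - a) / L" "(t - a) / L < of_int (- k) + 1" unfolding k_def by linarith+
  then show "a \<le> t + of_int k * L" "t + of_int k * L < a + L"
    using assms by (auto simp: field_simps)
qed

text \<open>Pulled back to the parameter interval, \<open>1 / w\<close> becomes the constant
  \<open>i (b - a)\<close>. The arc need not close up, so fractions of a turn are counted, as the
  half turns below require.\<close>

lemma winding_number_part_circlepath_centre:
  assumes "r > 0"
  shows "winding_number (part_circlepath 0 r a b) 0 = complex_of_real ((b - a) / (2 * pi))"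
proof -
  have nz: "0 \<notin> path_image (part_circlepath 0 r a b)"
    using assms by (auto simp: path_image_def part_circlepath_def)
  have "((\<lambda>w. 1 / (w - 0)) has_contour_integral (\<i> * (b - a))) (part_circlepath 0 r a b)"
    unfolding has_contour_integral_def
  proof (rule has_integral_eq)
    show "((\<lambda>x::real. \<i> * of_real (b - a)) has_integral \<i> * (b - a)) {0..1}"
      using has_integral_const_real[of "\<i> * (complex_of_real b - a)" 0 1] by simp
    fix x :: real assume x: "x \<in> {0..1}"
    show "\<i> * of_real (b - a) = 1 / (part_circlepath 0 r a b x - 0) *
         vector_derivative (part_circlepath 0 r a b) (at x within {0..1})"
    proof -
      have "part_circlepath 0 r a b x = r * exp (\<i> * linepath a b x)"
        by (simp add: part_circlepath_def)
      then show ?thesis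
        using assms x by (simp add: vector_derivative_part_circlepath01 field_simps)
    qed
  qed
  then have "contour_integral (part_circlepath 0 r a b) (\<lambda>w. 1 / (w - 0)) = \<i> * (b - a)"
    by (rule contour_integral_unique)
  then show ?thesis
    unfolding winding_number_valid_path[OF valid_path_part_circlepath nz] by simp
qed

text \<open>The integral over the window \<open>[x, x + L]\<close> has derivative
  \<open>f (x + L) - f x = 0\<close> in \<open>x\<close>, so it does not depend on the
  window.\<close>

lemma has_integral_periodic_shift:
  fixes f :: "real \<Rightarrow> 'a::euclidean_space"
  assumes cont: "continuous_on UNIV f" and per: "\<And>t. f (t + L) = f t" and L: "L \<ge> 0"
    and int: "((\<lambda>t. f (t + a)) has_integral I) {0..L}"
  shows "(f has_integral I) {0..L}"
proof -
  have cI: "f integrable_on {x..y}" for x y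
    by (rule integrable_continuous_real) (rule continuous_on_subset[OF cont], simp)
  \<comment> \<open>A base point of the primitive to the left of both \<open>0\<close> and
    \<open>a\<close>: both windows then lie where \<open>G\<close> is differentiable.\<close>
  define m where "m = min 0 a - 1"
  define G where "G x = integral {m..x} f" for x
  have dG: "(G has_vector_derivative f x) (at x)" if "x > m" for x
  proof -
    have "(G has_vector_derivative f x) (at x within {m..x+1})"
      unfolding G_def
      by (rule integral_has_vector_derivative) (use that in \<open>auto intro: continuous_on_subset[OF cont]\<close>)
    then show ?thesis
      using that at_within_interior[of x "{m..x+1}"] by simp
  qed
  define D where "D x = G (x + L) - G x" for x
  have "(D has_vector_derivative 0) (at x within {m<..})" if "x \<in> {m<..}" for x
  proof -
    have 1: "((\<lambda>x. G (x + L)) has_vector_derivative f (x + L)) (at x)"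
    proof -
      have "((\<lambda>x. x + L) has_vector_derivative 1) (at x)"
        by (auto intro!: derivative_eq_intros)
      from vector_diff_chain_at[OF this dG[of "x + L"]] show ?thesis
        using that L by (simp add: o_def)
    qed
    have "(D has_vector_derivative (f (x + L) - f x)) (at x)"
      unfolding D_def by (intro has_vector_derivative_diff 1 dG) (use that in auto)
    then show ?thesis using per by (simp add: has_vector_derivative_at_within)
  qed
  then obtain c where c: "\<And>x. x \<in> {m<..} \<Longrightarrow> D x = c"
    using has_vector_derivative_zero_constant[of "{m<..}" D] by (metis convex_real_interval(3))
  have D: "D a = D 0" using c[of a] c[of 0] by (simp add: m_def)
  have GG: "G y - G x = integral {x..y} f" if "m \<le> x" "x \<le> y" for x y
    unfolding G_def using Henstock_Kurzweil_Integration.integral_combine[OF that cI] by (simp add: algebra_simps)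
  have "integral {a..a+L} f = integral {0..L} f"
    using D GG[of 0 L] GG[of a "a + L"] L by (simp add: D_def m_def)
  moreover have "((\<lambda>t. f (t + a)) has_integral integral {a..a+L} f) {0..L}"
    using has_integral_shift_Icc_real[of f a "integral {a..a + L} f" 0 L] cI[of a "a+L"]
    by (simp add: o_def add.commute integrable_integral)
  ultimately have "I = integral {0..L} f"
    using int has_integral_unique by blast
  then show ?thesis using cI by (simp add: has_integral_integral)
qed

text \<open>The path stays in a closed half plane, and the comparison half circle, apart from its
  end points, in the open one. A segment joining the two can therefore meet \<open>0\<close> only on
  the path itself, so the straight-line homotopy avoids \<open>0\<close>.\<close>

lemma winding_number_half_turn:
  fixes x \<theta> :: real
  assumes p: "path p" "0 \<notin> path_image p" "pathstart p = of_real x" "pathfinish p = - of_real x"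
    and \<theta>: "\<theta> = 1 \<or> \<theta> = -1" and half: "\<And>t. t \<in> {0..1} \<Longrightarrow> \<theta> * Im (p t) \<ge> 0"
  shows "winding_number p 0 = complex_of_real (\<theta> * sgn x / 2)"
proof -
  have x: "x \<noteq> 0" using p pathstart_in_path_image[of p] by auto
  \<comment> \<open>\<open>\<alpha>\<close> is the argument of \<open>x\<close>. From a positive
    \<open>x\<close> the way through the upper half plane is counterclockwise, from a negative one
    clockwise; hence the product \<open>\<theta> * sgn x\<close> in the arc.\<close>
  define \<alpha> where "\<alpha> = (if x > 0 then 0 else pi)"
  define q where "q = part_circlepath 0 \<bar>x\<bar> \<alpha> (\<alpha> + \<theta> * sgn x * pi)"
  have q: "q t = of_real \<bar>x\<bar> * cis (\<alpha> + t * (\<theta> * sgn x * pi))" for t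
    by (simp add: q_def part_circlepath_def cis_conv_exp linepath_def algebra_simps)
  have q0: "q 0 = of_real x" using x by (auto simp: q \<alpha>_def complex_eq_iff)
  have q1: "q 1 = - of_real x" using x \<theta> by (auto simp: q \<alpha>_def complex_eq_iff sgn_if)
  have Imq: "\<theta> * Im (q t) = \<bar>x\<bar> * sin (pi * t)" for t
    using x \<theta> by (auto simp: q \<alpha>_def sgn_if mult.commute)
  have "homotopic_paths (-{0}) p q"
  proof (rule homotopic_paths_linear)
    show "path p" by fact
    show "path q" by (simp add: q_def)
    show "pathstart q = pathstart p" "pathfinish q = pathfinish p"
      using q0 q1 p by (auto simp: pathstart_def pathfinish_def)
    fix t :: real assume t: "t \<in> {0..1}"
    have pt: "p t \<noteq> 0" using p(2) t by (auto simp: path_image_def)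
    show "closed_segment (p t) (q t) \<subseteq> - {0}"
    proof (cases "t = 0 \<or> t = 1")
      case True
      then have "p t = q t" using q0 q1 p by (auto simp: pathstart_def pathfinish_def)
      with pt show ?thesis by auto
    next
      case False
      with t have "sin (pi * t) > 0" by (intro sin_gt_zero) auto
      with x have pos: "\<theta> * Im (q t) > 0" by (simp add: Imq)
      have False if "0 = (1 - u) *\<^sub>R p t + u *\<^sub>R q t" "0 \<le> u" "u \<le> 1" for u
      proof -
        have "0 = Im ((1 - u) *\<^sub>R p t + u *\<^sub>R q t)" using that(1) by (metis zero_complex.simps(2))
        then have "0 = (1 - u) * Im (p t) + u * Im (q t)" by simp
        then have "0 = (1 - u) * (\<theta> * Im (p t)) + u * (\<theta> * Im (q t))"
          using \<theta> by auto
        moreover have "(1 - u) * (\<theta> * Im (p t)) \<ge> 0" using half[OF t] that by simp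
        moreover have "u * (\<theta> * Im (q t)) \<ge> 0" using pos that by simp
        ultimately have "u * (\<theta> * Im (q t)) = 0" by linarith
        then have "u = 0" using pos by auto
        with that(1) pt show False by auto
      qed
      then show ?thesis by (auto simp: closed_segment_def)
    qed
  qed
  then have "winding_number p 0 = winding_number q 0" by (rule winding_number_homotopic_paths)
  also have "\<dots> = complex_of_real (\<theta> * sgn x / 2)"
    using x unfolding q_def by (subst winding_number_part_circlepath_centre) auto
  finally show ?thesis .
qed

text \<open>Hopf's argument: the tangent loop is the diagonal of the triangle \<open>0 \<le> s \<le> t \<le> L\<close> under the
  rescaled secant map, and the two legs of the triangle are half turns because the curve starts at
  a lowest point.\<close>

lemma umlaufsatz_lowest_base_point:
  fixes c c' c'' :: "real \<Rightarrow> complex"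
  assumes L: "L > 0" and d1: "\<And>t. (c has_vector_derivative c' t) (at t)"
    and d2: "\<And>t. (c' has_vector_derivative c'' t) (at t)" and cont: "continuous_on UNIV c''"
    and per: "\<And>t. c (t + L) = c t" and inj: "inj_on c {0..<L}" and nz: "\<And>t. c' t \<noteq> 0"
    and low: "\<And>t. Im (c 0) \<le> Im (c t)"
  shows "\<exists>\<sigma>\<in>{1, -1 :: real}. ((\<lambda>t. c'' t / c' t) has_integral (2 * pi * \<sigma> * \<i>)) {0..L}"
proof -
  have contc': "continuous_on A c'" for A
    using d2 by (meson continuous_at_imp_continuous_on has_vector_derivative_continuous)+
  \<comment> \<open>The difference quotient as a mean of \<open>c'\<close> along the parameter
    interval: no division, so it stays continuous on the diagonal, where it equals
    \<open>c'\<close>.\<close>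
  define Q where "Q a b = integral (cbox 0 1) (\<lambda>\<tau>. c' (a + \<tau> * (b - a)))" for a b :: real
  have Qeq: "of_real (b - a) * Q a b = c b - c a" for a b
  proof -
    have "((\<lambda>\<tau>. (b - a) *\<^sub>R c' (a + \<tau> * (b - a))) has_integral
        (c (a + 1 * (b - a)) - c (a + 0 * (b - a)))) {0..1}"
    proof (rule fundamental_theorem_of_calculus)
      fix x :: real
      have "((\<lambda>\<tau>. a + \<tau> * (b - a)) has_vector_derivative (b - a)) (at x)"
        by (auto intro!: derivative_eq_intros)
      from vector_diff_chain_at[OF this d1]
      show "((\<lambda>\<tau>. c (a + \<tau> * (b - a))) has_vector_derivative (b - a) *\<^sub>R c' (a + x * (b - a)))
          (at x within {0..1})"
        by (simp add: o_def has_vector_derivative_at_within)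
    qed simp
    then have "integral {0..1} (\<lambda>\<tau>. (b - a) *\<^sub>R c' (a + \<tau> * (b - a))) =
        c (a + 1 * (b - a)) - c (a + 0 * (b - a))"
      by (rule integral_unique)
    then show ?thesis by (simp add: Q_def scaleR_conv_of_real)
  qed
  have Qdiag: "Q a a = c' a" for a
    by (simp add: Q_def)
  have "continuous_on UNIV (\<lambda>z. integral (cbox 0 1) (\<lambda>\<tau>. c' (fst z + \<tau> * (snd z - fst z))))"
    by (rule integral_continuous_on_param)
       (auto simp: case_prod_unfold intro!: continuous_intros continuous_on_compose2[OF contc'[of UNIV]])
  then have contQ: "continuous_on UNIV (\<lambda>z. Q (fst z) (snd z))" by (simp add: Q_def)
  have contQ': "continuous_on A (\<lambda>z. Q (u z) (v z))"
    if "continuous_on A u" "continuous_on A v" for A :: "(real \<times> real) set" and u v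
    using continuous_on_compose2[OF contQ, of A "\<lambda>z. (u z, v z)"] that
    by (auto intro!: continuous_intros)
  \<comment> \<open>The secant \<open>c t - c s\<close> divided by
    \<open>(t - s) * (L - (t - s))\<close>, which vanishes at both places of \<open>T\<close> where
    the secant does: the diagonal and the corner \<open>(0, L)\<close>. Each branch is regular near
    one of them, the second one thanks to periodicity; off these places both equal the quotient
    (\<open>Fsec\<close>).\<close>
  define F where "F z = (if snd z - fst z \<le> L / 2
      then Q (fst z) (snd z) / of_real (L - (snd z - fst z))
      else - Q (snd z - L) (fst z) / of_real (snd z - fst z))" for z
  have Fsec: "F z = (c (snd z) - c (fst z)) / of_real ((snd z - fst z) * (L - (snd z - fst z)))"
    if "snd z - fst z \<noteq> 0" "snd z - fst z \<noteq> L" for z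
  proof -
    have 1: "Q (fst z) (snd z) = (c (snd z) - c (fst z)) / of_real (snd z - fst z)"
      using Qeq[of "snd z" "fst z"] that by (metis eq_iff_diff_eq_0 nonzero_mult_div_cancel_left of_real_eq_0_iff)
    have "of_real (L - (snd z - fst z)) * Q (snd z - L) (fst z) = c (fst z) - c (snd z)"
      using Qeq[of "fst z" "snd z - L"] per[of "snd z - L"] by (simp add: algebra_simps)
    then have 2: "Q (snd z - L) (fst z) = (c (fst z) - c (snd z)) / of_real (L - (snd z - fst z))"
      using that by (metis eq_iff_diff_eq_0 nonzero_mult_div_cancel_left of_real_eq_0_iff)
    show ?thesis
      unfolding F_def 1 2 by (auto simp: minus_divide_left mult.commute)
  qed
  have contF: "continuous_on UNIV F"
    unfolding F_def
  proof (rule continuous_on_cases_le)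
    show "continuous_on {z \<in> UNIV. snd z - fst z \<le> L / 2}
        (\<lambda>z. Q (fst z) (snd z) / of_real (L - (snd z - fst z)))"
      using L by (auto intro!: continuous_intros contQ' simp flip: of_real_diff)
    show "continuous_on {z \<in> UNIV. L / 2 \<le> snd z - fst z}
        (\<lambda>z. - Q (snd z - L) (fst z) / of_real (snd z - fst z))"
      using L by (auto intro!: continuous_intros contQ' simp flip: of_real_diff)
    show "continuous_on UNIV (\<lambda>z::real\<times>real. snd z - fst z)" by (intro continuous_intros)
    fix z :: "real \<times> real" assume z: "snd z - fst z = L / 2"
    have 1: "of_real (L/2) * Q (fst z) (snd z) = c (snd z) - c (fst z)"
      using Qeq[of "snd z" "fst z"] z by metis
    have "fst z - (snd z - L) = L / 2" using z by (simp add: algebra_simps)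
    then have 2: "of_real (L/2) * Q (snd z - L) (fst z) = c (fst z) - c (snd z)"
      using Qeq[of "fst z" "snd z - L"] per[of "snd z - L"] by (metis diff_add_cancel)
    have "of_real (L/2) * Q (fst z) (snd z) = of_real (L/2) * (- Q (snd z - L) (fst z))"
      unfolding mult_minus_right 1 2 by simp
    moreover have "complex_of_real (L/2) \<noteq> 0" using L by simp
    ultimately have "Q (fst z) (snd z) = - Q (snd z - L) (fst z)" by (metis mult_left_cancel)
    then show "Q (fst z) (snd z) / of_real (L - (snd z - fst z)) =
        - Q (snd z - L) (fst z) / of_real (snd z - fst z)"
      unfolding z by simp
  qed
  define T where "T = {z::real\<times>real. 0 \<le> fst z \<and> fst z \<le> snd z \<and> snd z \<le> L}"
  have nzF: "F z \<noteq> 0" if "z \<in> T" for z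
  proof -
    consider "fst z = snd z" | "fst z = 0" "snd z = L" | "fst z < snd z" "\<not> (fst z = 0 \<and> snd z = L)"
      using \<open>z \<in> T\<close> by (force simp: T_def)
    then show ?thesis
    proof cases
      case 1
      then show ?thesis using L nz by (simp add: F_def Qdiag)
    next
      case 2
      then show ?thesis using L nz by (simp add: F_def Qdiag)
    next
      case 3
      have b: "0 \<le> fst z" "fst z < L" "snd z \<le> L" using \<open>z \<in> T\<close> 3 by (auto simp: T_def)
      have "c (snd z) \<noteq> c (fst z)"
      proof (cases "snd z = L")
        case True
        then have "c (snd z) = c 0" using per[of 0] by simp
        then show ?thesis
          using 3 True b L inj_onD[OF inj, of 0 "fst z"] by auto
      next
        case False
        then show ?thesis using 3 b inj_onD[OF inj, of "snd z" "fst z"] by auto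
      qed
      moreover have "snd z - fst z \<noteq> L" using 3 b by auto
      ultimately show ?thesis using 3 by (subst Fsec) (auto simp del: of_real_diff of_real_mult)
    qed
  qed
  have convT: "convex T"
  proof -
    have "T = {z. (-1, 0) \<bullet> z \<le> 0} \<inter> {z. (1, -1) \<bullet> z \<le> 0} \<inter> {z. (0, 1) \<bullet> z \<le> L}"
      by (auto simp: T_def inner_prod_def)
    then show ?thesis by (simp add: convex_Int convex_halfspace_le)
  qed
  define dg l1 l2 where "dg = linepath (0::real,0::real) (L,L)"
    and "l1 = linepath (0::real,0::real) (0,L)" and "l2 = linepath (0::real,L) (L,L)"
  have cor: "(0,0) \<in> T" "(0,L) \<in> T" "(L,L) \<in> T" using L by (auto simp: T_def)
  have im: "path_image dg \<subseteq> T" "path_image l1 \<subseteq> T" "path_image l2 \<subseteq> T"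
    unfolding dg_def l1_def l2_def path_image_linepath
    by (intro closed_segment_subset convT cor)+
  have "homotopic_paths T dg (l1 +++ l2)"
  proof (rule homotopic_paths_linear)
    fix t :: real assume t: "t \<in> {0..1}"
    have "path_image (l1 +++ l2) \<subseteq> T" using im by (simp add: subset_path_image_join)
    then show "closed_segment (dg t) ((l1 +++ l2) t) \<subseteq> T"
      using t im by (intro closed_segment_subset convT) (auto simp: path_image_def)
  qed (auto simp: dg_def l1_def l2_def)
  then have "homotopic_paths (-{0}) (F \<circ> dg) (F \<circ> (l1 +++ l2))"
    by (rule homotopic_paths_continuous_image)
       (use nzF in \<open>auto intro: continuous_on_subset[OF contF]\<close>)
  then have "winding_number (F \<circ> dg) 0 = winding_number (F \<circ> (l1 +++ l2)) 0"
    by (rule winding_number_homotopic_paths)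
  also have "F \<circ> (l1 +++ l2) = (F \<circ> l1) +++ (F \<circ> l2)" by (simp add: path_compose_join)
  finally have W1: "winding_number (F \<circ> dg) 0 = winding_number ((F \<circ> l1) +++ (F \<circ> l2)) 0" .
  have pa: "path (F \<circ> l1)" "path (F \<circ> l2)"
    unfolding l1_def l2_def
    by (auto intro!: path_continuous_image continuous_on_subset[OF contF])
  have pi0: "0 \<notin> path_image (F \<circ> l1)" "0 \<notin> path_image (F \<circ> l2)"
    using nzF im by (auto simp: path_image_compose)
  define x where "x = Re (c' 0) / L"
  \<comment> \<open>At a lowest point the tangent is horizontal, so \<open>F\<close> is real at all
    three corners, as the half turns require.\<close>
  have "((\<lambda>t. Im (c t)) has_real_derivative Im (c' 0)) (at 0)"
    using bounded_linear.has_vector_derivative[OF bounded_linear_Im d1[of 0]]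
    by (simp add: has_real_derivative_iff_has_vector_derivative)
  then have "Im (c' 0) = 0"
    by (rule DERIV_local_min[where d=1]) (use low in auto)
  then have c'0: "c' 0 / of_real L = of_real x"
    by (simp add: x_def complex_eq_iff)
  have c'L: "c' L = c' 0"
  proof -
    have "((\<lambda>t. t + L) has_vector_derivative 1) (at 0)" by (auto intro!: derivative_eq_intros)
    then have "(c \<circ> (\<lambda>t. t + L) has_vector_derivative 1 *\<^sub>R c' (0 + L)) (at 0)"
      by (rule vector_diff_chain_at) (use d1 in auto)
    then have "(c has_vector_derivative c' L) (at 0)" using per by (simp add: o_def)
    with d1[of 0] show ?thesis using vector_derivative_unique_at by blast
  qed
  have F0: "F (0,0) = of_real x" "F (L,L) = of_real x" "F (0,L) = - of_real x"
    using L c'0 c'L by (simp_all add: F_def Qdiag)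
  have xn: "x \<noteq> 0" using F0(1) nzF[OF cor(1)] by auto
  have w1: "winding_number (F \<circ> l1) 0 = complex_of_real (1 * sgn x / 2)"
  proof (rule winding_number_half_turn)
    show "pathstart (F \<circ> l1) = of_real x" "pathfinish (F \<circ> l1) = - of_real x"
      using F0 by (auto simp: l1_def pathstart_compose pathfinish_compose)
    fix t :: real assume t: "t \<in> {0..1}"
    have l: "l1 t = (0, t * L)" by (simp add: l1_def linepath_def)
    show "1 * Im ((F \<circ> l1) t) \<ge> 0"
    proof (cases "t = 0 \<or> t = 1")
      case True
      then show ?thesis using F0 l by auto
    next
      case False
      then have "t * L \<noteq> 0" "t * L < L" "t * L \<ge> 0" "t \<noteq> 1" using t L by auto
      then show ?thesis using Fsec[of "l1 t"] low[of "t * L"]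
        by (simp add: l Im_divide_of_real less_imp_le flip: of_real_diff of_real_mult)
    qed
  qed (use pa pi0 in auto)
  \<comment> \<open>On this leg the secant points from \<open>c t\<close> to the lowest point
    \<open>c L = c 0\<close>, so its imaginary part is nonpositive. Starting point and half plane
    are both reflected, hence the two half turns add up instead of cancelling.\<close>
  have w2: "winding_number (F \<circ> l2) 0 = complex_of_real (- 1 * sgn (-x) / 2)"
  proof (rule winding_number_half_turn)
    show "pathstart (F \<circ> l2) = of_real (- x)" "pathfinish (F \<circ> l2) = - of_real (- x)"
      using F0 by (auto simp: l2_def pathstart_compose pathfinish_compose)
    fix t :: real assume t: "t \<in> {0..1}"
    have l: "l2 t = (t * L, L)" by (simp add: l2_def linepath_def algebra_simps)
    show "- 1 * Im ((F \<circ> l2) t) \<ge> 0"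
    proof (cases "t = 0 \<or> t = 1")
      case True
      then show ?thesis using F0 l by auto
    next
      case False
      then have *: "L - t * L \<noteq> 0" "t * L < L" "t * L > 0" "t \<noteq> 0" "t \<noteq> 1" using t L by auto
      moreover have "Im (c L) \<le> Im (c (t * L))" using low[of "t * L"] per[of 0] by simp
      ultimately show ?thesis using Fsec[of "l2 t"]
        by (auto simp: l Im_divide_of_real simp flip: of_real_diff of_real_mult
            intro!: divide_nonneg_pos)
    qed
  qed (use pa pi0 in auto)
  have W2: "winding_number (F \<circ> dg) 0 = of_real (sgn x)"
  proof -
    have "pathfinish (F \<circ> l1) = pathstart (F \<circ> l2)"
      by (simp add: pathfinish_compose pathstart_compose l1_def l2_def)
    then show ?thesis
      using W1 winding_number_join[OF pa(1) pi0(1) pa(2) pi0(2)] w1 w2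
      by (simp add: sgn_minus)
  qed
  define J where "J = integral {0..L} (\<lambda>t. c'' t / c' t)"
  have ci: "continuous_on A (\<lambda>t. c'' t / c' t)" for A
    using nz by (auto intro!: continuous_intros contc' continuous_on_subset[OF cont])
  have Ji: "((\<lambda>t. c'' t / c' t) has_integral J) {0..L}"
    unfolding J_def by (intro integrable_integral integrable_continuous_real ci)
  \<comment> \<open>On the diagonal \<open>F\<close> is \<open>c' / L\<close>, a C^1 path, so its
    winding number can be computed as the integral of \<open>c'' / c'\<close>.\<close>
  define \<delta> where "\<delta> s = c' (s * L) / of_real L" for s
  have dF: "F \<circ> dg = \<delta>"
    by (auto simp: fun_eq_iff dg_def linepath_def \<delta>_def F_def Qdiag L less_imp_le)
  have dd: "(\<delta> has_vector_derivative c'' (s * L)) (at s)" for s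
  proof -
    have "((\<lambda>t. t * L) has_vector_derivative L) (at s)" by (auto intro!: derivative_eq_intros)
    from vector_diff_chain_at[OF this d2]
    have "((\<lambda>s. c' (s * L)) has_vector_derivative L *\<^sub>R c'' (s * L)) (at s)" by (simp add: o_def)
    then have "(\<delta> has_vector_derivative (L *\<^sub>R c'' (s * L)) / of_real L) (at s)"
      unfolding \<delta>_def by (rule has_vector_derivative_divide)
    then show ?thesis using L by (simp add: scaleR_conv_of_real)
  qed
  have vd: "valid_path \<delta>"
    unfolding valid_path_def
    by (rule C1_differentiable_imp_piecewise)
       (use dd in \<open>auto simp: C1_differentiable_on_def intro!: exI[of _ "\<lambda>s. c'' (s * L)"]
          continuous_on_compose2[OF cont] continuous_intros\<close>)
  have nd: "0 \<notin> path_image \<delta>" using nz L by (auto simp: path_image_def \<delta>_def)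
  have "((\<lambda>w. 1 / (w - 0)) has_contour_integral J) \<delta>"
    unfolding has_contour_integral_def
  proof (rule has_integral_eq)
    have "((\<lambda>s. c'' (L *\<^sub>R s + 0) / c' (L *\<^sub>R s + 0)) has_integral (J /\<^sub>R L ^ DIM(real)))
        (cbox ((0 - 0) /\<^sub>R L) ((L - 0) /\<^sub>R L))"
      using has_integral_affinity'[of "\<lambda>t. c'' t / c' t" J 0 L L 0] Ji L by simp
    then have "((\<lambda>s. c'' (s * L) / c' (s * L)) has_integral (J /\<^sub>R L)) {0..1}"
      using L by (simp add: mult.commute)
    then have "((\<lambda>s. L *\<^sub>R (c'' (s * L) / c' (s * L))) has_integral L *\<^sub>R (J /\<^sub>R L)) {0..1}"
      by (rule has_integral_cmul)
    then show "((\<lambda>s. L *\<^sub>R (c'' (s * L) / c' (s * L))) has_integral J) {0..1}"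
      using L by simp
    fix s :: real assume "s \<in> {0..1}"
    then have "vector_derivative \<delta> (at s within {0..1}) = c'' (s * L)"
      by (intro vector_derivative_at_within_ivl dd) auto
    then show "L *\<^sub>R (c'' (s * L) / c' (s * L)) = 1 / (\<delta> s - 0) * vector_derivative \<delta> (at s within {0..1})"
      using L by (simp add: \<delta>_def scaleR_conv_of_real)
  qed
  then have "contour_integral \<delta> (\<lambda>w. 1 / (w - 0)) = J" by (rule contour_integral_unique)
  then have "winding_number \<delta> 0 = J / (2 * pi * \<i>)"
    using winding_number_valid_path[OF vd nd] by (simp add: field_simps)
  then have "J = 2 * pi * sgn x * \<i>" using W2 dF by (simp add: field_simps)
  then show ?thesis
    using Ji xn by (intro bexI[of _ "sgn x"]) (auto simp: sgn_if)
qed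

text \<open>A parameter shift moves the base point to a lowest point, and the integral of the
  periodic \<open>c'' / c'\<close> over a period is unaffected by it. For unit speed this integrand
  is \<open>i\<close> times the curvature.\<close>

theorem umlaufsatz:
  fixes c c' c'' :: "real \<Rightarrow> complex"
  assumes L: "L > 0" and d1: "\<And>t. (c has_vector_derivative c' t) (at t)"
    and d2: "\<And>t. (c' has_vector_derivative c'' t) (at t)" and cont: "continuous_on UNIV c''"
    and per: "\<And>t. c (t + L) = c t" "\<And>t. c' (t + L) = c' t" "\<And>t. c'' (t + L) = c'' t"
    and inj: "\<And>s t. c s = c t \<Longrightarrow> \<exists>k::int. t = s + of_int k * L" and nz: "\<And>t. c' t \<noteq> 0"
  shows "\<exists>\<sigma>\<in>{1, -1 :: real}. ((\<lambda>t. c'' t / c' t) has_integral (2 * pi * \<sigma> * \<i>)) {0..L}"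
proof -
  have contc: "continuous_on A c" and contc': "continuous_on A c'" for A
    using d1 d2 by (meson continuous_at_imp_continuous_on has_vector_derivative_continuous)+
  have perk: "c (t + of_int k * L) = c t" for t and k :: int by (rule periodic_int) (rule per(1))
  obtain a where a: "a \<in> {0..L}" "\<And>t. t \<in> {0..L} \<Longrightarrow> Im (c a) \<le> Im (c t)"
    using continuous_attains_inf[of "{0..L}" "\<lambda>t. Im (c t)"] L continuous_on_Im[OF contc]
    by (auto simp del: atLeastAtMost_iff)
  have low: "Im (c a) \<le> Im (c t)" for t
  proof -
    obtain k :: int where "0 \<le> t + of_int k * L" "t + of_int k * L < 0 + L" by (rule shift_into_period[OF L])
    then show ?thesis using a(2)[of "t + of_int k * L"] perk[of t k] by simp
  qed
  have sh: "((\<lambda>t. f (t + a)) has_vector_derivative f' (t + a)) (at t)"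
    if "\<And>t. (f has_vector_derivative f' t) (at t)" for f f' :: "real \<Rightarrow> complex" and t
  proof -
    have "((\<lambda>t. t + a) has_vector_derivative 1) (at t)" by (auto intro!: derivative_eq_intros)
    from vector_diff_chain_at[OF this that] show ?thesis by (simp add: o_def)
  qed
  have "\<exists>\<sigma>\<in>{1, -1 :: real}. ((\<lambda>t. c'' (t + a) / c' (t + a)) has_integral (2 * pi * \<sigma> * \<i>)) {0..L}"
  proof (rule umlaufsatz_lowest_base_point[of L "\<lambda>t. c (t + a)"])
    show "continuous_on UNIV (\<lambda>t. c'' (t + a))"
      by (intro continuous_on_compose2[OF cont] continuous_intros) auto
    show "c (t + L + a) = c (t + a)" for t using per(1)[of "t + a"] by (simp add: algebra_simps)
    show "inj_on (\<lambda>t. c (t + a)) {0..<L}"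
    proof (rule inj_onI)
      fix s t assume st: "s \<in> {0..<L}" "t \<in> {0..<L}" "c (s + a) = c (t + a)"
      obtain k :: int where k: "t = s + of_int k * L" using inj[OF st(3)] by auto
      then have "\<bar>of_int k * L\<bar> < L" using st by auto
      then have "\<bar>of_int k\<bar> * L < 1 * L" using L by (simp add: abs_mult)
      then have "k = 0" using L by (simp only: mult_less_cancel_right) auto
      with k show "s = t" by simp
    qed
  qed (use L sh[OF d1] sh[OF d2] nz low in auto)
  then show ?thesis
    using has_integral_periodic_shift[of "\<lambda>t. c'' t / c' t" L a] L nz per
    by (auto intro!: continuous_intros contc' cont)
qed

section \<open>Hausdorff measure of a simple closed curve\<close>

lemma hausdorff1_content_le:
  assumes "A \<subseteq> (\<Union>i. C i)" "\<And>i. bounded (C i)" "\<And>i. diameter (C i) \<le> \<delta>"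
  shows "hausdorff1_content \<delta> A \<le> (\<Sum>i. ennreal (diameter (C i)))"
  unfolding hausdorff1_content_def using assms by (auto intro!: INF_lower2[of C])

lemma hausdorff1_content_approx:
  fixes A :: "'a::metric_space set"
  assumes "hausdorff1_content \<delta> A < x"
  obtains C where "A \<subseteq> (\<Union>i. C i)" "\<And>i::nat. bounded (C i)" "\<And>i. diameter (C i) \<le> \<delta>"
    "(\<Sum>i. ennreal (diameter (C i))) < x"
  using assms unfolding hausdorff1_content_def by (auto simp: INF_less_iff)

lemma hausdorff1_content_mono:
  assumes "A \<subseteq> B" shows "hausdorff1_content \<delta> A \<le> hausdorff1_content \<delta> B"
  unfolding hausdorff1_content_def using assms by (intro INF_superset_mono) auto

lemma hausdorff1_content_antimono:
  assumes "\<delta> \<le> \<delta>'" shows "hausdorff1_content \<delta>' A \<le> hausdorff1_content \<delta> A"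
  unfolding hausdorff1_content_def using assms by (intro INF_superset_mono) (auto intro: order.trans)

lemma hausdorff1_content_le_outer:
  "\<delta> > 0 \<Longrightarrow> hausdorff1_content \<delta> A \<le> hausdorff1_outer A"
  unfolding hausdorff1_outer_def by (rule SUP_upper) simp

lemma hausdorff1_outer_mono: "A \<subseteq> B \<Longrightarrow> hausdorff1_outer A \<le> hausdorff1_outer B"
  unfolding hausdorff1_outer_def by (intro SUP_mono') (rule hausdorff1_content_mono)

text \<open>Near-optimal covers with errors \<open>e / 2^(i+1)\<close> are merged into one sequence
  through the pairing of natural numbers.\<close>

lemma hausdorff1_content_countably_subadditive:
  fixes A :: "nat \<Rightarrow> 'a::metric_space set"
  shows "hausdorff1_content \<delta> (\<Union>i. A i) \<le> (\<Sum>i. hausdorff1_content \<delta> (A i))"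
proof (cases "(\<Sum>i. hausdorff1_content \<delta> (A i)) = \<infinity>")
  case False
  then have fin: "hausdorff1_content \<delta> (A i) \<noteq> \<infinity>" for i
    by (metis ennreal_suminf_lessD infinity_ennreal_def less_irrefl top.not_eq_extremum)
  show ?thesis
  proof (rule ennreal_le_epsilon)
    fix e :: real assume e: "e > 0"
    have "\<exists>C. A i \<subseteq> (\<Union>j. C j) \<and> (\<forall>j::nat. bounded (C j) \<and> diameter (C j) \<le> \<delta>) \<and>
        (\<Sum>j. ennreal (diameter (C j))) < hausdorff1_content \<delta> (A i) + ennreal (e * (1/2)^Suc i)" for i
    proof -
      have "hausdorff1_content \<delta> (A i) < hausdorff1_content \<delta> (A i) + ennreal (e * (1/2)^Suc i)"
        using ennreal_add_left_cancel_less[of "hausdorff1_content \<delta> (A i)" 0] fin[of i] e by simp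
      then show ?thesis by (metis hausdorff1_content_approx)
    qed
    then obtain C where C: "\<And>i. A i \<subseteq> (\<Union>j. C i j)" "\<And>i j. bounded (C i j)"
        "\<And>i j. diameter (C i j) \<le> \<delta>"
        "\<And>i. (\<Sum>j. ennreal (diameter (C i j))) < hausdorff1_content \<delta> (A i) + ennreal (e * (1/2)^Suc i)"
      by metis
    have "hausdorff1_content \<delta> (\<Union>i. A i) \<le> (\<Sum>n. ennreal (diameter (case_prod C (prod_decode n))))"
    proof (rule hausdorff1_content_le)
      show "(\<Union>i. A i) \<subseteq> (\<Union>n. case_prod C (prod_decode n))"
      proof
        fix x assume "x \<in> (\<Union>i. A i)"
        then obtain i j where "x \<in> C i j" using C(1) by blast
        then show "x \<in> (\<Union>n. case_prod C (prod_decode n))"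
          by (intro UN_I[of "prod_encode (i,j)"]) auto
      qed
    qed (auto simp: C split: prod.split)
    also have "\<dots> = (\<Sum>i. \<Sum>j. ennreal (diameter (C i j)))"
      using suminf_ennreal_2dimen[of "\<lambda>i. \<Sum>j. ennreal (diameter (C i j))"
          "\<lambda>p. ennreal (diameter (case_prod C p))"] by (simp add: o_def)
    also have "\<dots> \<le> (\<Sum>i. hausdorff1_content \<delta> (A i) + ennreal (e * (1/2)^Suc i))"
      by (intro suminf_le) (use C(4) in \<open>auto intro: less_imp_le\<close>)
    also have "\<dots> = (\<Sum>i. hausdorff1_content \<delta> (A i)) + (\<Sum>i. ennreal (e * (1/2)^Suc i))"
      by (rule suminf_add[symmetric]) auto
    also have "(\<Sum>i. ennreal (e * (1/2)^Suc i)) = ennreal (e * 1)"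
      using e power_half_series by (intro suminf_ennreal_eq sums_mult) auto
    finally show "hausdorff1_content \<delta> (\<Union>i. A i) \<le> (\<Sum>i. hausdorff1_content \<delta> (A i)) + ennreal e"
      by simp
  qed
qed auto

lemma hausdorff1_outer_countably_subadditive:
  fixes A :: "nat \<Rightarrow> 'a::metric_space set"
  shows "hausdorff1_outer (\<Union>i. A i) \<le> (\<Sum>i. hausdorff1_outer (A i))"
  unfolding hausdorff1_outer_def[of "\<Union>i. A i"]
proof (rule SUP_least)
  fix \<delta> :: real assume "\<delta> \<in> {0<..}"
  then show "hausdorff1_content \<delta> (\<Union>i. A i) \<le> (\<Sum>i. hausdorff1_outer (A i))"
    by (intro order.trans[OF hausdorff1_content_countably_subadditive] suminf_le
        hausdorff1_content_le_outer) auto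
qed

lemma hausdorff1_outer_empty [simp]: "hausdorff1_outer ({} :: 'a::metric_space set) = 0"
proof -
  have "hausdorff1_content \<delta> ({} :: 'a set) = 0" if "\<delta> > 0" for \<delta>
    using hausdorff1_content_le[of "{}" "\<lambda>_. {}" \<delta>] that by simp
  then show ?thesis by (auto simp: hausdorff1_outer_def)
qed

lemma hausdorff1_outer_Un_le: "hausdorff1_outer (A \<union> B) \<le> hausdorff1_outer A + hausdorff1_outer B"
proof -
  define D where "D i = (if i = (0::nat) then A else if i = 1 then B else {})" for i
  have "A \<union> B = (\<Union>i. D i)" by (auto simp: D_def split: if_splits)
  moreover have "(\<Sum>i. hausdorff1_outer (D i)) = (\<Sum>i\<in>{0,1}. hausdorff1_outer (D i))"
    by (rule suminf_finite) (auto simp: D_def)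
  ultimately show ?thesis
    using hausdorff1_outer_countably_subadditive[of D] by (simp add: D_def)
qed

text \<open>A set of diameter below \<open>d\<close> cannot meet both \<open>A\<close> and
  \<open>B\<close>, so at scales below \<open>d\<close> every cover splits into a cover of
  \<open>A\<close> and one of \<open>B\<close>.\<close>

lemma hausdorff1_outer_Un_separated:
  fixes A B :: "'a::metric_space set"
  assumes d: "d > 0" and sep: "\<And>x y. x \<in> A \<Longrightarrow> y \<in> B \<Longrightarrow> d \<le> dist x y"
  shows "hausdorff1_outer A + hausdorff1_outer B \<le> hausdorff1_outer (A \<union> B)"
proof -
  have *: "hausdorff1_content \<delta> A + hausdorff1_content \<delta> B \<le> hausdorff1_content \<delta> (A \<union> B)"
    if "\<delta> < d" for \<delta>
    unfolding hausdorff1_content_def[of \<delta> "A \<union> B"]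
  proof (rule INF_greatest, clarify)
    fix C :: "nat \<Rightarrow> 'a set"
    assume C: "A \<union> B \<subseteq> (\<Union>i. C i)" "\<forall>i. bounded (C i) \<and> diameter (C i) \<le> \<delta>"
    define P where "P i \<longleftrightarrow> C i \<inter> A \<noteq> {}" for i
    have PB: "C i \<inter> B = {}" if "P i" for i
    proof (rule ccontr)
      assume "C i \<inter> B \<noteq> {}"
      then obtain x y where xy: "x \<in> C i" "x \<in> A" "y \<in> C i" "y \<in> B" using \<open>P i\<close> by (auto simp: P_def)
      then have "dist x y \<le> \<delta>" using C(2) diameter_bounded_bound[of "C i" x y] by (metis order.trans)
      with sep xy \<open>\<delta> < d\<close> show False by force
    qed
    have "0 \<le> diameter (C i)" for i using C(2) diameter_ge_0 by blast
    then have \<delta>0: "0 \<le> \<delta>" using C(2) order.trans by blast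
    have 1: "hausdorff1_content \<delta> A \<le> (\<Sum>i. ennreal (diameter (if P i then C i else {})))"
      using C \<delta>0 by (intro hausdorff1_content_le) (auto simp: P_def subset_eq, blast)
    have 2: "hausdorff1_content \<delta> B \<le> (\<Sum>i. ennreal (diameter (if P i then {} else C i)))"
      using C \<delta>0 PB by (intro hausdorff1_content_le) (auto simp: subset_eq, blast)
    have 3: "(\<Sum>i. ennreal (diameter (if P i then C i else {}))) +
        (\<Sum>i. ennreal (diameter (if P i then {} else C i))) = (\<Sum>i. ennreal (diameter (C i)))"
      by (subst suminf_add) (auto intro!: suminf_cong)
    show "hausdorff1_content \<delta> A + hausdorff1_content \<delta> B \<le> (\<Sum>i. ennreal (diameter (C i)))"
      by (rule order.trans[OF add_mono[OF 1 2] eq_refl[OF 3]])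
  qed
  show ?thesis
  proof (rule ennreal_le_epsilon)
    fix e :: real assume fin: "hausdorff1_outer (A \<union> B) < top" and e: "e > 0"
    have ex: "\<exists>\<delta>>0. hausdorff1_outer X \<le> hausdorff1_content \<delta> X + ennreal (e/2)"
      if "X \<subseteq> A \<union> B" for X
    proof (cases "hausdorff1_outer X = 0")
      case True
      then show ?thesis by (intro exI[of _ 1]) auto
    next
      case False
      have "hausdorff1_outer X < top" using hausdorff1_outer_mono[OF that] fin by (rule le_less_trans)
      then have "hausdorff1_outer X - ennreal (e/2) < hausdorff1_outer X"
        using False e by (intro ennreal_between) (auto simp: zero_less_iff_neq_zero)
      then obtain \<delta> where "\<delta> > 0" "hausdorff1_outer X - ennreal (e/2) < hausdorff1_content \<delta> X"
        unfolding hausdorff1_outer_def[of X] by (auto simp: less_SUP_iff)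
      then show ?thesis
        by (metis add.commute ennreal_minus_le_iff less_imp_le)
    qed
    obtain \<delta>1 \<delta>2 where \<delta>: "\<delta>1 > 0" "hausdorff1_outer A \<le> hausdorff1_content \<delta>1 A + ennreal (e/2)"
      "\<delta>2 > 0" "hausdorff1_outer B \<le> hausdorff1_content \<delta>2 B + ennreal (e/2)"
      using ex[of A] ex[of B] by auto
    \<comment> \<open>Content grows as the scale shrinks, so the scales found separately for
      \<open>A\<close> and \<open>B\<close> may be replaced by a smaller common one, taken below
      \<open>d\<close>.\<close>
    define \<delta> where "\<delta> = Min {\<delta>1, \<delta>2, d/2}"
    have \<delta>': "0 < \<delta>" "\<delta> \<le> \<delta>1" "\<delta> \<le> \<delta>2" "\<delta> < d" using \<delta> d by (auto simp: \<delta>_def min_def)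
    have "hausdorff1_outer A + hausdorff1_outer B \<le>
        (hausdorff1_content \<delta> A + ennreal (e/2)) + (hausdorff1_content \<delta> B + ennreal (e/2))"
      using \<delta> \<delta>' by (intro add_mono; meson add_right_mono hausdorff1_content_antimono order.trans)
    also have "\<dots> = (hausdorff1_content \<delta> A + hausdorff1_content \<delta> B) + ennreal e"
      using e by (simp add: ennreal_plus[symmetric] add_ac del: ennreal_plus)
    also have "\<dots> \<le> hausdorff1_outer (A \<union> B) + ennreal e"
      using *[OF \<delta>'(4)] hausdorff1_content_le_outer[OF \<delta>'(1), of "A \<union> B"]
      by (intro add_right_mono) (rule order.trans)
    finally show "hausdorff1_outer A + hausdorff1_outer B \<le> hausdorff1_outer (A \<union> B) + ennreal e" .
  qed
qed

section \<open>Caratheodory measurability of Borel sets\<close>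

lemma ennreal_suminf_tail_tendsto_0:
  fixes f :: "nat \<Rightarrow> ennreal"
  assumes "(\<Sum>i. f i) < top"
  shows "(\<lambda>n. \<Sum>i. f (i + n)) \<longlonglongrightarrow> 0"
proof -
  define r where "r i = enn2real (f i)" for i
  have "f i < top" for i using ennreal_suminf_lessD[OF assms] .
  then have f: "f i = ennreal (r i)" for i by (simp add: r_def)
  have r0: "r i \<ge> 0" for i by (simp add: r_def)
  have sr: "summable r" using assms f r0 by (intro summable_suminf_not_top) auto
  have "(\<Sum>i. f (i + n)) = ennreal (\<Sum>i. r (i + n))" for n
    using sr r0 by (simp add: f suminf_ennreal2 summable_iff_shift)
  then show ?thesis
    using tendsto_ennrealI[OF suminf_exist_split2[OF sr]] by simp
qed

text \<open>The Caratheodory criterion for metric outer measures: the layers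
  \<open>1/(n+2) \<le> setdist < 1/(n+1)\<close> are pairwise separated along the even and along the odd indices.\<close>

lemma hausdorff1_outer_caratheodory_closed:
  fixes F E :: "'a::metric_space set"
  assumes F: "closed F"
  shows "hausdorff1_outer (E \<inter> F) + hausdorff1_outer (E - F) \<le> hausdorff1_outer E"
proof (cases "F = {} \<or> hausdorff1_outer E = top")
  case True
  then show ?thesis by auto
next
  case False
  then have F0: "F \<noteq> {}" and fin: "hausdorff1_outer E < top" by (auto simp: less_top)
  let ?H = "hausdorff1_outer :: 'a set \<Rightarrow> ennreal"
  define A where "A n = {x\<in>E. infdist x F \<ge> 1 / real (Suc n)}" for n
  define D where "D n = {x\<in>E. 1 / real (Suc (Suc n)) \<le> infdist x F \<and> infdist x F < 1 / real (Suc n)}" for n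
  have pos: "infdist x F > 0" if "x \<in> E - F" for x
    using that F F0 by (simp add: infdist_pos_not_in_closed)
  have lip: "infdist x F - infdist y F \<le> dist x y" for x y
    using infdist_triangle[of x F y] by simp
  have sep: "?H (D n) + ?H (\<Union>i\<in>I. D i) \<le> ?H (D n \<union> (\<Union>i\<in>I. D i))"
    if "\<And>i. i \<in> I \<Longrightarrow> n + 2 \<le> i" for n I
  proof (rule hausdorff1_outer_Un_separated)
    \<comment> \<open>Points of layer \<open>n\<close> have distance at least \<open>1/(n+2)\<close>
      from \<open>F\<close>, points of layer \<open>n + 2\<close> or higher less than
      \<open>1/(n+3)\<close>, and the distance to \<open>F\<close> is 1-Lipschitz.\<close>
    show "1 / real (n + 2) - 1 / real (n + 3) > 0" by (simp add: divide_strict_left_mono)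
    fix x y assume "x \<in> D n" "y \<in> (\<Union>i\<in>I. D i)"
    then obtain i where i: "i \<in> I" "infdist y F < 1 / real (Suc i)" "1 / real (Suc (Suc n)) \<le> infdist x F"
      by (auto simp: D_def)
    have "1 / real (Suc i) \<le> 1 / real (n + 3)" using that[OF i(1)] by (intro divide_left_mono) auto
    then show "1 / real (n + 2) - 1 / real (n + 3) \<le> dist x y"
      using i lip[of x y] by auto
  qed
  have layers: "(\<Sum>i<m. ?H (D (2 * i + k))) \<le> ?H (\<Union>i<m. D (2 * i + k))" for m k
  proof -
    have "(\<Sum>i\<in>{l..<m}. ?H (D (2 * i + k))) \<le> ?H (\<Union>i\<in>{l..<m}. D (2 * i + k))" if "l \<le> m" for l
      using that
    proof (induction l rule: inc_induct)
      case (step l)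
      have eq: "{l..<m} = insert l {Suc l..<m}" using step by auto
      have "(\<Sum>i\<in>{l..<m}. ?H (D (2 * i + k))) \<le> ?H (D (2 * l + k)) + ?H (\<Union>i\<in>{Suc l..<m}. D (2 * i + k))"
        using step by (simp add: eq add_left_mono)
      also have "\<dots> = ?H (D (2 * l + k)) + ?H (\<Union>i\<in>(\<lambda>i. 2 * i + k) ` {Suc l..<m}. D i)"
        by simp
      also have "\<dots> \<le> ?H (D (2 * l + k) \<union> (\<Union>i\<in>(\<lambda>i. 2 * i + k) ` {Suc l..<m}. D i))"
        by (rule sep) auto
      finally show ?case by (simp add: eq)
    qed simp
    from this[of 0] show ?thesis by (simp add: atLeast0LessThan)
  qed
  have "(\<Sum>i. ?H (D (2 * i + k))) \<le> ?H E" for k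
  proof (rule suminf_le_const)
    fix m
    have "(\<Union>i<m. D (2 * i + k)) \<subseteq> E" by (auto simp: D_def)
    then show "(\<Sum>i<m. ?H (D (2 * i + k))) \<le> ?H E"
      by (rule order.trans[OF layers hausdorff1_outer_mono])
  qed simp
  then have sfin: "(\<Sum>i. ?H (D (2 * i + k))) < top" for k by (rule le_less_trans[OF _ fin])
  \<comment> \<open>Up to the layers of index at least \<open>2 * n\<close>, the set
    \<open>E - F\<close> is \<open>A (2 * n)\<close>, which has positive distance from
    \<open>F\<close>. Even and odd layers are kept apart because the sums are controlled along one
    parity at a time.\<close>
  have tail: "E - F \<subseteq> A (2 * n) \<union> (\<Union>i. D (2 * (i + n) + 0)) \<union> (\<Union>i. D (2 * (i + n) + 1))" for n
  proof
    fix x assume x: "x \<in> E - F"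
    obtain m where m: "1 / real (Suc m) \<le> infdist x F"
      using pos[OF x] reals_Archimedean by (metis inverse_eq_divide less_imp_le)
    define k where "k = (LEAST m. 1 / real (Suc m) \<le> infdist x F)"
    have k: "1 / real (Suc k) \<le> infdist x F" unfolding k_def using m by (rule LeastI)
    show "x \<in> A (2 * n) \<union> (\<Union>i. D (2 * (i + n) + 0)) \<union> (\<Union>i. D (2 * (i + n) + 1))"
    proof (cases "k \<le> 2 * n")
      case True
      then have "1 / real (Suc (2 * n)) \<le> 1 / real (Suc k)" by (intro divide_left_mono) auto
      with k x show ?thesis by (auto simp: A_def)
    next
      case False
      then obtain j where j: "k = Suc j" "j \<ge> 2 * n" by (cases k) auto
      have "\<not> 1 / real (Suc j) \<le> infdist x F"
        using not_less_Least[of j "\<lambda>m. 1 / real (Suc m) \<le> infdist x F"] j by (simp add: k_def)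
      then have xD: "x \<in> D j" using k j x by (simp add: D_def)
      have "j = 2 * ((j div 2 - n) + n) + 0 \<or> j = 2 * ((j div 2 - n) + n) + 1"
        using j(2) by presburger
      with xD show ?thesis by (metis UN_I UNIV_I UnCI)
    qed
  qed
  have sepA: "?H (E \<inter> F) + ?H (A n) \<le> ?H E" for n
  proof -
    have "?H (E \<inter> F) + ?H (A n) \<le> ?H (E \<inter> F \<union> A n)"
    proof (rule hausdorff1_outer_Un_separated)
      fix x y assume "x \<in> E \<inter> F" "y \<in> A n"
      then show "1 / real (Suc n) \<le> dist x y"
        using infdist_le[of x F y] by (auto simp: A_def dist_commute)
    qed simp
    also have "\<dots> \<le> ?H E" by (rule hausdorff1_outer_mono) (auto simp: A_def)
    finally show ?thesis .
  qed
  have "?H (E \<inter> F) + ?H (E - F) \<le> ?H E + (\<Sum>i. ?H (D (2 * (i + n) + 0))) + (\<Sum>i. ?H (D (2 * (i + n) + 1)))" for n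
  proof -
    have "?H (E - F) \<le> ?H (A (2 * n) \<union> (\<Union>i. D (2 * (i + n) + 0)) \<union> (\<Union>i. D (2 * (i + n) + 1)))"
      by (rule hausdorff1_outer_mono) (rule tail)
    also have "\<dots> \<le> ?H (A (2 * n)) + ?H (\<Union>i. D (2 * (i + n) + 0)) + ?H (\<Union>i. D (2 * (i + n) + 1))"
      by (meson add_right_mono hausdorff1_outer_Un_le order.trans)
    also have "\<dots> \<le> ?H (A (2 * n)) + (\<Sum>i. ?H (D (2 * (i + n) + 0))) + (\<Sum>i. ?H (D (2 * (i + n) + 1)))"
      by (intro add_mono order.refl hausdorff1_outer_countably_subadditive)
    finally have "?H (E \<inter> F) + ?H (E - F) \<le> (?H (E \<inter> F) + ?H (A (2 * n))) +
        (\<Sum>i. ?H (D (2 * (i + n) + 0))) + (\<Sum>i. ?H (D (2 * (i + n) + 1)))"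
      by (metis (no_types, lifting) add.assoc add_left_mono)
    also have "\<dots> \<le> ?H E + (\<Sum>i. ?H (D (2 * (i + n) + 0))) + (\<Sum>i. ?H (D (2 * (i + n) + 1)))"
      by (intro add_right_mono sepA)
    finally show ?thesis .
  qed
  moreover have "(\<lambda>n. ?H E + (\<Sum>i. ?H (D (2 * (i + n) + 0))) + (\<Sum>i. ?H (D (2 * (i + n) + 1))))
      \<longlonglongrightarrow> ?H E + 0 + 0"
    by (intro tendsto_add tendsto_const ennreal_suminf_tail_tendsto_0 sfin)
  ultimately show ?thesis by (intro LIMSEQ_le_const) auto
qed

text \<open>The Caratheodory measurable sets form a \<sigma>-algebra that contains the closed sets,
  hence all Borel sets.\<close>

lemma measure_space_hausdorff1_outer:
  "measure_space UNIV (sets (borel :: 'a::metric_space measure)) hausdorff1_outer"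
proof -
  let ?H = "hausdorff1_outer :: 'a set \<Rightarrow> ennreal"
  let ?\<Lambda> = "lambda_system UNIV UNIV ?H"
  have "outer_measure_space UNIV ?H"
    by (auto simp: outer_measure_space_def positive_def increasing_def countably_subadditive_def
        intro: hausdorff1_outer_mono hausdorff1_outer_countably_subadditive)
  then have ms: "measure_space UNIV ?\<Lambda> ?H"
    using sigma_algebra.caratheodory_lemma[OF sigma_algebra_Pow[of UNIV], of ?H] by simp
  have "F \<in> ?\<Lambda>" if "closed F" for F :: "'a set"
  proof -
    have "?H (F \<inter> E) + ?H ((UNIV - F) \<inter> E) = ?H E" for E
    proof (rule antisym)
      show "?H (F \<inter> E) + ?H ((UNIV - F) \<inter> E) \<le> ?H E"
        using hausdorff1_outer_caratheodory_closed[OF that, of E]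
        by (simp add: Int_commute Diff_eq)
      have "E = (F \<inter> E) \<union> ((UNIV - F) \<inter> E)" by auto
      then show "?H E \<le> ?H (F \<inter> E) + ?H ((UNIV - F) \<inter> E)"
        by (metis hausdorff1_outer_Un_le)
    qed
    then show ?thesis by (simp add: lambda_system_def)
  qed
  moreover have "sigma_algebra UNIV ?\<Lambda>" using ms by (simp add: measure_space_def)
  ultimately have "sets (borel :: 'a measure) \<subseteq> ?\<Lambda>"
    using sigma_algebra.sigma_sets_subset[of UNIV ?\<Lambda> "Collect closed"]
    by (simp add: borel_eq_closed subset_iff)
  then show ?thesis
    using ms unfolding measure_space_def
    by (auto simp: countably_additive_def positive_def subset_iff
        intro: sets.sigma_algebra_axioms[of borel, simplified])
qed

lemma sets_hausdorff1 [simp, measurable_cong]: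
  "sets (hausdorff1 :: 'a::metric_space measure) = sets borel"
  unfolding hausdorff1_def by (simp add: sets.sigma_sets_eq[of borel, simplified])

lemma space_hausdorff1 [simp]: "space hausdorff1 = UNIV"
  unfolding hausdorff1_def by simp

lemma emeasure_hausdorff1:
  "A \<in> sets borel \<Longrightarrow> emeasure (hausdorff1 :: 'a::metric_space measure) A = hausdorff1_outer A"
  unfolding hausdorff1_def
  using measure_space_hausdorff1_outer by (intro emeasure_measure_of_sigma) (auto simp: measure_space_def)

section \<open>Arc length as Hausdorff measure\<close>

lemma hausdorff1_outer_lipschitz_interval:
  fixes g :: "real \<Rightarrow> 'a::metric_space"
  assumes L: "L > 0" and lip: "\<And>s t. dist (g s) (g t) \<le> \<bar>s - t\<bar>"
  shows "hausdorff1_outer (g ` {0..L}) \<le> ennreal L"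
  unfolding hausdorff1_outer_def
proof (rule SUP_least)
  fix \<delta> :: real assume "\<delta> \<in> {0<..}"
  then have \<delta>: "\<delta> > 0" by simp
  \<comment> \<open>With more than \<open>L / \<delta>\<close> equal pieces every arc has diameter
    at most \<open>L / m \<le> \<delta>\<close>, because \<open>g\<close> is 1-Lipschitz, and the
    \<open>m\<close> diameters add up to at most \<open>L\<close>.\<close>
  obtain m :: nat where m: "L / \<delta> < real m" using reals_Archimedean2 by blast
  have m0: "real m > 0" using m L \<delta> by (meson divide_pos_pos less_trans)
  have Lm: "L / real m \<le> \<delta>" "L / real m > 0" using m m0 \<delta> L by (auto simp: field_simps)
  define C where "C i = (if i < m then g ` {real i * (L / m)..real (Suc i) * (L / m)} else {})" for i
  have dC: "dist x y \<le> L / m" if "x \<in> C i" "y \<in> C i" for x y i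
  proof -
    obtain s t where xy: "x = g s" "y = g t" and
      st: "s \<in> {real i * (L / m)..real (Suc i) * (L / m)}" "t \<in> {real i * (L / m)..real (Suc i) * (L / m)}"
    proof -
      have "i < m" using \<open>x \<in> C i\<close> by (auto simp: C_def split: if_splits)
      then have "C i = g ` {real i * (L / m)..real (Suc i) * (L / m)}" by (simp only: C_def if_True)
      then show ?thesis using \<open>x \<in> C i\<close> \<open>y \<in> C i\<close> that by blast
    qed
    moreover have "real (Suc i) * (L / m) - real i * (L / m) = L / m"
      by (simp only: of_nat_Suc distrib_right mult_1_left add_diff_cancel_right')
    then have "\<bar>s - t\<bar> \<le> L / m" using st by (simp only: atLeastAtMost_iff) linarith
    ultimately show ?thesis using lip[of s t] xy by simp
  qed
  have bC: "bounded (C i)" for i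
    unfolding bounded_two_points using dC by blast
  have diamC: "diameter (C i) \<le> (if i < m then L / m else 0)" for i
  proof (cases "i < m")
    case True
    moreover have "real i * (L / m) \<le> real (Suc i) * (L / m)" using Lm(2) by (intro mult_right_mono) auto
    ultimately have "C i \<noteq> {}" unfolding C_def by (simp only: if_True) auto
    then show ?thesis
      using True dC by (auto simp: diameter_def intro!: cSUP_least)
  qed (simp add: C_def)
  have "hausdorff1_content \<delta> (g ` {0..L}) \<le> (\<Sum>i. ennreal (diameter (C i)))"
  proof (rule hausdorff1_content_le)
    show "g ` {0..L} \<subseteq> (\<Union>i. C i)"
    proof clarify
      fix t assume t: "t \<in> {0..L}"
      define q where "q = t / (L / m)"
      have q: "0 \<le> q" "q \<le> real m" using t L m0 Lm by (auto simp: q_def field_simps)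
      \<comment> \<open>The minimum with \<open>m - 1\<close> puts the end point
        \<open>t = L\<close> into the last piece.\<close>
      define i where "i = min (m - 1) (nat \<lfloor>q\<rfloor>)"
      have n: "real (nat \<lfloor>q\<rfloor>) \<le> q" "q < real (nat \<lfloor>q\<rfloor>) + 1"
        using q(1) by (simp_all add: of_nat_nat)
      have "i < m" using m0 by (simp add: i_def)
      moreover have "real i \<le> q"
        using n(1) by (rule order.trans[rotated]) (simp add: i_def)
      moreover have "q \<le> real (Suc i)"
      proof (cases "m - 1 \<le> nat \<lfloor>q\<rfloor>")
        case True
        then have "Suc i = m" using m0 by (simp add: i_def)
        then show ?thesis using q(2) by simp
      next
        case False
        then have "i = nat \<lfloor>q\<rfloor>" by (simp add: i_def)
        then show ?thesis using n(2) by linarith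
      qed
      ultimately have "real i \<le> t / (L / m)" "t / (L / m) \<le> real (Suc i)" "i < m" by (simp_all only: q_def)
      then have "t \<in> {real i * (L / m)..real (Suc i) * (L / m)}"
        using Lm(2) by (simp only: pos_le_divide_eq pos_divide_le_eq atLeastAtMost_iff)
      then show "g t \<in> (\<Union>i. C i)" using \<open>i < m\<close> by (auto simp: C_def)
    qed
    show "diameter (C i) \<le> \<delta>" for i using diamC[of i] Lm by (auto split: if_splits)
  qed (rule bC)
  also have "\<dots> \<le> (\<Sum>i. ennreal (if i < m then L / m else 0))"
    by (intro suminf_le ennreal_leI diamC) auto
  also have "\<dots> = (\<Sum>i<m. ennreal (if i < m then L / m else 0))"
    by (rule suminf_finite) auto
  also have "\<dots> = ennreal L"
    using Lm m0 by (simp add: ennreal_of_nat_eq_real_of_nat flip: ennreal_mult)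
  finally show "hausdorff1_content \<delta> (g ` {0..L}) \<le> ennreal L" .
qed

text \<open>A covering set of diameter \<open>D\<close> has a preimage in \<open>J\<close> of
  diameter at most \<open>D / \<theta>\<close>. Covering sets may be arbitrary, so the preimages are
  enclosed in closed intervals, to which Lebesgue subadditivity applies. The content at the single
  scale \<open>1\<close> already yields the bound.\<close>

lemma hausdorff1_outer_image_ge:
  fixes g :: "real \<Rightarrow> 'a::metric_space"
  assumes \<theta>: "\<theta> > 0" and bil: "\<And>s t. s \<in> J \<Longrightarrow> t \<in> J \<Longrightarrow> \<theta> * \<bar>s - t\<bar> \<le> dist (g s) (g t)"
    and B: "{t\<in>J. g t \<in> B} \<in> sets borel"
  shows "ennreal \<theta> * emeasure lborel {t\<in>J. g t \<in> B} \<le> hausdorff1_outer (B \<inter> g ` J)"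
proof -
  have "ennreal \<theta> * emeasure lborel {t\<in>J. g t \<in> B} \<le> hausdorff1_content 1 (B \<inter> g ` J)"
    unfolding hausdorff1_content_def
  proof (rule INF_greatest, clarify)
    fix C :: "nat \<Rightarrow> 'a set"
    assume C: "B \<inter> g ` J \<subseteq> (\<Union>i. C i)" "\<forall>i. bounded (C i) \<and> diameter (C i) \<le> 1"
    define S where "S i = {t\<in>J. g t \<in> C i}" for i
    define D where "D i = diameter (C i) / \<theta>" for i
    have SD: "\<bar>s - t\<bar> \<le> D i" if "s \<in> S i" "t \<in> S i" for s t i
    proof -
      have "\<theta> * \<bar>s - t\<bar> \<le> diameter (C i)"
        using bil[of s t] diameter_bounded_bound[of "C i" "g s" "g t"] C(2) that
        by (force simp: S_def)
      then show ?thesis using \<theta> by (simp add: D_def field_simps)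
    qed
    define I where "I i = (if S i = {} then {} else {Inf (S i)..Inf (S i) + D i})" for i
    have SI: "S i \<subseteq> I i" for i
    proof
      fix t assume t: "t \<in> S i"
      have "t - D i \<le> s" if "s \<in> S i" for s using SD[OF t that] by linarith
      then have "bdd_below (S i)" "t - D i \<le> Inf (S i)"
        using t by (auto intro!: cInf_greatest bdd_belowI[of _ "t - D i"])
      then show "t \<in> I i" using t by (auto simp: I_def intro: cInf_lower)
    qed
    have D0: "D i \<ge> 0" for i using C(2) \<theta> by (simp add: D_def diameter_ge_0)
    have "emeasure lborel {t\<in>J. g t \<in> B} \<le> emeasure lborel (\<Union>i. I i)"
    proof (rule emeasure_mono)
      show "{t\<in>J. g t \<in> B} \<subseteq> (\<Union>i. I i)"
      proof
        fix t assume "t \<in> {t\<in>J. g t \<in> B}"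
        then obtain i where "t \<in> S i" using C(1) by (auto simp: S_def)
        then show "t \<in> (\<Union>i. I i)" using SI by blast
      qed
    qed (auto simp: I_def)
    also have "\<dots> \<le> (\<Sum>i. emeasure lborel (I i))"
      by (rule emeasure_subadditive_countably) (auto simp: I_def)
    also have "\<dots> \<le> (\<Sum>i. ennreal (D i))"
      by (rule suminf_le) (use D0 in \<open>auto simp: I_def\<close>)
    finally have "ennreal \<theta> * emeasure lborel {t\<in>J. g t \<in> B} \<le> ennreal \<theta> * (\<Sum>i. ennreal (D i))"
      by (rule mult_left_mono) simp
    also have "\<dots> = (\<Sum>i. ennreal (diameter (C i)))"
      using \<theta> D0 by (simp flip: ennreal_suminf_cmult ennreal_mult) (simp add: D_def)
    finally show "ennreal \<theta> * emeasure lborel {t\<in>J. g t \<in> B} \<le> (\<Sum>i. ennreal (diameter (C i)))" .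
  qed
  also have "\<dots> \<le> hausdorff1_outer (B \<inter> g ` J)" by (rule hausdorff1_content_le_outer) simp
  finally show ?thesis .
qed

text \<open>A half-open interval is a countable union of compact ones, whose images are closed.
  Half-open pieces occur because they partition \<open>{0..<L}\<close>.\<close>

lemma continuous_image_atLeastLessThan_borel:
  fixes g :: "real \<Rightarrow> 'a::metric_space"
  assumes "continuous_on UNIV g"
  shows "g ` {a..<b} \<in> sets borel"
proof -
  have "{a..<b} = (\<Union>n. {a..b - 1 / real (Suc n)})"
  proof (intro equalityI subsetI)
    fix x assume x: "x \<in> {a..<b}"
    then obtain n where "1 / real (Suc n) < b - x"
      using reals_Archimedean[of "b - x"] by (auto simp: inverse_eq_divide)
    with x show "x \<in> (\<Union>n. {a..b - 1 / real (Suc n)})" by (intro UN_I[of n]) auto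
  next
    fix x assume "x \<in> (\<Union>n. {a..b - 1 / real (Suc n)})"
    then obtain n where "a \<le> x" "x \<le> b - 1 / real (Suc n)" by auto
    moreover have "1 / real (Suc n) > 0" by simp
    ultimately show "x \<in> {a..<b}" unfolding atLeastLessThan_iff by linarith
  qed
  then have "g ` {a..<b} = (\<Union>n. g ` {a..b - 1 / real (Suc n)})" by (simp add: image_UN)
  moreover have "closed (g ` {a..b - 1 / real (Suc n)})" for n
    by (intro compact_imp_closed compact_continuous_image continuous_on_subset[OF assms]) auto
  ultimately show ?thesis by auto
qed

text \<open>The lower bound is an equality because the total masses agree.\<close>

theorem restrict_hausdorff1_simple_closed_curve:
  fixes g :: "real \<Rightarrow> 'a::metric_space"
  assumes L: "L > 0" and lip: "\<And>s t. dist (g s) (g t) \<le> \<bar>s - t\<bar>"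
    and inj: "inj_on g {0..<L}" and closed: "g L = g 0"
    and loc: "\<And>\<theta>. 0 < \<theta> \<Longrightarrow> \<theta> < 1 \<Longrightarrow> \<exists>l>0. \<forall>s t. \<bar>s - t\<bar> \<le> l \<longrightarrow> \<theta> * \<bar>s - t\<bar> \<le> dist (g s) (g t)"
  shows "restrict_measure hausdorff1 (g ` {0..L}) = distr (restrict_space lborel {0..<L}) borel g"
    (is "?M = ?N")
proof -
  have "1-lipschitz_on UNIV g" using lip by (simp add: lipschitz_on_def dist_real_def)
  then have contg: "continuous_on UNIV g" by (rule lipschitz_on_continuous_on)
  then have gm [measurable]: "g \<in> borel_measurable borel" by (rule borel_measurable_continuous_onI)
  define \<Gamma> where "\<Gamma> = g ` {0..L}"
  have "compact \<Gamma>"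
    unfolding \<Gamma>_def by (intro compact_continuous_image continuous_on_subset[OF contg]) auto
  then have \<Gamma>B: "\<Gamma> \<in> sets borel" by (intro borel_closed compact_imp_closed)
  let ?H = "emeasure (hausdorff1 :: 'a measure)"
  define \<nu> where "\<nu> B = emeasure lborel {t\<in>{0..<L}. g t \<in> B}" for B
  have mB: "{t\<in>{a..<b}. g t \<in> B} \<in> sets borel" if "B \<in> sets borel" for B and a b :: real
  proof -
    have "{t\<in>{a..<b}. g t \<in> B} = {a..<b} \<inter> g -` B" by auto
    then show ?thesis using measurable_sets_borel[OF gm that] by simp
  qed
  have N: "emeasure ?N B = \<nu> B" if "B \<in> sets borel" for B
  proof -
    have "emeasure ?N B = emeasure (restrict_space lborel {0..<L}) (g -` B \<inter> {0..<L})"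
      using that by (subst emeasure_distr) (auto simp: space_restrict_space intro: measurable_restrict_space1)
    also have "\<dots> = emeasure lborel (g -` B \<inter> {0..<L})"
      by (rule emeasure_restrict_space) auto
    also have "g -` B \<inter> {0..<L} = {t\<in>{0..<L}. g t \<in> B}" by auto
    finally show ?thesis by (simp add: \<nu>_def)
  qed
  have M: "emeasure ?M B = ?H (\<Gamma> \<inter> B)" if "B \<in> sets borel" for B
    unfolding restrict_measure_def \<Gamma>_def[symmetric]
    by (rule emeasure_restricted) (use \<Gamma>B that in auto)
  have \<nu>fin: "\<nu> B \<le> ennreal L" if "B \<in> sets borel" for B
  proof -
    have "\<nu> B \<le> emeasure lborel {0..<L}" unfolding \<nu>_def by (rule emeasure_mono) auto
    then show ?thesis using L by simp
  qed
  have theta: "ennreal \<theta> * \<nu> B \<le> ?H (\<Gamma> \<inter> B)" if B: "B \<in> sets borel" and \<theta>: "0 < \<theta>" "\<theta> < 1" for B \<theta>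
  proof -
    obtain l where l: "l > 0" "\<And>s t. \<bar>s - t\<bar> \<le> l \<Longrightarrow> \<theta> * \<bar>s - t\<bar> \<le> dist (g s) (g t)"
      using loc[OF \<theta>] by auto
    obtain m :: nat where m: "L / l < real m" using reals_Archimedean2 by blast
    have m0: "real m > 0" using m L l by (meson divide_pos_pos less_trans)
    define w where "w = L / real m"
    have w: "w \<le> l" "w > 0" using m m0 l L by (auto simp: field_simps w_def)
    \<comment> \<open>Pieces of length at most \<open>l\<close>: on each of them \<open>g\<close>
      shrinks distances at most by the factor \<open>\<theta>\<close>, and by injectivity their
      images are disjoint, so the local bounds add up.\<close>
    define J where "J k = {real k * w..<real (Suc k) * w}" for k :: nat
    have Jeq: "t \<in> J k \<longleftrightarrow> nat \<lfloor>t / w\<rfloor> = k" if "t \<ge> 0" for t k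
    proof -
      have "t \<in> J k \<longleftrightarrow> real k \<le> t / w \<and> t / w < real k + 1"
        using w by (auto simp: J_def pos_le_divide_eq pos_divide_less_eq algebra_simps)
      also have "\<dots> \<longleftrightarrow> \<lfloor>t / w\<rfloor> = int k" by (auto simp: floor_eq_iff)
      also have "\<dots> \<longleftrightarrow> nat \<lfloor>t / w\<rfloor> = k" using that w by auto
      finally show ?thesis .
    qed
    have J0: "t \<ge> 0" if "t \<in> J k" for t k
    proof -
      have "0 \<le> real k * w" using w by simp
      with that show ?thesis by (simp add: J_def)
    qed
    have JL: "t < L" if "t \<in> J k" "k < m" for t k
    proof -
      have "real (Suc k) * w \<le> real m * w" using that w by (intro mult_right_mono) auto
      with that m0 show ?thesis by (simp add: J_def w_def)
    qed
    have UJ: "\<exists>k<m. t \<in> J k" if "t \<in> {0..<L}" for t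
    proof -
      have "t / w < real m" using that m0 L by (simp add: w_def field_simps)
      then have "nat \<lfloor>t / w\<rfloor> < m" using that w by (simp add: floor_less_iff nat_less_iff)
      then show ?thesis using Jeq[of t] that by auto
    qed
    have "\<nu> B = emeasure lborel (\<Union>k<m. {t\<in>J k. g t \<in> B})"
    proof -
      have "{t\<in>{0..<L}. g t \<in> B} = (\<Union>k<m. {t\<in>J k. g t \<in> B})"
      proof (intro equalityI subsetI)
        fix t assume t: "t \<in> {t\<in>{0..<L}. g t \<in> B}"
        then obtain k where "k < m" "t \<in> J k" using UJ by blast
        with t show "t \<in> (\<Union>k<m. {t\<in>J k. g t \<in> B})" by blast
      next
        fix t assume "t \<in> (\<Union>k<m. {t\<in>J k. g t \<in> B})"
        then obtain k where "k < m" "t \<in> J k" "g t \<in> B" by blast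
        then show "t \<in> {t\<in>{0..<L}. g t \<in> B}" using J0 JL by simp
      qed
      then show ?thesis unfolding \<nu>_def by simp
    qed
    also have "\<dots> = (\<Sum>k<m. emeasure lborel {t\<in>J k. g t \<in> B})"
    proof (rule sum_emeasure[symmetric])
      show "(\<lambda>k. {t\<in>J k. g t \<in> B}) ` {..<m} \<subseteq> sets lborel"
        using mB[OF B] by (auto simp: J_def)
      show "disjoint_family_on (\<lambda>k. {t\<in>J k. g t \<in> B}) {..<m}"
      proof (unfold disjoint_family_on_def, intro ballI impI, rule ccontr)
        fix i j assume ij: "i \<noteq> j" "{t\<in>J i. g t \<in> B} \<inter> {t\<in>J j. g t \<in> B} \<noteq> {}"
        then obtain t where t: "t \<in> J i" "t \<in> J j" by blast
        show False using Jeq[OF J0[OF t(1)], of i] Jeq[OF J0[OF t(1)], of j] t ij(1) by simp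
      qed
    qed simp
    finally have "ennreal \<theta> * \<nu> B = (\<Sum>k<m. ennreal \<theta> * emeasure lborel {t\<in>J k. g t \<in> B})"
      by (simp add: sum_distrib_left)
    also have "\<dots> \<le> (\<Sum>k<m. ?H (B \<inter> g ` J k))"
    proof (rule sum_mono)
      fix k
      have "ennreal \<theta> * emeasure lborel {t\<in>J k. g t \<in> B} \<le> hausdorff1_outer (B \<inter> g ` J k)"
      proof (rule hausdorff1_outer_image_ge)
        fix s t assume "s \<in> J k" "t \<in> J k"
        then have "\<bar>s - t\<bar> \<le> l" using w by (auto simp: J_def algebra_simps)
        then show "\<theta> * \<bar>s - t\<bar> \<le> dist (g s) (g t)" by (rule l)
      qed (use \<theta> mB[OF B] in \<open>auto simp: J_def\<close>)
      then show "ennreal \<theta> * emeasure lborel {t\<in>J k. g t \<in> B} \<le> ?H (B \<inter> g ` J k)"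
        using B by (subst emeasure_hausdorff1)
          (auto simp: J_def intro!: continuous_image_atLeastLessThan_borel contg)
    qed
    also have "\<dots> = ?H (\<Union>k<m. B \<inter> g ` J k)"
    proof (rule sum_emeasure)
      show "(\<lambda>k. B \<inter> g ` J k) ` {..<m} \<subseteq> sets hausdorff1"
        using B contg by (auto simp: J_def intro!: continuous_image_atLeastLessThan_borel)
      show "disjoint_family_on (\<lambda>k. B \<inter> g ` J k) {..<m}"
      proof (unfold disjoint_family_on_def, intro ballI impI, rule ccontr)
        fix i j assume ij: "i \<in> {..<m}" "j \<in> {..<m}" "i \<noteq> j" "(B \<inter> g ` J i) \<inter> (B \<inter> g ` J j) \<noteq> {}"
        then obtain s t where st: "s \<in> J i" "t \<in> J j" "g s = g t" by auto
        then have "s = t"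
          using ij J0[OF st(1)] J0[OF st(2)] JL[OF st(1)] JL[OF st(2)] by (intro inj_onD[OF inj]) auto
        then show False
          using Jeq[OF J0[OF st(1)], of i] Jeq[OF J0[OF st(1)], of j] st ij(3) by simp
      qed
    qed simp
    also have "\<dots> \<le> ?H (\<Gamma> \<inter> B)"
    proof (rule emeasure_mono)
      show "(\<Union>k<m. B \<inter> g ` J k) \<subseteq> \<Gamma> \<inter> B"
      proof
        fix x assume "x \<in> (\<Union>k<m. B \<inter> g ` J k)"
        then obtain k t where "k < m" "t \<in> J k" "x = g t" "x \<in> B" by blast
        then show "x \<in> \<Gamma> \<inter> B" using J0[of t k] JL[of t k] by (auto simp: \<Gamma>_def)
      qed
    qed (use B \<Gamma>B in auto)
    finally show ?thesis .
  qed
  have ge: "\<nu> B \<le> ?H (\<Gamma> \<inter> B)" if B: "B \<in> sets borel" for B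
  proof (cases "?H (\<Gamma> \<inter> B) = top")
    case False
    have nf: "\<nu> B \<noteq> top" using \<nu>fin[OF B] by (metis ennreal_neq_top top.extremum_unique)
    define n h where "n = enn2real (\<nu> B)" and "h = enn2real (?H (\<Gamma> \<inter> B))"
    have nh: "\<nu> B = ennreal n" "?H (\<Gamma> \<inter> B) = ennreal h" "n \<ge> 0" "h \<ge> 0"
      using nf False by (auto simp: n_def h_def less_top)
    \<comment> \<open>Both sides are finite here, so the factor \<open>\<theta>\<close> is removed
      by letting it tend to \<open>1\<close>.\<close>
    have "n \<le> h"
    proof (rule field_le_mult_one_interval)
      fix z :: real assume z: "0 < z" "z < 1"
      then show "z * n \<le> h" using theta[OF B z] nh by (simp flip: ennreal_mult)
    qed
    then show ?thesis using nh by simp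
  qed simp
  have total: "?H \<Gamma> \<le> ennreal L"
    using hausdorff1_outer_lipschitz_interval[OF L lip] \<Gamma>B by (simp add: emeasure_hausdorff1 \<Gamma>_def)
  have eq: "?H (\<Gamma> \<inter> B) = \<nu> B" if B: "B \<in> sets borel" for B
  proof (rule antisym)
    have "\<nu> B + \<nu> (- B) = emeasure lborel ({t\<in>{0..<L}. g t \<in> B} \<union> {t\<in>{0..<L}. g t \<in> - B})"
      unfolding \<nu>_def using B by (intro plus_emeasure mB) auto
    also have "{t\<in>{0..<L}. g t \<in> B} \<union> {t\<in>{0..<L}. g t \<in> - B} = {0..<L}" by auto
    finally have \<nu>s: "\<nu> B + \<nu> (- B) = ennreal L" using L by simp
    have "?H (\<Gamma> \<inter> B) + ?H (\<Gamma> \<inter> - B) = ?H (\<Gamma> \<inter> B \<union> \<Gamma> \<inter> - B)"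
      using B \<Gamma>B by (intro plus_emeasure) auto
    also have "\<Gamma> \<inter> B \<union> \<Gamma> \<inter> - B = \<Gamma>" by auto
    finally have "?H (\<Gamma> \<inter> B) + ?H (\<Gamma> \<inter> - B) \<le> \<nu> B + \<nu> (- B)" using total \<nu>s by simp
    moreover have "\<nu> (- B) \<le> ?H (\<Gamma> \<inter> - B)" using B by (intro ge) auto
    ultimately have "?H (\<Gamma> \<inter> B) + \<nu> (- B) \<le> \<nu> B + \<nu> (- B)"
      by (meson add_left_mono order.trans)
    moreover have "\<nu> (- B) \<noteq> top" using \<nu>fin[of "- B"] B by (metis ennreal_neq_top top.extremum_unique borel_comp)
    ultimately show "?H (\<Gamma> \<inter> B) \<le> \<nu> B"
      by (metis add.commute ennreal_add_left_cancel_le infinity_ennreal_def)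
  qed (rule ge[OF B])
  show ?thesis
  proof (rule measure_eqI)
    show "sets ?M = sets ?N" by (simp add: restrict_measure_def)
    fix B assume "B \<in> sets ?M"
    then have "B \<in> sets borel" by (simp add: restrict_measure_def)
    then show "emeasure ?M B = emeasure ?N B" using M N eq by simp
  qed
qed

section \<open>Exponentially small quantities\<close>

lemma exponentially_small_le:
  assumes "exponentially_small X" "\<forall>\<^sub>F \<epsilon> in at_right 0. \<bar>R \<epsilon>\<bar> \<le> \<bar>X \<epsilon>\<bar>"
  shows "exponentially_small R"
proof -
  obtain C c where C: "C > 0" "c > 0" "\<forall>\<^sub>F \<epsilon> in at_right 0. \<bar>X \<epsilon>\<bar> \<le> C * exp (- c / \<epsilon>)"
    using assms(1) by (auto simp: exponentially_small_def)
  have "\<forall>\<^sub>F \<epsilon> in at_right 0. \<bar>R \<epsilon>\<bar> \<le> C * exp (- c / \<epsilon>)"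
    using assms(2) C(3) by eventually_elim simp
  with C(1,2) show ?thesis unfolding exponentially_small_def by blast
qed

lemma exponentially_small_le_pos:
  assumes "exponentially_small X" "\<And>\<epsilon>. \<epsilon> > 0 \<Longrightarrow> \<bar>R \<epsilon>\<bar> \<le> X \<epsilon>"
  shows "exponentially_small R"
  using assms(2) by (intro exponentially_small_le[OF assms(1)] eventually_at_right_less[THEN eventually_mono])
    (meson abs_ge_self order.trans)

lemma exponentially_small_exp: "c > 0 \<Longrightarrow> exponentially_small (\<lambda>\<epsilon>. exp (- c / \<epsilon>))"
  unfolding exponentially_small_def by (intro exI[of _ 1] conjI exI[of _ c]) auto

lemma exponentially_small_cmult:
  assumes "exponentially_small X" shows "exponentially_small (\<lambda>\<epsilon>. k * X \<epsilon>)"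
proof -
  obtain C c where C: "C > 0" "c > 0" "\<forall>\<^sub>F \<epsilon> in at_right 0. \<bar>X \<epsilon>\<bar> \<le> C * exp (- c / \<epsilon>)"
    using assms(1) by (auto simp: exponentially_small_def)
  have "\<forall>\<^sub>F \<epsilon> in at_right 0. \<bar>k * X \<epsilon>\<bar> \<le> ((\<bar>k\<bar> + 1) * C) * exp (- c / \<epsilon>)"
    using C(3)
  proof eventually_elim
    case (elim \<epsilon>)
    have "\<bar>k * X \<epsilon>\<bar> \<le> (\<bar>k\<bar> + 1) * (C * exp (- c / \<epsilon>))"
      unfolding abs_mult by (intro mult_mono elim) auto
    then show ?case by (simp add: mult.assoc)
  qed
  moreover have "(\<bar>k\<bar> + 1) * C > 0" using C(1) by (intro mult_pos_pos) auto
  ultimately show ?thesis using C(2) unfolding exponentially_small_def by blast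
qed

lemma exponentially_small_add:
  assumes "exponentially_small X" "exponentially_small Y"
  shows "exponentially_small (\<lambda>\<epsilon>. X \<epsilon> + Y \<epsilon>)"
proof -
  obtain C c where C: "C > 0" "c > 0" "\<forall>\<^sub>F \<epsilon> in at_right 0. \<bar>X \<epsilon>\<bar> \<le> C * exp (- c / \<epsilon>)"
    using assms(1) by (auto simp: exponentially_small_def)
  obtain D d where D: "D > 0" "d > 0" "\<forall>\<^sub>F \<epsilon> in at_right 0. \<bar>Y \<epsilon>\<bar> \<le> D * exp (- d / \<epsilon>)"
    using assms(2) by (auto simp: exponentially_small_def)
  have "\<forall>\<^sub>F \<epsilon> in at_right 0. \<bar>X \<epsilon> + Y \<epsilon>\<bar> \<le> (C + D) * exp (- min c d / \<epsilon>)"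
    using C(3) D(3) eventually_at_right_less[of 0]
  proof eventually_elim
    case (elim \<epsilon>)
    have "C * exp (- c / \<epsilon>) \<le> C * exp (- min c d / \<epsilon>)"
      using C(1) elim(3) by (intro mult_left_mono) (auto simp: divide_right_mono)
    moreover have "D * exp (- d / \<epsilon>) \<le> D * exp (- min c d / \<epsilon>)"
      using D(1) elim(3) by (intro mult_left_mono) (auto simp: divide_right_mono)
    ultimately show ?case using elim by (simp add: distrib_right)
  qed
  then show ?thesis using C D unfolding exponentially_small_def
    by (intro exI[of _ "C + D"] exI[of _ "min c d"] conjI) auto
qed

text \<open>The factor \<open>1 / \<epsilon>\<close> is absorbed by half of the exponential, so the
  rate \<open>c\<close> drops to \<open>c / 2\<close>.\<close>

lemma exponentially_small_divide:
  assumes "exponentially_small X" shows "exponentially_small (\<lambda>\<epsilon>. X \<epsilon> / \<epsilon>)"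
proof -
  obtain C c where C: "C > 0" "c > 0" "\<forall>\<^sub>F \<epsilon> in at_right 0. \<bar>X \<epsilon>\<bar> \<le> C * exp (- c / \<epsilon>)"
    using assms(1) by (auto simp: exponentially_small_def)
  have "\<forall>\<^sub>F \<epsilon> in at_right 0. \<bar>X \<epsilon> / \<epsilon>\<bar> \<le> (2 * C / c) * exp (- (c / 2) / \<epsilon>)"
    using C(3) eventually_at_right_less[of 0]
  proof eventually_elim
    case (elim \<epsilon>)
    have "c / (2 * \<epsilon>) \<le> exp (c / (2 * \<epsilon>))" using exp_ge_add_one_self[of "c / (2 * \<epsilon>)"] by linarith
    then have "1 / \<epsilon> \<le> (2 / c) * exp (c / (2 * \<epsilon>))" using C(2) elim(2) by (simp add: field_simps)
    then have "C * exp (- c / \<epsilon>) * (1 / \<epsilon>) \<le> C * exp (- c / \<epsilon>) * ((2 / c) * exp (c / (2 * \<epsilon>)))"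
      using C(1) by (intro mult_left_mono) auto
    also have "\<dots> = (2 * C / c) * (exp (- c / \<epsilon>) * exp (c / (2 * \<epsilon>)))" by simp
    also have "exp (- c / \<epsilon>) * exp (c / (2 * \<epsilon>)) = exp (- (c / 2) / \<epsilon>)"
      by (simp add: field_simps flip: exp_add)
    finally have "C * exp (- c / \<epsilon>) * (1 / \<epsilon>) \<le> (2 * C / c) * exp (- (c / 2) / \<epsilon>)" .
    moreover have "\<bar>X \<epsilon> / \<epsilon>\<bar> \<le> C * exp (- c / \<epsilon>) * (1 / \<epsilon>)"
      using elim by (simp add: divide_right_mono)
    ultimately show ?case by linarith
  qed
  moreover have "2 * C / c > 0" "c / 2 > 0" using C by auto
  ultimately show ?thesis unfolding exponentially_small_def by blast
qed

lemma exponentially_small_bounded_mult: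
  assumes X: "exponentially_small X" and f: "\<forall>\<^sub>F \<epsilon> in at_right 0. \<bar>f \<epsilon>\<bar> \<le> K"
  shows "exponentially_small (\<lambda>\<epsilon>. f \<epsilon> * X \<epsilon>)"
  using f by (intro exponentially_small_le[OF exponentially_small_cmult[OF X, of K]])
    (auto elim!: eventually_mono simp: abs_mult intro!: mult_right_mono)

lemma eventually_less_at_right_0: "\<forall>\<^sub>F \<epsilon> in at_right (0::real). \<bar>\<epsilon>\<bar> \<le> 1"
  by (auto simp: eventually_at_right_field intro!: exI[of _ 1])

lemma exponentially_small_times_eps:
  "exponentially_small X \<Longrightarrow> exponentially_small (\<lambda>\<epsilon>. \<epsilon> * X \<epsilon>)"
  by (rule exponentially_small_bounded_mult[OF _ eventually_less_at_right_0])

lemma exponentially_small_tendsto_0: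
  assumes "exponentially_small X" shows "(X \<longlongrightarrow> 0) (at_right 0)"
proof -
  obtain C c where C: "C > 0" "c > 0" "\<forall>\<^sub>F \<epsilon> in at_right 0. \<bar>X \<epsilon>\<bar> \<le> C * exp (- c / \<epsilon>)"
    using assms by (auto simp: exponentially_small_def)
  have "((\<lambda>\<epsilon>. C * exp (- c / \<epsilon>)) \<longlongrightarrow> 0) (at_right 0)" using C(2) by real_asymp
  then show ?thesis
    by (rule Lim_null_comparison[rotated]) (use C(3) in simp)
qed

lemma exponentially_small_eventually_le_1:
  assumes "exponentially_small X" shows "\<forall>\<^sub>F \<epsilon> in at_right 0. \<bar>X \<epsilon>\<bar> \<le> 1"
  using tendstoD[OF exponentially_small_tendsto_0[OF assms] zero_less_one]
  by eventually_elim simp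

lemma exponentially_small_mult:
  "exponentially_small X \<Longrightarrow> exponentially_small Y \<Longrightarrow> exponentially_small (\<lambda>\<epsilon>. X \<epsilon> * Y \<epsilon>)"
  by (rule exponentially_small_bounded_mult[OF _ exponentially_small_eventually_le_1])

lemmas exponentially_small_intros =
  exponentially_small_add exponentially_small_cmult exponentially_small_divide
  exponentially_small_times_eps exponentially_small_mult

lemma exponentially_small_bigo:
  assumes "exponentially_small X" shows "X \<in> O[at_right 0](\<lambda>\<epsilon>. \<epsilon>\<^sup>2)"
proof -
  obtain C c where C: "C > 0" "c > 0" "\<forall>\<^sub>F \<epsilon> in at_right 0. \<bar>X \<epsilon>\<bar> \<le> C * exp (- c / \<epsilon>)"
    using assms by (auto simp: exponentially_small_def)
  have "(\<lambda>\<epsilon>. exp (- c / \<epsilon>)) \<in> O[at_right 0](\<lambda>\<epsilon>. \<epsilon>\<^sup>2)" using C(2) by real_asymp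
  moreover have "X \<in> O[at_right 0](\<lambda>\<epsilon>. exp (- c / \<epsilon>))"
    using C(3) by (intro bigoI[of _ C]) simp
  ultimately show ?thesis by (rule landau_o.big_trans[rotated])
qed

text \<open>An exponential beats every power of \<open>\<epsilon>\<close>, negative ones included;
  this is why the penalty terms of \<open>F_eps\<close> vanish for all exponents
  \<open>\<alpha>\<close> and \<open>\<beta>\<close>.\<close>

lemma exponentially_small_powr:
  assumes "exponentially_small X" shows "((\<lambda>\<epsilon>. \<epsilon> powr a * (X \<epsilon>)\<^sup>2) \<longlongrightarrow> 0) (at_right 0)"
proof -
  obtain C c where C: "C > 0" "c > 0" "\<forall>\<^sub>F \<epsilon> in at_right 0. \<bar>X \<epsilon>\<bar> \<le> C * exp (- c / \<epsilon>)"
    using assms by (auto simp: exponentially_small_def)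
  have "((\<lambda>\<epsilon>. \<epsilon> powr a * (C * exp (- c / \<epsilon>))\<^sup>2) \<longlongrightarrow> 0) (at_right 0)" using C(1,2) by real_asymp
  moreover have "\<forall>\<^sub>F \<epsilon> in at_right 0. norm (\<epsilon> powr a * (X \<epsilon>)\<^sup>2) \<le> \<epsilon> powr a * (C * exp (- c / \<epsilon>))\<^sup>2"
    using C(3)
  proof eventually_elim
    case (elim \<epsilon>)
    have "(X \<epsilon>)\<^sup>2 \<le> (C * exp (- c / \<epsilon>))\<^sup>2" using elim by (intro iffD1[OF abs_le_square_iff]) simp
    then show ?case by (simp add: abs_mult mult_left_mono)
  qed
  ultimately show ?thesis by (rule Lim_null_comparison[rotated])
qed

section \<open>The optimal profile\<close>

definition ramp :: "nat \<Rightarrow> real \<Rightarrow> real" where "ramp n x = (max 0 x) ^ n"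

lemma ramp_nonpos: "x \<le> 0 \<Longrightarrow> n > 0 \<Longrightarrow> ramp n x = 0"
  by (simp add: ramp_def max_def)

lemma ramp_nonneg_eq: "x \<ge> 0 \<Longrightarrow> ramp n x = x ^ n"
  by (simp add: ramp_def)

text \<open>At the kink the difference quotient is \<open>ramp (Suc n)\<close>, which tends to
  \<open>0\<close> since its exponent is still positive.\<close>

lemma has_real_derivative_ramp:
  "(ramp (Suc (Suc n)) has_real_derivative real (Suc (Suc n)) * ramp (Suc n) x) (at x)"
proof -
  consider "x > 0" | "x < 0" | "x = 0" by linarith
  then show ?thesis
  proof cases
    case 1
    have "((\<lambda>x. x ^ Suc (Suc n)) has_real_derivative real (Suc (Suc n)) * x ^ Suc n) (at x)"
      using DERIV_pow[of "Suc (Suc n)" x] by simp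
    then have "(ramp (Suc (Suc n)) has_real_derivative real (Suc (Suc n)) * x ^ Suc n) (at x)"
      by (rule has_field_derivative_transform_within_open[of _ _ _ "{0<..}"]) (use 1 in \<open>auto simp: ramp_def\<close>)
    then show ?thesis using 1 by (simp add: ramp_def)
  next
    case 2
    have "((\<lambda>x. 0) has_real_derivative 0) (at x)" by simp
    then have "(ramp (Suc (Suc n)) has_real_derivative 0) (at x)"
      by (rule has_field_derivative_transform_within_open[of _ _ _ "{..<0}"]) (use 2 in \<open>auto simp: ramp_def\<close>)
    then show ?thesis using 2 by (simp add: ramp_def)
  next
    case 3
    have "((\<lambda>h. ramp (Suc n) h) \<longlongrightarrow> ramp (Suc n) 0) (at 0)"
      unfolding ramp_def by (intro tendsto_intros)
    then have lim: "((\<lambda>h. ramp (Suc n) h) \<longlongrightarrow> 0) (at 0)" by (simp add: ramp_def)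
    have "((\<lambda>h. ramp (Suc (Suc n)) h / h) \<longlongrightarrow> 0) (at 0)"
    proof (rule Lim_transform_eventually[OF lim])
      show "\<forall>\<^sub>F h in at 0. ramp (Suc n) h = ramp (Suc (Suc n)) h / h"
        by (auto simp: eventually_at_filter ramp_def max_def)
    qed
    then show ?thesis using 3 by (simp add: has_field_derivative_def[symmetric] DERIV_def ramp_def)
  qed
qed

text \<open>The integrals of the quadratic B-spline with nodes \<open>0, 1, 2, 3\<close>, of the B-spline itself and
  of its derivative.\<close>

definition step0 :: "real \<Rightarrow> real"
  where "step0 x = (ramp 3 x - 3 * ramp 3 (x - 1) + 3 * ramp 3 (x - 2) - ramp 3 (x - 3)) / 6"
definition step1 :: "real \<Rightarrow> real"
  where "step1 x = (ramp 2 x - 3 * ramp 2 (x - 1) + 3 * ramp 2 (x - 2) - ramp 2 (x - 3)) / 2"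
definition step2 :: "real \<Rightarrow> real"
  where "step2 x = ramp 1 x - 3 * ramp 1 (x - 1) + 3 * ramp 1 (x - 2) - ramp 1 (x - 3)"

lemma has_real_derivative_ramp_shift:
  "((\<lambda>x. ramp 3 (x - k)) has_real_derivative 3 * ramp 2 (x - k)) (at x)"
  "((\<lambda>x. ramp 2 (x - k)) has_real_derivative 2 * ramp 1 (x - k)) (at x)"
proof -
  have "(ramp 3 has_real_derivative 3 * ramp 2 y) (at y)" "(ramp 2 has_real_derivative 2 * ramp 1 y) (at y)" for y
    using has_real_derivative_ramp[of 1 y] has_real_derivative_ramp[of 0 y]
    by (simp_all add: numeral_3_eq_3 numeral_2_eq_2)
  note r = this
  have d: "((\<lambda>x. x - k) has_real_derivative 1) (at x)" by (auto intro!: derivative_eq_intros)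
  show "((\<lambda>x. ramp 3 (x - k)) has_real_derivative 3 * ramp 2 (x - k)) (at x)"
    using DERIV_chain2[where f="ramp 3" and g="\<lambda>x. x - k", OF r(1) d] by simp
  show "((\<lambda>x. ramp 2 (x - k)) has_real_derivative 2 * ramp 1 (x - k)) (at x)"
    using DERIV_chain2[where f="ramp 2" and g="\<lambda>x. x - k", OF r(2) d] by simp
qed

lemma has_real_derivative_step0: "(step0 has_real_derivative step1 x) (at x)"
  unfolding step0_def[abs_def] step1_def
  using has_real_derivative_ramp_shift(1)[of 0] has_real_derivative_ramp_shift(1)[of 1]
    has_real_derivative_ramp_shift(1)[of 2] has_real_derivative_ramp_shift(1)[of 3]
  by (auto intro!: derivative_eq_intros)

lemma has_real_derivative_step1: "(step1 has_real_derivative step2 x) (at x)"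
  unfolding step1_def[abs_def] step2_def
  using has_real_derivative_ramp_shift(2)[of 0] has_real_derivative_ramp_shift(2)[of 1]
    has_real_derivative_ramp_shift(2)[of 2] has_real_derivative_ramp_shift(2)[of 3]
  by (auto intro!: derivative_eq_intros)

lemma continuous_on_step2: "continuous_on A step2"
  unfolding step2_def[abs_def] ramp_def by (intro continuous_intros)

lemma step_nonpos: "x \<le> 0 \<Longrightarrow> step0 x = 0" "x \<le> 0 \<Longrightarrow> step1 x = 0" "x \<le> 0 \<Longrightarrow> step2 x = 0"
  by (auto simp: step0_def step1_def step2_def ramp_nonpos)

lemma step_ge_3: "x \<ge> 3 \<Longrightarrow> step0 x = 1" "x \<ge> 3 \<Longrightarrow> step1 x = 0" "x \<ge> 3 \<Longrightarrow> step2 x = 0"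
  by (auto simp: step0_def step1_def step2_def ramp_nonneg_eq power2_eq_square power3_eq_cube algebra_simps)

lemma step1_bounds: "0 \<le> step1 x" "step1 x \<le> 1"
proof -
  consider "x \<le> 0" | "0 \<le> x" "x \<le> 1" | "1 \<le> x" "x \<le> 2" | "2 \<le> x" "x \<le> 3" | "x \<ge> 3" by linarith
  then have "0 \<le> step1 x \<and> step1 x \<le> 1"
  proof cases
    case 2
    then have "step1 x = x\<^sup>2 / 2" by (simp add: step1_def ramp_nonneg_eq ramp_nonpos)
    moreover have "x\<^sup>2 \<le> 1" using 2 by (simp add: power_le_one)
    ultimately show ?thesis using zero_le_power2[of x] by linarith
  next
    case 3
    \<comment> \<open>On the middle interval the B-spline is the parabola with maximum
      \<open>3/4\<close> at \<open>3/2\<close>.\<close>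
    then have s: "step1 x = 1/2 + (x - 1) * (2 - x)"
      by (simp add: step1_def ramp_nonneg_eq ramp_nonpos power2_eq_square field_simps)
    have "0 \<le> (x - 1) * (2 - x)" using 3 by simp
    moreover have "(x - 1) * (2 - x) = 1/4 - (x - 3/2)\<^sup>2" by (simp add: power2_eq_square algebra_simps)
    then have "(x - 1) * (2 - x) \<le> 1/4" by simp
    ultimately show ?thesis using s by simp
  next
    case 4
    then have "step1 x = (3 - x)\<^sup>2 / 2"
      by (simp add: step1_def ramp_nonneg_eq ramp_nonpos power2_eq_square algebra_simps)
    moreover have "(3 - x)\<^sup>2 \<le> 1" using 4 by (simp add: power_le_one)
    ultimately show ?thesis using zero_le_power2[of "3 - x"] by linarith
  qed (auto simp: step_nonpos step_ge_3)
  then show "0 \<le> step1 x" "step1 x \<le> 1" by auto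
qed

lemma step2_bound: "\<bar>step2 x\<bar> \<le> 1"
proof -
  consider "x \<le> 0" | "0 \<le> x" "x \<le> 1" | "1 \<le> x" "x \<le> 2" | "2 \<le> x" "x \<le> 3" | "x \<ge> 3" by linarith
  then show ?thesis
    by cases (auto simp: step_nonpos step_ge_3, auto simp: step2_def ramp_nonneg_eq ramp_nonpos)
qed

text \<open>The derivative \<open>step1\<close> is nonnegative, and \<open>step0\<close> is constant
  outside the nodes \<open>0\<close> and \<open>3\<close>, with values \<open>0\<close> and
  \<open>1\<close>.\<close>

lemma step0_bounds: "0 \<le> step0 x" "step0 x \<le> 1"
proof -
  have mono: "step0 x \<le> step0 y" if "x \<le> y" for x y
    using that by (rule DERIV_nonneg_imp_nondecreasing)
      (use has_real_derivative_step0 step1_bounds in blast)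
  show "0 \<le> step0 x" using mono[of "min x 0" x] by (simp add: step_nonpos)
  show "step0 x \<le> 1" using mono[of x "max x 3"] by (simp add: step_ge_3)
qed

section \<open>The hyperbolic tangent as transition profile\<close>

lemma one_minus_tanh: "1 - tanh (x::real) \<le> 2 * exp (- 2 * x)"
proof -
  have "1 - tanh x = 2 * exp (- 2 * x) / (1 + exp (- 2 * x))"
    by (simp add: tanh_real_altdef field_simps add_pos_pos add_nonneg_eq_0_iff)
  also have "\<dots> \<le> 2 * exp (- 2 * x) / 1" by (intro divide_left_mono) (auto intro: add_pos_pos)
  finally show ?thesis by simp
qed

text \<open>On \<open>{-1..1}\<close> the root of \<open>2 * W\<close> is the polynomial
  \<open>(1 - s^2) / sqrt 2\<close>, which has an explicit primitive.\<close>

lemma c0_eq: "c0 = 4 / (3 * sqrt 2)"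
proof -
  have "((\<lambda>s. sqrt (2 * W s)) has_integral (1 - 1^3/3) / sqrt 2 - ((-1) - (-1)^3/3) / sqrt 2) {-1..1}"
  proof (rule fundamental_theorem_of_calculus)
    fix s :: real assume s: "s \<in> {-1..1}"
    then have "s\<^sup>2 \<le> 1" by (simp add: abs_square_le_1 abs_le_iff)
    then have "sqrt (2 * W s) = (1 - s\<^sup>2) / sqrt 2"
      by (intro real_sqrt_unique) (auto simp: W_def power_divide)
    moreover have "((\<lambda>s. s - s^3/3) has_real_derivative 1 - s\<^sup>2) (at s within {-1..1})"
      by (auto intro!: derivative_eq_intros)
    then have "((\<lambda>s. (s - s^3/3) / sqrt 2) has_real_derivative (1 - s\<^sup>2) / sqrt 2) (at s within {-1..1})"
      by (rule DERIV_cdivide)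
    ultimately show "((\<lambda>s. (s - s^3/3) / sqrt 2) has_vector_derivative sqrt (2 * W s)) (at s within {-1..1})"
      by (simp add: has_real_derivative_iff_has_vector_derivative)
  qed simp
  then have "integral {-1..1} (\<lambda>s. sqrt (2 * W s)) = 4 / (3 * sqrt 2)"
    by (simp add: integral_unique field_simps)
  moreover have "set_integrable lborel {-1..1} (\<lambda>s. sqrt (2 * W s))"
    by (rule borel_integrable_atLeastAtMost') (auto simp: W_def intro!: continuous_intros)
  ultimately show ?thesis
    unfolding c0_def by (simp add: set_borel_integral_eq_integral)
qed

lemma c0_pos: "c0 > 0"
  by (simp add: c0_eq)

text \<open>For \<open>a = 1 / (sqrt 2 * \<epsilon>)\<close> this is the solution of
  \<open>\<epsilon> q'' = W'(q) / \<epsilon>\<close> joining \<open>-1\<close> to \<open>1\<close>.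
  Its derivatives are written as polynomials in \<open>trans0\<close>, so that this equation and the
  equality of the two energy parts become algebraic identities.\<close>

definition trans0 :: "real \<Rightarrow> real \<Rightarrow> real" where "trans0 a r = tanh (a * r)"
definition trans1 :: "real \<Rightarrow> real \<Rightarrow> real" where "trans1 a r = a * (1 - (trans0 a r)\<^sup>2)"
definition trans2 :: "real \<Rightarrow> real \<Rightarrow> real"
  where "trans2 a r = - 2 * a\<^sup>2 * trans0 a r * (1 - (trans0 a r)\<^sup>2)"

lemma has_real_derivative_trans0: "(trans0 a has_real_derivative trans1 a r) (at r)"
  unfolding trans0_def[abs_def] trans1_def by (auto intro!: derivative_eq_intros)

lemma has_real_derivative_trans1: "(trans1 a has_real_derivative trans2 a r) (at r)"
  unfolding trans1_def[abs_def] trans2_def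
  by (auto intro!: derivative_eq_intros has_real_derivative_trans0 simp: trans1_def power2_eq_square)

lemma trans_minus: "trans0 a (- r) = - trans0 a r" "trans1 a (- r) = trans1 a r"
  "trans2 a (- r) = - trans2 a r"
  by (auto simp: trans0_def trans1_def trans2_def)

lemma trans0_bounds: "- 1 \<le> trans0 a r" "trans0 a r \<le> 1"
  using tanh_real_bounds[of "a * r"] by (auto simp: trans0_def)

lemma trans0_sq_le: "(trans0 a r)\<^sup>2 \<le> 1"
  using trans0_bounds[of a r] by (simp add: abs_square_le_1 abs_le_iff)

lemma trans1_bounds: "a \<ge> 0 \<Longrightarrow> 0 \<le> trans1 a r" "a \<ge> 0 \<Longrightarrow> trans1 a r \<le> a"
  using trans0_sq_le[of a r] by (auto simp: trans1_def mult_left_le)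

text \<open>Adding \<open>bump0\<close> replaces the tail of \<open>tanh\<close> by the constant \<open>1\<close> between \<open>\<rho>\<close> and \<open>4 \<rho>\<close>.\<close>

definition bump0 :: "real \<Rightarrow> real \<Rightarrow> real \<Rightarrow> real"
  where "bump0 \<rho> a r = step0 ((r - \<rho>) / \<rho>) * (1 - trans0 a r)"
definition bump1 :: "real \<Rightarrow> real \<Rightarrow> real \<Rightarrow> real"
  where "bump1 \<rho> a r = step1 ((r - \<rho>) / \<rho>) / \<rho> * (1 - trans0 a r) - step0 ((r - \<rho>) / \<rho>) * trans1 a r"
definition bump2 :: "real \<Rightarrow> real \<Rightarrow> real \<Rightarrow> real"
  where "bump2 \<rho> a r = step2 ((r - \<rho>) / \<rho>) / \<rho>\<^sup>2 * (1 - trans0 a r)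
    - 2 * (step1 ((r - \<rho>) / \<rho>) / \<rho>) * trans1 a r - step0 ((r - \<rho>) / \<rho>) * trans2 a r"

lemma has_real_derivative_step_scaled:
  assumes "\<rho> > 0"
  shows "((\<lambda>r. step0 ((r - \<rho>) / \<rho>)) has_real_derivative step1 ((r - \<rho>) / \<rho>) / \<rho>) (at r)"
    "((\<lambda>r. step1 ((r - \<rho>) / \<rho>)) has_real_derivative step2 ((r - \<rho>) / \<rho>) / \<rho>) (at r)"
proof -
  have d: "((\<lambda>r. (r - \<rho>) / \<rho>) has_real_derivative 1 / \<rho>) (at r)"
    using assms by (auto intro!: derivative_eq_intros)
  show "((\<lambda>r. step0 ((r - \<rho>) / \<rho>)) has_real_derivative step1 ((r - \<rho>) / \<rho>) / \<rho>) (at r)"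
    using DERIV_chain2[where f=step0 and g="\<lambda>r. (r - \<rho>) / \<rho>", OF has_real_derivative_step0 d] by simp
  show "((\<lambda>r. step1 ((r - \<rho>) / \<rho>)) has_real_derivative step2 ((r - \<rho>) / \<rho>) / \<rho>) (at r)"
    using DERIV_chain2[where f=step1 and g="\<lambda>r. (r - \<rho>) / \<rho>", OF has_real_derivative_step1 d] by simp
qed

lemma has_real_derivative_bump0:
  assumes "\<rho> > 0" shows "(bump0 \<rho> a has_real_derivative bump1 \<rho> a r) (at r)"
  unfolding bump0_def[abs_def] bump1_def
  using DERIV_mult[OF has_real_derivative_step_scaled(1)[OF assms]
      DERIV_diff[OF DERIV_const has_real_derivative_trans0]]
  by (rule DERIV_cong) simp

lemma has_real_derivative_bump1:
  assumes "\<rho> > 0" shows "(bump1 \<rho> a has_real_derivative bump2 \<rho> a r) (at r)"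
proof -
  have "((\<lambda>r. step1 ((r - \<rho>) / \<rho>) / \<rho>) has_real_derivative step2 ((r - \<rho>) / \<rho>) / \<rho> / \<rho>) (at r)"
    by (rule DERIV_cdivide[OF has_real_derivative_step_scaled(2)[OF assms]])
  from DERIV_diff[OF DERIV_mult[OF this DERIV_diff[OF DERIV_const has_real_derivative_trans0]]
      DERIV_mult[OF has_real_derivative_step_scaled(1)[OF assms] has_real_derivative_trans1]]
  show ?thesis
    unfolding bump1_def[abs_def] bump2_def
    by (rule DERIV_cong) (use assms in \<open>simp add: power2_eq_square algebra_simps\<close>)
qed

lemma bump_eq_0: 
  assumes "\<rho> > 0" "r \<le> \<rho>" shows "bump0 \<rho> a r = 0" "bump1 \<rho> a r = 0" "bump2 \<rho> a r = 0"
proof -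
  have "(r - \<rho>) / \<rho> \<le> 0" using assms by (simp add: divide_nonpos_pos)
  then show "bump0 \<rho> a r = 0" "bump1 \<rho> a r = 0" "bump2 \<rho> a r = 0"
    by (auto simp: bump0_def bump1_def bump2_def step_nonpos)
qed

lemma bump_far:
  assumes "\<rho> > 0" "r \<ge> 4 * \<rho>"
  shows "bump0 \<rho> a r = 1 - trans0 a r" "bump1 \<rho> a r = - trans1 a r" "bump2 \<rho> a r = - trans2 a r"
proof -
  have "(r - \<rho>) / \<rho> \<ge> 3" using assms by (simp add: field_simps)
  then show "bump0 \<rho> a r = 1 - trans0 a r" "bump1 \<rho> a r = - trans1 a r" "bump2 \<rho> a r = - trans2 a r"
    by (auto simp: bump0_def bump1_def bump2_def step_ge_3)
qed

text \<open>The first factor bounds \<open>1 - trans0 a r\<close> for \<open>r \<ge> \<rho>\<close>.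
  The second adds up the coefficients with which this tail enters \<open>bump0\<close>,
  \<open>bump1\<close> and \<open>bump2\<close>, so that one quantity bounds all three.\<close>

definition bump_bound :: "real \<Rightarrow> real \<Rightarrow> real"
  where "bump_bound \<rho> a = 2 * exp (- 2 * a * \<rho>) * (1 + 1 / \<rho> + 2 * a + 1 / \<rho>\<^sup>2 + 4 * a / \<rho> + 4 * a\<^sup>2)"

lemma bump_bound_nonneg: "\<rho> > 0 \<Longrightarrow> a > 0 \<Longrightarrow> bump_bound \<rho> a \<ge> 0"
  by (simp add: bump_bound_def)

text \<open>Each term is a bounded coefficient times the tail \<open>z = 1 - trans0 a r\<close>,
  because \<open>1 - t^2 \<le> 2 * (1 - t)\<close>. Beyond \<open>\<rho>\<close> the tail is at most
  \<open>2 * exp (- 2 * a * \<rho>)\<close>; up to \<open>\<rho>\<close> the bumps vanish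
  altogether, which matters since \<open>z\<close> is not small there.\<close>

lemma bump_le:
  assumes \<rho>: "\<rho> > 0" and a: "a > 0"
  shows "\<bar>bump0 \<rho> a r\<bar> \<le> bump_bound \<rho> a" "\<bar>bump1 \<rho> a r\<bar> \<le> bump_bound \<rho> a" "\<bar>bump2 \<rho> a r\<bar> \<le> bump_bound \<rho> a"
proof -
  define s0 s1 s2 where "s0 = step0 ((r - \<rho>) / \<rho>)" and "s1 = step1 ((r - \<rho>) / \<rho>)" and "s2 = step2 ((r - \<rho>) / \<rho>)"
  define z where "z = 1 - trans0 a r"
  have z0: "0 \<le> z" using trans0_bounds[of a r] by (simp add: z_def)
  have s: "\<bar>s0\<bar> \<le> 1" "\<bar>s1\<bar> \<le> 1" "\<bar>s2\<bar> \<le> 1"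
    using step0_bounds step1_bounds step2_bound by (auto simp: s0_def s1_def s2_def)
  have t1: "\<bar>trans1 a r\<bar> \<le> 2 * a * z"
  proof -
    have "trans1 a r = a * z * (1 + trans0 a r)"
      by (simp add: trans1_def z_def power2_eq_square algebra_simps)
    also have "\<dots> \<le> a * z * 2" using a z0 trans0_bounds[of a r] by (intro mult_left_mono) auto
    finally show ?thesis using trans1_bounds(1)[of a r] a by simp
  qed
  have t2: "\<bar>trans2 a r\<bar> \<le> 4 * a\<^sup>2 * z"
  proof -
    have "\<bar>trans2 a r\<bar> = 2 * a * \<bar>trans1 a r\<bar> * \<bar>trans0 a r\<bar>"
      using a by (simp add: trans2_def trans1_def abs_mult power2_eq_square)
    also have "\<dots> \<le> 2 * a * \<bar>trans1 a r\<bar> * 1"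
      using a trans0_bounds[of a r] by (intro mult_left_mono) auto
    also have "\<dots> \<le> 2 * a * (2 * a * z)" using t1 a by simp
    finally show ?thesis by (simp add: power2_eq_square)
  qed
  let ?B = "1 + 1 / \<rho> + 2 * a + 1 / \<rho>\<^sup>2 + 4 * a / \<rho> + 4 * a\<^sup>2"
  have p: "0 \<le> 1 / \<rho>" "0 \<le> 2 * a" "0 \<le> 1 / \<rho>\<^sup>2" "0 \<le> 4 * a / \<rho>" "0 \<le> 4 * a\<^sup>2" using \<rho> a by auto
  have "\<bar>s0 * z\<bar> \<le> 1 * z" unfolding abs_mult using s z0 by (intro mult_mono) auto
  also have "\<dots> \<le> ?B * z" using z0 p by (intro mult_right_mono) linarith+
  finally have 0: "\<bar>bump0 \<rho> a r\<bar> \<le> ?B * z" by (simp add: bump0_def s0_def z_def)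
  have m1: "\<bar>s1 / \<rho> * z\<bar> \<le> 1 / \<rho> * z" and m2: "\<bar>s2 / \<rho>\<^sup>2 * z\<bar> \<le> 1 / \<rho>\<^sup>2 * z"
    unfolding abs_mult abs_divide using s z0 \<rho> by (intro mult_mono divide_mono; auto)+
  have m3: "\<bar>s0 * trans1 a r\<bar> \<le> 1 * (2 * a * z)" and m4: "\<bar>s0 * trans2 a r\<bar> \<le> 1 * (4 * a\<^sup>2 * z)"
    unfolding abs_mult using s t1 t2 by (intro mult_mono; auto)+
  have m5: "\<bar>2 * (s1 / \<rho>) * trans1 a r\<bar> \<le> 2 * (1 / \<rho>) * (2 * a * z)"
    unfolding abs_mult abs_divide using s t1 \<rho> by (intro mult_mono divide_mono; auto)
  have "\<bar>bump1 \<rho> a r\<bar> \<le> (1 / \<rho> + 2 * a) * z"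
  proof -
    have "\<bar>bump1 \<rho> a r\<bar> = \<bar>s1 / \<rho> * z - s0 * trans1 a r\<bar>"
      by (simp add: bump1_def s0_def s1_def z_def)
    also have "\<dots> \<le> 1 / \<rho> * z + 1 * (2 * a * z)"
      using m1 m3 by linarith
    finally show ?thesis by (simp add: distrib_right)
  qed
  also have "\<dots> \<le> ?B * z" using z0 p by (intro mult_right_mono) linarith+
  finally have 1: "\<bar>bump1 \<rho> a r\<bar> \<le> ?B * z" .
  have "\<bar>bump2 \<rho> a r\<bar> \<le> (1 / \<rho>\<^sup>2 + 4 * a / \<rho> + 4 * a\<^sup>2) * z"
  proof -
    have "\<bar>bump2 \<rho> a r\<bar> = \<bar>s2 / \<rho>\<^sup>2 * z - 2 * (s1 / \<rho>) * trans1 a r - s0 * trans2 a r\<bar>"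
      by (simp add: bump2_def s0_def s1_def s2_def z_def)
    also have "\<dots> \<le> 1 / \<rho>\<^sup>2 * z + 2 * (1 / \<rho>) * (2 * a * z) + 1 * (4 * a\<^sup>2 * z)"
      using m2 m4 m5 by linarith
    finally show ?thesis by (simp add: distrib_right)
  qed
  also have "\<dots> \<le> ?B * z" using z0 p by (intro mult_right_mono) linarith+
  finally have 2: "\<bar>bump2 \<rho> a r\<bar> \<le> ?B * z" .
  have "\<bar>b\<bar> \<le> bump_bound \<rho> a" if "\<bar>b\<bar> \<le> ?B * z" "r \<le> \<rho> \<longrightarrow> b = 0" for b
  proof (cases "r \<le> \<rho>")
    case True
    then show ?thesis using that bump_bound_nonneg[OF \<rho> a] by simp
  next
    case False
    then have "a * \<rho> \<le> a * r" using a by simp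
    then have "exp (- 2 * (a * r)) \<le> exp (- 2 * a * \<rho>)" by simp
    then have "z \<le> 2 * exp (- 2 * a * \<rho>)"
      using one_minus_tanh[of "a * r"] unfolding z_def trans0_def by linarith
    then have "?B * z \<le> ?B * (2 * exp (- 2 * a * \<rho>))" using p by (intro mult_left_mono) linarith+
    then show ?thesis using that by (simp add: bump_bound_def mult.commute)
  qed
  note fin = this
  show "\<bar>bump0 \<rho> a r\<bar> \<le> bump_bound \<rho> a" "\<bar>bump1 \<rho> a r\<bar> \<le> bump_bound \<rho> a" "\<bar>bump2 \<rho> a r\<bar> \<le> bump_bound \<rho> a"
    using 0 1 2 \<rho> bump_eq_0 by (auto intro!: fin)
qed

text \<open>Both tails are corrected by the same bump, reflected with the sign that parity dictates,
  so the profile stays exactly odd and no parity defect has to be estimated later.\<close>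

definition prof0 :: "real \<Rightarrow> real \<Rightarrow> real \<Rightarrow> real"
  where "prof0 \<rho> a r = trans0 a r + (bump0 \<rho> a r - bump0 \<rho> a (- r))"
definition prof1 :: "real \<Rightarrow> real \<Rightarrow> real \<Rightarrow> real"
  where "prof1 \<rho> a r = trans1 a r + (bump1 \<rho> a r + bump1 \<rho> a (- r))"
definition prof2 :: "real \<Rightarrow> real \<Rightarrow> real \<Rightarrow> real"
  where "prof2 \<rho> a r = trans2 a r + (bump2 \<rho> a r - bump2 \<rho> a (- r))"

context
  fixes \<rho> a :: real
  assumes \<rho>: "\<rho> > 0" and a: "a > 0"
begin

lemma has_real_derivative_prof0: "(prof0 \<rho> a has_real_derivative prof1 \<rho> a r) (at r)"
proof -
  have "((\<lambda>r. bump0 \<rho> a (- r)) has_real_derivative bump1 \<rho> a (- r) * - 1) (at r)"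
    by (rule DERIV_chain2[OF has_real_derivative_bump0[OF \<rho>]]) (auto intro!: derivative_eq_intros)
  from DERIV_add[OF has_real_derivative_trans0 DERIV_diff[OF has_real_derivative_bump0[OF \<rho>] this]]
  show ?thesis unfolding prof0_def[abs_def] prof1_def by simp
qed

lemma has_real_derivative_prof1: "(prof1 \<rho> a has_real_derivative prof2 \<rho> a r) (at r)"
proof -
  have "((\<lambda>r. bump1 \<rho> a (- r)) has_real_derivative bump2 \<rho> a (- r) * - 1) (at r)"
    by (rule DERIV_chain2[OF has_real_derivative_bump1[OF \<rho>]]) (auto intro!: derivative_eq_intros)
  from DERIV_add[OF has_real_derivative_trans1 DERIV_add[OF has_real_derivative_bump1[OF \<rho>] this]]
  show ?thesis unfolding prof1_def[abs_def] prof2_def by simp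
qed

lemma continuous_on_prof: "continuous_on A (prof0 \<rho> a)" "continuous_on A (prof1 \<rho> a)"
  using has_real_derivative_prof0 has_real_derivative_prof1
  by (auto intro!: continuous_at_imp_continuous_on DERIV_isCont)

lemma continuous_on_prof2: "continuous_on A (prof2 \<rho> a)"
proof -
  have t: "continuous_on A (trans0 a)" "continuous_on A (trans1 a)" for A
    using has_real_derivative_trans0 has_real_derivative_trans1
    by (auto intro!: continuous_at_imp_continuous_on DERIV_isCont)
  then have t2: "continuous_on A (trans2 a)" for A
    unfolding trans2_def[abs_def] by (intro continuous_intros)
  have s: "continuous_on UNIV step0" "continuous_on UNIV step1"
    using has_real_derivative_step0 has_real_derivative_step1
    by (auto intro!: continuous_at_imp_continuous_on DERIV_isCont)
  have s': "continuous_on UNIV (\<lambda>r. step0 ((r - \<rho>) / \<rho>))" "continuous_on UNIV (\<lambda>r. step1 ((r - \<rho>) / \<rho>))"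
      "continuous_on UNIV (\<lambda>r. step2 ((r - \<rho>) / \<rho>))"
    using \<rho> by (auto intro!: continuous_on_compose2[OF s(1)] continuous_on_compose2[OF s(2)]
        continuous_on_compose2[OF continuous_on_step2[of UNIV]] continuous_intros)
  have b: "continuous_on UNIV (bump2 \<rho> a)"
    unfolding bump2_def[abs_def] using \<rho> by (auto intro!: continuous_intros s' t t2)
  show ?thesis
    unfolding prof2_def[abs_def]
    by (auto intro!: continuous_intros t2 continuous_on_compose2[OF b] continuous_on_subset[OF b])
qed

lemma prof_minus: "prof0 \<rho> a (- r) = - prof0 \<rho> a r" "prof1 \<rho> a (- r) = prof1 \<rho> a r"
  "prof2 \<rho> a (- r) = - prof2 \<rho> a r"
  by (simp_all add: prof0_def prof1_def prof2_def trans_minus)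

lemma prof_far:
  assumes "r \<ge> 4 * \<rho>"
  shows "prof0 \<rho> a r = 1" "prof1 \<rho> a r = 0" "prof2 \<rho> a r = 0"
  using assms \<rho> by (simp_all add: prof0_def prof1_def prof2_def bump_far bump_eq_0)

lemma prof_far':
  assumes "r \<le> - 4 * \<rho>"
  shows "prof0 \<rho> a r = - 1" "prof1 \<rho> a r = 0" "prof2 \<rho> a r = 0"
  using prof_far[of "- r"] prof_minus[of r] assms by auto

text \<open>On the right half line the profile is a convex combination of \<open>tanh\<close> and
  the constant \<open>1\<close>; the left half follows by oddness.\<close>

lemma prof0_bounds: "\<bar>prof0 \<rho> a r\<bar> \<le> 1"
proof -
  have "\<bar>prof0 \<rho> a r\<bar> \<le> 1" if "r \<ge> 0" for r
  proof -
    define s where "s = step0 ((r - \<rho>) / \<rho>)"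
    have "prof0 \<rho> a r = trans0 a r + s * (1 - trans0 a r)"
      using that \<rho> by (simp add: prof0_def bump0_def s_def flip: bump0_def) (simp add: bump_eq_0)
    moreover have "0 \<le> s * (1 - trans0 a r)" "s * (1 - trans0 a r) \<le> 1 * (1 - trans0 a r)"
      using step0_bounds trans0_bounds[of a r] unfolding s_def
      by (auto intro!: mult_nonneg_nonneg mult_left_le_one_le)
    ultimately show ?thesis using trans0_bounds[of a r] by auto
  qed
  from this[of r] this[of "- r"] show ?thesis using prof_minus(1)[of r] by (cases "r \<ge> 0") auto
qed

text \<open>Differentiating the convex combination of \<open>tanh\<close> and \<open>1\<close>
  leaves two nonnegative terms. Monotonicity is what later makes the integral of the absolute slope
  equal to the jump and gives the turning energy a definite sign.\<close>

lemma prof1_nonneg: "prof1 \<rho> a r \<ge> 0"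
proof -
  have "prof1 \<rho> a r \<ge> 0" if "r \<ge> 0" for r
  proof -
    define s where "s = step0 ((r - \<rho>) / \<rho>)"
    have b: "bump1 \<rho> a (- r) = 0" using that \<rho> by (simp add: bump_eq_0)
    have "prof1 \<rho> a r = trans1 a r * (1 - s) + step1 ((r - \<rho>) / \<rho>) / \<rho> * (1 - trans0 a r)"
      unfolding prof1_def b by (simp add: bump1_def s_def algebra_simps)
    moreover have "trans1 a r * (1 - s) \<ge> 0" "step1 ((r - \<rho>) / \<rho>) / \<rho> * (1 - trans0 a r) \<ge> 0"
      using step0_bounds step1_bounds trans0_bounds[of a r] trans1_bounds(1)[of a r] a \<rho> unfolding s_def
      by (auto intro!: mult_nonneg_nonneg)
    ultimately show ?thesis by linarith
  qed
  from this[of r] this[of "- r"] show ?thesis using prof_minus(2)[of r] by (cases "r \<ge> 0") auto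
qed

lemma prof_minus_trans:
  "\<bar>prof0 \<rho> a r - trans0 a r\<bar> \<le> 2 * bump_bound \<rho> a"
  "\<bar>prof1 \<rho> a r - trans1 a r\<bar> \<le> 2 * bump_bound \<rho> a"
  "\<bar>prof2 \<rho> a r - trans2 a r\<bar> \<le> 2 * bump_bound \<rho> a"
  using bump_le[OF \<rho> a, of r] bump_le[OF \<rho> a, of "- r"] by (auto simp: prof0_def prof1_def prof2_def)

end

text \<open>The exponent is \<open>2 a \<rho> = sqrt 2 \<rho> / \<epsilon>\<close>. The powers of
  \<open>a\<close> contribute at most \<open>1 / \<epsilon>^2\<close>, which the closure under
  division absorbs.\<close>

lemma exponentially_small_bump_bound:
  assumes "\<rho> > 0" shows "exponentially_small (\<lambda>\<epsilon>. bump_bound \<rho> (1 / (sqrt 2 * \<epsilon>)))"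
proof -
  define e where "e \<epsilon> = exp (- (sqrt 2 * \<rho>) / \<epsilon>)" for \<epsilon> :: real
  have e: "exponentially_small e" unfolding e_def using assms by (intro exponentially_small_exp) simp
  show ?thesis
  proof (rule exponentially_small_le_pos)
    show "exponentially_small (\<lambda>\<epsilon>. 2 * (1 + 1 / \<rho> + 1 / \<rho>\<^sup>2) * e \<epsilon> +
        (sqrt 2 * (2 + 4 / \<rho>) * (e \<epsilon> / \<epsilon>) + 4 * (e \<epsilon> / \<epsilon> / \<epsilon>)))"
      by (intro exponentially_small_intros e)
    fix \<epsilon> :: real assume \<epsilon>: "\<epsilon> > 0"
    have s2: "2 / sqrt 2 = sqrt 2" by (simp add: real_div_sqrt)
    have s2': "1 / (sqrt 2 * \<epsilon>) = sqrt 2 / (2 * \<epsilon>)"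
      using s2 \<epsilon> by (simp add: field_simps)
    have ex: "exp (- 2 * (1 / (sqrt 2 * \<epsilon>)) * \<rho>) = e \<epsilon>"
      by (simp add: s2' e_def)
    have "bump_bound \<rho> (1 / (sqrt 2 * \<epsilon>)) = 2 * (1 + 1 / \<rho> + 1 / \<rho>\<^sup>2) * e \<epsilon> +
        (sqrt 2 * (2 + 4 / \<rho>) * (e \<epsilon> / \<epsilon>) + 4 * (e \<epsilon> / \<epsilon> / \<epsilon>))"
      unfolding bump_bound_def unfolding ex unfolding s2'
      by (simp add: power_divide power_mult_distrib power2_eq_square[of \<epsilon>] algebra_simps add_divide_distrib)
    then show "\<bar>bump_bound \<rho> (1 / (sqrt 2 * \<epsilon>))\<bar> \<le> 2 * (1 + 1 / \<rho> + 1 / \<rho>\<^sup>2) * e \<epsilon> +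
        (sqrt 2 * (2 + 4 / \<rho>) * (e \<epsilon> / \<epsilon>) + 4 * (e \<epsilon> / \<epsilon> / \<epsilon>))"
      using bump_bound_nonneg[OF assms, of "1 / (sqrt 2 * \<epsilon>)"] \<epsilon> by simp
  qed
qed

section \<open>Defects of the cut-off profile\<close>

lemma deriv_W: "deriv W r = r ^ 3 - r"
proof -
  have "(W has_real_derivative r ^ 3 - r) (at r)"
    unfolding W_def[abs_def]
    by (auto intro!: derivative_eq_intros simp: power2_eq_square power3_eq_cube algebra_simps)
  then show ?thesis by (rule DERIV_imp_deriv)
qed

lemma continuous_on_W: "continuous_on S W" "continuous_on S (deriv W)"
proof -
  show "continuous_on S W" unfolding W_def[abs_def] by (intro continuous_intros)
  have "deriv W = (\<lambda>r. r ^ 3 - r)" by (simp add: fun_eq_iff deriv_W)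
  then show "continuous_on S (deriv W)" by (simp add: continuous_intros)
qed

context
  fixes \<rho> \<epsilon> a b :: real
  assumes \<rho>: "\<rho> > 0" and \<epsilon>: "\<epsilon> > 0"
  defines "a \<equiv> 1 / (sqrt 2 * \<epsilon>)" and "b \<equiv> bump_bound \<rho> a"
begin

lemma a_pos: "a > 0" using \<epsilon> by (simp add: a_def)

lemma eps_a_sq: "2 * \<epsilon> * a\<^sup>2 = 1 / \<epsilon>"
  using \<epsilon> by (simp add: a_def power_divide power_mult_distrib power2_eq_square[of \<epsilon>])

lemma b_nonneg: "b \<ge> 0" unfolding b_def using \<rho> a_pos by (rule bump_bound_nonneg)

text \<open>\<open>tanh\<close> solves the profile equation exactly, so only differences of
  \<open>prof\<close> and \<open>trans\<close> remain, and \<open>deriv W\<close> is Lipschitz on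
  \<open>[-1, 1]\<close>.\<close>

lemma prof_chem_pot_bound: "\<bar>- \<epsilon> * prof2 \<rho> a r + deriv W (prof0 \<rho> a r) / \<epsilon>\<bar> \<le> 2 * (\<epsilon> * b) + 28 * (b / \<epsilon>)"
proof -
  define t y where "t = trans0 a r" and "y = prof0 \<rho> a r - t"
  have y: "\<bar>y\<bar> \<le> 2 * b" using prof_minus_trans(1)[OF \<rho> a_pos] by (simp add: y_def t_def b_def)
  have t1: "\<bar>t\<bar> \<le> 1" using trans0_bounds[of a r] by (simp add: t_def abs_le_iff)
  have p1: "\<bar>prof0 \<rho> a r\<bar> \<le> 1" by (rule prof0_bounds[OF \<rho> a_pos])
  have "\<epsilon> * trans2 a r = - (2 * \<epsilon> * a\<^sup>2) * (t * (1 - t\<^sup>2))" by (simp add: trans2_def t_def)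
  then have tr: "\<epsilon> * trans2 a r = (t ^ 3 - t) / \<epsilon>"
    unfolding eps_a_sq by (simp add: power2_eq_square power3_eq_cube algebra_simps diff_divide_distrib)
  have "\<bar>(prof0 \<rho> a r ^ 3 - prof0 \<rho> a r) - (t ^ 3 - t)\<bar> \<le> 14 * \<bar>y\<bar>"
  proof -
    have "(prof0 \<rho> a r ^ 3 - prof0 \<rho> a r) - (t ^ 3 - t) = y * ((prof0 \<rho> a r)\<^sup>2 + prof0 \<rho> a r * t + t\<^sup>2 - 1)"
      by (simp add: y_def power2_eq_square power3_eq_cube algebra_simps)
    \<comment> \<open>This factor lies between \<open>-1\<close> and \<open>2\<close>; the bound
      \<open>14\<close> is generous, and with \<open>\<bar>y\<bar> \<le> 2 * b\<close> it produces
      the \<open>28\<close>.\<close>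
    moreover have "\<bar>(prof0 \<rho> a r)\<^sup>2 + prof0 \<rho> a r * t + t\<^sup>2 - 1\<bar> \<le> 14"
    proof -
      have "(prof0 \<rho> a r)\<^sup>2 \<le> 1" "t\<^sup>2 \<le> 1" using t1 p1 by (auto simp: abs_square_le_1)
      moreover have "\<bar>prof0 \<rho> a r * t\<bar> \<le> 1 * 1" unfolding abs_mult using t1 p1 by (intro mult_mono) auto
      ultimately show ?thesis using zero_le_power2[of "prof0 \<rho> a r"] zero_le_power2[of t] by linarith
    qed
    ultimately show ?thesis by (simp add: abs_mult mult_left_mono mult.commute)
  qed
  then have W: "\<bar>((prof0 \<rho> a r ^ 3 - prof0 \<rho> a r) - (t ^ 3 - t)) / \<epsilon>\<bar> \<le> 28 * b / \<epsilon>"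
    unfolding abs_divide using y \<epsilon> by (auto intro!: divide_right_mono)
  have "- \<epsilon> * prof2 \<rho> a r + deriv W (prof0 \<rho> a r) / \<epsilon> =
      - (\<epsilon> * (prof2 \<rho> a r - trans2 a r)) + ((prof0 \<rho> a r ^ 3 - prof0 \<rho> a r) - (t ^ 3 - t)) / \<epsilon>"
    unfolding diff_divide_distrib[of _ "t ^ 3 - t"] tr[symmetric] deriv_W by (simp add: algebra_simps)
  moreover have "\<bar>\<epsilon> * (prof2 \<rho> a r - trans2 a r)\<bar> \<le> \<epsilon> * (2 * b)"
    unfolding abs_mult using \<epsilon> prof_minus_trans(3)[OF \<rho> a_pos, of r] by (auto simp: b_def)
  moreover have "x = - y + z \<Longrightarrow> \<bar>y\<bar> \<le> \<epsilon> * (2 * b) \<Longrightarrow> \<bar>z\<bar> \<le> 28 * b / \<epsilon> \<Longrightarrow>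
      \<bar>x\<bar> \<le> 2 * (\<epsilon> * b) + 28 * (b / \<epsilon>)" for x y z :: real by simp
  ultimately show ?thesis using W by blast
qed

lemma prof1_sq_bound: "\<bar>\<epsilon> * (prof1 \<rho> a r)\<^sup>2 - \<epsilon> * (trans1 a r)\<^sup>2\<bar> \<le> 2 * sqrt 2 * b + 4 * (\<epsilon> * (b * b))"
proof -
  have d: "\<bar>prof1 \<rho> a r - trans1 a r\<bar> \<le> 2 * b" using prof_minus_trans(2)[OF \<rho> a_pos] by (simp add: b_def)
  have t: "\<bar>trans1 a r\<bar> \<le> a" using trans1_bounds[of a r] a_pos by simp
  have "\<bar>\<epsilon> * (prof1 \<rho> a r)\<^sup>2 - \<epsilon> * (trans1 a r)\<^sup>2\<bar> =
      \<epsilon> * (\<bar>prof1 \<rho> a r - trans1 a r\<bar> * \<bar>prof1 \<rho> a r + trans1 a r\<bar>)"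
  proof -
    have "\<epsilon> * (prof1 \<rho> a r)\<^sup>2 - \<epsilon> * (trans1 a r)\<^sup>2 =
        \<epsilon> * ((prof1 \<rho> a r - trans1 a r) * (prof1 \<rho> a r + trans1 a r))"
      by (simp add: power2_eq_square algebra_simps)
    then show ?thesis using \<epsilon> by (simp add: abs_mult)
  qed
  also have "\<dots> \<le> \<epsilon> * (2 * b * (2 * b + 2 * a))"
    using \<epsilon> d t b_nonneg by (intro mult_left_mono mult_mono) auto
  also have "\<dots> = 4 * (\<epsilon> * a) * b + 4 * (\<epsilon> * (b * b))" by (simp add: algebra_simps)
  also have "4 * (\<epsilon> * a) = 2 * (2 / sqrt 2)" using \<epsilon> by (simp add: a_def)
  also have "2 / sqrt 2 = sqrt 2" by (simp add: real_div_sqrt)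
  finally show ?thesis .
qed

text \<open>For \<open>tanh\<close> gradient part and potential part coincide (equipartition), so
  its whole energy density is \<open>\<epsilon> * (trans1 a r)^2\<close>; what remains are
  differences of \<open>prof\<close> and \<open>trans\<close>.\<close>

lemma prof_energy_bound:
  "\<bar>(\<epsilon> / 2 * (prof1 \<rho> a r)\<^sup>2 + W (prof0 \<rho> a r) / \<epsilon>) - \<epsilon> * (trans1 a r)\<^sup>2\<bar> \<le>
     2 * sqrt 2 * b + 4 * (\<epsilon> * (b * b)) + 2 * (b / \<epsilon>)"
proof -
  define t q where "t = trans0 a r" and "q = prof0 \<rho> a r"
  have "\<bar>t\<bar> \<le> 1" "\<bar>q\<bar> \<le> 1"
    using trans0_bounds[of a r] prof0_bounds[OF \<rho> a_pos] by (auto simp: t_def q_def abs_le_iff)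
  then have sq: "t\<^sup>2 \<le> 1" "q\<^sup>2 \<le> 1" and tq: "\<bar>t + q\<bar> \<le> 2" by (auto simp: abs_square_le_1)
  have y: "\<bar>q - t\<bar> \<le> 2 * b" using prof_minus_trans(1)[OF \<rho> a_pos] by (simp add: q_def t_def b_def)
  have "W t / \<epsilon> = 1 / \<epsilon> * (1 - t\<^sup>2)\<^sup>2 / 4" by (simp add: W_def)
  also have "\<dots> = \<epsilon> / 2 * (trans1 a r)\<^sup>2"
    unfolding eps_a_sq[symmetric] by (simp add: trans1_def t_def power_mult_distrib)
  finally have e: "W t / \<epsilon> = \<epsilon> / 2 * (trans1 a r)\<^sup>2" .
  have "W q - W t = (t - q) * ((t + q) * (2 - q\<^sup>2 - t\<^sup>2) / 4)"
    by (simp add: W_def power2_eq_square field_simps)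
  also have "\<bar>\<dots>\<bar> \<le> \<bar>t - q\<bar> * (2 * 2 / 4)"
  proof -
    have "\<bar>(t + q) * (2 - q\<^sup>2 - t\<^sup>2)\<bar> \<le> 2 * 2"
      unfolding abs_mult using sq tq zero_le_power2[of t] zero_le_power2[of q] by (intro mult_mono) linarith+
    then show ?thesis unfolding abs_mult[of "t - q"] abs_divide by (intro mult_left_mono divide_right_mono) auto
  qed
  finally have "\<bar>W q - W t\<bar> \<le> 2 * b" using y by simp
  then have 1: "\<bar>(W q - W t) / \<epsilon>\<bar> \<le> 2 * (b / \<epsilon>)" using \<epsilon> by (simp add: abs_divide divide_right_mono)
  have "(\<epsilon> / 2 * (prof1 \<rho> a r)\<^sup>2 + W q / \<epsilon>) - \<epsilon> * (trans1 a r)\<^sup>2 =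
     (\<epsilon> * (prof1 \<rho> a r)\<^sup>2 - \<epsilon> * (trans1 a r)\<^sup>2) / 2 + (W q - W t) / \<epsilon>"
    unfolding diff_divide_distrib[of "W q"] e by (simp add: diff_divide_distrib)
  moreover have "\<bar>(\<epsilon> * (prof1 \<rho> a r)\<^sup>2 - \<epsilon> * (trans1 a r)\<^sup>2) / 2\<bar> \<le> 2 * sqrt 2 * b + 4 * (\<epsilon> * (b * b))"
    by (rule order.trans[OF _ prof1_sq_bound[of r]]) simp
  ultimately show ?thesis using 1 unfolding q_def by linarith
qed

text \<open>A primitive is \<open>\<epsilon> a (t - t^3 / 3)\<close> with
  \<open>t = trans0 a r\<close>. Its increase misses the full value \<open>c0\<close> by a multiple
  of \<open>(1 - T)^2\<close>, of which one factor already gives the exponential.\<close>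

lemma integral_trans1_sq:
  assumes "\<delta> > 0"
  shows "\<bar>integral {-\<delta>..\<delta>} (\<lambda>r. \<epsilon> * (trans1 a r)\<^sup>2) - c0\<bar> \<le> 6 * exp (- (sqrt 2 * \<delta>) / \<epsilon>)"
proof -
  define T where "T = trans0 a \<delta>"
  have T0: "0 \<le> T" "T \<le> 1" using assms a_pos trans0_bounds[of a \<delta>] by (auto simp: T_def trans0_def)
  have "((\<lambda>r. \<epsilon> * (trans1 a r)\<^sup>2) has_integral
      (\<epsilon> * a * (trans0 a \<delta> - trans0 a \<delta> ^ 3 / 3) - \<epsilon> * a * (trans0 a (-\<delta>) - trans0 a (-\<delta>) ^ 3 / 3))) {-\<delta>..\<delta>}"
  proof (rule fundamental_theorem_of_calculus)
    fix r :: real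
    have "((\<lambda>r. \<epsilon> * a * (trans0 a r - trans0 a r ^ 3 / 3)) has_real_derivative
        \<epsilon> * a * (trans1 a r - (trans0 a r)\<^sup>2 * trans1 a r)) (at r within {-\<delta>..\<delta>})"
      by (auto intro!: derivative_eq_intros has_field_derivative_at_within[OF has_real_derivative_trans0])
    moreover have "\<epsilon> * a * (trans1 a r - (trans0 a r)\<^sup>2 * trans1 a r) = \<epsilon> * (trans1 a r)\<^sup>2"
      by (simp add: trans1_def power2_eq_square algebra_simps)
    ultimately show "((\<lambda>r. \<epsilon> * a * (trans0 a r - trans0 a r ^ 3 / 3)) has_vector_derivative
        \<epsilon> * (trans1 a r)\<^sup>2) (at r within {-\<delta>..\<delta>})"
      by (simp add: has_real_derivative_iff_has_vector_derivative)
  qed (use assms in simp)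
  then have "integral {-\<delta>..\<delta>} (\<lambda>r. \<epsilon> * (trans1 a r)\<^sup>2) =
      \<epsilon> * a * (trans0 a \<delta> - trans0 a \<delta> ^ 3 / 3) - \<epsilon> * a * (trans0 a (-\<delta>) - trans0 a (-\<delta>) ^ 3 / 3)"
    by (rule integral_unique)
  also have "\<dots> = 2 * (\<epsilon> * a) * (T - T ^ 3 / 3)"
    by (simp add: trans_minus T_def algebra_simps)
  also have "2 * (\<epsilon> * a) = sqrt 2" using \<epsilon> by (simp add: a_def real_div_sqrt)
  finally have I: "integral {-\<delta>..\<delta>} (\<lambda>r. \<epsilon> * (trans1 a r)\<^sup>2) = sqrt 2 * (T - T ^ 3 / 3)" .
  have c: "c0 = sqrt 2 * (2 / 3)"
  proof -
    have "4 / (3 * sqrt 2) = (2 / 3) * (2 / sqrt 2)" by simp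
    also have "2 / sqrt 2 = sqrt 2" by (simp add: real_div_sqrt)
    finally show ?thesis by (simp add: c0_eq)
  qed
  have "integral {-\<delta>..\<delta>} (\<lambda>r. \<epsilon> * (trans1 a r)\<^sup>2) - c0 = sqrt 2 * ((T - T ^ 3 / 3) - 2 / 3)"
    unfolding I c by (simp add: right_diff_distrib)
  also have "(T - T ^ 3 / 3) - 2 / 3 = - ((1 - T) * ((1 - T) * (T + 2) / 3))"
    by (simp add: field_simps power3_eq_cube)
  also have "\<bar>sqrt 2 * - ((1 - T) * ((1 - T) * (T + 2) / 3))\<bar> = sqrt 2 * ((1 - T) * ((1 - T) * (T + 2) / 3))"
    using T0 by (simp add: abs_mult)
  also have "\<dots> \<le> 2 * ((1 - T) * (1 * 3 / 3))"
    using T0 sqrt2_less_2 by (intro mult_mono divide_right_mono) auto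
  finally have "\<bar>integral {-\<delta>..\<delta>} (\<lambda>r. \<epsilon> * (trans1 a r)\<^sup>2) - c0\<bar> \<le> 2 * (1 - T)" by simp
  moreover have "1 - T \<le> 2 * exp (- 2 * (a * \<delta>))" unfolding T_def trans0_def by (rule one_minus_tanh)
  moreover have "- 2 * (a * \<delta>) = - (sqrt 2 * \<delta>) / \<epsilon>"
  proof -
    have "2 * a = (2 / sqrt 2) / \<epsilon>" using \<epsilon> by (simp add: a_def)
    also have "2 / sqrt 2 = sqrt 2" by (simp add: real_div_sqrt)
    finally have "- ((2 * a) * \<delta>) = - (sqrt 2 * \<delta>) / \<epsilon>" by simp
    then show ?thesis by simp
  qed
  ultimately show ?thesis using exp_gt_zero[of "- (sqrt 2 * \<delta>) / \<epsilon>"] by simp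
qed

text \<open>In the variable \<open>x = a r\<close> this is the boundedness of
  \<open>x^2 * exp (- 2 * x)\<close>. Of the two factors \<open>trans1\<close> in the energy
  density, one is spent here on turning \<open>r^2\<close> into \<open>\<epsilon>^2\<close>; the
  other has integral at most \<open>2\<close>.\<close>

lemma trans1_moment: "\<epsilon> * trans1 a r * r\<^sup>2 \<le> 4 * \<epsilon>\<^sup>2"
proof -
  have *: "(1 - (trans0 a r)\<^sup>2) * r\<^sup>2 \<le> 4 * \<epsilon>\<^sup>2" if "r \<ge> 0" for r
  proof (cases "r = 0")
    case False
    with that have r: "r > 0" by simp
    define x where "x = a * r"
    have x: "x > 0" using r a_pos by (simp add: x_def)
    have "exp (2 * x) \<ge> 1 + 2 * x + (2 * x)\<^sup>2 / 2" using x by (intro exp_lower_Taylor_quadratic) auto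
    then have "2 * x\<^sup>2 \<le> exp (2 * x)" using x by (simp add: power_mult_distrib)
    then have ex: "exp (- 2 * x) * (2 * x\<^sup>2) \<le> 1"
      by (simp add: exp_minus field_simps)
    have "1 - (trans0 a r)\<^sup>2 = (1 - trans0 a r) * (1 + trans0 a r)"
      by (simp add: power2_eq_square algebra_simps)
    also have "\<dots> \<le> (2 * exp (- 2 * x)) * 2"
      using one_minus_tanh[of x] trans0_bounds[of a r] by (intro mult_mono) (auto simp: trans0_def x_def)
    finally have "(1 - (trans0 a r)\<^sup>2) * r\<^sup>2 \<le> (2 * exp (- 2 * x)) * 2 * r\<^sup>2"
      by (rule mult_right_mono) simp
    also have "\<dots> = 4 * \<epsilon>\<^sup>2 * (exp (- 2 * x) * (2 * x\<^sup>2))"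
    proof -
      have "r\<^sup>2 = 2 * \<epsilon>\<^sup>2 * x\<^sup>2"
        using \<epsilon> by (simp add: x_def a_def power_mult_distrib power_divide)
      then show ?thesis by simp
    qed
    also have "\<dots> \<le> 4 * \<epsilon>\<^sup>2 * 1" using ex by (intro mult_left_mono) auto
    finally show ?thesis by simp
  qed simp
  have "(1 - (trans0 a r)\<^sup>2) * r\<^sup>2 \<le> 4 * \<epsilon>\<^sup>2"
    using *[of r] *[of "- r"] by (cases "r \<ge> 0") (auto simp: trans_minus)
  moreover have "\<epsilon> * a \<le> 1" "\<epsilon> * a \<ge> 0" using \<epsilon> by (auto simp: a_def)
  ultimately have "(\<epsilon> * a) * ((1 - (trans0 a r)\<^sup>2) * r\<^sup>2) \<le> 1 * (4 * \<epsilon>\<^sup>2)"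
    using trans0_sq_le[of a r] by - (rule mult_mono, auto)
  then show ?thesis by (simp add: trans1_def algebra_simps)
qed

lemma integral_trans1: "\<delta> > 0 \<Longrightarrow> (trans1 a has_integral (trans0 a \<delta> - trans0 a (- \<delta>))) {-\<delta>..\<delta>}"
  by (rule fundamental_theorem_of_calculus)
    (auto simp: has_real_derivative_iff_has_vector_derivative[symmetric]
      intro: has_field_derivative_at_within[OF has_real_derivative_trans0])

text \<open>The leading constant \<open>16\<close> is \<open>2 * 4 * 2\<close>: the square of a sum,
  the bound of \<open>trans1_moment\<close>, and the total increase of \<open>tanh\<close>. The
  cut-off enters only through \<open>b\<close>.\<close>

lemma prof1_moment:
  assumes \<delta>: "\<delta> > 0"
  shows "integral {-\<delta>..\<delta>} (\<lambda>r. \<epsilon> * (prof1 \<rho> a r)\<^sup>2 * r\<^sup>2) \<le> 16 * \<epsilon>\<^sup>2 + 16 * \<delta> ^ 3 * (\<epsilon> * (b * b))"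
proof -
  have pw: "\<epsilon> * (prof1 \<rho> a r)\<^sup>2 * r\<^sup>2 \<le> 8 * \<epsilon>\<^sup>2 * trans1 a r + 8 * \<delta>\<^sup>2 * (\<epsilon> * (b * b))" if "r \<in> {-\<delta>..\<delta>}" for r
  proof -
    define y where "y = prof1 \<rho> a r - trans1 a r"
    have y: "y\<^sup>2 \<le> (2 * b)\<^sup>2"
      unfolding abs_le_square_iff[symmetric]
      using prof_minus_trans(2)[OF \<rho> a_pos, of r] b_nonneg by (simp add: b_def y_def)
    have "prof1 \<rho> a r = trans1 a r + y" by (simp add: y_def)
    then have "(prof1 \<rho> a r)\<^sup>2 \<le> 2 * (trans1 a r)\<^sup>2 + 2 * y\<^sup>2"
      using zero_le_power2[of "trans1 a r - y"] by (simp add: power2_eq_square algebra_simps)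
    then have "(prof1 \<rho> a r)\<^sup>2 \<le> 2 * (trans1 a r)\<^sup>2 + 8 * (b * b)"
      using y by (simp add: power2_eq_square)
    then have "\<epsilon> * (prof1 \<rho> a r)\<^sup>2 * r\<^sup>2 \<le> \<epsilon> * (2 * (trans1 a r)\<^sup>2 + 8 * (b * b)) * r\<^sup>2"
      using \<epsilon> by (intro mult_right_mono mult_left_mono) auto
    also have "\<dots> = 2 * trans1 a r * (\<epsilon> * trans1 a r * r\<^sup>2) + 8 * r\<^sup>2 * (\<epsilon> * (b * b))"
      by (simp add: power2_eq_square algebra_simps)
    also have "\<dots> \<le> 2 * trans1 a r * (4 * \<epsilon>\<^sup>2) + 8 * \<delta>\<^sup>2 * (\<epsilon> * (b * b))"
    proof (rule add_mono)
      show "2 * trans1 a r * (\<epsilon> * trans1 a r * r\<^sup>2) \<le> 2 * trans1 a r * (4 * \<epsilon>\<^sup>2)"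
        using trans1_bounds(1)[of a r] a_pos by (intro mult_left_mono trans1_moment) auto
      have "r\<^sup>2 \<le> \<delta>\<^sup>2" unfolding abs_le_square_iff[symmetric] using that by auto
      then show "8 * r\<^sup>2 * (\<epsilon> * (b * b)) \<le> 8 * \<delta>\<^sup>2 * (\<epsilon> * (b * b))"
        using \<epsilon> b_nonneg by (intro mult_right_mono) auto
    qed
    finally show ?thesis by (simp add: algebra_simps)
  qed
  have J: "((\<lambda>r. 8 * \<epsilon>\<^sup>2 * trans1 a r + 8 * \<delta>\<^sup>2 * (\<epsilon> * (b * b))) has_integral
      8 * \<epsilon>\<^sup>2 * (trans0 a \<delta> - trans0 a (- \<delta>)) + (8 * \<delta>\<^sup>2 * (\<epsilon> * (b * b))) * (\<delta> - (-\<delta>))) {-\<delta>..\<delta>}"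
    using \<delta> has_integral_const_real[of "8 * \<delta>\<^sup>2 * (\<epsilon> * (b * b))" "-\<delta>" \<delta>]
    by (intro has_integral_add has_integral_mult_right integral_trans1) (auto simp: mult.commute)
  have "integral {-\<delta>..\<delta>} (\<lambda>r. \<epsilon> * (prof1 \<rho> a r)\<^sup>2 * r\<^sup>2) \<le>
      8 * \<epsilon>\<^sup>2 * (trans0 a \<delta> - trans0 a (- \<delta>)) + (8 * \<delta>\<^sup>2 * (\<epsilon> * (b * b))) * (\<delta> - (-\<delta>))"
  proof (rule has_integral_le[OF integrable_integral J])
    show "(\<lambda>r. \<epsilon> * (prof1 \<rho> a r)\<^sup>2 * r\<^sup>2) integrable_on {-\<delta>..\<delta>}"
      by (intro integrable_continuous_real continuous_intros continuous_on_prof \<rho> a_pos)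
  qed (use pw in auto)
  also have "\<dots> \<le> 8 * \<epsilon>\<^sup>2 * 2 + (8 * \<delta>\<^sup>2 * (\<epsilon> * (b * b))) * (\<delta> - (-\<delta>))"
    using trans0_bounds[of a \<delta>] by (intro add_right_mono mult_left_mono) (auto simp: trans_minus)
  finally show ?thesis by (simp add: power2_eq_square power3_eq_cube algebra_simps)
qed

end

lemma abs_integral_diff_le:
  fixes f g :: "real \<Rightarrow> real"
  assumes "continuous_on {-\<delta>..\<delta>} f" "continuous_on {-\<delta>..\<delta>} g" "\<And>r. \<bar>f r - g r\<bar> \<le> B" "\<delta> > 0"
  shows "\<bar>integral {-\<delta>..\<delta>} f - integral {-\<delta>..\<delta>} g\<bar> \<le> 2 * \<delta> * B"
proof -
  have "integral {-\<delta>..\<delta>} f - integral {-\<delta>..\<delta>} g = integral {-\<delta>..\<delta>} (\<lambda>r. f r - g r)"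
    by (rule integral_diff[symmetric]) (intro integrable_continuous_real assms)+
  also have "norm \<dots> \<le> B * (\<delta> - (-\<delta>))"
    by (rule integral_bound) (use assms in \<open>auto intro!: continuous_intros\<close>)
  finally show ?thesis by (simp add: algebra_simps)
qed

text \<open>Interface of the profile to the geometric part: from here on only parity, monotonicity,
  constancy near the edge of the tube and the size of the defects count, not the
  construction.\<close>

lemma optimal_profile:
  fixes \<delta> :: real
  assumes \<delta>: "\<delta> > 0"
  obtains q q1 q2 :: "real \<Rightarrow> real \<Rightarrow> real" and X :: "real \<Rightarrow> real"
  where "exponentially_small X" and "\<And>\<epsilon>. \<epsilon> > 0 \<Longrightarrow> X \<epsilon> \<ge> 0"
    and "\<And>\<epsilon> r. \<epsilon> > 0 \<Longrightarrow> (q \<epsilon> has_real_derivative q1 \<epsilon> r) (at r)"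
    and "\<And>\<epsilon> r. \<epsilon> > 0 \<Longrightarrow> (q1 \<epsilon> has_real_derivative q2 \<epsilon> r) (at r)"
    and "\<And>\<epsilon>. \<epsilon> > 0 \<Longrightarrow> continuous_on UNIV (q2 \<epsilon>)"
    and "\<And>\<epsilon> r. \<epsilon> > 0 \<Longrightarrow> \<bar>q \<epsilon> r\<bar> \<le> 1" and "\<And>\<epsilon> r. \<epsilon> > 0 \<Longrightarrow> q1 \<epsilon> r \<ge> 0"
    and "\<And>\<epsilon> r. \<epsilon> > 0 \<Longrightarrow> r \<ge> 4 * \<delta> / 5 \<Longrightarrow> q \<epsilon> r = 1"
    and "\<And>\<epsilon> r. \<epsilon> > 0 \<Longrightarrow> r \<le> - (4 * \<delta> / 5) \<Longrightarrow> q \<epsilon> r = - 1"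
    and "\<And>\<epsilon> r. \<epsilon> > 0 \<Longrightarrow> \<bar>r\<bar> \<ge> 4 * \<delta> / 5 \<Longrightarrow> q1 \<epsilon> r = 0"
    and "\<And>\<epsilon> r. \<epsilon> > 0 \<Longrightarrow> \<bar>r\<bar> \<ge> 4 * \<delta> / 5 \<Longrightarrow> q2 \<epsilon> r = 0"
    and "\<And>\<epsilon> r. \<epsilon> > 0 \<Longrightarrow> q \<epsilon> (- r) = - q \<epsilon> r" and "\<And>\<epsilon> r. \<epsilon> > 0 \<Longrightarrow> q1 \<epsilon> (- r) = q1 \<epsilon> r"
    and "\<And>\<epsilon> r. \<epsilon> > 0 \<Longrightarrow> q2 \<epsilon> (- r) = - q2 \<epsilon> r"
    and "\<And>\<epsilon> r. \<epsilon> > 0 \<Longrightarrow> \<bar>- \<epsilon> * q2 \<epsilon> r + deriv W (q \<epsilon> r) / \<epsilon>\<bar> \<le> X \<epsilon>"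
    and "\<And>\<epsilon> r. \<epsilon> > 0 \<Longrightarrow> \<bar>(\<epsilon> / 2 * (q1 \<epsilon> r)\<^sup>2 + W (q \<epsilon> r) / \<epsilon>) - \<epsilon> * (q1 \<epsilon> r)\<^sup>2\<bar> \<le> X \<epsilon>"
    and "\<And>\<epsilon>. \<epsilon> > 0 \<Longrightarrow> \<bar>integral {-\<delta>..\<delta>} (\<lambda>r. \<epsilon> / 2 * (q1 \<epsilon> r)\<^sup>2 + W (q \<epsilon> r) / \<epsilon>) - c0\<bar> \<le> X \<epsilon>"
    and "\<And>\<epsilon>. \<epsilon> > 0 \<Longrightarrow> \<bar>integral {-\<delta>..\<delta>} (\<lambda>r. \<epsilon> * (q1 \<epsilon> r)\<^sup>2) - c0\<bar> \<le> X \<epsilon>"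
    and "\<And>\<epsilon>. \<epsilon> > 0 \<Longrightarrow> integral {-\<delta>..\<delta>} (\<lambda>r. \<epsilon> * (q1 \<epsilon> r)\<^sup>2 * r\<^sup>2) \<le> 16 * \<epsilon>\<^sup>2 + X \<epsilon>"
proof -
  \<comment> \<open>The cut-off is complete at
    \<open>4 * \<rho> = 4 * \<delta> / 5 < \<delta>\<close>, which leaves a margin inside the tube
    where the field is already constant.\<close>
  define \<rho> where "\<rho> = \<delta> / 5"
  have \<rho>: "\<rho> > 0" using \<delta> by (simp add: \<rho>_def)
  define a where "a \<epsilon> = 1 / (sqrt 2 * \<epsilon>)" for \<epsilon> :: real
  define b where "b \<epsilon> = bump_bound \<rho> (a \<epsilon>)" for \<epsilon>
  have es: "exponentially_small b"
    unfolding b_def a_def by (rule exponentially_small_bump_bound[OF \<rho>])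
  have apos: "a \<epsilon> > 0" if "\<epsilon> > 0" for \<epsilon> using that by (simp add: a_def)
  have b0: "b \<epsilon> \<ge> 0" if "\<epsilon> > 0" for \<epsilon> unfolding b_def by (rule bump_bound_nonneg[OF \<rho> apos[OF that]])
  define A B D M where "A \<epsilon> = 2 * (\<epsilon> * b \<epsilon>) + 28 * (b \<epsilon> / \<epsilon>)"
    and "B \<epsilon> = 2 * sqrt 2 * b \<epsilon> + 4 * (\<epsilon> * (b \<epsilon> * b \<epsilon>)) + 2 * (b \<epsilon> / \<epsilon>)"
    and "D \<epsilon> = 6 * exp (- (sqrt 2 * \<delta>) / \<epsilon>)"
    and "M \<epsilon> = 16 * \<delta> ^ 3 * (\<epsilon> * (b \<epsilon> * b \<epsilon>))" for \<epsilon>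
  have nn: "A \<epsilon> \<ge> 0" "B \<epsilon> \<ge> 0" "D \<epsilon> \<ge> 0" "M \<epsilon> \<ge> 0" if "\<epsilon> > 0" for \<epsilon>
    using b0[OF that] that \<delta> by (auto simp: A_def B_def D_def M_def)
  \<comment> \<open>The summand \<open>2 * B\<close> serves the equipartition defect, which compares
    with \<open>tanh\<close> twice; \<open>2 * \<delta> * B\<close> is the same defect integrated
    over \<open>{-\<delta>..\<delta>}\<close>, to which \<open>D\<close> adds the missing tail of
    \<open>tanh\<close>.\<close>
  define X where "X \<epsilon> = A \<epsilon> + (2 * \<delta> * B \<epsilon> + (2 * B \<epsilon> + (D \<epsilon> + M \<epsilon>)))" for \<epsilon>
  have "exponentially_small X"
    unfolding X_def A_def B_def D_def M_def
    using \<delta> by (intro exponentially_small_intros es exponentially_small_exp) auto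
  moreover have "X \<epsilon> \<ge> 0" if "\<epsilon> > 0" for \<epsilon> using nn[OF that] \<delta> by (simp add: X_def)
  moreover have tc: "continuous_on S (\<lambda>r. \<epsilon> * (trans1 (a \<epsilon>) r)\<^sup>2)" for S \<epsilon>
  proof -
    have "continuous_on S (trans1 (a \<epsilon>))"
      using has_real_derivative_trans1 by (auto intro!: continuous_at_imp_continuous_on DERIV_isCont)
    then show ?thesis by (intro continuous_intros)
  qed
  have X1: "\<bar>integral {-\<delta>..\<delta>} (\<lambda>r. \<epsilon> / 2 * (prof1 \<rho> (a \<epsilon>) r)\<^sup>2 + W (prof0 \<rho> (a \<epsilon>) r) / \<epsilon>) - c0\<bar> \<le> X \<epsilon>"
    if \<epsilon>: "\<epsilon> > 0" for \<epsilon>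
  proof -
    have "\<bar>integral {-\<delta>..\<delta>} (\<lambda>r. \<epsilon> / 2 * (prof1 \<rho> (a \<epsilon>) r)\<^sup>2 + W (prof0 \<rho> (a \<epsilon>) r) / \<epsilon>) -
        integral {-\<delta>..\<delta>} (\<lambda>r. \<epsilon> * (trans1 (a \<epsilon>) r)\<^sup>2)\<bar> \<le> 2 * \<delta> * B \<epsilon>"
      using prof_energy_bound[OF \<rho> \<epsilon>, folded a_def, folded b_def] \<epsilon> \<delta>
      by (intro abs_integral_diff_le tc) (auto simp: W_def B_def intro!: continuous_intros continuous_on_prof \<rho> apos)
    moreover have "\<bar>integral {-\<delta>..\<delta>} (\<lambda>r. \<epsilon> * (trans1 (a \<epsilon>) r)\<^sup>2) - c0\<bar> \<le> D \<epsilon>"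
      using integral_trans1_sq[OF \<rho> \<epsilon> \<delta>] by (simp add: a_def D_def)
    ultimately show ?thesis using nn[OF \<epsilon>] unfolding X_def by linarith
  qed
  have B1: "\<bar>\<epsilon> * (prof1 \<rho> (a \<epsilon>) r)\<^sup>2 - \<epsilon> * (trans1 (a \<epsilon>) r)\<^sup>2\<bar> \<le> B \<epsilon>" if \<epsilon>: "\<epsilon> > 0" for \<epsilon> r
  proof -
    have "b \<epsilon> / \<epsilon> \<ge> 0" using b0[OF \<epsilon>] \<epsilon> by simp
    then show ?thesis
      using prof1_sq_bound[OF \<rho> \<epsilon>, folded a_def, folded b_def, of r] unfolding B_def by linarith
  qed
  have X5: "\<bar>(\<epsilon> / 2 * (prof1 \<rho> (a \<epsilon>) r)\<^sup>2 + W (prof0 \<rho> (a \<epsilon>) r) / \<epsilon>) - \<epsilon> * (prof1 \<rho> (a \<epsilon>) r)\<^sup>2\<bar> \<le> X \<epsilon>"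
    if \<epsilon>: "\<epsilon> > 0" for \<epsilon> r
  proof -
    have "\<bar>(\<epsilon> / 2 * (prof1 \<rho> (a \<epsilon>) r)\<^sup>2 + W (prof0 \<rho> (a \<epsilon>) r) / \<epsilon>) - \<epsilon> * (trans1 (a \<epsilon>) r)\<^sup>2\<bar> \<le> B \<epsilon>"
      using prof_energy_bound[OF \<rho> \<epsilon>, folded a_def, folded b_def] by (simp only: B_def)
    moreover have "0 \<le> 2 * \<delta> * B \<epsilon>" using nn[OF \<epsilon>] \<delta> by simp
    ultimately show ?thesis using B1[OF \<epsilon>, of r] nn[OF \<epsilon>] unfolding X_def by linarith
  qed
  have X2: "\<bar>integral {-\<delta>..\<delta>} (\<lambda>r. \<epsilon> * (prof1 \<rho> (a \<epsilon>) r)\<^sup>2) - c0\<bar> \<le> X \<epsilon>"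
    if \<epsilon>: "\<epsilon> > 0" for \<epsilon>
  proof -
    have "\<bar>integral {-\<delta>..\<delta>} (\<lambda>r. \<epsilon> * (prof1 \<rho> (a \<epsilon>) r)\<^sup>2) -
        integral {-\<delta>..\<delta>} (\<lambda>r. \<epsilon> * (trans1 (a \<epsilon>) r)\<^sup>2)\<bar> \<le> 2 * \<delta> * B \<epsilon>"
    proof (intro abs_integral_diff_le tc B1[OF \<epsilon>])
    qed (use \<epsilon> \<delta> in \<open>auto intro!: continuous_intros continuous_on_prof \<rho> apos\<close>)
    moreover have "\<bar>integral {-\<delta>..\<delta>} (\<lambda>r. \<epsilon> * (trans1 (a \<epsilon>) r)\<^sup>2) - c0\<bar> \<le> D \<epsilon>"
      using integral_trans1_sq[OF \<rho> \<epsilon> \<delta>] by (simp add: a_def D_def)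
    ultimately show ?thesis using nn[OF \<epsilon>] unfolding X_def by linarith
  qed
  have X3: "integral {-\<delta>..\<delta>} (\<lambda>r. \<epsilon> * (prof1 \<rho> (a \<epsilon>) r)\<^sup>2 * r\<^sup>2) \<le> 16 * \<epsilon>\<^sup>2 + X \<epsilon>" if \<epsilon>: "\<epsilon> > 0" for \<epsilon>
  proof -
    have "0 \<le> 2 * \<delta> * B \<epsilon>" using nn[OF \<epsilon>] \<delta> by simp
    then show ?thesis
      using prof1_moment[OF \<rho> \<epsilon> \<delta>, folded a_def, folded b_def, folded M_def] nn[OF \<epsilon>]
      unfolding X_def by linarith
  qed
  have X4: "\<bar>- \<epsilon> * prof2 \<rho> (a \<epsilon>) r + deriv W (prof0 \<rho> (a \<epsilon>) r) / \<epsilon>\<bar> \<le> X \<epsilon>" if \<epsilon>: "\<epsilon> > 0" for \<epsilon> r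
  proof -
    have "0 \<le> 2 * \<delta> * B \<epsilon>" using nn[OF \<epsilon>] \<delta> by simp
    moreover have "\<bar>- \<epsilon> * prof2 \<rho> (a \<epsilon>) r + deriv W (prof0 \<rho> (a \<epsilon>) r) / \<epsilon>\<bar> \<le> A \<epsilon>"
      using prof_chem_pot_bound[OF \<rho> \<epsilon>, of r] by (simp only: a_def b_def A_def)
    ultimately show ?thesis using nn[OF \<epsilon>] unfolding X_def by linarith
  qed
  have far: "4 * \<rho> = 4 * \<delta> / 5" by (simp add: \<rho>_def)
  have far0: "prof1 \<rho> (a \<epsilon>) r = 0" "prof2 \<rho> (a \<epsilon>) r = 0" if "\<epsilon> > 0" "\<bar>r\<bar> \<ge> 4 * \<delta> / 5" for \<epsilon> r
    using prof_far(2,3)[OF \<rho> apos[OF that(1)], of r] prof_far'(2,3)[OF \<rho> apos[OF that(1)], of r] that(2) far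
    by (auto simp: abs_if split: if_splits)
  show ?thesis
    by (rule that[of X "\<lambda>\<epsilon>. prof0 \<rho> (a \<epsilon>)" "\<lambda>\<epsilon>. prof1 \<rho> (a \<epsilon>)" "\<lambda>\<epsilon>. prof2 \<rho> (a \<epsilon>)"])
      (use \<open>exponentially_small X\<close> \<open>\<And>\<epsilon>. \<epsilon> > 0 \<Longrightarrow> X \<epsilon> \<ge> 0\<close> X1 X2 X3 X4 X5 far far0 in
        \<open>auto simp: prof_minus[OF \<rho> apos] intro: has_real_derivative_prof0[OF \<rho> apos]
          has_real_derivative_prof1[OF \<rho> apos] continuous_on_prof2[OF \<rho> apos] prof0_bounds[OF \<rho> apos]
          prof1_nonneg[OF \<rho> apos] prof_far(1)[OF \<rho> apos] prof_far'(1)[OF \<rho> apos]\<close>)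
qed

section \<open>Polynomial mollification\<close>

lemma real_polynomial_function_directional_derivative:
  fixes p :: "'a::real_normed_vector \<Rightarrow> real" and e :: 'a
  assumes "real_polynomial_function p"
  shows "\<exists>p'. real_polynomial_function p' \<and> (\<forall>x. ((\<lambda>t. p (x + t *\<^sub>R e)) has_real_derivative p' x) (at 0))"
  using assms
proof induction
  case (linear f)
  interpret bounded_linear f by fact
  have "((\<lambda>t. f (x + t *\<^sub>R e)) has_real_derivative f e) (at 0)" for x
    by (auto simp: add scaleR intro!: derivative_eq_intros)
  then show ?case by (intro exI[of _ "\<lambda>_. f e"]) (auto intro: real_polynomial_function.intros)
next
  case (const c)
  then show ?case by (intro exI[of _ "\<lambda>_. 0"]) (auto intro: real_polynomial_function.intros)
next
  case (add f g)
  then obtain f' g' where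
    "real_polynomial_function f'" "\<And>x. ((\<lambda>t. f (x + t *\<^sub>R e)) has_real_derivative f' x) (at 0)"
    "real_polynomial_function g'" "\<And>x. ((\<lambda>t. g (x + t *\<^sub>R e)) has_real_derivative g' x) (at 0)" by auto
  then show ?case
    by (intro exI[of _ "\<lambda>x. f' x + g' x"]) (auto intro: real_polynomial_function.intros DERIV_add)
next
  case (mult f g)
  then obtain f' g' where *:
    "real_polynomial_function f'" "\<And>x. ((\<lambda>t. f (x + t *\<^sub>R e)) has_real_derivative f' x) (at 0)"
    "real_polynomial_function g'" "\<And>x. ((\<lambda>t. g (x + t *\<^sub>R e)) has_real_derivative g' x) (at 0)" by auto
  have "((\<lambda>t. f (x + t *\<^sub>R e) * g (x + t *\<^sub>R e)) has_real_derivative f' x * g x + g' x * f x) (at 0)" for x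
    using DERIV_mult[OF *(2)[of x] *(4)[of x]] by simp
  then show ?case using * mult.hyps
    by (intro exI[of _ "\<lambda>x. f' x * g x + g' x * f x"])
      (auto intro: real_polynomial_function.intros)
qed

lemma real_polynomial_function_partial_deriv:
  "real_polynomial_function p \<Longrightarrow> real_polynomial_function (partial_deriv i p)"
proof -
  assume "real_polynomial_function p"
  then obtain p' where p': "real_polynomial_function p'"
    "\<And>x. ((\<lambda>t. p (x + t *\<^sub>R axis i 1)) has_real_derivative p' x) (at 0)"
    using real_polynomial_function_directional_derivative by blast
  have "partial_deriv i p = p'"
    by (auto simp: fun_eq_iff partial_deriv_def intro!: DERIV_imp_deriv p')
  with p' show ?thesis by simp
qed

text \<open>Partial derivatives of polynomials are polynomials, so every order of differentiability
  follows by induction.\<close>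

lemma smooth_on_real_polynomial_function:
  assumes "real_polynomial_function p" shows "smooth_on S p"
proof -
  have "Ck_on k S p" if "real_polynomial_function p" for k p
    using that
  proof (induction k arbitrary: p)
    case 0
    then show ?case
      by (auto intro!: continuous_at_imp_continuous_on continuous_real_polymonial_function)
  next
    case (Suc k)
    then show ?case
      by (auto simp: differentiable_on_real_polynomial_function real_polynomial_function_partial_deriv)
  qed
  with assms show ?thesis by (simp add: smooth_on_def)
qed

text \<open>Kernels \<open>\<Sum> A\<^sub>i(x) B\<^sub>i(y)\<close> with polynomials \<open>A\<^sub>i\<close>: integrating over \<open>y\<close> leaves a polynomial in \<open>x\<close>.\<close>

inductive separated :: "('a::euclidean_space \<Rightarrow> 'a \<Rightarrow> real) \<Rightarrow> bool" where
  mult: "real_polynomial_function A \<Longrightarrow> continuous_on UNIV B \<Longrightarrow> separated (\<lambda>x y. A x * B y)"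
| add: "separated F \<Longrightarrow> separated G \<Longrightarrow> separated (\<lambda>x y. F x y + G x y)"

lemma separated_mult:
  assumes "separated F" "separated G" shows "separated (\<lambda>x y. F x y * G x y)"
  using assms
proof (induction F arbitrary: G)
  case (mult A B)
  from mult.prems mult.hyps show ?case
  proof (induction G)
    case (mult A' B')
    have "separated (\<lambda>x y. (A x * A' x) * (B y * B' y))"
      using mult by (intro separated.mult real_polynomial_function.intros(4) continuous_intros)
    then show ?case by (simp add: ac_simps)
  next
    case (add F G)
    then have "separated (\<lambda>x y. A x * B y * F x y + A x * B y * G x y)"
      by (intro separated.add) auto
    then show ?case by (simp add: distrib_left)
  qed
next
  case (add F1 F2)
  then have "separated (\<lambda>x y. F1 x y * G x y + F2 x y * G x y)"
    by (intro separated.add) auto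
  then show ?case by (simp add: distrib_right)
qed

lemma separated_polynomial_diff:
  assumes "real_polynomial_function p" shows "separated (\<lambda>x y. p (x - y))"
  using assms
proof induction
  case (linear f)
  then have bl: "bounded_linear f" .
  then interpret bounded_linear f .
  have "separated (\<lambda>x y. f x * 1 + 1 * (- f y))"
    using bl by (intro separated.add separated.mult real_polynomial_function.intros(1,2) continuous_intros
        linear_continuous_on)
  then show ?case by (simp add: diff)
next
  case (const c)
  have "separated (\<lambda>x y::'a. c * 1)"
    by (intro separated.intros real_polynomial_function.intros continuous_intros)
  then show ?case by simp
qed (auto intro: separated.add separated_mult)

lemma separated_continuous:
  "separated F \<Longrightarrow> continuous_on UNIV (F x)"
  by (induction rule: separated.induct) (auto intro!: continuous_intros)

lemma real_polynomial_function_integral_separated: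
  fixes w :: "'a::euclidean_space \<Rightarrow> real"
  assumes "separated F" and w: "continuous_on UNIV w"
  shows "real_polynomial_function (\<lambda>x. integral (cbox a b) (\<lambda>y. F x y * w y))"
  using assms(1)
proof induction
  case (mult A B)
  have "integral (cbox a b) (\<lambda>y. A x * B y * w y) = A x * integral (cbox a b) (\<lambda>y. B y * w y)" for x
    by (simp add: mult.assoc)
  with mult show ?case by (simp add: real_polynomial_function.intros)
next
  case (add F G)
  have i: "(\<lambda>y. H x y * w y) integrable_on cbox a b" if "separated H" for H x
    using separated_continuous[OF that, of x] w
    by (intro integrable_continuous continuous_intros) (auto intro: continuous_on_subset)
  have "integral (cbox a b) (\<lambda>y. (F x y + G x y) * w y) =
      integral (cbox a b) (\<lambda>y. F x y * w y) + integral (cbox a b) (\<lambda>y. G x y * w y)" for x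
    unfolding distrib_right using add.hyps by (intro integral_add i)
  with add show ?case by (simp add: real_polynomial_function.intros)
qed

section \<open>Landau kernels and mollification\<close>

definition cube :: "real \<Rightarrow> (real^2) set" where "cube c = cbox (\<chi> i. - c) (\<chi> i. c)"

lemma mem_cube: "x \<in> cube c \<longleftrightarrow> \<bar>x$1\<bar> \<le> c \<and> \<bar>x$2\<bar> \<le> c"
  by (auto simp: cube_def mem_box_cart forall_2)

lemma content_cube: "c > 0 \<Longrightarrow> measure lborel (cube c) > 0"
  unfolding cube_def by (subst content_pos_lt_eq) (auto simp: Basis_vec_def inner_axis)

lemma norm_sq_2: "(norm (x::real^2))\<^sup>2 = (x$1)\<^sup>2 + (x$2)\<^sup>2"
  by (simp add: norm_vec_def L2_set_def sum_2)

text \<open>Since \<open>(norm z)\<^sup>2 \<le> 8\<close> on \<open>cube 2\<close>, the kernel is positive there, and \<open>cube 2\<close> contains all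
  differences of points of the unit disk.\<close>

definition landau :: "nat \<Rightarrow> real^2 \<Rightarrow> real" where "landau n z = (1 - (norm z)\<^sup>2 / 9) ^ n"

lemma real_polynomial_function_landau: "real_polynomial_function (landau n)"
proof -
  have *: "landau n z = (\<lambda>z. (1 + (- 1/9) * (z$1 * z$1 + z$2 * z$2)) ^ n) z" for z
  proof -
    have "(norm z)\<^sup>2 = z$1 * z$1 + z$2 * z$2" unfolding norm_sq_2 by (simp add: power2_eq_square)
    then show ?thesis by (simp only: landau_def) (simp add: field_simps)
  qed
  have "real_polynomial_function (\<lambda>z::real^2. 1 + (- 1/9) * (z$1 * z$1 + z$2 * z$2))"
    by (intro real_polynomial_function.intros bounded_linear_vec_nth)
  then show ?thesis unfolding * [abs_def] by (rule real_polynomial_function_power)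
qed

lemma continuous_on_landau: "continuous_on A (landau n)"
  unfolding landau_def[abs_def] by (intro continuous_intros) auto

lemma norm_sq_cube: "z \<in> cube 2 \<Longrightarrow> (norm z)\<^sup>2 \<le> 8"
proof -
  assume "z \<in> cube 2"
  then have "\<bar>z$1\<bar> \<le> \<bar>2\<bar>" "\<bar>z$2\<bar> \<le> \<bar>2\<bar>" by (auto simp: mem_cube)
  then have "(z$1)\<^sup>2 \<le> 2\<^sup>2" "(z$2)\<^sup>2 \<le> 2\<^sup>2" by (simp_all only: abs_le_square_iff)
  then show ?thesis by (simp add: norm_sq_2)
qed

lemma landau_nonneg: "z \<in> cube 2 \<Longrightarrow> landau n z \<ge> 0"
  using norm_sq_cube[of z] by (simp add: landau_def)

definition landau_mass :: "nat \<Rightarrow> real" where "landau_mass n = integral (cube 2) (landau n)"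

lemma integrable_on_cube: "continuous_on (cube c) f \<Longrightarrow> f integrable_on cube c"
  for f :: "real^2 \<Rightarrow> real"
  unfolding cube_def by (rule integrable_continuous)

text \<open>On \<open>cube (d / 4)\<close> one has \<open>norm z \<le> d / 2\<close>, whence the
  base \<open>1 - d^2 / 36\<close>. The point is that it exceeds the base \<open>1 - d^2 / 9\<close>
  which bounds the kernel outside the ball of radius \<open>d\<close>: the mass concentrates at
  \<open>0\<close>.\<close>

lemma landau_mass_ge:
  assumes d: "0 < d" "d \<le> 2"
  shows "landau_mass n \<ge> measure lborel (cube (d / 4)) * (1 - d\<^sup>2 / 36) ^ n"
proof -
  have "measure lborel (cube (d/4)) * (1 - d\<^sup>2 / 36) ^ n = integral (cube (d/4)) (\<lambda>_. (1 - d\<^sup>2 / 36) ^ n)"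
    by (simp add: cube_def)
  also have "\<dots> \<le> integral (cube (d/4)) (landau n)"
  proof (rule integral_le)
    fix z assume "z \<in> cube (d/4)"
    then have "\<bar>z$1\<bar> \<le> \<bar>d/4\<bar>" "\<bar>z$2\<bar> \<le> \<bar>d/4\<bar>" using d by (auto simp: mem_cube)
    then have "(z$1)\<^sup>2 \<le> (d/4)\<^sup>2" "(z$2)\<^sup>2 \<le> (d/4)\<^sup>2" by (simp_all only: abs_le_square_iff)
    then have "(z$1)\<^sup>2 \<le> d\<^sup>2 / 16" "(z$2)\<^sup>2 \<le> d\<^sup>2 / 16" by (simp_all add: power_divide)
    then have "(norm z)\<^sup>2 \<le> d\<^sup>2 / 4"
      unfolding norm_sq_2 using zero_le_power2[of d] by linarith
    moreover have "d\<^sup>2 \<le> 2\<^sup>2" using d by (intro power_mono) auto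
    ultimately show "(1 - d\<^sup>2 / 36) ^ n \<le> landau n z"
      unfolding landau_def by (intro power_mono) auto
  qed (auto intro!: integrable_on_cube continuous_on_landau)
  also have "\<dots> \<le> landau_mass n"
    unfolding landau_mass_def
  proof (rule integral_subset_le)
    show "cube (d/4) \<subseteq> cube 2" using d by (auto simp: mem_cube)
  qed (auto intro!: integrable_on_cube continuous_on_landau landau_nonneg)
  finally show ?thesis .
qed

lemma landau_mass_pos: "landau_mass n > 0"
proof -
  have "0 < measure lborel (cube (1 / 4)) * (1 - 1\<^sup>2 / 36) ^ n"
    using content_cube[of "1/4"] by (intro mult_pos_pos) auto
  also have "\<dots> \<le> landau_mass n" by (rule landau_mass_ge) auto
  finally show ?thesis .
qed

text \<open>The variable \<open>x\<close> is placed in \<open>h\<close>, not in the kernel: in this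
  form bounds carry over and derivatives fall on \<open>h\<close>. The other form, in which the
  result is visibly polynomial, appears in \<open>mollify_polynomial\<close>.\<close>

definition mollify :: "nat \<Rightarrow> (real^2 \<Rightarrow> real) \<Rightarrow> real^2 \<Rightarrow> real"
  where "mollify n h x = integral (cube 2) (\<lambda>z. landau n z * h (x - z)) / landau_mass n"

lemma mollify_integrable:
  assumes "continuous_on UNIV h" shows "(\<lambda>z. landau n z * h (x - z)) integrable_on cube 2"
  by (intro integrable_on_cube continuous_intros continuous_on_landau continuous_on_compose2[OF assms]) auto

text \<open>The mollification is an average with nonnegative weights; this keeps the phase field in
  \<open>[-1, 1]\<close> exactly.\<close>

lemma mollify_bounds:
  assumes h: "continuous_on UNIV h" "\<And>x. h x \<in> {a..b}"
  shows "mollify n h x \<in> {a..b}"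
proof -
  have "integral (cube 2) (\<lambda>z. landau n z * a) \<le> integral (cube 2) (\<lambda>z. landau n z * h (x - z))"
    using h by (intro integral_le mollify_integrable integrable_on_cube continuous_intros continuous_on_landau
        mult_left_mono landau_nonneg) auto
  moreover have "integral (cube 2) (\<lambda>z. landau n z * h (x - z)) \<le> integral (cube 2) (\<lambda>z. landau n z * b)"
    using h by (intro integral_le mollify_integrable integrable_on_cube continuous_intros continuous_on_landau
        mult_left_mono landau_nonneg) auto
  ultimately show ?thesis
    using landau_mass_pos[of n] by (simp add: mollify_def field_simps landau_mass_def[symmetric])
qed

text \<open>Close to \<open>0\<close> continuity of \<open>h\<close> controls the integrand. Outside
  the ball of radius \<open>d\<close> the kernel is geometrically small relative to its mass, by
  \<open>landau_mass_ge\<close>.\<close>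

lemma mollify_tendsto:
  assumes h: "continuous_on UNIV h" and M: "\<And>x. \<bar>h x\<bar> \<le> M"
  shows "(\<lambda>n. mollify n h x) \<longlonglongrightarrow> h x"
proof (rule LIMSEQ_I)
  fix \<eta> :: real assume \<eta>: "\<eta> > 0"
  have "isCont h x" using h by (simp add: continuous_on_eq_continuous_at)
  then obtain d0 where d0: "d0 > 0" "\<And>y. dist y x < d0 \<Longrightarrow> dist (h y) (h x) < \<eta> / 2"
    using \<eta> unfolding continuous_at_eps_delta by (meson half_gt_zero)
  \<comment> \<open>The cap \<open>2\<close> keeps \<open>\<kappa>\<close> nonnegative and makes
    \<open>landau_mass_ge\<close> applicable.\<close>
  define d where "d = min d0 2"
  have d: "0 < d" "d \<le> 2" "d \<le> d0" using d0 by (auto simp: d_def)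
  have M0: "M \<ge> 0" using M[of x] by linarith
  define \<kappa> \<kappa>' where "\<kappa> = 1 - d\<^sup>2 / 9" and "\<kappa>' = 1 - d\<^sup>2 / 36"
  have "d\<^sup>2 \<le> 2\<^sup>2" using d by (intro power_mono) auto
  then have \<kappa>: "0 \<le> \<kappa>" "\<kappa> < \<kappa>'" "0 < \<kappa>'" using d by (auto simp: \<kappa>_def \<kappa>'_def)
  define C where "C = 2 * M * measure lborel (cube 2) / measure lborel (cube (d / 4))"
  have "(\<lambda>n. (\<kappa> / \<kappa>') ^ n) \<longlonglongrightarrow> 0" using \<kappa> by (intro LIMSEQ_power_zero) auto
  then have "(\<lambda>n. C * (\<kappa> / \<kappa>') ^ n) \<longlonglongrightarrow> C * 0" by (intro tendsto_mult tendsto_const)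
  then have "\<forall>\<^sub>F n in sequentially. C * (\<kappa> / \<kappa>') ^ n < \<eta> / 2"
    using \<eta> by (intro order_tendstoD(2)[of _ "C * 0"]) auto
  then obtain N where N: "\<And>n. n \<ge> N \<Longrightarrow> C * (\<kappa> / \<kappa>') ^ n < \<eta> / 2"
    by (auto simp: eventually_sequentially)
  have "norm (mollify n h x - h x) < \<eta>" if n: "n \<ge> N" for n
  proof -
    have "integral (cube 2) (\<lambda>z. landau n z * (h (x - z) - h x)) =
        integral (cube 2) (\<lambda>z. landau n z * h (x - z)) - integral (cube 2) (\<lambda>z. landau n z * h x)"
      unfolding right_diff_distrib
      by (intro integral_diff mollify_integrable h integrable_on_cube continuous_intros continuous_on_landau)
    also have "integral (cube 2) (\<lambda>z. landau n z * h x) = landau_mass n * h x"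
      by (simp add: landau_mass_def)
    finally have eq: "landau_mass n * (mollify n h x - h x) =
        integral (cube 2) (\<lambda>z. landau n z * (h (x - z) - h x))"
      using landau_mass_pos[of n] by (simp add: mollify_def right_diff_distrib)
    have "norm (integral (cube 2) (\<lambda>z. landau n z * (h (x - z) - h x))) \<le>
        integral (cube 2) (\<lambda>z. landau n z * (\<eta> / 2) + 2 * M * \<kappa> ^ n)"
    proof (rule integral_norm_bound_integral)
      show "(\<lambda>z. landau n z * (h (x - z) - h x)) integrable_on cube 2"
        by (intro integrable_on_cube continuous_intros continuous_on_landau continuous_on_compose2[OF h]) auto
      show "(\<lambda>z. landau n z * (\<eta> / 2) + 2 * M * \<kappa> ^ n) integrable_on cube 2"
        by (intro integrable_on_cube continuous_intros continuous_on_landau)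
      fix z assume z: "z \<in> cube 2"
      show "norm (landau n z * (h (x - z) - h x)) \<le> landau n z * (\<eta> / 2) + 2 * M * \<kappa> ^ n"
      proof (cases "norm z < d")
        case True
        then have "\<bar>h (x - z) - h x\<bar> \<le> \<eta> / 2"
          using d0(2)[of "x - z"] d by (simp add: dist_norm)
        then have "norm (landau n z * (h (x - z) - h x)) \<le> landau n z * (\<eta> / 2)"
          using mult_left_mono[OF _ landau_nonneg[OF z], of "\<bar>h (x - z) - h x\<bar>" "\<eta> / 2" n]
            landau_nonneg[OF z, of n] by (simp add: abs_mult)
        moreover have "0 \<le> 2 * M * \<kappa> ^ n" using M0 \<kappa> by simp
        ultimately show ?thesis by linarith
      next
        case False
        then have "d\<^sup>2 \<le> (norm z)\<^sup>2" using d by (intro power_mono) auto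
        then have l: "landau n z \<le> \<kappa> ^ n"
          unfolding landau_def \<kappa>_def using norm_sq_cube[OF z] by (intro power_mono) auto
        have "\<bar>h (x - z) - h x\<bar> \<le> 2 * M" using M[of "x - z"] M[of x] by linarith
        then have "norm (landau n z * (h (x - z) - h x)) \<le> \<kappa> ^ n * (2 * M)"
          unfolding real_norm_def abs_mult using l landau_nonneg[OF z, of n] zero_le_power[OF \<kappa>(1), of n]
            by (intro mult_mono) auto
        moreover have "0 \<le> landau n z * (\<eta> / 2)" using landau_nonneg[OF z] \<eta> by simp
        ultimately show ?thesis by (simp add: mult.commute)
      qed
    qed
    also have "\<dots> = landau_mass n * (\<eta> / 2) + measure lborel (cube 2) * (2 * M * \<kappa> ^ n)"
    proof -
      have "integral (cube 2) (\<lambda>z. landau n z * (\<eta> / 2) + 2 * M * \<kappa> ^ n) =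
          integral (cube 2) (\<lambda>z. landau n z * (\<eta> / 2)) + integral (cube 2) (\<lambda>z. 2 * M * \<kappa> ^ n)"
        by (intro integral_add integrable_on_cube continuous_intros continuous_on_landau)
      then show ?thesis by (simp add: landau_mass_def) (simp add: cube_def)
    qed
    also have "measure lborel (cube 2) * (2 * M * \<kappa> ^ n) =
        C * (\<kappa> / \<kappa>') ^ n * (measure lborel (cube (d/4)) * \<kappa>' ^ n)"
      using \<kappa> content_cube[of "d/4"] d by (simp add: C_def power_divide)
    also have "landau_mass n * (\<eta> / 2) + \<dots> \<le> landau_mass n * (\<eta> / 2) + C * (\<kappa> / \<kappa>') ^ n * landau_mass n"
      unfolding \<kappa>'_def using landau_mass_ge[OF d(1,2), of n] \<kappa> M0 content_cube[of "d/4"] content_cube[of 2] d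
      by (intro add_left_mono mult_left_mono) (auto simp: C_def \<kappa>'_def)
    also have "\<dots> < landau_mass n * (\<eta> / 2) + \<eta> / 2 * landau_mass n"
      using mult_strict_right_mono[OF N[OF n] landau_mass_pos[of n]] by linarith
    finally have "\<bar>landau_mass n * (mollify n h x - h x)\<bar> < landau_mass n * \<eta>"
      unfolding eq by (simp add: mult.commute)
    then show ?thesis using landau_mass_pos[of n] by (simp add: abs_mult)
  qed
  then show "\<exists>N. \<forall>n\<ge>N. norm (mollify n h x - h x) < \<eta>" by blast
qed

text \<open>Differentiation under the integral sign lets the derivative fall on \<open>h\<close>, so
  bounds and limits for the derivatives of the mollification reduce to those for
  mollifications.\<close>

lemma mollify_derivative:
  assumes h: "continuous_on UNIV h" and h': "continuous_on UNIV h'"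
    and d: "\<And>x. ((\<lambda>t. h (x + t *\<^sub>R e)) has_real_derivative h' x) (at 0)"
  shows "((\<lambda>t. mollify n h (x + t *\<^sub>R e)) has_real_derivative mollify n h' x) (at 0)"
proof -
  have dt: "((\<lambda>t. h (y + t *\<^sub>R e)) has_real_derivative h' (y + t *\<^sub>R e)) (at t)" for y t
  proof -
    have "((\<lambda>s. h ((y + t *\<^sub>R e) + (s - t) *\<^sub>R e)) has_real_derivative h' (y + t *\<^sub>R e) * 1) (at t)"
      by (rule DERIV_chain2[where g="\<lambda>s. s - t"]) (use d in \<open>auto intro!: derivative_eq_intros\<close>)
    moreover have "(y + t *\<^sub>R e) + (s - t) *\<^sub>R e = y + s *\<^sub>R e" for s
      by (simp add: scaleR_left_diff_distrib)
    ultimately show ?thesis by simp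
  qed
  have "((\<lambda>t. integral (cbox (\<chi> i. - 2) (\<chi> i. 2)) (\<lambda>z. landau n z * h (x + t *\<^sub>R e - z))) has_real_derivative
      integral (cbox (\<chi> i. - 2) (\<chi> i. 2)) (\<lambda>z. landau n z * h' (x + 0 *\<^sub>R e - z))) (at 0 within UNIV)"
  proof (rule leibniz_rule_field_derivative)
    fix t z
    show "((\<lambda>t. landau n z * h (x + t *\<^sub>R e - z)) has_real_derivative landau n z * h' (x + t *\<^sub>R e - z))
        (at t within UNIV)"
      using DERIV_cmult[OF dt[of "x - z" t], of "landau n z"] by (simp add: algebra_simps)
    show "(\<lambda>z. landau n z * h (x + t *\<^sub>R e - z)) integrable_on cbox (\<chi> i. - 2) (\<chi> i. 2)"
      using mollify_integrable[OF h] by (simp add: cube_def)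
  next
    show "continuous_on (UNIV \<times> cbox (\<chi> i. - 2) (\<chi> i. 2)) (\<lambda>(t, z). landau n z * h' (x + t *\<^sub>R e - z))"
      unfolding case_prod_unfold
      by (intro continuous_intros continuous_on_compose2[OF continuous_on_landau[of UNIV]]
          continuous_on_compose2[OF h']) auto
  qed auto
  from DERIV_cdivide[OF this, of "landau_mass n"] show ?thesis
    by (simp add: mollify_def cube_def)
qed

text \<open>After the substitution \<open>y = x - z\<close> the domain is \<open>cube 2\<close>
  shifted by \<open>x\<close>. For \<open>x\<close> in the disk it contains \<open>cube 1\<close>,
  hence the support of \<open>h\<close>, so the domain may be fixed independently of
  \<open>x\<close>; then \<open>x\<close> occurs in the polynomial kernel only.\<close>

lemma mollify_polynomial:
  assumes h: "continuous_on UNIV h" and supp: "\<And>x. norm x \<ge> 1 \<Longrightarrow> h x = 0"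
  obtains p where "real_polynomial_function p" "\<And>x. norm x < 1 \<Longrightarrow> p x = mollify n h x"
proof
  let ?p = "\<lambda>x. integral (cbox (\<chi> i. - 1) (\<chi> i. 1)) (\<lambda>y. landau n (x - y) * h y)"
  show "real_polynomial_function (\<lambda>x. ?p x * (1 / landau_mass n))"
    by (intro real_polynomial_function.intros real_polynomial_function_integral_separated h
        separated_polynomial_diff real_polynomial_function_landau)
  fix x :: "real^2" assume x: "norm x < 1"
  define f where "f y = landau n (x - y) * h y" for y
  have f: "continuous_on UNIV f"
    unfolding f_def by (intro continuous_intros h continuous_on_compose2[OF continuous_on_landau[of UNIV]]) auto
  have f0: "f y = 0" if "y \<notin> cbox (\<chi> i. - 1) (\<chi> i. 1)" for y
  proof -
    have "\<exists>i. \<bar>y$i\<bar> > 1"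
    proof (rule ccontr)
      assume "\<nexists>i. \<bar>y$i\<bar> > 1"
      then have "\<bar>y$i\<bar> \<le> 1" for i by (meson not_less)
      then show False using that by (auto simp: mem_box_cart abs_le_iff minus_le_iff)
    qed
    then obtain i where "\<bar>y$i\<bar> > 1" ..
    then have "norm y \<ge> 1" using component_le_norm_cart[of y i] by linarith
    then show ?thesis by (simp add: f_def supp)
  qed
  have xi: "\<bar>x$i\<bar> < 1" for i using component_le_norm_cart[of x i] x by linarith
  have sub: "cbox (\<chi> i. - 1) (\<chi> i. 1) \<subseteq> cbox ((\<chi> i. - 2) + x) ((\<chi> i. 2) + x)"
  proof
    fix y :: "real^2" assume y: "y \<in> cbox (\<chi> i. - 1) (\<chi> i. 1)"
    have "- 2 + x$i \<le> y$i \<and> y$i \<le> 2 + x$i" for i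
      using y xi[of i] by (auto simp: mem_box_cart dest!: spec[of _ i])
    then show "y \<in> cbox ((\<chi> i. - 2) + x) ((\<chi> i. 2) + x)" by (auto simp: mem_box_cart)
  qed
  have "(f has_integral ?p x) (cbox (\<chi> i. - 1) (\<chi> i. 1))"
    unfolding f_def[symmetric]
    by (intro integrable_integral integrable_continuous continuous_on_subset[OF f]) auto
  then have "(f has_integral ?p x) (cbox ((\<chi> i. - 2) + x) ((\<chi> i. 2) + x))"
    by (rule has_integral_on_superset) (use f0 sub in auto)
  then have "?p x = integral (cbox (\<chi> i. - 2) (\<chi> i. 2)) (f \<circ> (+) x)"
    by (simp add: integral_unique integral_shift_cbox_plus)
  also have "\<dots> = integral (cbox (- (\<chi> i. 2)) (- (\<chi> i. - 2))) (\<lambda>z. (f \<circ> (+) x) (- z))"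
    by (rule Henstock_Kurzweil_Integration.integral_reflect[symmetric])
  also have "\<dots> = integral (cbox (\<chi> i. - 2) (\<chi> i. 2)) (\<lambda>z. (f \<circ> (+) x) (- z))"
  proof -
    have "(- (\<chi> i. 2)) = ((\<chi> i. - 2) :: real^2)" "(- (\<chi> i. - 2)) = ((\<chi> i. 2) :: real^2)"
      by (simp_all add: vec_eq_iff)
    then show ?thesis by (simp only:)
  qed
  also have "(\<lambda>z. (f \<circ> (+) x) (- z)) = (\<lambda>z. landau n z * h (x - z))"
    by (simp add: f_def fun_eq_iff)
  finally show "?p x * (1 / landau_mass n) = mollify n h x"
    by (simp add: mollify_def cube_def)
qed

text \<open>Pointwise limits with uniform bounds are exactly what dominated convergence will
  consume. Mixed second derivatives are left out because the Laplacian does not contain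
  them.\<close>

lemma C2_polynomial_approximation:
  fixes w :: "real^2 \<Rightarrow> real" and w1 w2 :: "2 \<Rightarrow> real^2 \<Rightarrow> real"
  assumes cont: "continuous_on UNIV w" "\<And>i. continuous_on UNIV (w1 i)" "\<And>i. continuous_on UNIV (w2 i)"
    and d1: "\<And>i x. ((\<lambda>t. w (x + t *\<^sub>R axis i 1)) has_real_derivative w1 i x) (at 0)"
    and d2: "\<And>i x. ((\<lambda>t. w1 i (x + t *\<^sub>R axis i 1)) has_real_derivative w2 i x) (at 0)"
    and supp: "\<And>x. norm x \<ge> 1 \<Longrightarrow> w x = 0" and range: "\<And>x. w x \<in> {a..b}"
    and bnd: "\<And>i x. \<bar>w1 i x\<bar> \<le> M" "\<And>i x. \<bar>w2 i x\<bar> \<le> M"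
  obtains U :: "nat \<Rightarrow> real^2 \<Rightarrow> real" where "\<And>n. real_polynomial_function (U n)"
    and "\<And>n x. norm x < 1 \<Longrightarrow> U n x \<in> {a..b}"
    and "\<And>n i x. norm x < 1 \<Longrightarrow> \<bar>partial_deriv i (U n) x\<bar> \<le> M"
    and "\<And>n i x. norm x < 1 \<Longrightarrow> \<bar>partial_deriv i (partial_deriv i (U n)) x\<bar> \<le> M"
    and "\<And>x. norm x < 1 \<Longrightarrow> (\<lambda>n. U n x) \<longlonglongrightarrow> w x"
    and "\<And>i x. norm x < 1 \<Longrightarrow> (\<lambda>n. partial_deriv i (U n) x) \<longlonglongrightarrow> w1 i x"
    and "\<And>i x. norm x < 1 \<Longrightarrow> (\<lambda>n. partial_deriv i (partial_deriv i (U n)) x) \<longlonglongrightarrow> w2 i x"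
proof -
  have "\<exists>p. real_polynomial_function p \<and> (\<forall>x. norm x < 1 \<longrightarrow> p x = mollify n w x)" for n
    using mollify_polynomial[OF cont(1) supp] by metis
  then obtain U where U: "\<And>n. real_polynomial_function (U n)" "\<And>n x. norm x < 1 \<Longrightarrow> U n x = mollify n w x"
    by metis
  \<comment> \<open>The polynomial agrees with the mollification on the open disk only; there
    partial derivatives depend on nearby values alone.\<close>
  have loc: "partial_deriv i f x = g' x"
    if "\<And>x. norm x < 1 \<Longrightarrow> f x = g x" "norm x < 1"
      "((\<lambda>t. g (x + t *\<^sub>R axis i 1)) has_real_derivative g' x) (at 0)" for f g g' i and x :: "real^2"
  proof -
    have "((\<lambda>t. norm (x + t *\<^sub>R axis i 1)) \<longlongrightarrow> norm (x + 0 *\<^sub>R axis i 1)) (at 0)"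
      by (intro tendsto_intros)
    then have "\<forall>\<^sub>F t in at 0. norm (x + t *\<^sub>R axis i 1) < 1"
      by (rule order_tendstoD(2)) (use that in simp)
    then have ev: "\<forall>\<^sub>F t in nhds 0. f (x + t *\<^sub>R axis i 1) = g (x + t *\<^sub>R axis i 1)"
      using that(1,2) by (auto simp: eventually_nhds_conv_at elim: eventually_mono)
    have "((\<lambda>t. f (x + t *\<^sub>R axis i 1)) has_real_derivative g' x) (at 0)"
      by (rule DERIV_cong_ev[OF refl ev refl, THEN iffD2, OF that(3)])
    then show ?thesis unfolding partial_deriv_def by (rule DERIV_imp_deriv)
  qed
  have p1: "partial_deriv i (U n) x = mollify n (w1 i) x" if "norm x < 1" for i n x
    by (rule loc[of "U n" "mollify n w" x i "mollify n (w1 i)",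
          OF U(2) that mollify_derivative[OF cont(1) cont(2) d1]])
  have p2: "partial_deriv i (partial_deriv i (U n)) x = mollify n (w2 i) x" if "norm x < 1" for i n x
    by (rule loc[of "partial_deriv i (U n)" "mollify n (w1 i)" x i "mollify n (w2 i)",
          OF p1 that mollify_derivative[OF cont(2) cont(3) d2]])
  have wM: "\<bar>w x\<bar> \<le> max \<bar>a\<bar> \<bar>b\<bar>" for x using range[of x] by auto
  show ?thesis
  proof (rule that[of U])
    show "\<bar>partial_deriv i (U n) x\<bar> \<le> M" if "norm x < 1" for n i x
      using mollify_bounds[OF cont(2)[of i], of "-M" M n x] bnd(1) p1[OF that] by (auto simp: abs_le_iff minus_le_iff)
    show "\<bar>partial_deriv i (partial_deriv i (U n)) x\<bar> \<le> M" if "norm x < 1" for n i x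
      using mollify_bounds[OF cont(3)[of i], of "-M" M n x] bnd(2) p2[OF that] by (auto simp: abs_le_iff minus_le_iff)
    show "(\<lambda>n. U n x) \<longlonglongrightarrow> w x" if "norm x < 1" for x
      using mollify_tendsto[OF cont(1) wM] U(2)[OF that] by simp
    show "(\<lambda>n. partial_deriv i (U n) x) \<longlonglongrightarrow> w1 i x" if "norm x < 1" for i x
      using mollify_tendsto[OF cont(2) bnd(1)] p1[OF that] by simp
    show "(\<lambda>n. partial_deriv i (partial_deriv i (U n)) x) \<longlonglongrightarrow> w2 i x" if "norm x < 1" for i x
      using mollify_tendsto[OF cont(3) bnd(2)] p2[OF that] by simp
  qed (use U mollify_bounds[OF cont(1) range] in auto)
qed

section \<open>Tubular neighbourhoods of simple closed curves\<close>

lemma norm_diff_le_vector_derivative: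
  fixes f :: "real \<Rightarrow> 'a::real_normed_vector"
  assumes "\<And>t. (f has_vector_derivative f' t) (at t)" "\<And>t. t \<in> closed_segment a b \<Longrightarrow> norm (f' t) \<le> B"
  shows "norm (f b - f a) \<le> B * \<bar>b - a\<bar>"
proof -
  have "norm (f b - f a) \<le> B * norm (b - a)"
  proof (rule differentiable_bound[of "closed_segment a b" f "\<lambda>t h. h *\<^sub>R f' t"])
    fix t assume t: "t \<in> closed_segment a b"
    show "(f has_derivative (\<lambda>h. h *\<^sub>R f' t)) (at t within closed_segment a b)"
      using assms(1)[of t] by (simp add: has_vector_derivative_def has_derivative_at_withinI)
    show "onorm (\<lambda>h. h *\<^sub>R f' t) \<le> B"
      using assms(2)[OF t] by (intro onorm_bound) (auto simp: mult.commute[of B] intro: mult_left_mono order.trans[OF norm_ge_zero])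
  qed auto
  then show ?thesis by simp
qed

section \<open>Frame, curvature and chords of the curve\<close>

definition rot :: "real^2 \<Rightarrow> real^2" where "rot v = vector [- v$2, v$1]"

lemma rot_nth [simp]: "rot v $ 1 = - v$2" "rot v $ 2 = v$1"
  by (simp_all add: rot_def)

lemma inner_2: "(x::real^2) \<bullet> y = x$1 * y$1 + x$2 * y$2"
  by (simp add: inner_vec_def sum_2)

lemma vec2_eqI: "x$1 = y$1 \<Longrightarrow> x$2 = y$2 \<Longrightarrow> x = y" for x y :: "real^2"
  by (simp add: vec_eq_iff forall_2)

lemma rot_simps: "rot v \<bullet> rot w = v \<bullet> w" "rot v \<bullet> v = 0" "v \<bullet> rot v = 0" "norm (rot v) = norm v" "rot (rot v) = - v"
  "rot (c *\<^sub>R v) = c *\<^sub>R rot v" "rot (v + w) = rot v + rot w" "rot (v - w) = rot v - rot w"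
  by (auto simp: inner_2 norm_eq_sqrt_inner intro: vec2_eqI)

lemma bounded_linear_rot: "bounded_linear rot"
  by (rule bounded_linear_intro[where K=1]) (auto simp: rot_simps)

lemma orthonormal_expansion:
  assumes "norm u = 1" shows "v = (v \<bullet> u) *\<^sub>R u + (v \<bullet> rot u) *\<^sub>R rot u"
proof -
  have u: "u$1 * u$1 + u$2 * u$2 = 1" using assms by (simp add: norm_eq_sqrt_inner inner_2)
  have "v$1 * (u$1 * u$1 + u$2 * u$2) = (v$1 * u$1 + v$2 * u$2) * u$1 + (v$1 * - u$2 + v$2 * u$1) * - u$2"
    "v$2 * (u$1 * u$1 + u$2 * u$2) = (v$1 * u$1 + v$2 * u$2) * u$2 + (v$1 * - u$2 + v$2 * u$1) * u$1"
    by algebra+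
  then show ?thesis unfolding u by (intro vec2_eqI) (simp_all add: inner_2)
qed

locale simple_closed_C2_curve =
  fixes L :: real and g g1 g2 :: "real \<Rightarrow> real^2"
  assumes L_pos: "L > 0" and deriv_g: "\<And>t. (g has_vector_derivative g1 t) (at t)"
    and deriv_g1: "\<And>t. (g1 has_vector_derivative g2 t) (at t)" and cont_g2: "continuous_on UNIV g2"
    and per: "\<And>t. g (t + L) = g t" and inj: "inj_on g {0..<L}" and unit: "\<And>t. norm (g1 t) = 1"
begin

definition nrm :: "real \<Rightarrow> real^2" where "nrm t = rot (g1 t)"
text \<open>Signed curvature with respect to the left normal, positive where the curve turns left.
  The sign matters: this is the function whose integral the Umlaufsatz computes.\<close>

definition curv :: "real \<Rightarrow> real" where "curv t = g2 t \<bullet> nrm t"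

lemma cont_g: "continuous_on A g" and cont_g1: "continuous_on A g1"
  using deriv_g deriv_g1 by (meson continuous_at_imp_continuous_on has_vector_derivative_continuous)+

lemma cont_nrm: "continuous_on A nrm"
  unfolding nrm_def[abs_def]
  by (rule continuous_on_compose2[OF linear_continuous_on[OF bounded_linear_rot] cont_g1]) auto

lemma cont_curv: "continuous_on A curv"
  unfolding curv_def[abs_def]
  by (intro continuous_intros cont_nrm continuous_on_subset[OF cont_g2]) auto

lemma norm_nrm: "norm (nrm t) = 1" and nrm_g1: "nrm t \<bullet> g1 t = 0" "g1 t \<bullet> nrm t = 0"
  and inner_g1: "g1 t \<bullet> g1 t = 1" and inner_nrm: "nrm t \<bullet> nrm t = 1"
  using unit[of t] by (auto simp: nrm_def rot_simps norm_eq_1)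

text \<open>Differentiating \<open>g1 t \<bullet> g1 t = 1\<close> shows that \<open>g2\<close> has
  no tangential part.\<close>

lemma g2_eq: "g2 t = curv t *\<^sub>R nrm t"
proof -
  have "((\<lambda>t. g1 t \<bullet> g1 t) has_derivative (\<lambda>h. g1 t \<bullet> (h *\<^sub>R g2 t) + (h *\<^sub>R g2 t) \<bullet> g1 t)) (at t)"
    using deriv_g1[of t] unfolding has_vector_derivative_def by (intro has_derivative_inner)
  then have "((\<lambda>t. 1) has_derivative (\<lambda>h. h * (2 * (g2 t \<bullet> g1 t)))) (at t)"
    by (simp add: inner_g1 inner_commute algebra_simps)
  moreover have "((\<lambda>t. 1) has_derivative (\<lambda>h. 0)) (at t)" by simp
  ultimately have "(\<lambda>h. h * (2 * (g2 t \<bullet> g1 t))) = (\<lambda>h. 0)" by (rule has_derivative_unique)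
  from fun_cong[OF this, of 1] have "g2 t \<bullet> g1 t = 0" by simp
  then show ?thesis using orthonormal_expansion[OF unit, of "g2 t" t] by (simp add: curv_def nrm_def)
qed

lemma deriv_nrm: "(nrm has_vector_derivative - curv t *\<^sub>R g1 t) (at t)"
proof -
  have "((\<lambda>t. rot (g1 t)) has_vector_derivative rot (g2 t)) (at t)"
    by (rule bounded_linear.has_vector_derivative[OF bounded_linear_rot deriv_g1])
  then show ?thesis by (simp add: nrm_def[abs_def] g2_eq rot_simps)
qed

lemma norm_g2: "norm (g2 t) = \<bar>curv t\<bar>"
  by (simp add: g2_eq norm_nrm)

lemma per1: "g1 (t + L) = g1 t"
  by (rule has_vector_derivative_periodic[OF deriv_g per])

lemma per2: "g2 (t + L) = g2 t"
  by (rule has_vector_derivative_periodic[OF deriv_g1 per1])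

lemma per_nrm: "nrm (t + L) = nrm t" and per_curv: "curv (t + L) = curv t"
  by (auto simp: nrm_def curv_def per1 per2)

lemma periods: "g (t + of_int k * L) = g t" "g1 (t + of_int k * L) = g1 t"
  "nrm (t + of_int k * L) = nrm t" "curv (t + of_int k * L) = curv t"
  using periodic_int[of g] periodic_int[of g1] periodic_int[of nrm] periodic_int[of curv]
  by (auto simp: per per1 per_nrm per_curv)

lemmas reduce_period = shift_into_period[OF L_pos]

lemma inj_mod:
  assumes "g s = g t" shows "\<exists>k::int. t = s + of_int k * L"
proof -
  obtain j where j: "0 \<le> s + of_int j * L" "s + of_int j * L < 0 + L" by (rule reduce_period)
  obtain k where k: "0 \<le> t + of_int k * L" "t + of_int k * L < 0 + L" by (rule reduce_period)
  have "s + of_int j * L = t + of_int k * L"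
    by (rule inj_onD[OF inj]) (use j k assms in \<open>auto simp: periods\<close>)
  then have "t = s + of_int (j - k) * L" by (simp add: algebra_simps)
  then show ?thesis ..
qed

lemma lipschitz_g: "dist (g s) (g t) \<le> \<bar>s - t\<bar>"
  using norm_diff_le_vector_derivative[OF deriv_g, of t s 1] by (simp add: unit dist_norm)

lemma bounded_curv: obtains K where "K > 0" "\<And>t. \<bar>curv t\<bar> \<le> K"
proof -
  have "compact (curv ` {0..L})" by (intro compact_continuous_image cont_curv) auto
  then obtain B where B: "\<And>t. t \<in> {0..L} \<Longrightarrow> norm (curv t) \<le> B"
    using compact_imp_bounded bounded_iff by (metis image_eqI)
  have "\<bar>curv t\<bar> \<le> max B 1" for t
  proof -
    obtain k where "0 \<le> t + of_int k * L" "t + of_int k * L < 0 + L" by (rule reduce_period)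
    then have "\<bar>curv (t + of_int k * L)\<bar> \<le> B" using B[of "t + of_int k * L"] by simp
    then show ?thesis by (simp add: periods)
  qed
  then show ?thesis by (rule that[rotated]) simp
qed

text \<open>Tangent and normal are \<open>K\<close>-Lipschitz, so a chord deviates from its tangent
  line by at most \<open>K * \<bar>s - t\<bar>^2\<close>.\<close>

lemma chord_near:
  assumes K: "\<And>t. \<bar>curv t\<bar> \<le> K"
  shows "\<bar>(g s - g t) \<bullet> g1 t\<bar> \<ge> \<bar>s - t\<bar> - K * \<bar>s - t\<bar>\<^sup>2" and "norm (nrm s - nrm t) \<le> K * \<bar>s - t\<bar>"
proof -
  have K0: "K \<ge> 0" using K[of 0] by linarith
  have g1: "norm (g1 u - g1 t) \<le> K * \<bar>u - t\<bar>" for u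
    by (rule norm_diff_le_vector_derivative[OF deriv_g1]) (simp add: norm_g2 K)
  have "((\<lambda>u. g u - u *\<^sub>R g1 t) has_vector_derivative (g1 u - g1 t)) (at u)" for u
    by (auto intro!: derivative_eq_intros deriv_g)
  then have "norm ((g s - s *\<^sub>R g1 t) - (g t - t *\<^sub>R g1 t)) \<le> (K * \<bar>s - t\<bar>) * \<bar>s - t\<bar>"
  proof (rule norm_diff_le_vector_derivative)
    fix u assume "u \<in> closed_segment t s"
    then have "\<bar>u - t\<bar> \<le> \<bar>s - t\<bar>" by (auto simp: closed_segment_eq_real_ivl split: if_splits)
    then show "norm (g1 u - g1 t) \<le> K * \<bar>s - t\<bar>"
      using g1[of u] K0 mult_left_mono order.trans by blast
  qed
  then have *: "norm ((g s - g t) - (s - t) *\<^sub>R g1 t) \<le> K * \<bar>s - t\<bar>\<^sup>2"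
    by (simp add: algebra_simps power2_eq_square)
  have "\<bar>((g s - g t) - (s - t) *\<^sub>R g1 t) \<bullet> g1 t\<bar> \<le> norm ((g s - g t) - (s - t) *\<^sub>R g1 t) * norm (g1 t)"
    by (rule Cauchy_Schwarz_ineq2)
  also have "\<dots> \<le> K * \<bar>s - t\<bar>\<^sup>2" using * by (simp add: unit)
  also have "((g s - g t) - (s - t) *\<^sub>R g1 t) \<bullet> g1 t = (g s - g t) \<bullet> g1 t - (s - t)"
    by (simp add: inner_diff_left inner_g1)
  finally show "\<bar>(g s - g t) \<bullet> g1 t\<bar> \<ge> \<bar>s - t\<bar> - K * \<bar>s - t\<bar>\<^sup>2" by linarith
  show "norm (nrm s - nrm t) \<le> K * \<bar>s - t\<bar>"
    by (rule norm_diff_le_vector_derivative[OF deriv_nrm]) (simp add: unit K)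
qed

text \<open>Projecting a short chord to the tangent loses only a quadratic term. This supplies the
  local hypothesis of the Hausdorff measure computation.\<close>

lemma locally_bilipschitz:
  assumes "0 < \<theta>" "\<theta> < 1"
  shows "\<exists>l>0. \<forall>s t. \<bar>s - t\<bar> \<le> l \<longrightarrow> \<theta> * \<bar>s - t\<bar> \<le> dist (g s) (g t)"
proof -
  obtain K where K: "K > 0" "\<And>t. \<bar>curv t\<bar> \<le> K" using bounded_curv by blast
  show ?thesis
  proof (intro exI[of _ "(1 - \<theta>) / K"] conjI allI impI)
    fix s t assume "\<bar>s - t\<bar> \<le> (1 - \<theta>) / K"
    then have "K * \<bar>s - t\<bar> \<le> 1 - \<theta>" using K(1) by (simp add: field_simps)
    then have "(K * \<bar>s - t\<bar>) * \<bar>s - t\<bar> \<le> (1 - \<theta>) * \<bar>s - t\<bar>" by (rule mult_right_mono) simp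
    then have "\<theta> * \<bar>s - t\<bar> \<le> \<bar>s - t\<bar> - K * \<bar>s - t\<bar>\<^sup>2" by (simp add: algebra_simps power2_eq_square)
    also have "\<dots> \<le> \<bar>(g s - g t) \<bullet> g1 t\<bar>" by (rule chord_near(1)[OF K(2)])
    also have "\<dots> \<le> norm (g s - g t) * norm (g1 t)" by (rule Cauchy_Schwarz_ineq2)
    finally show "\<theta> * \<bar>s - t\<bar> \<le> dist (g s) (g t)" by (simp add: unit dist_norm)
  qed (use assms K in simp)
qed

text \<open>Compactness and injectivity. Pairs are described by start and increment, so that
  periodicity brings the start into \<open>{0..L}\<close> while the increment stays between
  \<open>l\<close> and \<open>L - l\<close>.\<close>

lemma chord_far:
  assumes l: "0 < l"
  obtains m where "m > 0" "\<And>s t. l \<le> \<bar>s - t\<bar> \<Longrightarrow> \<bar>s - t\<bar> \<le> L - l \<Longrightarrow> m \<le> norm (g s - g t)"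
proof (cases "l \<le> L - l")
  case False
  then show ?thesis using that[of 1] by auto
next
  case True
  let ?C = "{0..L} \<times> {l..L - l}"
  have cf: "continuous_on ?C (\<lambda>z. norm (g (fst z) - g (fst z + snd z)))"
    by (intro continuous_intros continuous_on_compose2[OF cont_g[of UNIV]]) auto
  have "compact ?C" "?C \<noteq> {}" using L_pos True by (auto intro: compact_Times)
  then obtain z where z: "z \<in> ?C" "\<And>y. y \<in> ?C \<Longrightarrow>
      norm (g (fst z) - g (fst z + snd z)) \<le> norm (g (fst y) - g (fst y + snd y))"
    using continuous_attains_inf[OF _ _ cf] by blast
  define m where "m = norm (g (fst z) - g (fst z + snd z))"
  have "m \<noteq> 0"
  proof
    assume "m = 0"
    then have "g (fst z) = g (fst z + snd z)" by (simp add: m_def)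
    from inj_mod[OF this] obtain k :: int where k: "snd z = of_int k * L" by auto
    have "0 < snd z" "snd z < L" using z(1) l by auto
    then have "0 < of_int k * L" "of_int k * L < L" unfolding k .
    then have "0 < k" "of_int k < (1::real)"
      using L_pos mult_less_cancel_right_pos[of L "of_int k" 1] by (auto simp: zero_less_mult_iff)
    then show False by simp
  qed
  then have "m > 0" by (simp add: m_def)
  moreover have "m \<le> norm (g s - g t)" if "l \<le> \<bar>s - t\<bar>" "\<bar>s - t\<bar> \<le> L - l" for s t
  proof -
    have *: "m \<le> norm (g s - g t)" if "l \<le> t - s" "t - s \<le> L - l" for s t
    proof -
      obtain k where k: "0 \<le> s + of_int k * L" "s + of_int k * L < 0 + L" by (rule reduce_period)
      then have "m \<le> norm (g (s + of_int k * L) - g ((s + of_int k * L) + (t - s)))"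
        using z(2)[of "(s + of_int k * L, t - s)"] that by (simp add: m_def)
      also have "(s + of_int k * L) + (t - s) = t + of_int k * L" by simp
      finally show ?thesis by (simp add: periods)
    qed
    show ?thesis
      using that *[of s t] *[of t s] by (cases "s \<le> t") (auto simp: norm_minus_commute)
  qed
  ultimately show ?thesis by (rule that)
qed

text \<open>Two normal segments might meet at remote parameters, which \<open>chord_far\<close>
  excludes, or at nearby ones. In the second case the chord is almost tangential, whereas the two
  normals differ tangentially only by \<open>K * \<bar>s - t\<bar>\<close>, and a factor
  \<open>r \<le> \<delta>\<close> makes this too small.\<close>

lemma tube_exists:
  assumes ball: "\<And>t. g t \<in> ball 0 1"
  obtains \<delta> K where "\<delta> > 0" "\<And>t. \<bar>curv t\<bar> \<le> K" "K * \<delta> \<le> 1 / 2"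
    "\<And>s t r r'. \<bar>r\<bar> \<le> \<delta> \<Longrightarrow> \<bar>r'\<bar> \<le> \<delta> \<Longrightarrow> g s + r *\<^sub>R nrm s = g t + r' *\<^sub>R nrm t \<Longrightarrow>
       r = r' \<and> (\<exists>k::int. t = s + of_int k * L)"
    "\<And>s r. \<bar>r\<bar> \<le> \<delta> \<Longrightarrow> norm (g s + r *\<^sub>R nrm s) < 1"
proof -
  obtain K where K: "K > 0" "\<And>t. \<bar>curv t\<bar> \<le> K" using bounded_curv by blast
  define l where "l = min (1 / (4 * K)) (L / 4)"
  have l: "0 < l" "l \<le> 1 / (4 * K)" "l \<le> L / 4" using K L_pos by (auto simp: l_def)
  obtain m where m: "m > 0" "\<And>s t. l \<le> \<bar>s - t\<bar> \<Longrightarrow> \<bar>s - t\<bar> \<le> L - l \<Longrightarrow> m \<le> norm (g s - g t)"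
    using chord_far[OF l(1)] by blast
  obtain a where a: "a \<in> {0..L}" "\<And>t. t \<in> {0..L} \<Longrightarrow> norm (g t) \<le> norm (g a)"
    using continuous_attains_sup[of "{0..L}" "\<lambda>t. norm (g t)"] L_pos continuous_on_norm[OF cont_g]
    by (auto simp del: atLeastAtMost_iff)
  have na: "norm (g t) \<le> norm (g a)" for t
  proof -
    obtain k where "0 \<le> t + of_int k * L" "t + of_int k * L < 0 + L" by (rule reduce_period)
    then show ?thesis using a(2)[of "t + of_int k * L"] by (simp add: periods)
  qed
  \<comment> \<open>The three bounds give \<open>K * \<delta> \<le> 1 / 4\<close> for nearby
    parameters, displacements too short to bridge the distance \<open>m\<close> of remote points,
    and a tube inside the disk.\<close>
  define \<delta> where "\<delta> = min (1 / (4 * K)) (min (m / 4) ((1 - norm (g a)) / 2))"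
  have ga: "norm (g a) < 1" using ball[of a] by simp
  have \<delta>: "\<delta> > 0" "\<delta> \<le> 1 / (4 * K)" "\<delta> \<le> m / 4" "\<delta> \<le> (1 - norm (g a)) / 2"
  proof -
    show "\<delta> > 0" using K m ga by (simp add: \<delta>_def)
    show "\<delta> \<le> 1 / (4 * K)" "\<delta> \<le> m / 4" "\<delta> \<le> (1 - norm (g a)) / 2"
      unfolding \<delta>_def by linarith+
  qed
  have K\<delta>: "K * \<delta> \<le> 1 / 4" "K * l \<le> 1 / 4" using \<delta>(2) l(2) K(1) by (auto simp: field_simps)
  show ?thesis
  proof (rule that[OF \<delta>(1) K(2)])
    show "K * \<delta> \<le> 1 / 2" using K\<delta> by simp
    show "norm (g s + r *\<^sub>R nrm s) < 1" if "\<bar>r\<bar> \<le> \<delta>" for s r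
      using norm_triangle_ineq[of "g s" "r *\<^sub>R nrm s"] na[of s] that \<delta>(4) ga by (simp add: norm_nrm field_simps)
    fix s t r r' assume r: "\<bar>r\<bar> \<le> \<delta>" "\<bar>r'\<bar> \<le> \<delta>" and eq: "g s + r *\<^sub>R nrm s = g t + r' *\<^sub>R nrm t"
    \<comment> \<open>A representative within half a period of \<open>s\<close>: since
      \<open>l \<le> L / 4\<close>, this gives \<open>\<bar>s - t'\<bar> \<le> L - l\<close>, as the
      choice of \<open>m\<close> requires.\<close>
    obtain k where k: "s - L / 2 \<le> t + of_int k * L" "t + of_int k * L < s - L / 2 + L" by (rule reduce_period)
    define t' where "t' = t + of_int k * L"
    have t': "\<bar>s - t'\<bar> \<le> L / 2" using k unfolding t'_def by linarith
    have eq': "g s - g t' = r' *\<^sub>R nrm t' - r *\<^sub>R nrm s"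
      using eq unfolding t'_def periods by (simp add: algebra_simps)
    have "s = t'"
    proof (cases "\<bar>s - t'\<bar> < l")
      case False
      then have "m \<le> norm (g s - g t')" using m(2)[of s t'] t' l by simp
      also have "\<dots> \<le> norm (r' *\<^sub>R nrm t') + norm (r *\<^sub>R nrm s)" unfolding eq' by (rule norm_triangle_ineq4)
      also have "\<dots> \<le> m / 4 + m / 4" using r \<delta>(3) by (simp add: norm_nrm)
      finally show ?thesis using m(1) by simp
    next
      case True
      \<comment> \<open>The normal at \<open>t'\<close> is orthogonal to \<open>g1 t'\<close>, so
        only the change of the normal from \<open>t'\<close> to \<open>s\<close> is left.\<close>
      have "(g s - g t') \<bullet> g1 t' = - (r * ((nrm s - nrm t') \<bullet> g1 t'))"
        unfolding eq' by (simp add: inner_diff_left nrm_g1)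
      then have "\<bar>(g s - g t') \<bullet> g1 t'\<bar> = \<bar>r\<bar> * \<bar>(nrm s - nrm t') \<bullet> g1 t'\<bar>" by (simp add: abs_mult)
      also have "\<dots> \<le> \<delta> * (K * \<bar>s - t'\<bar>)"
      proof (rule mult_mono)
        have "\<bar>(nrm s - nrm t') \<bullet> g1 t'\<bar> \<le> norm (nrm s - nrm t') * norm (g1 t')" by (rule Cauchy_Schwarz_ineq2)
        then show "\<bar>(nrm s - nrm t') \<bullet> g1 t'\<bar> \<le> K * \<bar>s - t'\<bar>"
          using chord_near(2)[OF K(2), of s t'] by (simp add: unit)
      qed (use r \<delta> in auto)
      also have "\<dots> = (K * \<delta>) * \<bar>s - t'\<bar>" by simp
      also have "\<dots> \<le> 1 / 4 * \<bar>s - t'\<bar>" using K\<delta> by (intro mult_right_mono) auto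
      finally have "\<bar>s - t'\<bar> - K * \<bar>s - t'\<bar>\<^sup>2 \<le> 1 / 4 * \<bar>s - t'\<bar>"
        using chord_near(1)[OF K(2), of s t'] by linarith
      moreover have "K * \<bar>s - t'\<bar>\<^sup>2 \<le> 1 / 4 * \<bar>s - t'\<bar>"
      proof -
        have "K * \<bar>s - t'\<bar> \<le> K * l" using True K(1) by simp
        then have "(K * \<bar>s - t'\<bar>) * \<bar>s - t'\<bar> \<le> 1 / 4 * \<bar>s - t'\<bar>" using K\<delta> by (intro mult_right_mono) auto
        then show ?thesis by (simp add: power2_eq_square)
      qed
      moreover have "a - X \<le> 1 / 4 * a \<Longrightarrow> X \<le> 1 / 4 * a \<Longrightarrow> a \<le> 0" for a X :: real by linarith
      ultimately have "\<bar>s - t'\<bar> \<le> 0" by blast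
      then show ?thesis by simp
    qed
    moreover from this have "r *\<^sub>R nrm s = r' *\<^sub>R nrm s" using eq' by auto
    then have "r = r'" using norm_nrm[of s] by (metis norm_zero scaleR_cancel_right zero_neq_one)
    moreover have "t = s + of_int (- k) * L" using \<open>s = t'\<close> by (simp add: t'_def)
    ultimately show "r = r' \<and> (\<exists>k::int. t = s + of_int k * L)" by blast
  qed
qed

section \<open>Tubular coordinates: arc length and signed distance\<close>

definition Phi :: "real^2 \<Rightarrow> real^2" where "Phi p = g (p$1) + p$2 *\<^sub>R nrm (p$1)"

definition DPhi :: "real^2 \<Rightarrow> real^2 \<Rightarrow> real^2"
  where "DPhi p h = (h$1 * (1 - curv (p$1) * p$2)) *\<^sub>R g1 (p$1) + h$2 *\<^sub>R nrm (p$1)"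

lemma deriv_comp_fst:
  fixes p :: "real^2"
  assumes "(f has_vector_derivative f') (at (p$1))"
  shows "((\<lambda>p::real^2. f (p$1)) has_derivative (\<lambda>h. h$1 *\<^sub>R f')) (at p)"
proof -
  have 1: "((\<lambda>p::real^2. p$1) has_derivative (\<lambda>h. h$1)) (at p)"
    by (rule bounded_linear_imp_has_derivative) (rule bounded_linear_vec_nth)
  have 2: "(f has_derivative (\<lambda>h. h *\<^sub>R f')) (at (p$1))"
    using assms by (simp add: has_vector_derivative_def)
  show ?thesis by (rule has_derivative_compose[OF 1 2])
qed

lemma has_derivative_Phi: "(Phi has_derivative DPhi p) (at p)"
proof -
  have "((\<lambda>p. g (p$1) + p$2 *\<^sub>R nrm (p$1)) has_derivative
      (\<lambda>h. h$1 *\<^sub>R g1 (p$1) + (p$2 *\<^sub>R (h$1 *\<^sub>R - curv (p$1) *\<^sub>R g1 (p$1)) + h$2 *\<^sub>R nrm (p$1)))) (at p)"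
    by (intro has_derivative_add has_derivative_scaleR deriv_comp_fst deriv_g deriv_nrm
        bounded_linear_imp_has_derivative bounded_linear_vec_nth)
  then show ?thesis
    unfolding Phi_def[abs_def] by (rule has_derivative_eq_rhs) (auto simp: DPhi_def fun_eq_iff algebra_simps)
qed

lemma cont_Phi: "continuous_on A Phi"
  using has_derivative_Phi by (meson continuous_at_imp_continuous_on has_derivative_continuous)

text \<open>With respect to the orthonormal frame the differential is diagonal with entries
  \<open>1 - \<kappa> r\<close> and \<open>1\<close>.\<close>

lemma det_DPhi: "det (matrix (DPhi p)) = 1 - curv (p$1) * p$2"
proof -
  have u: "g1 (p$1) $ 1 * g1 (p$1) $ 1 + g1 (p$1) $ 2 * g1 (p$1) $ 2 = 1"
    using inner_g1[of "p$1"] unfolding inner_2 .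
  have ax: "axis 1 (1::real) $ (1::2) = 1" "axis 1 (1::real) $ (2::2) = 0"
      "axis 2 (1::real) $ (1::2) = 0" "axis 2 (1::real) $ (2::2) = 1"
    by (simp_all add: axis_def)
  define j where "j = 1 - curv (p$1) * p$2"
  have D: "DPhi p (axis 1 1) = j *\<^sub>R g1 (p$1)" "DPhi p (axis 2 1) = nrm (p$1)"
    by (simp_all add: DPhi_def ax j_def)
  have "det (matrix (DPhi p)) = j * (g1 (p$1) $ 1 * g1 (p$1) $ 1 + g1 (p$1) $ 2 * g1 (p$1) $ 2)"
    unfolding det_2 matrix_def by (simp add: D nrm_def) (simp add: algebra_simps)
  then show ?thesis using u by (simp add: j_def)
qed

end

locale tube = simple_closed_C2_curve +
  fixes \<delta> K :: real
  assumes \<delta>_pos: "\<delta> > 0" and curv_le: "\<And>t. \<bar>curv t\<bar> \<le> K" and K\<delta>: "K * \<delta> \<le> 1 / 2"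
    and tube_inj: "\<And>s t r r'. \<bar>r\<bar> \<le> \<delta> \<Longrightarrow> \<bar>r'\<bar> \<le> \<delta> \<Longrightarrow> g s + r *\<^sub>R nrm s = g t + r' *\<^sub>R nrm t \<Longrightarrow>
       r = r' \<and> (\<exists>k::int. t = s + of_int k * L)"
    and tube_ball: "\<And>s r. \<bar>r\<bar> \<le> \<delta> \<Longrightarrow> norm (g s + r *\<^sub>R nrm s) < 1"
begin

definition strip :: "(real^2) set" where "strip = {p. \<bar>p$2\<bar> < \<delta>}"

definition nbhd :: "(real^2) set" where "nbhd = Phi ` strip"

text \<open>The first component of \<open>foot\<close> is determined up to multiples of the period only.\<close>

definition foot :: "real^2 \<Rightarrow> real^2" where "foot x = (SOME p. p \<in> strip \<and> Phi p = x)"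

lemma curv_small: "\<bar>r\<bar> \<le> \<delta> \<Longrightarrow> \<bar>curv s * r\<bar> \<le> 1 / 2"
proof -
  assume "\<bar>r\<bar> \<le> \<delta>"
  then have "\<bar>curv s * r\<bar> \<le> K * \<delta>"
    unfolding abs_mult by (rule mult_mono[OF curv_le]) (simp_all add: order.trans[OF abs_ge_zero curv_le])
  with K\<delta> show ?thesis by linarith
qed

lemma jacobian_pos: "\<bar>r\<bar> \<le> \<delta> \<Longrightarrow> 1 - curv s * r \<ge> 1 / 2"
  using curv_small[of r s] by linarith

lemma foot: "x \<in> nbhd \<Longrightarrow> foot x \<in> strip \<and> Phi (foot x) = x"
  unfolding foot_def nbhd_def by (rule someI_ex) auto

lemma foot_Phi:
  assumes "p \<in> strip"
  obtains k :: int where "foot (Phi p) $ 1 = p$1 + of_int k * L" "foot (Phi p) $ 2 = p$2"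
proof -
  have "foot (Phi p) \<in> strip \<and> Phi (foot (Phi p)) = Phi p" using assms by (intro foot) (simp add: nbhd_def)
  then have "p$2 = foot (Phi p) $ 2 \<and> (\<exists>k::int. foot (Phi p) $ 1 = p$1 + of_int k * L)"
    using assms by (intro tube_inj) (auto simp: strip_def Phi_def)
  then show ?thesis using that by metis
qed

text \<open>Functions of the coordinates that do not see the period chosen by \<open>foot\<close>;
  they descend to functions on the tube although \<open>foot\<close> is not canonical.\<close>

definition strip_periodic :: "(real^2 \<Rightarrow> 'b) \<Rightarrow> bool"
  where "strip_periodic F \<longleftrightarrow> (\<forall>p q. (\<exists>k::int. q$1 = p$1 + of_int k * L) \<and> q$2 = p$2 \<longrightarrow> F q = F p)"

lemma strip_periodic_foot:
  assumes "strip_periodic F" "p \<in> strip" shows "F (foot (Phi p)) = F p"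
proof -
  obtain k :: int where "foot (Phi p) $ 1 = p$1 + of_int k * L" "foot (Phi p) $ 2 = p$2"
    using foot_Phi[OF assms(2)] .
  then show ?thesis using assms(1) unfolding strip_periodic_def by blast
qed

lemma open_strip: "open strip"
  unfolding strip_def by (intro open_Collect_less continuous_intros)

text \<open>A local inverse of \<open>Phi\<close>, by invariance of domain; it differs from \<open>foot\<close> by periods only.\<close>

lemma local_inverse:
  assumes p: "p \<in> strip"
  obtains V \<psi> where "open V" "Phi p \<in> V" "V \<subseteq> nbhd" "\<psi> (Phi p) = p" "continuous_on V \<psi>"
    "\<And>x. x \<in> V \<Longrightarrow> Phi (\<psi> x) = x \<and> \<psi> x \<in> strip"
proof -
  \<comment> \<open>In an open window of one period no two distinct points differ by a multiple of
    \<open>L\<close>, so \<open>Phi\<close> is injective there.\<close>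
  define U where "U = {q \<in> strip. \<bar>q$1 - p$1\<bar> < L / 2}"
  have "U = strip \<inter> {q. \<bar>q$1 - p$1\<bar> < L / 2}" by (auto simp: U_def)
  moreover have "open {q::real^2. \<bar>q$1 - p$1\<bar> < L / 2}" by (intro open_Collect_less continuous_intros)
  ultimately have oU: "open U" using open_strip by auto
  have injU: "inj_on Phi U"
  proof (rule inj_onI)
    fix a b assume ab: "a \<in> U" "b \<in> U" "Phi a = Phi b"
    then obtain k :: int where k: "a$2 = b$2" "b$1 = a$1 + of_int k * L"
      using tube_inj[of "a$2" "b$2" "a$1" "b$1"] by (auto simp: U_def strip_def Phi_def)
    have "\<bar>a$1 - p$1\<bar> < L / 2" "\<bar>b$1 - p$1\<bar> < L / 2" using ab unfolding U_def by blast+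
    then have "\<bar>b$1 - a$1\<bar> < L" by linarith
    then have "\<bar>of_int k\<bar> * L < 1 * L" using k(2) L_pos by (simp add: abs_mult)
    then have "\<bar>of_int k\<bar> < (1::real)" using L_pos by (simp only: mult_less_cancel_right_pos)
    then have "k = 0" by simp
    with k show "a = b" by (intro vec2_eqI) auto
  qed
  obtain \<psi> where h: "homeomorphism U (Phi ` U) Phi \<psi>"
    using invariance_of_domain_homeomorphism[OF oU cont_Phi _ injU] by auto
  show ?thesis
  proof (rule that[of "Phi ` U" \<psi>])
    show "open (Phi ` U)" by (rule invariance_of_domain[OF cont_Phi oU injU])
    show "Phi p \<in> Phi ` U" using p L_pos by (auto simp: U_def)
    show "\<psi> (Phi p) = p" using h p L_pos by (auto simp: homeomorphism_def U_def)
  qed (use h in \<open>auto simp: homeomorphism_def U_def nbhd_def\<close>)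
qed

lemma open_nbhd: "open nbhd"
proof -
  have "\<exists>V. open V \<and> x \<in> V \<and> V \<subseteq> nbhd" if "x \<in> nbhd" for x
  proof -
    obtain p where p: "p \<in> strip" "x = Phi p" using \<open>x \<in> nbhd\<close> by (auto simp: nbhd_def)
    from local_inverse[OF p(1)] p(2) show ?thesis by metis
  qed
  then show ?thesis by (subst open_subopen) blast
qed

text \<open>\<open>foot\<close> may jump by periods and need not be continuous itself, but near
  \<open>Phi p\<close> the composite equals \<open>F (\<psi> x)\<close> with a continuous local
  inverse \<open>\<psi>\<close>.\<close>

lemma isCont_comp_foot:
  assumes F: "strip_periodic F" "isCont F p" and p: "p \<in> strip"
  shows "isCont (\<lambda>x. F (foot x)) (Phi p)"
proof -
  obtain V \<psi> where V: "open V" "Phi p \<in> V" "\<psi> (Phi p) = p" "continuous_on V \<psi>"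
    "\<And>x. x \<in> V \<Longrightarrow> Phi (\<psi> x) = x \<and> \<psi> x \<in> strip" using local_inverse[OF p] by metis
  have eq: "F (foot x) = F (\<psi> x)" if "x \<in> V" for x
    using strip_periodic_foot[OF F(1), of "\<psi> x"] V(5)[OF that] by simp
  have "isCont \<psi> (Phi p)" using V by (simp add: continuous_on_eq_continuous_at)
  then have "isCont (\<lambda>x. F (\<psi> x)) (Phi p)"
    by (rule isCont_o2) (use F V(3) in simp)
  then show ?thesis
  proof (rule isCont_cong[THEN iffD2, rotated])
    show "\<forall>\<^sub>F x in nhds (Phi p). F (foot x) = F (\<psi> x)"
      using eventually_nhds_in_open[OF V(1,2)] by eventually_elim (rule eq)
  qed
qed

text \<open>The derivative of the local inverse resolves \<open>h\<close> in the frame at the foot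
  point: the tangential component is divided by the Jacobian factor, the normal one is kept.\<close>

lemma has_derivative_comp_foot:
  assumes F: "strip_periodic F" "(F has_derivative F') (at p)" and p: "p \<in> strip"
  shows "((\<lambda>x. F (foot x)) has_derivative
    (\<lambda>h. F' (vector [(h \<bullet> g1 (p$1)) / (1 - curv (p$1) * p$2), h \<bullet> nrm (p$1)]))) (at (Phi p))"
proof -
  obtain V \<psi> where V: "open V" "Phi p \<in> V" "\<psi> (Phi p) = p" "continuous_on V \<psi>"
    "\<And>x. x \<in> V \<Longrightarrow> Phi (\<psi> x) = x \<and> \<psi> x \<in> strip" using local_inverse[OF p] by metis
  have eq: "F (foot x) = F (\<psi> x)" if "x \<in> V" for x
    using strip_periodic_foot[OF F(1), of "\<psi> x"] V(5)[OF that] by simp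
  define J where "J = 1 - curv (p$1) * p$2"
  have J: "J \<noteq> 0" using jacobian_pos[of "p$2" "p$1"] p by (auto simp: J_def strip_def)
  define D where "D h = (vector [(h \<bullet> g1 (p$1)) / J, h \<bullet> nrm (p$1)] :: real^2)" for h
  have "(\<psi> has_derivative D) (at (Phi p))"
  proof (rule has_derivative_inverse_basic)
    show "(Phi has_derivative DPhi p) (at (\<psi> (Phi p)))" using has_derivative_Phi[of p] V(3) by simp
    have "linear D"
      by (rule linearI) (auto simp: D_def inner_add_left add_divide_distrib intro!: vec2_eqI)
    then show "bounded_linear D" by (rule linear_conv_bounded_linear[THEN iffD1])
    show "D \<circ> DPhi p = id"
      using J by (auto simp: fun_eq_iff D_def DPhi_def inner_add_left nrm_g1 inner_g1 inner_nrm
          J_def[symmetric] intro!: vec2_eqI)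
    show "continuous (at (Phi p)) \<psi>" using V by (simp add: continuous_on_eq_continuous_at)
  qed (use V in auto)
  moreover have "(F has_derivative F') (at (\<psi> (Phi p)))" using F V by simp
  ultimately have "((\<lambda>x. F (\<psi> x)) has_derivative (\<lambda>h. F' (D h))) (at (Phi p))"
    by (rule has_derivative_compose)
  then have "((\<lambda>x. F (foot x)) has_derivative (\<lambda>h. F' (D h))) (at (Phi p))"
    by (rule has_derivative_transform_within_open[OF _ V(1,2)]) (simp add: eq)
  then show ?thesis by (simp add: D_def J_def)
qed

end

context tube
begin

text \<open>A common shape for all functions needed below: \<open>h\<close> receives signed
  distance, normal, tangent and curvature, the arguments called \<open>r n e k\<close> in its
  instances.\<close>

lemma strip_periodic_intros:
  "strip_periodic (\<lambda>p. h (p$2) (nrm (p$1)) (g1 (p$1)) (curv (p$1)))"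
  unfolding strip_periodic_def
proof (intro allI impI)
  fix p q :: "real^2" assume pq: "(\<exists>k::int. q$1 = p$1 + of_int k * L) \<and> q$2 = p$2"
  then obtain k :: int where k: "q$1 = p$1 + of_int k * L" by blast
  show "h (q$2) (nrm (q$1)) (g1 (q$1)) (curv (q$1)) = h (p$2) (nrm (p$1)) (g1 (p$1)) (curv (p$1))"
    unfolding k periods using pq by simp
qed

lemma range_g: "range g = g ` {0..L}"
proof
  show "range g \<subseteq> g ` {0..L}"
  proof clarify
    fix t
    obtain k where "0 \<le> t + of_int k * L" "t + of_int k * L < 0 + L" by (rule reduce_period)
    then show "g t \<in> g ` {0..L}" by (intro image_eqI[of _ _ "t + of_int k * L"]) (auto simp: periods)
  qed
qed auto

lemma Phi_nbhd: "p \<in> strip \<Longrightarrow> Phi p \<in> nbhd"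
  by (simp add: nbhd_def)

lemma Phi_vector: "Phi (vector [s, r]) = g s + r *\<^sub>R nrm s"
  by (simp add: Phi_def)

lemma range_g_nbhd: "range g \<subseteq> nbhd"
proof clarify
  fix t
  have "Phi (vector [t, 0]) = g t" by (simp add: Phi_vector)
  then show "g t \<in> nbhd" unfolding nbhd_def
    by (rule image_eqI[OF sym]) (use \<delta>_pos in \<open>simp add: strip_def\<close>)
qed

lemma Phi_not_range: "p \<in> strip \<Longrightarrow> p$2 \<noteq> 0 \<Longrightarrow> Phi p \<notin> range g"
proof
  assume p: "p \<in> strip" "p$2 \<noteq> 0" "Phi p \<in> range g"
  then obtain t where "g (p$1) + p$2 *\<^sub>R nrm (p$1) = g t + 0 *\<^sub>R nrm t" by (auto simp: Phi_def)
  then show False using tube_inj[of "p$2" 0 "p$1" t] p \<delta>_pos by (auto simp: strip_def)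
qed

lemma nbhd_ball: "nbhd \<subseteq> ball 0 1"
  using tube_ball by (auto simp: nbhd_def Phi_def strip_def)

text \<open>The two sides of the curve are the two components given by the Jordan curve theorem; both
  halves of the tube cannot lie in the same one, since each component accumulates at the curve.\<close>

lemma sides:
  obtains P Q where "open P" "open Q" "P \<inter> Q = {}" "P \<union> Q = - range g"
    "\<And>p. p \<in> strip \<Longrightarrow> p$2 > 0 \<Longrightarrow> Phi p \<in> P" "\<And>p. p \<in> strip \<Longrightarrow> p$2 < 0 \<Longrightarrow> Phi p \<in> Q"
    "- ball 0 1 \<subseteq> P \<or> - ball 0 1 \<subseteq> Q"
proof -
  \<comment> \<open>The Jordan curve theorem is applied in the complex plane; \<open>cx\<close> is
    an isometric identification with it.\<close>
  define cx where "cx v = Complex (v$1) (v$2)" for v :: "real^2"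
  have ncx: "norm (cx v - cx w) = norm (v - w)" for v w
  proof -
    have "norm (v - w) = sqrt ((v$1 - w$1)\<^sup>2 + (v$2 - w$2)\<^sup>2)"
      by (simp add: norm_eq_sqrt_inner inner_2 power2_eq_square)
    then show ?thesis by (simp add: cx_def cmod_def)
  qed
  have cont_cx: "continuous_on UNIV cx"
    unfolding cx_def Complex_eq by (intro continuous_intros)
  have inj_cx: "cx v = cx w \<longleftrightarrow> v = w" for v w
    using ncx[of v w] by (metis norm_eq_zero right_minus_eq)
  have surj_cx: "\<exists>v. z = cx v" for z
    by (rule exI[of _ "vector [Re z, Im z]"]) (simp add: cx_def)
  define c where "c t = cx (g (L * t))" for t
  have pc: "path c"
    unfolding path_def c_def
    by (intro continuous_on_compose2[OF cont_cx] continuous_on_compose2[OF cont_g[of UNIV]] continuous_intros) auto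
  have "loop_free c"
    unfolding loop_free_def
  proof (intro ballI impI)
    fix x y :: real assume xy: "x \<in> {0..1}" "y \<in> {0..1}" "c x = c y"
    then have "g (L * x) = g (L * y)" by (simp add: c_def inj_cx)
    from inj_mod[OF this] obtain k :: int where "L * y = L * x + of_int k * L" ..
    then have "L * y = L * (x + of_int k)" by (simp add: algebra_simps)
    then have k: "y = x + of_int k" using L_pos by simp
    then have "-1 \<le> k" "k \<le> 1" using xy by auto
    then have "k = -1 \<or> k = 0 \<or> k = 1" by presburger
    then show "x = y \<or> x = 0 \<and> y = 1 \<or> x = 1 \<and> y = 0" using k xy by auto
  qed
  with pc have sp: "simple_path c" by (simp add: simple_path_def)
  have cl: "pathfinish c = pathstart c"
    using per[of 0] by (simp add: pathfinish_def pathstart_def c_def)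
  have pim: "path_image c = cx ` range g"
  proof -
    have "(\<lambda>t. L * t) ` {0..1} = {0..L}"
      using L_pos image_mult_atLeastAtMost[of L 0 1] by simp
    moreover have "path_image c = cx ` g ` (\<lambda>t. L * t) ` {0..1}"
      by (simp only: path_image_def c_def[abs_def] image_image)
    ultimately have "path_image c = cx ` g ` {0..L}" by (simp only:)
    then show ?thesis by (simp add: range_g)
  qed
  have J: "open (inside (path_image c))" "open (outside (path_image c))"
    "inside (path_image c) \<inter> outside (path_image c) = {}"
    "inside (path_image c) \<union> outside (path_image c) = - path_image c"
    "frontier (inside (path_image c)) = path_image c" "frontier (outside (path_image c)) = path_image c"
    using Jordan_inside_outside[OF sp cl] by - (elim conjE, assumption)+
  define I O' where "I = cx -` inside (path_image c)" and "O' = cx -` outside (path_image c)"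
  have oI: "open I" and oO: "open O'"
    unfolding I_def O'_def by (rule open_vimage[OF J(1) cont_cx], rule open_vimage[OF J(2) cont_cx])
  have dis: "I \<inter> O' = {}" using J(3) unfolding I_def O'_def by blast
  have un: "I \<union> O' = - range g"
  proof -
    have "I \<union> O' = cx -` (- path_image c)" using J(4) unfolding I_def O'_def by blast
    also have "\<dots> = - range g" unfolding pim using inj_cx by auto
    finally show ?thesis .
  qed
  \<comment> \<open>The two halves of the tube. Each is the continuous image of a convex strip that
    misses the curve, hence connected and contained in one component.\<close>
  define Np Nm where "Np = Phi ` {p \<in> strip. p$2 > 0}" and "Nm = Phi ` {p \<in> strip. p$2 < 0}"
  have cv: "convex {p \<in> strip. p$2 > 0}" "convex {p \<in> strip. p$2 < 0}"
  proof -
    have "{p \<in> strip. p$2 > 0} = {p. axis 2 1 \<bullet> p < \<delta>} \<inter> {p. axis 2 1 \<bullet> p > 0}"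
      "{p \<in> strip. p$2 < 0} = {p. axis 2 1 \<bullet> p < 0} \<inter> {p. axis 2 1 \<bullet> p > - \<delta>}"
      using \<delta>_pos by (auto simp: strip_def inner_axis')
    then show "convex {p \<in> strip. p$2 > 0}" "convex {p \<in> strip. p$2 < 0}"
      by (auto intro!: convex_Int convex_halfspace_lt convex_halfspace_gt)
  qed
  have conn: "connected Np" "connected Nm" unfolding Np_def Nm_def
    by (rule connected_continuous_image[OF cont_Phi convex_connected[OF cv(1)]],
        rule connected_continuous_image[OF cont_Phi convex_connected[OF cv(2)]])
  have sub: "Np \<subseteq> I \<union> O'" "Nm \<subseteq> I \<union> O'"
  proof -
    have "x \<notin> range g" if x: "x \<in> Np \<union> Nm" for x
    proof -
      obtain p where "p \<in> strip" "p$2 \<noteq> 0" "x = Phi p" using x unfolding Np_def Nm_def by auto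
      then show ?thesis using Phi_not_range by simp
    qed
    then show "Np \<subseteq> I \<union> O'" "Nm \<subseteq> I \<union> O'" unfolding un by blast+
  qed
  have dis': "I \<inter> O' \<inter> A = {}" for A using dis by simp
  note alt = connectedD[OF conn(1) oI oO dis' sub(1)] connectedD[OF conn(2) oI oO dis' sub(2)]
  have meet: "(Np \<union> Nm) \<inter> S \<noteq> {}" if "S = cx -` T" "frontier T = path_image c" "open T" for S T
  proof -
    have "cx (g 0) \<in> frontier T" unfolding that(2) pim by (intro imageI rangeI)
    then have "cx (g 0) \<in> closure T" unfolding frontier_def by simp
    moreover obtain e where e: "e > 0" "ball (g 0) e \<subseteq> nbhd"
      using open_nbhd range_g_nbhd open_contains_ball by blast
    ultimately obtain z where z: "z \<in> T" "dist z (cx (g 0)) < e" using closure_approachable by blast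
    obtain v where v: "z = cx v" using surj_cx by blast
    then have "dist (g 0) v < e" using z ncx[of v "g 0"] by (simp add: dist_norm norm_minus_commute)
    then have "v \<in> nbhd" using e by auto
    then obtain p where p: "p \<in> strip" "v = Phi p" by (auto simp: nbhd_def)
    have "z \<notin> path_image c" using that(2,3) z(1) by (metis DiffE frontier_def interior_open)
    then have "v \<notin> range g" using v pim by blast
    then have "p$2 \<noteq> 0" using p unfolding Phi_def by auto
    then have "v \<in> Np \<union> Nm" using p unfolding Np_def Nm_def by (cases "p$2 > 0") auto
    moreover have "v \<in> S" using that z v by simp
    ultimately show ?thesis by blast
  qed
  have mI: "(Np \<union> Nm) \<inter> I \<noteq> {}" by (rule meet[OF I_def J(5) J(1)])
  have mO: "(Np \<union> Nm) \<inter> O' \<noteq> {}" by (rule meet[OF O'_def J(6) J(2)])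
  have "cx 0 = 0" by (simp add: cx_def complex_eq_iff)
  then have ncx0: "norm (cx v) = norm v" for v using ncx[of v 0] by simp
  \<comment> \<open>The disk is convex and contains the curve, so its complement lies outside the
    curve.\<close>
  have out: "- ball 0 1 \<subseteq> O'"
  proof -
    have "path_image c \<subseteq> ball 0 1"
    proof -
      have "norm (g t) < 1" for t using tube_ball[of 0 t] \<delta>_pos by simp
      then show ?thesis unfolding pim by (auto simp: ncx0)
    qed
    then have "- ball 0 1 \<subseteq> outside (path_image c)" by (intro outside_subset_convex) auto
    show ?thesis
    proof
      fix x :: "real^2" assume "x \<in> - ball 0 1"
      then have "cx x \<in> - ball 0 1" using ncx0[of x] by simp
      then show "x \<in> O'" using \<open>- ball 0 1 \<subseteq> outside (path_image c)\<close> unfolding O'_def by blast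
    qed
  qed
  have "Np \<subseteq> I \<and> Nm \<subseteq> O' \<or> Np \<subseteq> O' \<and> Nm \<subseteq> I"
    using alt mI mO sub by blast
  then show ?thesis
  proof
    assume "Np \<subseteq> I \<and> Nm \<subseteq> O'"
    then show ?thesis using that[of I O'] oI oO dis un out unfolding Np_def Nm_def by blast
  next
    assume "Np \<subseteq> O' \<and> Nm \<subseteq> I"
    then show ?thesis using that[of O' I] oI oO dis un out unfolding Np_def Nm_def by blast
  qed
qed

text \<open>Off this set the profile is constant. It is closed and lies in the open tube, so
  regularity can be checked on two overlapping open sets: the tube, and the complement of the
  core.\<close>

definition core :: "(real^2) set" where "core = Phi ` {p. \<bar>p$2\<bar> \<le> 4 * \<delta> / 5}"

text \<open>By periodicity the core is the image of a compact box.\<close>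

lemma closed_core: "closed core"
proof -
  have "core = Phi ` cbox (vector [0, - (4 * \<delta> / 5)]) (vector [L, 4 * \<delta> / 5])"
  proof
    show "core \<subseteq> Phi ` cbox (vector [0, - (4 * \<delta> / 5)]) (vector [L, 4 * \<delta> / 5])"
    proof
      fix x assume "x \<in> core"
      then obtain p where p: "\<bar>p$2\<bar> \<le> 4 * \<delta> / 5" "x = Phi p" by (auto simp: core_def)
      obtain k where k: "0 \<le> p$1 + of_int k * L" "p$1 + of_int k * L < 0 + L" by (rule reduce_period)
      have "x = Phi (vector [p$1 + of_int k * L, p$2])" by (simp add: p(2) Phi_def periods)
      moreover have "(vector [p$1 + of_int k * L, p$2] :: real^2) \<in> cbox (vector [0, - (4 * \<delta> / 5)]) (vector [L, 4 * \<delta> / 5])"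
        using p k by (auto simp: mem_box_cart forall_2 abs_le_iff)
      ultimately show "x \<in> Phi ` cbox (vector [0, - (4 * \<delta> / 5)]) (vector [L, 4 * \<delta> / 5])" by blast
    qed
    show "Phi ` cbox (vector [0, - (4 * \<delta> / 5)]) (vector [L, 4 * \<delta> / 5]) \<subseteq> core"
      by (auto simp: core_def mem_box_cart forall_2 abs_le_iff)
  qed
  then show ?thesis by (simp add: compact_imp_closed compact_continuous_image cont_Phi)
qed

lemma core_nbhd: "core \<subseteq> nbhd"
  using \<delta>_pos by (auto simp: core_def nbhd_def strip_def)

end

section \<open>The phase field\<close>

text \<open>The profile \<open>f\<close> is kept abstract so that it can become \<open>q\<close> or
  \<open>- q\<close> according to the orientation; \<open>P\<close> and \<open>Q\<close> are the
  sides of the curve on which \<open>r\<close> is positive and negative.\<close>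

locale phase = tube +
  fixes f f1 f2 :: "real \<Rightarrow> real" and P Q :: "(real^2) set"
  assumes df: "\<And>r. (f has_real_derivative f1 r) (at r)" and df1: "\<And>r. (f1 has_real_derivative f2 r) (at r)"
    and cont_f2: "continuous_on UNIV f2"
    and f_const: "\<And>r. r \<ge> 4 * \<delta> / 5 \<Longrightarrow> f r = f \<delta>" "\<And>r. r \<le> - (4 * \<delta> / 5) \<Longrightarrow> f r = f (- \<delta>)"
    and f1_0: "\<And>r. \<bar>r\<bar> \<ge> 4 * \<delta> / 5 \<Longrightarrow> f1 r = 0" and f2_0: "\<And>r. \<bar>r\<bar> \<ge> 4 * \<delta> / 5 \<Longrightarrow> f2 r = 0"
    and PQ: "open P" "open Q" "P \<inter> Q = {}" "P \<union> Q = - range g"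
    and Phi_P: "\<And>p. p \<in> strip \<Longrightarrow> p$2 > 0 \<Longrightarrow> Phi p \<in> P"
    and Phi_Q: "\<And>p. p \<in> strip \<Longrightarrow> p$2 < 0 \<Longrightarrow> Phi p \<in> Q"
begin

text \<open>Outside the tube the side of the curve decides between the two end values. That the
  clauses fit together is the content of \<open>off_core_P\<close> and
  \<open>off_core_Q\<close>.\<close>

definition v :: "real^2 \<Rightarrow> real"
  where "v x = (if x \<in> nbhd then f (foot x $ 2) else if x \<in> P then f \<delta> else f (- \<delta>))"

text \<open>The partial derivatives \<open>\<partial>\<^sub>i\<close> and \<open>\<partial>\<^sub>i \<partial>\<^sub>i\<close> of \<open>v\<close>; no mixed ones are needed for the energies.\<close>

definition v1 :: "2 \<Rightarrow> real^2 \<Rightarrow> real"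
  where "v1 i x = (if x \<in> nbhd then f1 (foot x $ 2) * nrm (foot x $ 1) $ i else 0)"

definition v2 :: "2 \<Rightarrow> real^2 \<Rightarrow> real"
  where "v2 i x = (if x \<in> nbhd then f2 (foot x $ 2) * (nrm (foot x $ 1) $ i)\<^sup>2
     - f1 (foot x $ 2) * curv (foot x $ 1) * (g1 (foot x $ 1) $ i)\<^sup>2 / (1 - curv (foot x $ 1) * foot x $ 2)
     else 0)"

lemma v_Phi: "p \<in> strip \<Longrightarrow> v (Phi p) = f (p$2)"
  using strip_periodic_foot[OF strip_periodic_intros[of "\<lambda>r n e k. f r"], of p]
  by (simp add: v_def Phi_nbhd)

lemma v1_Phi: "p \<in> strip \<Longrightarrow> v1 i (Phi p) = f1 (p$2) * nrm (p$1) $ i"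
  using strip_periodic_foot[OF strip_periodic_intros[of "\<lambda>r n e k. f1 r * n $ i"], of p]
  by (simp only: v1_def Phi_nbhd if_True)

lemma v2_Phi: "p \<in> strip \<Longrightarrow> v2 i (Phi p) =
   f2 (p$2) * (nrm (p$1) $ i)\<^sup>2 - f1 (p$2) * curv (p$1) * (g1 (p$1) $ i)\<^sup>2 / (1 - curv (p$1) * p$2)"
  using strip_periodic_foot[OF strip_periodic_intros[of "\<lambda>r n e k. f2 r * (n $ i)\<^sup>2 - f1 r * k * (e $ i)\<^sup>2 / (1 - k * r)"], of p]
  by (simp only: v2_def Phi_nbhd if_True)

lemma off_core_P: "x \<in> P - core \<Longrightarrow> v x = f \<delta>" and off_core_Q: "x \<in> Q - core \<Longrightarrow> v x = f (- \<delta>)"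
  and off_core: "x \<notin> core \<Longrightarrow> v1 i x = 0" "x \<notin> core \<Longrightarrow> v2 i x = 0"
proof -
  have far: "\<bar>p$2\<bar> \<ge> 4 * \<delta> / 5" if "Phi p \<notin> core" for p
    using that by (force simp: core_def)
  show "v x = f \<delta>" if x: "x \<in> P - core"
  proof (cases "x \<in> nbhd")
    case True
    then obtain p where p: "p \<in> strip" "x = Phi p" by (auto simp: nbhd_def)
    have "\<not> p$2 < 0" using Phi_Q[OF p(1)] PQ(3) x p(2) by blast
    then have "p$2 \<ge> 4 * \<delta> / 5" using far[of p] x p by auto
    then show ?thesis using v_Phi[OF p(1)] p(2) f_const(1) by simp
  next
    case False
    then show ?thesis using x by (simp add: v_def)
  qed
  show "v x = f (- \<delta>)" if x: "x \<in> Q - core"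
  proof (cases "x \<in> nbhd")
    case True
    then obtain p where p: "p \<in> strip" "x = Phi p" by (auto simp: nbhd_def)
    have "\<not> p$2 > 0" using Phi_P[OF p(1)] PQ(3) x p(2) by blast
    then have "p$2 \<le> - (4 * \<delta> / 5)" using far[of p] x p by auto
    then show ?thesis using v_Phi[OF p(1)] p(2) f_const(2) by simp
  next
    case False
    moreover have "x \<notin> P" using x PQ(3) by blast
    ultimately show ?thesis by (simp add: v_def)
  qed
  show "v1 i x = 0" if x: "x \<notin> core"
  proof (cases "x \<in> nbhd")
    case True
    then obtain p where p: "p \<in> strip" "x = Phi p" by (auto simp: nbhd_def)
    then show ?thesis using v1_Phi[OF p(1)] f1_0 far[of p] x by simp
  qed (simp add: v1_def)
  show "v2 i x = 0" if x: "x \<notin> core"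
  proof (cases "x \<in> nbhd")
    case True
    then obtain p where p: "p \<in> strip" "x = Phi p" by (auto simp: nbhd_def)
    then show ?thesis using v2_Phi[OF p(1)] f1_0 f2_0 far[of p] x by simp
  qed (simp add: v2_def)
qed

text \<open>The core contains the curve, so its complement is covered by the open sets
  \<open>P - core\<close> and \<open>Q - core\<close>, on each of which \<open>v\<close> is
  constant.\<close>

lemma off_core_cases:
  assumes "x \<notin> core"
  obtains c S where "open S" "x \<in> S" "\<And>y. y \<in> S \<Longrightarrow> v y = c" "\<And>y. y \<in> S \<Longrightarrow> y \<notin> core"
proof -
  have "range g \<subseteq> core"
  proof clarify
    fix t show "g t \<in> core"
      unfolding core_def by (rule image_eqI[of _ _ "vector [t, 0]"]) (use \<delta>_pos in \<open>auto simp: Phi_vector\<close>)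
  qed
  then have "x \<in> P \<union> Q" using PQ(4) assms by blast
  moreover have "open (P - core)" "open (Q - core)" using PQ closed_core by auto
  ultimately show ?thesis
    using that[of "P - core" "f \<delta>"] that[of "Q - core" "f (- \<delta>)"] off_core_P off_core_Q assms by blast
qed

lemma cont_f: "isCont f r" "isCont f1 r" "isCont f2 r"
  using DERIV_isCont[OF df] DERIV_isCont[OF df1] cont_f2 by (simp_all add: continuous_on_eq_continuous_at)

lemma isCont_coord: "isCont (\<lambda>p::real^2. p $ i) x"
  by (intro continuous_intros)

lemma isCont_curve_comp:
  "isCont (\<lambda>p::real^2. nrm (p$1)) x" "isCont (\<lambda>p::real^2. g1 (p$1)) x" "isCont (\<lambda>p::real^2. curv (p$1)) x"
proof -
  have c: "isCont nrm r" "isCont g1 r" "isCont curv r" for r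
    using cont_nrm[of UNIV] cont_g1[of UNIV] cont_curv[of UNIV]
    by (simp_all add: continuous_on_eq_continuous_at)
  show "isCont (\<lambda>p::real^2. nrm (p$1)) x" "isCont (\<lambda>p::real^2. g1 (p$1)) x" "isCont (\<lambda>p::real^2. curv (p$1)) x"
    by (rule isCont_o2[OF isCont_coord] c)+
qed

lemma isCont_f_comp:
  "isCont (\<lambda>p::real^2. f (p$2)) x" "isCont (\<lambda>p::real^2. f1 (p$2)) x" "isCont (\<lambda>p::real^2. f2 (p$2)) x"
  by (rule isCont_o2[OF isCont_coord] cont_f)+

lemma isCont_transform_open:
  "isCont F x \<Longrightarrow> open S \<Longrightarrow> x \<in> S \<Longrightarrow> (\<And>y. y \<in> S \<Longrightarrow> G y = F y) \<Longrightarrow> isCont G x"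
  for F G :: "'a::t2_space \<Rightarrow> 'b::topological_space"
proof -
  assume *: "isCont F x" "open S" "x \<in> S" "\<And>y. y \<in> S \<Longrightarrow> G y = F y"
  have "\<forall>\<^sub>F y in nhds x. G y = F y"
    using eventually_nhds_in_open[OF *(2,3)] by eventually_elim (rule *(4))
  then show "isCont G x" using isCont_cong *(1) by blast
qed

lemma continuous_v: "continuous_on UNIV v"
proof (rule continuous_at_imp_continuous_on, rule ballI)
  fix x
  show "isCont v x"
  proof (cases "x \<in> core")
    case True
    then have x: "x \<in> nbhd" using core_nbhd by blast
    then obtain p where p: "p \<in> strip" "x = Phi p" by (auto simp: nbhd_def)
    have "isCont (\<lambda>x. f (foot x $ 2)) (Phi p)"
      by (rule isCont_comp_foot[OF strip_periodic_intros[of "\<lambda>r n e k. f r"] isCont_f_comp(1) p(1)])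
    then show ?thesis using p(2) x by (auto intro: isCont_transform_open[OF _ open_nbhd] simp: v_def)
  next
    case False
    then obtain c S where "open S" "x \<in> S" "\<And>y. y \<in> S \<Longrightarrow> v y = c"
      using off_core_cases[OF False] by metis
    then show ?thesis by (auto intro: isCont_transform_open[where F="\<lambda>_. c"])
  qed
qed

lemma continuous_v1: "continuous_on UNIV (v1 i)"
proof (rule continuous_at_imp_continuous_on, rule ballI)
  fix x
  show "isCont (v1 i) x"
  proof (cases "x \<in> core")
    case True
    then have x: "x \<in> nbhd" using core_nbhd by blast
    then obtain p where p: "p \<in> strip" "x = Phi p" by (auto simp: nbhd_def)
    have "isCont (\<lambda>p. f1 (p$2) * nrm (p$1) $ i) p"
      by (intro continuous_intros isCont_f_comp isCont_curve_comp)
    from isCont_comp_foot[OF strip_periodic_intros[of "\<lambda>r n e k. f1 r * n $ i"] this p(1)]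
    show ?thesis using p(2) x by (auto intro: isCont_transform_open[OF _ open_nbhd] simp: v1_def)
  next
    case False
    show ?thesis
      by (rule isCont_transform_open[where F="\<lambda>_. 0" and S="- core"])
        (use closed_core off_core(1) False in auto)
  qed
qed

lemma continuous_v2: "continuous_on UNIV (v2 i)"
proof (rule continuous_at_imp_continuous_on, rule ballI)
  fix x
  show "isCont (v2 i) x"
  proof (cases "x \<in> core")
    case True
    then have x: "x \<in> nbhd" using core_nbhd by blast
    then obtain p where p: "p \<in> strip" "x = Phi p" by (auto simp: nbhd_def)
    have "1 - curv (p$1) * p$2 \<noteq> 0" using jacobian_pos[of "p$2" "p$1"] p by (auto simp: strip_def)
    then have "isCont (\<lambda>p. f2 (p$2) * (nrm (p$1) $ i)\<^sup>2 - f1 (p$2) * curv (p$1) * (g1 (p$1) $ i)\<^sup>2 / (1 - curv (p$1) * p$2)) p"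
      by (intro continuous_intros isCont_f_comp isCont_curve_comp) auto
    from isCont_comp_foot[OF strip_periodic_intros[of "\<lambda>r n e k. f2 r * (n $ i)\<^sup>2 - f1 r * k * (e $ i)\<^sup>2 / (1 - k * r)"] this p(1)]
    show ?thesis using p(2) x by (auto intro: isCont_transform_open[OF _ open_nbhd] simp: v2_def)
  next
    case False
    show ?thesis
      by (rule isCont_transform_open[where F="\<lambda>_. 0" and S="- core"])
        (use closed_core off_core(2) False in auto)
  qed
qed

lemma line_derivative:
  fixes G F :: "real^2 \<Rightarrow> real"
  assumes "(F has_derivative D) (at x)" "open S" "x \<in> S" "\<And>y. y \<in> S \<Longrightarrow> G y = F y"
  shows "((\<lambda>t. G (x + t *\<^sub>R e)) has_real_derivative D e) (at 0)"
proof -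
  have G: "(G has_derivative D) (at x)"
    using has_derivative_transform_within_open[OF assms(1-3)] assms(4) by simp
  have "((\<lambda>t. x + t *\<^sub>R e) has_derivative (\<lambda>t. t *\<^sub>R e)) (at 0)"
    by (auto intro!: derivative_eq_intros)
  then have "((\<lambda>t. G (x + t *\<^sub>R e)) has_derivative (\<lambda>t. D (t *\<^sub>R e))) (at 0)"
    by (rule has_derivative_compose) (use G in simp)
  moreover have "D (t *\<^sub>R e) = D e * t" for t
    using has_derivative_bounded_linear[OF assms(1)] by (simp add: linear_scale bounded_linear.linear)
  ultimately show ?thesis by (simp add: has_field_derivative_def)
qed

lemma deriv_v: "((\<lambda>t. v (x + t *\<^sub>R axis i 1)) has_real_derivative v1 i x) (at 0)"
proof (cases "x \<in> core")
  case True
  then have x: "x \<in> nbhd" using core_nbhd by blast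
  then obtain p where p: "p \<in> strip" "x = Phi p" by (auto simp: nbhd_def)
  have "((\<lambda>p::real^2. f (p$2)) has_derivative (\<lambda>h. f1 (p$2) * h$2)) (at p)"
    using has_derivative_compose[OF bounded_linear_imp_has_derivative[OF bounded_linear_vec_nth[of 2]]
        df[unfolded has_field_derivative_def], of p] by simp
  from line_derivative[OF has_derivative_comp_foot[OF strip_periodic_intros[of "\<lambda>r n e k. f r"] this p(1)]
      open_nbhd, of v "axis i 1"]
  have "((\<lambda>t. v (Phi p + t *\<^sub>R axis i 1)) has_real_derivative f1 (p$2) * nrm (p$1) $ i) (at 0)"
    using x p(2) by (simp add: v_def inner_axis')
  then show ?thesis using p v1_Phi[OF p(1)] by simp
next
  case False
  then obtain c S where "open S" "x \<in> S" "\<And>y. y \<in> S \<Longrightarrow> v y = c"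
      using off_core_cases[OF False] by metis
  then have "((\<lambda>t. v (x + t *\<^sub>R axis i 1)) has_real_derivative 0) (at 0)"
    using line_derivative[of "\<lambda>_. c" "\<lambda>_. 0" x S v] by auto
  then show ?thesis using off_core(1)[OF False] by simp
qed

text \<open>The second derivative exists because \<open>v1\<close> is built from \<open>f1\<close>
  and the normal, both C^1 in tubular coordinates. The curvature term is the derivative of the
  normal, divided by the Jacobian factor through the inverse of \<open>Phi\<close>.\<close>

lemma deriv_v1: "((\<lambda>t. v1 i (x + t *\<^sub>R axis i 1)) has_real_derivative v2 i x) (at 0)"
proof (cases "x \<in> core")
  case True
  then have x: "x \<in> nbhd" using core_nbhd by blast
  then obtain p where p: "p \<in> strip" "x = Phi p" by (auto simp: nbhd_def)
  have d1: "((\<lambda>p::real^2. f1 (p$2)) has_derivative (\<lambda>h. f2 (p$2) * h$2)) (at p)"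
    using has_derivative_compose[OF bounded_linear_imp_has_derivative[OF bounded_linear_vec_nth[of 2]]
        df1[unfolded has_field_derivative_def], of p] by simp
  have d2: "((\<lambda>p::real^2. nrm (p$1) $ i) has_derivative (\<lambda>h. (h$1 *\<^sub>R (- curv (p$1) *\<^sub>R g1 (p$1))) $ i)) (at p)"
    by (rule bounded_linear.has_derivative[OF bounded_linear_vec_nth deriv_comp_fst[OF deriv_nrm]])
  have "((\<lambda>p::real^2. f1 (p$2) * nrm (p$1) $ i) has_derivative
      (\<lambda>h. f1 (p$2) * (h$1 *\<^sub>R (- curv (p$1) *\<^sub>R g1 (p$1))) $ i + f2 (p$2) * h$2 * nrm (p$1) $ i)) (at p)"
    by (rule has_derivative_mult[OF d1 d2])
  from line_derivative[OF has_derivative_comp_foot[OF strip_periodic_intros[of "\<lambda>r n e k. f1 r * n $ i"] this p(1)]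
      open_nbhd, of "v1 i" "axis i 1"]
  have "((\<lambda>t. v1 i (Phi p + t *\<^sub>R axis i 1)) has_real_derivative
      f2 (p$2) * (nrm (p$1) $ i)\<^sup>2 - f1 (p$2) * curv (p$1) * (g1 (p$1) $ i)\<^sup>2 / (1 - curv (p$1) * p$2)) (at 0)"
    using x p(2) by (simp add: v1_def inner_axis' power2_eq_square algebra_simps)
  then show ?thesis using p v2_Phi[OF p(1)] by simp
next
  case False
  have "((\<lambda>t. v1 i (x + t *\<^sub>R axis i 1)) has_real_derivative 0) (at 0)"
    using line_derivative[of "\<lambda>_. 0" "\<lambda>_. 0" x "- core" "v1 i"] closed_core False off_core(1) by auto
  then show ?thesis using off_core(2)[OF False] by simp
qed

lemma v_range: "v x \<in> range f"
  by (auto simp: v_def)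

end

section \<open>Integration in tubular coordinates\<close>

text \<open>Reduction to Fubini on \<open>real \<times> real\<close> through the volume preserving
  linear identification \<open>k\<close>.\<close>

lemma integral_cbox_vec2:
  fixes F :: "real^2 \<Rightarrow> real"
  assumes F: "continuous_on UNIV F"
  shows "integral (cbox (vector [a, c]) (vector [b, d])) F =
    integral {a..b} (\<lambda>s. integral {c..d} (\<lambda>r. F (vector [s, r])))"
proof -
  define h where "h p = (p$1, p$2)" for p :: "real^2"
  define k where "k z = (vector [fst z, snd z] :: real^2)" for z :: "real \<times> real"
  have hk: "h (k z) = z" and kh: "k (h p) = p" for z p
    by (auto simp: h_def k_def vec_eq_iff forall_2)
  have hbox: "h ` cbox u w = cbox (h u) (h w)" for u w
  proof
    show "h ` cbox u w \<subseteq> cbox (h u) (h w)" by (auto simp: h_def mem_box_cart)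
    show "cbox (h u) (h w) \<subseteq> h ` cbox u w"
    proof
      fix z assume "z \<in> cbox (h u) (h w)"
      then have "k z \<in> cbox u w" by (auto simp: h_def k_def mem_box_cart forall_2 cbox_Pair_eq)
      then show "z \<in> h ` cbox u w" by (intro image_eqI[of _ _ "k z"]) (simp_all add: hk)
    qed
  qed
  have kbox: "k ` cbox u w = cbox (k u) (k w)" for u w
  proof
    show "k ` cbox u w \<subseteq> cbox (k u) (k w)"
      by (cases u; cases w) (auto simp: k_def mem_box_cart forall_2 cbox_Pair_eq)
    show "cbox (k u) (k w) \<subseteq> k ` cbox u w"
    proof
      fix p assume "p \<in> cbox (k u) (k w)"
      then have "h p \<in> cbox u w"
        by (cases u; cases w) (auto simp: h_def k_def mem_box_cart forall_2 cbox_Pair_eq)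
      then show "p \<in> k ` cbox u w" by (intro image_eqI[of _ _ "h p"]) (simp_all add: kh)
    qed
  qed
  have contk: "continuous_on UNIV k"
    unfolding k_def
    by (rule linear_continuous_on, rule linear_conv_bounded_linear[THEN iffD1], rule linearI)
      (auto simp: vec_eq_iff forall_2)
  have ct: "measure lborel (k ` cbox u w) = 1 * measure lborel (cbox u w)" for u w
  proof (cases "cbox u w = {}")
    case False
    obtain u1 u2 w1 w2 where u: "u = (u1, u2)" "w = (w1, w2)" by (cases u; cases w)
    have ne: "cbox (k u) (k w) \<noteq> {}" using False unfolding kbox[symmetric] by simp
    have "u1 \<le> w1" "u2 \<le> w2" using False by (auto simp: u cbox_Pair_eq)
    then have "measure lborel (cbox u w) = (w1 - u1) * (w2 - u2)"
      by (simp add: u content_Pair)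
    moreover have "measure lborel (cbox (k u) (k w)) = (w1 - u1) * (w2 - u2)"
      using content_cbox_cart[OF ne] by (simp add: UNIV_2 k_def u)
    ultimately show ?thesis by (simp add: kbox)
  qed simp
  have "(F has_integral integral (cbox (k (a,c)) (k (b,d))) F) (cbox (k (a,c)) (k (b,d)))"
    by (intro integrable_integral integrable_continuous continuous_on_subset[OF F]) auto
  then have "((\<lambda>z. F (k z)) has_integral (1 / 1) *\<^sub>R integral (cbox (k (a,c)) (k (b,d))) F) (h ` cbox (k (a,c)) (k (b,d)))"
  proof (rule has_integral_twiddle[where g = k and h = h, OF zero_less_one hk kh _ _ _ ct, rotated 3])
    show "isCont k z" for z using contk continuous_on_eq_continuous_at[of UNIV k] by blast
    show "\<exists>w z. k ` cbox u v = cbox w z" for u v using kbox by blast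
    show "\<exists>w z. h ` cbox u v = cbox w z" for u v using hbox by blast
  qed
  then have "integral (cbox (a,c) (b,d)) (\<lambda>z. F (k z)) = integral (cbox (k (a,c)) (k (b,d))) F"
    by (simp add: hbox hk integral_unique)
  moreover have "integral (cbox (a,c) (b,d)) (\<lambda>z. F (k z)) =
      integral (cbox a b) (\<lambda>s. integral (cbox c d) (\<lambda>r. F (k (s, r))))"
    by (rule integral_prod_continuous) (auto intro!: continuous_on_compose2[OF F] continuous_on_subset[OF contk])
  ultimately show ?thesis by (simp add: k_def)
qed

text \<open>The integrand is regarded as a map into \<open>real^1\<close>, and the result is read
  off in its only component.\<close>

lemma integral_change_of_variables_vec2:
  fixes h :: "real^2 \<Rightarrow> real" and G :: "real^2 \<Rightarrow> real^2"
  assumes S: "S \<in> sets lebesgue" and d: "\<And>x. x \<in> S \<Longrightarrow> (G has_derivative G' x) (at x within S)"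
    and inj: "inj_on G S" and h: "h absolutely_integrable_on G ` S"
  shows "integral (G ` S) h = integral S (\<lambda>x. \<bar>det (matrix (G' x))\<bar> * h (G x))"
proof -
  define H where "H x = (vec (h x) :: real^1)" for x
  have H: "H absolutely_integrable_on G ` S"
  proof -
    have "bounded_linear (vec :: real \<Rightarrow> real^1)"
      by (rule linear_conv_bounded_linear[THEN iffD1], rule linearI) (simp_all add: vec_eq_iff)
    from absolutely_integrable_linear[OF h this] show ?thesis by (simp add: H_def[abs_def] o_def)
  qed
  have eq: "integral (G ` S) H = integral S (\<lambda>x. \<bar>det (matrix (G' x))\<bar> *\<^sub>R H (G x))"
    and H2: "(\<lambda>x. \<bar>det (matrix (G' x))\<bar> *\<^sub>R H (G x)) absolutely_integrable_on S"
    using has_absolute_integral_change_of_variables[OF S d inj, of H "integral (G ` S) H"] H by auto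
  have "integral (G ` S) h = integral (G ` S) (\<lambda>x. H x $ 1)" by (simp add: H_def)
  also have "\<dots> = integral (G ` S) H $ 1"
    using integral_linear[OF set_lebesgue_integral_eq_integral(1)[OF H] bounded_linear_vec_nth, of 1] by (simp add: o_def)
  also have "\<dots> = integral S (\<lambda>x. (\<bar>det (matrix (G' x))\<bar> *\<^sub>R H (G x)) $ 1)"
    unfolding eq
    using integral_linear[OF set_lebesgue_integral_eq_integral(1)[OF H2] bounded_linear_vec_nth, of 1] by (simp add: o_def)
  finally show ?thesis by (simp add: H_def)
qed

context tube
begin

lemma integral_nbhd:
  fixes h :: "real^2 \<Rightarrow> real"
  assumes h: "continuous_on UNIV h" and h0: "\<And>x. x \<notin> nbhd \<Longrightarrow> h x = 0"
  shows "(LINT x:ball 0 1|lborel. h x) =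
    integral {0..L} (\<lambda>s. integral {-\<delta>..\<delta>} (\<lambda>r. h (g s + r *\<^sub>R nrm s) * (1 - curv s * r)))"
proof -
  \<comment> \<open>One period, half open in the arc length, so that \<open>Phi\<close> maps
    \<open>S\<close> bijectively onto the tube.\<close>
  define S where "S = {p::real^2. 0 \<le> p$1 \<and> p$1 < L \<and> \<bar>p$2\<bar> < \<delta>}"
  have SS: "S = {p. 0 \<le> p$1} \<inter> ({p. p$1 < L} \<inter> strip)" by (auto simp: S_def strip_def)
  have "S \<in> sets borel" unfolding SS
    by (intro sets.Int borel_closed borel_open open_strip closed_Collect_le open_Collect_less continuous_intros)
  then have Sl: "S \<in> sets lebesgue" by (simp add: sets_completionI_sets)
  have Sstrip: "S \<subseteq> strip" by (auto simp: S_def strip_def)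
  have inj: "inj_on Phi S"
  proof (rule inj_onI)
    fix a b assume ab: "a \<in> S" "b \<in> S" "Phi a = Phi b"
    have "a$2 = b$2 \<and> (\<exists>k::int. b$1 = a$1 + of_int k * L)"
      by (rule tube_inj) (use ab in \<open>auto simp: S_def Phi_def\<close>)
    then obtain k :: int where k: "a$2 = b$2" "b$1 = a$1 + of_int k * L" by blast
    have "\<bar>of_int k * L\<bar> < L" using ab k by (auto simp: S_def)
    then have "\<bar>of_int k\<bar> * L < 1 * L" using L_pos by (simp add: abs_mult)
    then have "\<bar>of_int k\<bar> < (1::real)" using L_pos by (simp only: mult_less_cancel_right_pos)
    then have "k = 0" by simp
    with k show "a = b" by (intro vec2_eqI) auto
  qed
  have img: "Phi ` S = nbhd"
  proof
    show "Phi ` S \<subseteq> nbhd" using Sstrip by (auto simp: nbhd_def)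
    show "nbhd \<subseteq> Phi ` S"
    proof
      fix x assume "x \<in> nbhd"
      then obtain p where p: "p \<in> strip" "x = Phi p" by (auto simp: nbhd_def)
      obtain k where k: "0 \<le> p$1 + of_int k * L" "p$1 + of_int k * L < 0 + L" by (rule reduce_period)
      have "x = Phi (vector [p$1 + of_int k * L, p$2])" by (simp add: p(2) Phi_def periods)
      moreover have "vector [p$1 + of_int k * L, p$2] \<in> S" using p k by (auto simp: S_def strip_def)
      ultimately show "x \<in> Phi ` S" by blast
    qed
  qed
  have nb: "nbhd \<subseteq> ball 0 1" using tube_ball by (auto simp: nbhd_def Phi_def strip_def)
  have hb: "set_integrable lborel (cball 0 1) h"
    unfolding set_integrable_def
    by (rule borel_integrable_compact) (auto intro: continuous_on_subset[OF h])
  have hball: "set_integrable lborel (ball 0 1) h" by (rule set_integrable_subset[OF hb]) auto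
  have ha: "h absolutely_integrable_on ball 0 1"
    using hball by (simp add: set_integrable_def integrable_completion absolutely_integrable_on_def)
  have "h absolutely_integrable_on nbhd"
    by (rule set_integrable_subset[OF ha]) (use open_nbhd nb in \<open>auto intro: lmeasurable_open borel_open sets_completionI_sets\<close>)
  then have hn: "h absolutely_integrable_on Phi ` S" by (simp add: img)
  have "(LINT x:ball 0 1|lborel. h x) = integral (ball 0 1) h"
    by (rule set_borel_integral_eq_integral(2)[OF hball])
  also have "\<dots> = integral nbhd h"
  proof -
    have "(h has_integral integral nbhd h) nbhd"
      using hn unfolding img by (intro integrable_integral set_lebesgue_integral_eq_integral)
    then have "(h has_integral integral nbhd h) (ball 0 1)"
      by (rule has_integral_on_superset) (use h0 nb in auto)
    then show ?thesis by (rule integral_unique)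
  qed
  also have "\<dots> = integral S (\<lambda>p. \<bar>det (matrix (DPhi p))\<bar> * h (Phi p))"
    using integral_change_of_variables_vec2[OF Sl has_derivative_at_withinI[OF has_derivative_Phi] inj hn]
    by (simp add: img)
  also have "\<dots> = integral S (\<lambda>p. h (Phi p) * (1 - curv (p$1) * p$2))"
  proof (rule integral_cong)
    fix p assume "p \<in> S"
    then have "1 - curv (p$1) * p$2 \<ge> 1/2" by (intro jacobian_pos) (auto simp: S_def)
    then show "\<bar>det (matrix (DPhi p))\<bar> * h (Phi p) = h (Phi p) * (1 - curv (p$1) * p$2)"
      by (simp add: det_DPhi mult.commute)
  qed
  also have "\<dots> = integral (cbox (vector [0, -\<delta>]) (vector [L, \<delta>])) (\<lambda>p. h (Phi p) * (1 - curv (p$1) * p$2))"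
  \<comment> \<open>\<open>S\<close> and the closed box differ by parts of three lines, a null set;
    on the box the integral can be iterated.\<close>
  proof (rule integral_spike_set)
    let ?E = "{p::real^2. p$1 = L} \<union> ({p. p$2 = \<delta>} \<union> {p. p$2 = - \<delta>})"
    have "negligible {p::real^2. p$i = c}" for i c
      using negligible_standard_hyperplane[of "axis i 1 :: real^2" c] by (simp add: inner_axis axis_in_Basis_iff Basis_real_def)
    then have E: "negligible ?E" by (intro negligible_Un)
    show "negligible {p \<in> S - cbox (vector [0, -\<delta>]) (vector [L, \<delta>]). h (Phi p) * (1 - curv (p$1) * p$2) \<noteq> 0}"
      by (rule negligible_subset[OF E]) (auto simp: S_def mem_box_cart forall_2)
    show "negligible {p \<in> cbox (vector [0, -\<delta>]) (vector [L, \<delta>]) - S. h (Phi p) * (1 - curv (p$1) * p$2) \<noteq> 0}"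
      by (rule negligible_subset[OF E]) (auto simp: S_def mem_box_cart forall_2)
  qed
  also have "\<dots> = integral {0..L} (\<lambda>s. integral {-\<delta>..\<delta>} (\<lambda>r. h (Phi (vector [s, r])) * (1 - curv s * r)))"
  proof -
    have "continuous_on UNIV (\<lambda>p. h (Phi p) * (1 - curv (p$1) * p$2))"
      by (intro continuous_intros continuous_on_compose2[OF h cont_Phi] continuous_on_compose2[OF cont_curv[of UNIV]]) auto
    from integral_cbox_vec2[OF this] show ?thesis by simp
  qed
  finally show ?thesis by (simp add: Phi_def)
qed

end

lemma integral_odd_eq_0:
  fixes h :: "real \<Rightarrow> real"
  assumes "\<And>r. h (- r) = - h r" shows "integral {-\<delta>..\<delta>} h = 0"
proof -
  have "integral {-\<delta>..- (- \<delta>)} (\<lambda>r. h (- r)) = integral {-\<delta>..\<delta>} h"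
    by (rule Henstock_Kurzweil_Integration.integral_reflect_real)
  then show ?thesis by (simp add: assms)
qed

context tube
begin

text \<open>The two values \<open>r = \<plusminus>\<delta>\<close> form a null set, so the integrand
  has to be identified in the open tube only.\<close>

lemma integral_nbhd_eq:
  fixes h :: "real^2 \<Rightarrow> real"
  assumes h: "continuous_on UNIV h" "\<And>x. x \<notin> nbhd \<Longrightarrow> h x = 0"
    and H: "\<And>s r. \<bar>r\<bar> < \<delta> \<Longrightarrow> h (g s + r *\<^sub>R nrm s) * (1 - curv s * r) = H s r"
  shows "(LINT x:ball 0 1|lborel. h x) = integral {0..L} (\<lambda>s. integral {-\<delta>..\<delta>} (H s))"
proof -
  have "integral {-\<delta>..\<delta>} (\<lambda>r. h (g s + r *\<^sub>R nrm s) * (1 - curv s * r)) = integral {-\<delta>..\<delta>} (H s)" for s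
    by (rule integral_spike[of "{-\<delta>, \<delta>}"]) (auto intro!: H[symmetric])
  then show ?thesis by (simp add: integral_nbhd[OF h])
qed

lemma sum_sq_frame: "(nrm s $ 1)\<^sup>2 + (nrm s $ 2)\<^sup>2 = 1" "(g1 s $ 1)\<^sup>2 + (g1 s $ 2)\<^sup>2 = 1"
  using inner_nrm[of s] inner_g1[of s] by (simp_all add: inner_2 power2_eq_square)

end

section \<open>Energies of the phase field\<close>

context phase
begin

text \<open>\<open>dens\<close>, \<open>pot\<close> and \<open>slope\<close> are interface density,
  chemical potential and gradient norm of the C^2 field, with \<open>v1\<close>, \<open>v2\<close>
  in place of \<open>partial_deriv\<close>. They serve as limits of the corresponding quantities of
  the polynomials.\<close>

definition dens :: "real \<Rightarrow> real^2 \<Rightarrow> real"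
  where "dens \<epsilon> x = \<epsilon> / 2 * ((v1 1 x)\<^sup>2 + (v1 2 x)\<^sup>2) + 1 / \<epsilon> * W (v x)"

definition pot :: "real \<Rightarrow> real^2 \<Rightarrow> real"
  where "pot \<epsilon> x = - \<epsilon> * (v2 1 x + v2 2 x) + 1 / \<epsilon> * deriv W (v x)"

definition slope :: "real^2 \<Rightarrow> real" where "slope x = sqrt ((v1 1 x)\<^sup>2 + (v1 2 x)\<^sup>2)"

lemma continuous_dens: "continuous_on UNIV (dens \<epsilon>)"
  unfolding dens_def[abs_def]
  by (intro continuous_intros continuous_v1 continuous_on_compose2[OF continuous_on_W(1)[of UNIV] continuous_v]) auto

lemma continuous_pot: "continuous_on UNIV (pot \<epsilon>)"
  unfolding pot_def[abs_def]
  by (intro continuous_intros continuous_v2 continuous_on_compose2[OF continuous_on_W(2)[of UNIV] continuous_v]) auto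

lemma continuous_slope: "continuous_on UNIV slope"
  unfolding slope_def[abs_def] by (intro continuous_intros continuous_v1)

lemma dens_Phi: "p \<in> strip \<Longrightarrow> dens \<epsilon> (Phi p) = \<epsilon> / 2 * (f1 (p$2))\<^sup>2 + W (f (p$2)) / \<epsilon>"
proof -
  assume p: "p \<in> strip"
  have "(f1 (p$2) * nrm (p$1) $ 1)\<^sup>2 + (f1 (p$2) * nrm (p$1) $ 2)\<^sup>2 =
      (f1 (p$2))\<^sup>2 * ((nrm (p$1) $ 1)\<^sup>2 + (nrm (p$1) $ 2)\<^sup>2)"
    by (simp add: power_mult_distrib distrib_left)
  then show ?thesis unfolding dens_def v1_Phi[OF p] v_Phi[OF p] sum_sq_frame by simp
qed

lemma slope_Phi: "p \<in> strip \<Longrightarrow> slope (Phi p) = \<bar>f1 (p$2)\<bar>"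
proof -
  assume p: "p \<in> strip"
  have "(f1 (p$2) * nrm (p$1) $ 1)\<^sup>2 + (f1 (p$2) * nrm (p$1) $ 2)\<^sup>2 =
      (f1 (p$2))\<^sup>2 * ((nrm (p$1) $ 1)\<^sup>2 + (nrm (p$1) $ 2)\<^sup>2)"
    by (simp add: power_mult_distrib distrib_left)
  then show ?thesis unfolding slope_def v1_Phi[OF p] sum_sq_frame by simp
qed

text \<open>The Laplacian of \<open>f (d)\<close> is \<open>f'' + f' * \<Delta>d\<close>, and the
  signed distance has \<open>\<Delta>d = - \<kappa> / (1 - \<kappa> r)\<close>. Summing over
  \<open>i\<close> removes the components of the frame, whose vectors have norm one.\<close>

lemma pot_Phi: "p \<in> strip \<Longrightarrow> pot \<epsilon> (Phi p) = (- \<epsilon> * f2 (p$2) + deriv W (f (p$2)) / \<epsilon>) +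
   \<epsilon> * f1 (p$2) * curv (p$1) / (1 - curv (p$1) * p$2)"
proof -
  assume p: "p \<in> strip"
  define a c J where "a = f2 (p$2)" and "c = f1 (p$2) * curv (p$1)" and "J = 1 - curv (p$1) * p$2"
  have "v2 1 (Phi p) + v2 2 (Phi p) = a * ((nrm (p$1) $ 1)\<^sup>2 + (nrm (p$1) $ 2)\<^sup>2)
      - c * ((g1 (p$1) $ 1)\<^sup>2 + (g1 (p$1) $ 2)\<^sup>2) / J"
    unfolding v2_Phi[OF p] a_def c_def J_def by (simp add: algebra_simps add_divide_distrib)
  then have eq: "v2 1 (Phi p) + v2 2 (Phi p) = a - c / J" unfolding sum_sq_frame by simp
  show ?thesis unfolding pot_def v_Phi[OF p] eq by (simp add: a_def c_def J_def algebra_simps)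
qed

end

text \<open>\<open>X\<close> bounds all exponentially small defects of the cut-off profile at once.\<close>

locale optimal = phase +
  fixes \<epsilon> X :: real
  assumes \<epsilon>: "\<epsilon> > 0" and X: "X \<ge> 0"
    and odd: "\<And>r. f (- r) = - f r" "\<And>r. f1 (- r) = f1 r" "\<And>r. f2 (- r) = - f2 r"
    and f_le: "\<And>r. \<bar>f r\<bar> \<le> 1" and f_\<delta>: "\<bar>f \<delta>\<bar> = 1"
    and mono: "(\<forall>r. f1 r \<ge> 0) \<or> (\<forall>r. f1 r \<le> 0)"
    and A_le: "\<And>r. \<bar>- \<epsilon> * f2 r + deriv W (f r) / \<epsilon>\<bar> \<le> X"
    and E_le: "\<And>r. \<bar>(\<epsilon> / 2 * (f1 r)\<^sup>2 + W (f r) / \<epsilon>) - \<epsilon> * (f1 r)\<^sup>2\<bar> \<le> X"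
    and E_int: "\<bar>integral {-\<delta>..\<delta>} (\<lambda>r. \<epsilon> / 2 * (f1 r)\<^sup>2 + W (f r) / \<epsilon>) - c0\<bar> \<le> X"
    and f1_int: "\<bar>integral {-\<delta>..\<delta>} (\<lambda>r. \<epsilon> * (f1 r)\<^sup>2) - c0\<bar> \<le> X"
    and f1_mom: "integral {-\<delta>..\<delta>} (\<lambda>r. \<epsilon> * (f1 r)\<^sup>2 * r\<^sup>2) \<le> 16 * \<epsilon>\<^sup>2 + X"
begin

definition A :: "real \<Rightarrow> real" where "A r = - \<epsilon> * f2 r + deriv W (f r) / \<epsilon>"
definition E :: "real \<Rightarrow> real" where "E r = \<epsilon> / 2 * (f1 r)\<^sup>2 + W (f r) / \<epsilon>"

lemma K_nonneg: "K \<ge> 0" using curv_le[of 0] by linarith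

lemma c_f: "continuous_on S f" "continuous_on S f1" "continuous_on S f2"
  using cont_f by (auto intro: continuous_at_imp_continuous_on)

lemma c_A: "continuous_on S A" and c_E: "continuous_on S E"
  unfolding A_def[abs_def] E_def[abs_def]
  using \<epsilon> by (auto intro!: continuous_intros c_f continuous_on_compose2[OF continuous_on_W(1)[of UNIV]]
      continuous_on_compose2[OF continuous_on_W(2)[of UNIV]])

lemma A_odd: "A (- r) = - A r" and E_even: "E (- r) = E r"
  by (simp_all add: A_def E_def odd deriv_W W_def diff_divide_distrib)

lemma E_nonneg: "E r \<ge> 0" using \<epsilon> by (simp add: E_def W_def)

text \<open>Away from the tube \<open>v\<close> is \<open>1\<close> or \<open>-1\<close>, where both
  \<open>W\<close> and its derivative vanish.\<close>

lemma off_nbhd: "x \<notin> nbhd \<Longrightarrow> dens \<epsilon> x = 0" "x \<notin> nbhd \<Longrightarrow> pot \<epsilon> x = 0"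
proof -
  assume x: "x \<notin> nbhd"
  have "\<bar>f (- \<delta>)\<bar> = 1" using f_\<delta> odd(1)[of \<delta>] by simp
  then have "\<bar>v x\<bar> = 1" using x f_\<delta> by (auto simp: v_def)
  then have "(v x)\<^sup>2 = 1" "v x ^ 3 = v x"
    by (auto simp: abs_if power2_eq_square power3_eq_cube split: if_splits)
  then show "dens \<epsilon> x = 0" "pot \<epsilon> x = 0"
    using x by (auto simp: dens_def pot_def v1_def v2_def W_def deriv_W)
qed

lemma strip_vec: "\<bar>r\<bar> < \<delta> \<Longrightarrow> vector [s, r] \<in> strip" by (simp add: strip_def)

lemma at_tube:
  assumes "\<bar>r\<bar> < \<delta>"
  shows "dens \<epsilon> (g s + r *\<^sub>R nrm s) = E r" "slope (g s + r *\<^sub>R nrm s) = \<bar>f1 r\<bar>"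
    "pot \<epsilon> (g s + r *\<^sub>R nrm s) = A r + \<epsilon> * f1 r * curv s / (1 - curv s * r)"
  using dens_Phi[OF strip_vec[OF assms], of \<epsilon> s] slope_Phi[OF strip_vec[OF assms], of s]
    pot_Phi[OF strip_vec[OF assms], of \<epsilon> s]
  by (simp_all add: Phi_vector A_def E_def)

lemma int_cont: "continuous_on {-\<delta>..\<delta>} h \<Longrightarrow> h integrable_on {-\<delta>..\<delta>}" for h :: "real \<Rightarrow> real"
  by (rule integrable_continuous_real)

text \<open>\<open>E\<close> is even, so the part of the Jacobian linear in \<open>r\<close> drops
  out; this makes the length independent of the curvature.\<close>

lemma int_EJ: "integral {-\<delta>..\<delta>} (\<lambda>r. E r * (1 - k * r)) = integral {-\<delta>..\<delta>} E"
proof -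
  have "integral {-\<delta>..\<delta>} (\<lambda>r. E r - k * (r * E r)) =
      integral {-\<delta>..\<delta>} E - integral {-\<delta>..\<delta>} (\<lambda>r. k * (r * E r))"
    by (intro integral_diff int_cont continuous_intros c_E)
  moreover have "integral {-\<delta>..\<delta>} (\<lambda>r. k * (r * E r)) = 0"
    by (rule integral_odd_eq_0) (simp add: E_even)
  ultimately show ?thesis by (simp add: algebra_simps)
qed

lemma length_integral: "(LINT x:ball 0 1|lborel. dens \<epsilon> x) = L * integral {-\<delta>..\<delta>} E"
proof -
  have "(LINT x:ball 0 1|lborel. dens \<epsilon> x) = integral {0..L} (\<lambda>s. integral {-\<delta>..\<delta>} (\<lambda>r. E r * (1 - curv s * r)))"
    by (rule integral_nbhd_eq[OF continuous_dens off_nbhd(1)]) (simp_all add: at_tube)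
  then show ?thesis using L_pos by (simp add: int_EJ)
qed

lemma length_estimate: "\<bar>1 / c0 * (LINT x:ball 0 1|lborel. dens \<epsilon> x) - L\<bar> \<le> L / c0 * X"
proof -
  have "1 / c0 * (LINT x:ball 0 1|lborel. dens \<epsilon> x) - L = L / c0 * (integral {-\<delta>..\<delta>} E - c0)"
    unfolding length_integral using c0_pos by (simp add: field_simps)
  also have "\<bar>\<dots>\<bar> = L / c0 * \<bar>integral {-\<delta>..\<delta>} E - c0\<bar>" using L_pos c0_pos by (simp add: abs_mult)
  also have "\<dots> \<le> L / c0 * X" using E_int L_pos c0_pos unfolding E_def[abs_def] by (intro mult_left_mono) auto
  finally show ?thesis .
qed

section \<open>Turning\<close>

lemma int_abs_f1: "integral {-\<delta>..\<delta>} (\<lambda>r. \<bar>f1 r\<bar>) = 2"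
proof -
  have i: "(f1 has_integral (f \<delta> - f (- \<delta>))) {-\<delta>..\<delta>}"
    by (rule fundamental_theorem_of_calculus)
      (use \<delta>_pos df in \<open>auto simp: has_real_derivative_iff_has_vector_derivative[symmetric] intro: has_field_derivative_at_within\<close>)
  \<comment> \<open>By monotonicity \<open>\<bar>f1\<bar>\<close> is \<open>f1\<close> up to one
    fixed sign, so its integral is the size of the jump between \<open>-1\<close> and
    \<open>1\<close>.\<close>
  obtain c where c: "c = 1 \<or> c = -1" "\<And>r. \<bar>f1 r\<bar> = c * f1 r"
    using mono by (metis abs_of_nonneg abs_of_nonpos mult_1 mult_minus1)
  have "((\<lambda>r. \<bar>f1 r\<bar>) has_integral c * (f \<delta> - f (- \<delta>))) {-\<delta>..\<delta>}"
    unfolding c(2) by (rule has_integral_mult_right[OF i])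
  then have I: "integral {-\<delta>..\<delta>} (\<lambda>r. \<bar>f1 r\<bar>) = c * (2 * f \<delta>)" by (simp add: integral_unique odd)
  have "0 \<le> integral {-\<delta>..\<delta>} (\<lambda>r. \<bar>f1 r\<bar>)" by (rule integral_nonneg) (auto intro!: int_cont continuous_intros c_f)
  moreover have "\<bar>integral {-\<delta>..\<delta>} (\<lambda>r. \<bar>f1 r\<bar>)\<bar> = 2" using c(1) f_\<delta> by (auto simp: I abs_mult)
  ultimately show ?thesis by simp
qed

lemma int_Af1: "\<bar>integral {-\<delta>..\<delta>} (\<lambda>r. r * (A r * \<bar>f1 r\<bar>))\<bar> \<le> 2 * \<delta> * X"
proof -
  have "norm (integral {-\<delta>..\<delta>} (\<lambda>r. r * (A r * \<bar>f1 r\<bar>))) \<le> integral {-\<delta>..\<delta>} (\<lambda>r. \<delta> * (X * \<bar>f1 r\<bar>))"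
  proof (rule integral_norm_bound_integral)
    fix r assume r: "r \<in> {-\<delta>..\<delta>}"
    show "norm (r * (A r * \<bar>f1 r\<bar>)) \<le> \<delta> * (X * \<bar>f1 r\<bar>)"
      unfolding real_norm_def abs_mult abs_abs
      using r A_le[of r] X \<delta>_pos by (intro mult_mono) (auto simp: A_def)
  qed (auto intro!: int_cont continuous_intros c_f c_A)
  then show ?thesis by (simp add: int_abs_f1 mult.commute mult.left_commute)
qed

text \<open>The Jacobian cancels the denominator of the curvature term, which leaves an integrand
  affine in the curvature; its constant part is odd in \<open>r\<close>. Hence the integral is
  exactly a multiple of the total curvature, without any remainder in powers of
  \<open>\<epsilon>\<close>.\<close>

lemma turning_integral:
  "(LINT x:ball 0 1|lborel. pot \<epsilon> x * slope x) =
    (integral {-\<delta>..\<delta>} (\<lambda>r. \<epsilon> * (f1 r * \<bar>f1 r\<bar>)) - integral {-\<delta>..\<delta>} (\<lambda>r. r * (A r * \<bar>f1 r\<bar>))) * integral {0..L} curv"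
proof -
  define H where "H s r = (A r * \<bar>f1 r\<bar> - curv s * (r * (A r * \<bar>f1 r\<bar>))) + curv s * (\<epsilon> * (f1 r * \<bar>f1 r\<bar>))" for s r
  define S Z where "S = integral {-\<delta>..\<delta>} (\<lambda>r. \<epsilon> * (f1 r * \<bar>f1 r\<bar>))"
    and "Z = integral {-\<delta>..\<delta>} (\<lambda>r. r * (A r * \<bar>f1 r\<bar>))"
  have inner: "integral {-\<delta>..\<delta>} (H s) = (S - Z) * curv s" for s
  proof -
    have "integral {-\<delta>..\<delta>} (H s) = (integral {-\<delta>..\<delta>} (\<lambda>r. A r * \<bar>f1 r\<bar>)
        - integral {-\<delta>..\<delta>} (\<lambda>r. curv s * (r * (A r * \<bar>f1 r\<bar>)))) + integral {-\<delta>..\<delta>} (\<lambda>r. curv s * (\<epsilon> * (f1 r * \<bar>f1 r\<bar>)))"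
      unfolding H_def
      by (subst integral_add, (intro int_cont continuous_intros c_f c_A)+,
          subst integral_diff, (intro int_cont continuous_intros c_f c_A)+, simp)
    moreover have "integral {-\<delta>..\<delta>} (\<lambda>r. A r * \<bar>f1 r\<bar>) = 0"
      by (rule integral_odd_eq_0) (simp add: A_odd odd)
    moreover have "integral {-\<delta>..\<delta>} (\<lambda>r. curv s * (r * (A r * \<bar>f1 r\<bar>))) = curv s * Z"
      by (simp only: Z_def integral_mult_right)
    moreover have "integral {-\<delta>..\<delta>} (\<lambda>r. curv s * (\<epsilon> * (f1 r * \<bar>f1 r\<bar>))) = curv s * S"
      by (simp only: S_def integral_mult_right)
    ultimately show ?thesis by (simp add: algebra_simps)
  qed
  have "(LINT x:ball 0 1|lborel. pot \<epsilon> x * slope x) = integral {0..L} (\<lambda>s. integral {-\<delta>..\<delta>} (H s))"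
  proof (rule integral_nbhd_eq)
    show "continuous_on UNIV (\<lambda>x. pot \<epsilon> x * slope x)"
      by (intro continuous_intros continuous_pot continuous_slope)
    show "x \<notin> nbhd \<Longrightarrow> pot \<epsilon> x * slope x = 0" for x by (simp add: off_nbhd)
    fix s r assume r: "\<bar>r\<bar> < \<delta>"
    have J: "1 - curv s * r \<noteq> 0" using jacobian_pos[of r s] r by auto
    have "(A r + \<epsilon> * f1 r * curv s / (1 - curv s * r)) * (1 - curv s * r) = A r * (1 - curv s * r) + \<epsilon> * f1 r * curv s"
      using J by (simp add: distrib_right)
    then have "(A r + \<epsilon> * f1 r * curv s / (1 - curv s * r)) * \<bar>f1 r\<bar> * (1 - curv s * r) =
        (A r * (1 - curv s * r) + \<epsilon> * f1 r * curv s) * \<bar>f1 r\<bar>"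
      by (metis mult.assoc mult.commute)
    then show "pot \<epsilon> (g s + r *\<^sub>R nrm s) * slope (g s + r *\<^sub>R nrm s) * (1 - curv s * r) = H s r"
      unfolding at_tube[OF r] by (simp add: H_def algebra_simps)
  qed
  also have "\<dots> = integral {0..L} (\<lambda>s. (S - Z) * curv s)" by (simp only: inner)
  also have "\<dots> = (S - Z) * integral {0..L} curv"
    by (rule integral_mult_right)
  finally show ?thesis by (simp add: S_def Z_def)
qed

text \<open>If \<open>\<sigma>\<close> is the sign of both the total curvature and the slope, then
  \<open>f1 * \<bar>f1\<bar> = \<sigma> * f1^2\<close>, and \<open>\<sigma> * \<sigma> = 1\<close>
  produces \<open>+ 2 * pi\<close> for either orientation of the curve.\<close>

lemma turning_estimate:
  assumes \<sigma>: "\<sigma> = 1 \<or> \<sigma> = (-1::real)" and tot: "integral {0..L} curv = 2 * pi * \<sigma>" and s: "\<And>r. \<sigma> * f1 r \<ge> 0"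
  shows "\<bar>1 / c0 * (LINT x:ball 0 1|lborel. pot \<epsilon> x * slope x) - 2 * pi\<bar> \<le> 2 * pi / c0 * ((1 + 2 * \<delta>) * X)"
proof -
  define I Z where "I = integral {-\<delta>..\<delta>} (\<lambda>r. \<epsilon> * (f1 r)\<^sup>2)"
    and "Z = integral {-\<delta>..\<delta>} (\<lambda>r. r * (A r * \<bar>f1 r\<bar>))"
  have "\<epsilon> * (f1 r * \<bar>f1 r\<bar>) = \<sigma> * (\<epsilon> * (f1 r)\<^sup>2)" for r
    using s[of r] \<sigma> by (auto simp: power2_eq_square)
  then have S: "integral {-\<delta>..\<delta>} (\<lambda>r. \<epsilon> * (f1 r * \<bar>f1 r\<bar>)) = \<sigma> * I"
    by (simp only: I_def integral_mult_right)
  have ss: "\<sigma> * \<sigma> = 1" using \<sigma> by auto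
  have "1 / c0 * (LINT x:ball 0 1|lborel. pot \<epsilon> x * slope x) - 2 * pi = 1 / c0 * ((\<sigma> * I - Z) * (2 * pi * \<sigma>)) - 2 * pi"
    unfolding turning_integral S tot Z_def ..
  also have "(\<sigma> * I - Z) * (2 * pi * \<sigma>) = 2 * pi * (\<sigma> * \<sigma> * I - \<sigma> * Z)" by (simp add: algebra_simps)
  also have "1 / c0 * (2 * pi * (\<sigma> * \<sigma> * I - \<sigma> * Z)) - 2 * pi = 2 * pi / c0 * ((I - c0) - \<sigma> * Z)"
    unfolding ss using c0_pos by (simp add: field_simps)
  also have "\<bar>\<dots>\<bar> = 2 * pi / c0 * \<bar>(I - c0) - \<sigma> * Z\<bar>" using c0_pos by (simp add: abs_mult)
  also have "\<dots> \<le> 2 * pi / c0 * ((1 + 2 * \<delta>) * X)"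
  proof (rule mult_left_mono)
    have "\<bar>\<sigma> * Z\<bar> = \<bar>Z\<bar>" using \<sigma> by auto
    then show "\<bar>(I - c0) - \<sigma> * Z\<bar> \<le> (1 + 2 * \<delta>) * X"
      using f1_int int_Af1 unfolding I_def[symmetric] Z_def[symmetric] by (simp add: distrib_right)
  qed (use c0_pos in simp)
  finally show ?thesis .
qed

section \<open>Bending\<close>

definition bend :: "real \<Rightarrow> real \<Rightarrow> real"
  where "bend s r = 1 / \<epsilon> * (A r + \<epsilon> * f1 r * curv s / (1 - curv s * r))\<^sup>2 * (1 - curv s * r)"

lemma bending_integral:
  "(LINT x:ball 0 1|lborel. 1 / \<epsilon> * (pot \<epsilon> x)\<^sup>2) = integral {0..L} (\<lambda>s. integral {-\<delta>..\<delta>} (bend s))"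
proof (rule integral_nbhd_eq)
  show "continuous_on UNIV (\<lambda>x. 1 / \<epsilon> * (pot \<epsilon> x)\<^sup>2)" by (intro continuous_intros continuous_pot)
qed (simp_all add: off_nbhd at_tube bend_def)

lemma bend_cont: "continuous_on (UNIV \<times> {-\<delta>..\<delta>}) (\<lambda>z. bend (fst z) (snd z))"
proof -
  have J: "1 - curv (fst z) * snd z \<noteq> 0" if "z \<in> UNIV \<times> {-\<delta>..\<delta>}" for z
  proof -
    have "\<bar>snd z\<bar> \<le> \<delta>" using that by (cases z) (auto simp: abs_le_iff)
    then show ?thesis using jacobian_pos[of "snd z" "fst z"] by auto
  qed
  show ?thesis
    unfolding bend_def
    using J by (intro continuous_intros continuous_on_compose2[OF c_A[of UNIV]] continuous_on_compose2[OF c_f(2)[of UNIV]]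
      continuous_on_compose2[OF cont_curv[of UNIV]]) auto
qed

text \<open>Expanding \<open>1/(1 - \<kappa> r) = 1 + \<kappa> r + \<kappa>\<^sup>2 r\<^sup>2 / (1 - \<kappa> r)\<close>: the linear term drops out by
  parity, so the error is of second order in \<open>\<epsilon>\<close>.\<close>

lemma bend_estimate:
  "\<bar>integral {-\<delta>..\<delta>} (bend s) - (curv s)\<^sup>2 * c0\<bar> \<le>
    3 * \<delta> * (X * X / \<epsilon>) + 4 * K * X + 2 * K ^ 4 * (16 * \<epsilon>\<^sup>2 + X) + K\<^sup>2 * X"
proof -
  define k where "k = curv s"
  define J where "J r = 1 - k * r" for r
  have k: "\<bar>k\<bar> \<le> K" unfolding k_def by (rule curv_le)
  have J: "J r \<ge> 1/2" "J r \<le> 3/2" if "r \<in> {-\<delta>..\<delta>}" for r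
  proof -
    have "\<bar>r\<bar> \<le> \<delta>" using that by auto
    then show "J r \<ge> 1/2" "J r \<le> 3/2" using curv_small[of r s] by (auto simp: J_def k_def)
  qed
  have k2: "k\<^sup>2 \<le> K\<^sup>2" using k K_nonneg by (simp add: abs_le_square_iff[symmetric])
  have k4: "k ^ 4 \<le> K ^ 4"
  proof -
    have "(k\<^sup>2)\<^sup>2 \<le> (K\<^sup>2)\<^sup>2" by (rule power_mono[OF k2]) simp
    moreover have "x ^ 4 = (x\<^sup>2)\<^sup>2" for x :: real by (simp flip: power_mult)
    ultimately show ?thesis by (simp only:)
  qed
  \<comment> \<open>What remains of the bending density after removal of the leading term and of the
    term odd in \<open>r\<close>.\<close>
  define G where "G r = bend s r - (k\<^sup>2 * (\<epsilon> * (f1 r)\<^sup>2) + k ^ 3 * (r * (\<epsilon> * (f1 r)\<^sup>2)))" for r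
  have bc: "continuous_on {-\<delta>..\<delta>} (bend s)"
    using continuous_on_compose2[OF bend_cont, of "{-\<delta>..\<delta>}" "\<lambda>r. (s, r)",
        OF continuous_on_Pair[OF continuous_on_const continuous_on_id]] by auto
  have Gc: "continuous_on {-\<delta>..\<delta>} G" unfolding G_def by (intro continuous_intros bc c_f)
  have Gle: "\<bar>G r\<bar> \<le> (3 / 2 * (X * X / \<epsilon>) + 2 * K * X * \<bar>f1 r\<bar>) + 2 * K ^ 4 * (\<epsilon> * (f1 r)\<^sup>2 * r\<^sup>2)"
    if r: "r \<in> {-\<delta>..\<delta>}" for r
  proof -
    have J0: "J r \<noteq> 0" using J[OF r] by auto
    have "bend s r = (A r)\<^sup>2 * J r / \<epsilon> + 2 * k * A r * f1 r + \<epsilon> * (f1 r)\<^sup>2 * (k\<^sup>2 * (1 / J r))"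
      unfolding bend_def k_def[symmetric] J_def[symmetric] using J0 \<epsilon>
      by (simp add: power2_eq_square field_simps)
    also have "1 / J r = 1 + k * r + k\<^sup>2 * r\<^sup>2 / J r"
      using J0 by (simp add: field_simps, simp add: J_def power2_eq_square algebra_simps)
    finally have "G r = (A r)\<^sup>2 * J r / \<epsilon> + 2 * k * A r * f1 r + k ^ 4 * (\<epsilon> * (f1 r)\<^sup>2 * r\<^sup>2) * (1 / J r)"
      unfolding G_def by (simp add: algebra_simps power2_eq_square power3_eq_cube power4_eq_xxxx add_divide_distrib)
    moreover have "\<bar>(A r)\<^sup>2 * J r / \<epsilon>\<bar> \<le> X\<^sup>2 * (3 / 2) / \<epsilon>"
    proof -
      have "(A r)\<^sup>2 \<le> X\<^sup>2" using A_le[of r] X by (simp add: abs_le_square_iff[symmetric] A_def)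
      then have "(A r)\<^sup>2 * J r \<le> X\<^sup>2 * (3 / 2)" using J[OF r] by (intro mult_mono) auto
      then have "(A r)\<^sup>2 * J r / \<epsilon> \<le> X\<^sup>2 * (3 / 2) / \<epsilon>" using \<epsilon> by (intro divide_right_mono) auto
      moreover have "(A r)\<^sup>2 * J r / \<epsilon> \<ge> 0" using J[OF r] \<epsilon> by simp
      ultimately show ?thesis by simp
    qed
    moreover have "\<bar>2 * k * A r * f1 r\<bar> \<le> 2 * K * X * \<bar>f1 r\<bar>"
      unfolding abs_mult using k A_le[of r] K_nonneg by (intro mult_mono) (auto simp: A_def)
    moreover have "\<bar>k ^ 4 * (\<epsilon> * (f1 r)\<^sup>2 * r\<^sup>2) * (1 / J r)\<bar> \<le> K ^ 4 * (\<epsilon> * (f1 r)\<^sup>2 * r\<^sup>2) * 2"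
    proof -
      have "1 / J r \<le> 2" "1 / J r \<ge> 0" using J[OF r] by (auto simp: field_simps)
      then have "k ^ 4 * (\<epsilon> * (f1 r)\<^sup>2 * r\<^sup>2) * (1 / J r) \<le> K ^ 4 * (\<epsilon> * (f1 r)\<^sup>2 * r\<^sup>2) * 2"
        using k4 \<epsilon> K_nonneg by (intro mult_mono) auto
      moreover have "0 \<le> k ^ 4 * (\<epsilon> * (f1 r)\<^sup>2 * r\<^sup>2) * (1 / J r)"
        using \<epsilon> \<open>1 / J r \<ge> 0\<close> by simp
      ultimately show ?thesis by linarith
    qed
    moreover have "x = a + b + c \<Longrightarrow> \<bar>a\<bar> \<le> p \<Longrightarrow> \<bar>b\<bar> \<le> q \<Longrightarrow> \<bar>c\<bar> \<le> t \<Longrightarrow> \<bar>x\<bar> \<le> p + q + t"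
      for x a b c p q t :: real by linarith
    ultimately have "\<bar>G r\<bar> \<le> X\<^sup>2 * (3 / 2) / \<epsilon> + 2 * K * X * \<bar>f1 r\<bar> + K ^ 4 * (\<epsilon> * (f1 r)\<^sup>2 * r\<^sup>2) * 2"
      by blast
    then show ?thesis by (simp add: power2_eq_square mult_ac)
  qed
  have "norm (integral {-\<delta>..\<delta>} G) \<le> integral {-\<delta>..\<delta>}
      (\<lambda>r. (3 / 2 * (X * X / \<epsilon>) + 2 * K * X * \<bar>f1 r\<bar>) + 2 * K ^ 4 * (\<epsilon> * (f1 r)\<^sup>2 * r\<^sup>2))"
    using Gle by (intro integral_norm_bound_integral int_cont continuous_intros Gc c_f) auto
  also have "\<dots> = integral {-\<delta>..\<delta>} (\<lambda>r. 3 / 2 * (X * X / \<epsilon>)) + integral {-\<delta>..\<delta>} (\<lambda>r. 2 * K * X * \<bar>f1 r\<bar>)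
      + integral {-\<delta>..\<delta>} (\<lambda>r. 2 * K ^ 4 * (\<epsilon> * (f1 r)\<^sup>2 * r\<^sup>2))"
    by (subst integral_add, (intro int_cont continuous_intros c_f)+,
        subst integral_add, (intro int_cont continuous_intros c_f)+, simp)
  \<comment> \<open>The cross term is bounded through the integral of \<open>\<bar>f1\<bar>\<close>,
    which is \<open>2\<close> for every \<open>\<epsilon>\<close>; the second moment is the only
    contribution that is not exponentially small.\<close>
  also have "\<dots> = 3 * \<delta> * (X * X / \<epsilon>) + 4 * K * X + 2 * K ^ 4 * integral {-\<delta>..\<delta>} (\<lambda>r. \<epsilon> * (f1 r)\<^sup>2 * r\<^sup>2)"
    unfolding integral_mult_right int_abs_f1 using \<delta>_pos by simp
  also have "\<dots> \<le> 3 * \<delta> * (X * X / \<epsilon>) + 4 * K * X + 2 * K ^ 4 * (16 * \<epsilon>\<^sup>2 + X)"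
    using f1_mom K_nonneg by (intro add_left_mono mult_left_mono) auto
  finally have Gi: "\<bar>integral {-\<delta>..\<delta>} G\<bar> \<le> 3 * \<delta> * (X * X / \<epsilon>) + 4 * K * X + 2 * K ^ 4 * (16 * \<epsilon>\<^sup>2 + X)"
    by simp
  have "integral {-\<delta>..\<delta>} (bend s) = integral {-\<delta>..\<delta>} (\<lambda>r. G r + (k\<^sup>2 * (\<epsilon> * (f1 r)\<^sup>2) + k ^ 3 * (r * (\<epsilon> * (f1 r)\<^sup>2))))"
    by (simp add: G_def)
  also have "\<dots> = integral {-\<delta>..\<delta>} G + (integral {-\<delta>..\<delta>} (\<lambda>r. k\<^sup>2 * (\<epsilon> * (f1 r)\<^sup>2))
      + integral {-\<delta>..\<delta>} (\<lambda>r. k ^ 3 * (r * (\<epsilon> * (f1 r)\<^sup>2))))"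
    by (subst integral_add, (intro int_cont continuous_intros c_f Gc)+,
        subst integral_add, (intro int_cont continuous_intros c_f)+, simp)
  also have "integral {-\<delta>..\<delta>} (\<lambda>r. k ^ 3 * (r * (\<epsilon> * (f1 r)\<^sup>2))) = 0"
    by (rule integral_odd_eq_0) (simp add: odd)
  also have "integral {-\<delta>..\<delta>} (\<lambda>r. k\<^sup>2 * (\<epsilon> * (f1 r)\<^sup>2)) = k\<^sup>2 * integral {-\<delta>..\<delta>} (\<lambda>r. \<epsilon> * (f1 r)\<^sup>2)"
    by (rule integral_mult_right)
  finally have eq: "integral {-\<delta>..\<delta>} (bend s) - k\<^sup>2 * c0 =
      integral {-\<delta>..\<delta>} G + k\<^sup>2 * (integral {-\<delta>..\<delta>} (\<lambda>r. \<epsilon> * (f1 r)\<^sup>2) - c0)"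
    by (simp add: algebra_simps)
  have "\<bar>k\<^sup>2 * (integral {-\<delta>..\<delta>} (\<lambda>r. \<epsilon> * (f1 r)\<^sup>2) - c0)\<bar> \<le> K\<^sup>2 * X"
    unfolding abs_mult using k2 f1_int by (intro mult_mono) auto
  then show ?thesis using Gi eq unfolding k_def by linarith
qed

lemma bending_estimate:
  "\<bar>1 / c0 * (LINT x:ball 0 1|lborel. 1 / \<epsilon> * (pot \<epsilon> x)\<^sup>2) - integral {0..L} (\<lambda>s. (curv s)\<^sup>2)\<bar> \<le>
    L / c0 * (3 * \<delta> * (X * X / \<epsilon>) + 4 * K * X + 2 * K ^ 4 * (16 * \<epsilon>\<^sup>2 + X) + K\<^sup>2 * X)"
proof -
  define R where "R = 3 * \<delta> * (X * X / \<epsilon>) + 4 * K * X + 2 * K ^ 4 * (16 * \<epsilon>\<^sup>2 + X) + K\<^sup>2 * X"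
  have "continuous_on UNIV (\<lambda>s. integral (cbox (-\<delta>) \<delta>) (bend s))"
    by (rule integral_continuous_on_param) (use bend_cont in \<open>simp add: case_prod_unfold\<close>)
  then have bc: "continuous_on {0..L} (\<lambda>s. integral {-\<delta>..\<delta>} (bend s))"
    by (auto intro: continuous_on_subset)
  have "(LINT x:ball 0 1|lborel. 1 / \<epsilon> * (pot \<epsilon> x)\<^sup>2) - c0 * integral {0..L} (\<lambda>s. (curv s)\<^sup>2) =
      integral {0..L} (\<lambda>s. integral {-\<delta>..\<delta>} (bend s) - (curv s)\<^sup>2 * c0)"
    unfolding bending_integral
    by (subst integral_diff) (auto intro!: integrable_continuous_real bc continuous_intros cont_curv simp: mult.commute)
  also have "norm \<dots> \<le> R * (L - 0)"
    using L_pos bend_estimate unfolding R_def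
    by (intro integral_bound continuous_intros bc cont_curv) auto
  finally have "\<bar>(LINT x:ball 0 1|lborel. 1 / \<epsilon> * (pot \<epsilon> x)\<^sup>2) - c0 * integral {0..L} (\<lambda>s. (curv s)\<^sup>2)\<bar> / c0 \<le> R * L / c0"
    using c0_pos by (intro divide_right_mono) auto
  moreover have "\<bar>1 / c0 * (LINT x:ball 0 1|lborel. 1 / \<epsilon> * (pot \<epsilon> x)\<^sup>2) - integral {0..L} (\<lambda>s. (curv s)\<^sup>2)\<bar> =
      \<bar>(LINT x:ball 0 1|lborel. 1 / \<epsilon> * (pot \<epsilon> x)\<^sup>2) - c0 * integral {0..L} (\<lambda>s. (curv s)\<^sup>2)\<bar> / c0"
  proof -
    have "1 / c0 * a - b = (a - c0 * b) / c0" for a b using c0_pos by (simp add: field_simps)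
    then show ?thesis using c0_pos by (simp only: abs_divide abs_of_pos)
  qed
  ultimately show ?thesis by (simp add: R_def mult.commute)
qed

section \<open>The energy density against test functions\<close>

lemma E_moment: "integral {-\<delta>..\<delta>} (\<lambda>r. E r * r\<^sup>2) \<le> 16 * \<epsilon>\<^sup>2 + X + 2 * \<delta> ^ 3 * X"
proof -
  have "integral {-\<delta>..\<delta>} (\<lambda>r. E r * r\<^sup>2) \<le> integral {-\<delta>..\<delta>} (\<lambda>r. \<epsilon> * (f1 r)\<^sup>2 * r\<^sup>2 + X * \<delta>\<^sup>2)"
  proof (rule integral_le)
    fix r assume r: "r \<in> {-\<delta>..\<delta>}"
    have r2: "r\<^sup>2 \<le> \<delta>\<^sup>2" unfolding abs_le_square_iff[symmetric] using r by auto
    have "E r * r\<^sup>2 \<le> (\<epsilon> * (f1 r)\<^sup>2 + X) * r\<^sup>2"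
      using E_le[of r] unfolding E_def by (intro mult_right_mono) auto
    also have "\<dots> \<le> \<epsilon> * (f1 r)\<^sup>2 * r\<^sup>2 + X * \<delta>\<^sup>2"
      unfolding distrib_right using X r2 by (intro add_left_mono mult_left_mono) auto
    finally show "E r * r\<^sup>2 \<le> \<epsilon> * (f1 r)\<^sup>2 * r\<^sup>2 + X * \<delta>\<^sup>2" .
  qed (intro int_cont continuous_intros c_E c_f)+
  also have "\<dots> = integral {-\<delta>..\<delta>} (\<lambda>r. \<epsilon> * (f1 r)\<^sup>2 * r\<^sup>2) + integral {-\<delta>..\<delta>} (\<lambda>r. X * \<delta>\<^sup>2)"
    by (intro integral_add int_cont continuous_intros c_f)
  also have "integral {-\<delta>..\<delta>} (\<lambda>r. X * \<delta>\<^sup>2) = 2 * \<delta> ^ 3 * X"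
    using \<delta>_pos by (simp add: power2_eq_square power3_eq_cube)
  finally show ?thesis using f1_mom by linarith
qed

text \<open>Within distance \<open>\<rho>\<close> of the curve, \<open>\<phi>\<close> varies by at most \<open>\<eta>\<close>; farther away \<open>1 \<le> r\<^sup>2 / \<rho>\<^sup>2\<close>, so that
  the second moment of the profile takes over.\<close>

lemma test_estimate:
  fixes \<phi> :: "real^2 \<Rightarrow> real"
  assumes \<phi>: "continuous_on UNIV \<phi>" and M: "\<And>x. \<bar>\<phi> x\<bar> \<le> M"
    and \<rho>: "\<rho> > 0" and \<eta>: "\<eta> \<ge> 0" and uc: "\<And>x y. dist x y \<le> \<rho> \<Longrightarrow> \<bar>\<phi> x - \<phi> y\<bar> \<le> \<eta>"
  shows "\<bar>(LINT x:ball 0 1|lborel. \<phi> x * dens \<epsilon> x) - c0 * integral {0..L} (\<lambda>s. \<phi> (g s))\<bar> \<le>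
    L * (M * X + (3 / 2 * \<eta> * (c0 + X) + 3 * M / \<rho>\<^sup>2 * (16 * \<epsilon>\<^sup>2 + X + 2 * \<delta> ^ 3 * X)))"
proof -
  define H where "H s r = \<phi> (g s + r *\<^sub>R nrm s) * (E r * (1 - curv s * r))" for s r
  have M0: "M \<ge> 0" using M[of 0] by linarith
  have Hc: "continuous_on UNIV (\<lambda>z. H (fst z) (snd z))"
    unfolding H_def
    by (intro continuous_intros continuous_on_compose2[OF \<phi>] continuous_on_compose2[OF cont_g[of UNIV]]
        continuous_on_compose2[OF cont_nrm[of UNIV]] continuous_on_compose2[OF c_E[of UNIV]]
        continuous_on_compose2[OF cont_curv[of UNIV]]) auto
  have I: "(LINT x:ball 0 1|lborel. \<phi> x * dens \<epsilon> x) = integral {0..L} (\<lambda>s. integral {-\<delta>..\<delta>} (H s))"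
  proof (rule integral_nbhd_eq)
    show "continuous_on UNIV (\<lambda>x. \<phi> x * dens \<epsilon> x)" by (intro continuous_intros \<phi> continuous_dens)
  qed (simp_all add: off_nbhd at_tube H_def)
  have inner: "\<bar>integral {-\<delta>..\<delta>} (H s) - c0 * \<phi> (g s)\<bar> \<le>
      M * X + (3 / 2 * \<eta> * (c0 + X) + 3 * M / \<rho>\<^sup>2 * (16 * \<epsilon>\<^sup>2 + X + 2 * \<delta> ^ 3 * X))" for s
  proof -
    have Hs: "continuous_on {-\<delta>..\<delta>} (H s)"
      using continuous_on_compose2[OF Hc, of "{-\<delta>..\<delta>}" "\<lambda>r. (s, r)",
          OF continuous_on_Pair[OF continuous_on_const continuous_on_id]] by simp
    define D where "D r = H s r - \<phi> (g s) * (E r * (1 - curv s * r))" for r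
    have Dc: "continuous_on {-\<delta>..\<delta>} D" unfolding D_def by (intro continuous_intros Hs c_E)
    have "integral {-\<delta>..\<delta>} D = integral {-\<delta>..\<delta>} (H s) - integral {-\<delta>..\<delta>} (\<lambda>r. \<phi> (g s) * (E r * (1 - curv s * r)))"
      unfolding D_def by (intro integral_diff int_cont Hs continuous_intros c_E)
    also have "integral {-\<delta>..\<delta>} (\<lambda>r. \<phi> (g s) * (E r * (1 - curv s * r))) = \<phi> (g s) * integral {-\<delta>..\<delta>} E"
      unfolding integral_mult_right int_EJ ..
    finally have eq: "integral {-\<delta>..\<delta>} (H s) - c0 * \<phi> (g s) =
        \<phi> (g s) * (integral {-\<delta>..\<delta>} E - c0) + integral {-\<delta>..\<delta>} D"
      by (simp add: algebra_simps)
    have "norm (integral {-\<delta>..\<delta>} D) \<le> integral {-\<delta>..\<delta>} (\<lambda>r. 3 / 2 * \<eta> * E r + 3 * M / \<rho>\<^sup>2 * (E r * r\<^sup>2))"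
    proof (intro integral_norm_bound_integral int_cont Dc continuous_intros c_E)
      fix r assume r: "r \<in> {-\<delta>..\<delta>}"
      then have "\<bar>r\<bar> \<le> \<delta>" by (auto simp: abs_le_iff)
      \<comment> \<open>The Jacobian bound \<open>3 / 2\<close> is the source of the constants
        \<open>3 / 2\<close> and \<open>3 = 2 * (3 / 2)\<close> in the estimate.\<close>
      then have J: "\<bar>1 - curv s * r\<bar> \<le> 3 / 2" using curv_small[of r s] by linarith
      have d: "dist (g s + r *\<^sub>R nrm s) (g s) = \<bar>r\<bar>" by (simp add: dist_norm norm_nrm)
      have "\<bar>\<phi> (g s + r *\<^sub>R nrm s) - \<phi> (g s)\<bar> \<le> \<eta> + 2 * M / \<rho>\<^sup>2 * r\<^sup>2"
      proof (cases "\<bar>r\<bar> \<le> \<rho>")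
        case True
        then have "\<bar>\<phi> (g s + r *\<^sub>R nrm s) - \<phi> (g s)\<bar> \<le> \<eta>" using uc d by simp
        moreover have "0 \<le> 2 * M / \<rho>\<^sup>2 * r\<^sup>2" using M0 by simp
        ultimately show ?thesis by linarith
      next
        case False
        then have "\<rho>\<^sup>2 \<le> r\<^sup>2" using \<rho> by (simp add: abs_le_square_iff[symmetric])
        then have "2 * M * 1 \<le> 2 * M * (r\<^sup>2 / \<rho>\<^sup>2)" using M0 \<rho> by (intro mult_left_mono) auto
        moreover have "\<bar>\<phi> (g s + r *\<^sub>R nrm s) - \<phi> (g s)\<bar> \<le> 2 * M"
          using M[of "g s + r *\<^sub>R nrm s"] M[of "g s"] by linarith
        ultimately show ?thesis using \<eta> by simp
      qed
      then have "\<bar>\<phi> (g s + r *\<^sub>R nrm s) - \<phi> (g s)\<bar> * (E r * \<bar>1 - curv s * r\<bar>) \<le>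
          (\<eta> + 2 * M / \<rho>\<^sup>2 * r\<^sup>2) * (E r * (3 / 2))"
        using J E_nonneg[of r] \<eta> M0 by (intro mult_mono mult_left_mono) auto
      moreover have "norm (D r) = \<bar>\<phi> (g s + r *\<^sub>R nrm s) - \<phi> (g s)\<bar> * (E r * \<bar>1 - curv s * r\<bar>)"
      proof -
        have "D r = (\<phi> (g s + r *\<^sub>R nrm s) - \<phi> (g s)) * (E r * (1 - curv s * r))"
          by (simp add: D_def H_def left_diff_distrib)
        then show ?thesis using E_nonneg[of r] by (simp add: abs_mult)
      qed
      moreover have "(\<eta> + 2 * M / \<rho>\<^sup>2 * r\<^sup>2) * (E r * (3 / 2)) = 3 / 2 * \<eta> * E r + 3 * M / \<rho>\<^sup>2 * (E r * r\<^sup>2)"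
        by (simp add: algebra_simps)
      ultimately show "norm (D r) \<le> 3 / 2 * \<eta> * E r + 3 * M / \<rho>\<^sup>2 * (E r * r\<^sup>2)" by simp
    qed
    also have "\<dots> = integral {-\<delta>..\<delta>} (\<lambda>r. 3 / 2 * \<eta> * E r) + integral {-\<delta>..\<delta>} (\<lambda>r. 3 * M / \<rho>\<^sup>2 * (E r * r\<^sup>2))"
      by (intro integral_add int_cont continuous_intros c_E)
    also have "\<dots> = 3 / 2 * \<eta> * integral {-\<delta>..\<delta>} E + 3 * M / \<rho>\<^sup>2 * integral {-\<delta>..\<delta>} (\<lambda>r. E r * r\<^sup>2)"
      unfolding integral_mult_right ..
    also have "\<dots> \<le> 3 / 2 * \<eta> * (c0 + X) + 3 * M / \<rho>\<^sup>2 * (16 * \<epsilon>\<^sup>2 + X + 2 * \<delta> ^ 3 * X)"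
    proof -
      have "integral {-\<delta>..\<delta>} E \<le> c0 + X" using E_int unfolding E_def[abs_def] by linarith
      then show ?thesis using E_moment \<eta> M0 by (intro add_mono mult_left_mono) auto
    qed
    finally have D: "\<bar>integral {-\<delta>..\<delta>} D\<bar> \<le> 3 / 2 * \<eta> * (c0 + X) + 3 * M / \<rho>\<^sup>2 * (16 * \<epsilon>\<^sup>2 + X + 2 * \<delta> ^ 3 * X)"
      by simp
    have "\<bar>\<phi> (g s) * (integral {-\<delta>..\<delta>} E - c0)\<bar> \<le> M * X"
      unfolding abs_mult using M E_int M0 by (intro mult_mono) (auto simp: E_def[abs_def])
    then show ?thesis using D eq by linarith
  qed
  have "continuous_on UNIV (\<lambda>s. integral (cbox (-\<delta>) \<delta>) (H s))"
    by (rule integral_continuous_on_param) (use Hc in \<open>auto simp: case_prod_unfold intro: continuous_on_subset\<close>)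
  then have Hi: "continuous_on {0..L} (\<lambda>s. integral {-\<delta>..\<delta>} (H s))"
    by (auto intro: continuous_on_subset)
  have pc: "continuous_on {0..L} (\<lambda>s. \<phi> (g s))" by (intro continuous_on_compose2[OF \<phi> cont_g]) auto
  have "(LINT x:ball 0 1|lborel. \<phi> x * dens \<epsilon> x) - c0 * integral {0..L} (\<lambda>s. \<phi> (g s)) =
      integral {0..L} (\<lambda>s. integral {-\<delta>..\<delta>} (H s) - c0 * \<phi> (g s))"
    unfolding I by (subst integral_diff) (auto intro!: integrable_continuous_real Hi continuous_intros pc)
  also have "norm \<dots> \<le> (M * X + (3 / 2 * \<eta> * (c0 + X) + 3 * M / \<rho>\<^sup>2 * (16 * \<epsilon>\<^sup>2 + X + 2 * \<delta> ^ 3 * X))) * (L - 0)"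
    using L_pos inner by (intro integral_bound continuous_intros Hi pc) auto
  finally show ?thesis by (simp add: mult.commute)
qed

end

section \<open>Smooth approximation\<close>

lemma partial_deriv_add_const:
  fixes p :: "real^'n::finite \<Rightarrow> real"
  assumes "real_polynomial_function p"
  shows "partial_deriv i (\<lambda>x. p x + c) = partial_deriv i p"
proof
  fix x
  obtain p' where p': "((\<lambda>t. p (x + t *\<^sub>R axis i 1)) has_real_derivative p' x) (at 0)"
    using real_polynomial_function_directional_derivative[OF assms] by blast
  have "((\<lambda>t. p (x + t *\<^sub>R axis i 1) + c) has_real_derivative p' x) (at 0)"
    using DERIV_add[OF p' DERIV_const[of c]] by simp
  then show "partial_deriv i (\<lambda>x. p x + c) x = partial_deriv i p x"
    unfolding partial_deriv_def using p' by (simp add: DERIV_imp_deriv)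
qed

text \<open>A phase field does not vanish off the disk but equals \<open>1\<close> or
  \<open>-1\<close> there; subtracting this constant creates the required support and leaves the
  derivatives alone.\<close>

lemma C2_polynomial_approximation_const:
  fixes w :: "real^2 \<Rightarrow> real" and w1 w2 :: "2 \<Rightarrow> real^2 \<Rightarrow> real"
  assumes cont: "continuous_on UNIV w" "\<And>i. continuous_on UNIV (w1 i)" "\<And>i. continuous_on UNIV (w2 i)"
    and d1: "\<And>i x. ((\<lambda>t. w (x + t *\<^sub>R axis i 1)) has_real_derivative w1 i x) (at 0)"
    and d2: "\<And>i x. ((\<lambda>t. w1 i (x + t *\<^sub>R axis i 1)) has_real_derivative w2 i x) (at 0)"
    and supp: "\<And>x. norm x \<ge> 1 \<Longrightarrow> w x = c" and range: "\<And>x. w x \<in> {a..b}"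
    and bnd: "\<And>i x. \<bar>w1 i x\<bar> \<le> M" "\<And>i x. \<bar>w2 i x\<bar> \<le> M"
  obtains U :: "nat \<Rightarrow> real^2 \<Rightarrow> real" where "\<And>n. real_polynomial_function (U n)"
    and "\<And>n x. norm x < 1 \<Longrightarrow> U n x \<in> {a..b}"
    and "\<And>n i x. norm x < 1 \<Longrightarrow> \<bar>partial_deriv i (U n) x\<bar> \<le> M"
    and "\<And>n i x. norm x < 1 \<Longrightarrow> \<bar>partial_deriv i (partial_deriv i (U n)) x\<bar> \<le> M"
    and "\<And>x. norm x < 1 \<Longrightarrow> (\<lambda>n. U n x) \<longlonglongrightarrow> w x"
    and "\<And>i x. norm x < 1 \<Longrightarrow> (\<lambda>n. partial_deriv i (U n) x) \<longlonglongrightarrow> w1 i x"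
    and "\<And>i x. norm x < 1 \<Longrightarrow> (\<lambda>n. partial_deriv i (partial_deriv i (U n)) x) \<longlonglongrightarrow> w2 i x"
proof -
  have d1': "((\<lambda>t. w (x + t *\<^sub>R axis i 1) - c) has_real_derivative w1 i x) (at 0)" for i x
    using DERIV_diff[OF d1 DERIV_const[of c]] by simp
  obtain U :: "nat \<Rightarrow> real^2 \<Rightarrow> real" where U: "\<And>n. real_polynomial_function (U n)"
    "\<And>n x. norm x < 1 \<Longrightarrow> U n x \<in> {a - c..b - c}"
    "\<And>n i x. norm x < 1 \<Longrightarrow> \<bar>partial_deriv i (U n) x\<bar> \<le> M"
    "\<And>n i x. norm x < 1 \<Longrightarrow> \<bar>partial_deriv i (partial_deriv i (U n)) x\<bar> \<le> M"
    "\<And>x. norm x < 1 \<Longrightarrow> (\<lambda>n. U n x) \<longlonglongrightarrow> w x - c"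
    "\<And>i x. norm x < 1 \<Longrightarrow> (\<lambda>n. partial_deriv i (U n) x) \<longlonglongrightarrow> w1 i x"
    "\<And>i x. norm x < 1 \<Longrightarrow> (\<lambda>n. partial_deriv i (partial_deriv i (U n)) x) \<longlonglongrightarrow> w2 i x"
  proof (rule C2_polynomial_approximation[OF _ cont(2,3) d1' d2 _ _ bnd])
    show "continuous_on UNIV (\<lambda>x. w x - c)" by (intro continuous_intros cont)
    show "norm x \<ge> 1 \<Longrightarrow> w x - c = 0" for x using supp by simp
    show "w x - c \<in> {a - c..b - c}" for x using range[of x] by simp
  qed blast
  note pd = partial_deriv_add_const[OF U(1), where c = c]
  show ?thesis
  proof (rule that[of "\<lambda>n x. U n x + c"])
    show "real_polynomial_function (\<lambda>x. U n x + c)" for n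
      by (rule real_polynomial_function.intros(3)[OF U(1) real_polynomial_function.intros(2)])
    show "U n x + c \<in> {a..b}" if "norm x < 1" for n x using U(2)[OF that, of n] by auto
    show "(\<lambda>n. U n x + c) \<longlonglongrightarrow> w x" if "norm x < 1" for x
      using tendsto_add[OF U(5)[OF that] tendsto_const[of c]] by simp
  qed (unfold pd, (rule U; assumption)+)
qed

text \<open>Besides the integrals, convergence in mean is recorded: for the interface density it
  lets one polynomial serve all test functions at once.\<close>

lemma ball_dominated_convergence:
  fixes h :: "nat \<Rightarrow> real^2 \<Rightarrow> real"
  assumes h: "\<And>n. continuous_on UNIV (h n)" and k: "continuous_on UNIV k"
    and lim: "\<And>x. norm x < 1 \<Longrightarrow> (\<lambda>n. h n x) \<longlonglongrightarrow> k x"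
    and B: "\<And>n x. norm x < 1 \<Longrightarrow> \<bar>h n x\<bar> \<le> B"
  shows "(\<lambda>n. LINT x:ball 0 1|lborel. \<bar>h n x - k x\<bar>) \<longlonglongrightarrow> 0"
    and "(\<lambda>n. LINT x:ball 0 1|lborel. h n x) \<longlonglongrightarrow> (LINT x:ball 0 1|lborel. k x)"
proof -
  have [measurable]: "h n \<in> borel_measurable borel" "k \<in> borel_measurable borel" for n
    using h k by (auto intro: borel_measurable_continuous_onI)
  have kB: "\<bar>k x\<bar> \<le> B" if "norm x < 1" for x
    using tendsto_rabs[OF lim[OF that]] B[OF that] by (intro LIMSEQ_le_const2) auto
  have int: "integrable lborel (\<lambda>x. indicator (ball 0 1 :: (real^2) set) x *\<^sub>R C)" for C :: real
    by (intro integrable_scaleR_left integrable_real_indicator emeasure_bounded_finite) auto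
  have "(\<lambda>n. LINT x|lborel. indicator (ball 0 1) x *\<^sub>R \<bar>h n x - k x\<bar>) \<longlonglongrightarrow> (LINT x|(lborel :: (real^2) measure). (0::real))"
  proof (rule integral_dominated_convergence[where w = "\<lambda>x. indicator (ball 0 1) x *\<^sub>R (2 * B)"])
    show "AE x in lborel. (\<lambda>n. indicator (ball 0 1) x *\<^sub>R \<bar>h n x - k x\<bar>) \<longlonglongrightarrow> 0"
    proof (rule AE_I2)
      fix x
      show "(\<lambda>n. indicator (ball 0 1) x *\<^sub>R \<bar>h n x - k x\<bar>) \<longlonglongrightarrow> 0"
      proof (cases "norm x < 1")
        case True
        have "(\<lambda>n. \<bar>h n x - k x\<bar>) \<longlonglongrightarrow> \<bar>k x - k x\<bar>" by (intro tendsto_intros lim[OF True])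
        then show ?thesis using True by simp
      qed simp
    qed
    show "AE x in lborel. norm (indicator (ball 0 1) x *\<^sub>R \<bar>h n x - k x\<bar>) \<le> indicator (ball 0 1) x *\<^sub>R (2 * B)" for n
    proof (rule AE_I2)
      fix x
      show "norm (indicator (ball 0 1) x *\<^sub>R \<bar>h n x - k x\<bar>) \<le> indicator (ball 0 1) x *\<^sub>R (2 * B)"
      proof (cases "norm x < 1")
        case True
        then show ?thesis using B[OF True, of n] kB[OF True] by simp
      qed simp
    qed
  qed (use int in \<open>auto intro!: borel_measurable_times borel_measurable_indicator borel_measurable_abs borel_measurable_diff\<close>)
  then show "(\<lambda>n. LINT x:ball 0 1|lborel. \<bar>h n x - k x\<bar>) \<longlonglongrightarrow> 0"
    by (simp add: set_lebesgue_integral_def)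
  have "(\<lambda>n. LINT x|lborel. indicator (ball 0 1) x *\<^sub>R h n x) \<longlonglongrightarrow> (LINT x|lborel. indicator (ball 0 1) x *\<^sub>R k x)"
  proof (rule integral_dominated_convergence[where w = "\<lambda>x. indicator (ball 0 1) x *\<^sub>R B"])
    show "AE x in lborel. (\<lambda>n. indicator (ball 0 1) x *\<^sub>R h n x) \<longlonglongrightarrow> indicator (ball 0 1) x *\<^sub>R k x"
      using lim by (intro AE_I2) (auto simp: indicator_def)
    show "AE x in lborel. norm (indicator (ball 0 1) x *\<^sub>R h n x) \<le> indicator (ball 0 1) x *\<^sub>R B" for n
      using B by (intro AE_I2) (auto simp: indicator_def)
  qed (use int in \<open>auto intro!: borel_measurable_times borel_measurable_indicator borel_measurable_abs borel_measurable_diff\<close>)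
  then show "(\<lambda>n. LINT x:ball 0 1|lborel. h n x) \<longlonglongrightarrow> (LINT x:ball 0 1|lborel. k x)"
    by (simp add: set_lebesgue_integral_def)
qed

lemma norm_grad_2: "norm (grad u x) = sqrt ((partial_deriv 1 u x)\<^sup>2 + (partial_deriv 2 u x)\<^sup>2)" for u :: "real^2 \<Rightarrow> real"
  by (simp add: grad_def norm_vec_def L2_set_def sum_2)

lemma laplacian_2: "laplacian u x = partial_deriv 1 (partial_deriv 1 u) x + partial_deriv 2 (partial_deriv 2 u) x"
  for u :: "real^2 \<Rightarrow> real"
  by (simp add: laplacian_def sum_2)

lemma interface_density_2: "interface_density \<epsilon> u x =
    \<epsilon> / 2 * ((partial_deriv 1 u x)\<^sup>2 + (partial_deriv 2 u x)\<^sup>2) + 1 / \<epsilon> * W (u x)"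
  by (simp add: interface_density_def norm_grad_2)

lemma continuous_real_polynomial_function_on: "real_polynomial_function p \<Longrightarrow> continuous_on S p"
  by (auto intro!: continuous_at_imp_continuous_on continuous_real_polymonial_function)

lemma continuous_densities:
  assumes u: "real_polynomial_function u"
  shows "continuous_on UNIV (interface_density \<epsilon> u)" "continuous_on UNIV (chem_pot \<epsilon> u)"
    "continuous_on UNIV (bending_density \<epsilon> u)" "continuous_on UNIV (turning_density \<epsilon> u)"
proof -
  note c = continuous_real_polynomial_function_on
  note p = real_polynomial_function_partial_deriv
  show i: "continuous_on UNIV (interface_density \<epsilon> u)"
    unfolding interface_density_2[abs_def]
    by (intro continuous_intros c p u continuous_on_compose2[OF continuous_on_W(1)[of UNIV]]) auto
  show q: "continuous_on UNIV (chem_pot \<epsilon> u)"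
    unfolding chem_pot_def[abs_def] laplacian_2
    by (intro continuous_intros c p u continuous_on_compose2[OF continuous_on_W(2)[of UNIV]]) auto
  show "continuous_on UNIV (bending_density \<epsilon> u)"
    unfolding bending_density_def[abs_def] by (intro continuous_intros q)
  show "continuous_on UNIV (turning_density \<epsilon> u)"
    unfolding turning_density_def[abs_def] norm_grad_2 by (intro continuous_intros q c p u)
qed

lemma set_integrable_ball_continuous:
  fixes h :: "real^2 \<Rightarrow> real"
  assumes "continuous_on UNIV h" shows "set_integrable lborel (ball 0 1) h"
proof (rule set_integrable_subset)
  show "set_integrable lborel (cball 0 1) h"
    unfolding set_integrable_def
    by (rule borel_integrable_compact) (auto intro: continuous_on_subset[OF assms])
qed auto

lemma finite_energies_polynomial: "real_polynomial_function u \<Longrightarrow> finite_energies \<epsilon> u"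
  unfolding finite_energies_def by (intro conjI set_integrable_ball_continuous continuous_densities)

context optimal
begin

text \<open>Both are continuous and vanish off the core, which lies in the compact closed
  disk.\<close>

lemma bounded_v1_v2: obtains M where "\<And>i x. \<bar>v1 i x\<bar> \<le> M" "\<And>i x. \<bar>v2 i x\<bar> \<le> M"
proof -
  have "\<exists>B. \<forall>x. \<bar>h x\<bar> \<le> B" if h: "continuous_on UNIV h" "\<And>x. x \<notin> core \<Longrightarrow> h x = 0" for h :: "real^2 \<Rightarrow> real"
  proof -
    have "compact (h ` cball 0 1)" by (intro compact_continuous_image continuous_on_subset[OF h(1)]) auto
    then obtain B where B: "\<And>x. x \<in> cball 0 1 \<Longrightarrow> norm (h x) \<le> B"
      using compact_imp_bounded bounded_iff by (metis image_eqI)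
    have "\<bar>h x\<bar> \<le> max B 0" for x
    proof (cases "x \<in> core")
      case True
      then have "x \<in> cball 0 1" using core_nbhd nbhd_ball ball_subset_cball by blast
      then show ?thesis using B[of x] by simp
    qed (simp add: h(2))
    then show ?thesis by blast
  qed
  then have "\<exists>B. \<forall>x. \<bar>v1 i x\<bar> \<le> B" "\<exists>B. \<forall>x. \<bar>v2 i x\<bar> \<le> B" for i
    using continuous_v1 continuous_v2 off_core by blast+
  then obtain B1 B2 where B: "\<And>i x. \<bar>v1 i x\<bar> \<le> B1 i" "\<And>i x. \<bar>v2 i x\<bar> \<le> B2 i" by metis
  define M where "M = max (max (B1 1) (B1 2)) (max (B2 1) (B2 2))"
  have "B1 i \<le> M \<and> B2 i \<le> M" for i using exhaust_2[of i] by (auto simp: M_def)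
  then show ?thesis using B by (intro that[of M]) (meson order.trans)+
qed

text \<open>For fixed \<open>\<epsilon>\<close> all ingredients of the densities converge boundedly
  along the approximating polynomials, so a single index meets the three tolerances.\<close>

lemma smooth_approximation:
  assumes out: "- ball 0 1 \<subseteq> P \<or> - ball 0 1 \<subseteq> Q" and \<eta>: "\<eta> > 0"
  obtains u where "real_polynomial_function u" "u ` ball 0 1 \<subseteq> {-1..1}"
    "(LINT x:ball 0 1|lborel. \<bar>interface_density \<epsilon> u x - dens \<epsilon> x\<bar>) \<le> \<eta>"
    "\<bar>(LINT x:ball 0 1|lborel. turning_density \<epsilon> u x) - (LINT x:ball 0 1|lborel. pot \<epsilon> x * slope x)\<bar> \<le> \<eta>"
    "\<bar>(LINT x:ball 0 1|lborel. bending_density \<epsilon> u x) - (LINT x:ball 0 1|lborel. 1 / \<epsilon> * (pot \<epsilon> x)\<^sup>2)\<bar> \<le> \<eta>"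
proof -
  \<comment> \<open>The complement of the disk lies on one side of the curve and off the tube, so
    \<open>v\<close> is constant there; which constant it is depends on the orientation.\<close>
  obtain c where c: "\<And>x. norm x \<ge> 1 \<Longrightarrow> v x = c"
  proof (cases "- ball 0 1 \<subseteq> P")
    case True
    have "v x = f \<delta>" if "norm x \<ge> 1" for x
    proof -
      have "x \<in> P" "x \<notin> nbhd" using True that nbhd_ball by auto
      then show ?thesis by (simp add: v_def)
    qed
    then show ?thesis by (rule that)
  next
    case False
    then have q: "- ball 0 1 \<subseteq> Q" using out by blast
    have "v x = f (- \<delta>)" if "norm x \<ge> 1" for x
    proof -
      have "x \<in> Q" "x \<notin> nbhd" using q that nbhd_ball by auto
      moreover from this have "x \<notin> P" using PQ(3) by blast
      ultimately show ?thesis by (simp add: v_def)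
    qed
    then show ?thesis by (rule that)
  qed
  obtain M where M: "\<And>i x. \<bar>v1 i x\<bar> \<le> M" "\<And>i x. \<bar>v2 i x\<bar> \<le> M" by (rule bounded_v1_v2) blast
  have range: "v x \<in> {-1..1}" for x
  proof -
    obtain r where "v x = f r" using v_range[of x] by blast
    then show ?thesis using f_le[of r] by (auto simp: abs_le_iff)
  qed
  obtain U :: "nat \<Rightarrow> real^2 \<Rightarrow> real" where U: "\<And>n. real_polynomial_function (U n)"
    "\<And>n x. norm x < 1 \<Longrightarrow> U n x \<in> {-1..1}"
    "\<And>n i x. norm x < 1 \<Longrightarrow> \<bar>partial_deriv i (U n) x\<bar> \<le> M"
    "\<And>n i x. norm x < 1 \<Longrightarrow> \<bar>partial_deriv i (partial_deriv i (U n)) x\<bar> \<le> M"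
    "\<And>x. norm x < 1 \<Longrightarrow> (\<lambda>n. U n x) \<longlonglongrightarrow> v x"
    "\<And>i x. norm x < 1 \<Longrightarrow> (\<lambda>n. partial_deriv i (U n) x) \<longlonglongrightarrow> v1 i x"
    "\<And>i x. norm x < 1 \<Longrightarrow> (\<lambda>n. partial_deriv i (partial_deriv i (U n)) x) \<longlonglongrightarrow> v2 i x"
    using C2_polynomial_approximation_const[OF continuous_v continuous_v1 continuous_v2 deriv_v deriv_v1 c range M]
    by blast
  have M0: "M \<ge> 0" using M(1)[of 1 0] by linarith
  have sq: "(partial_deriv i (U n) x)\<^sup>2 \<le> M\<^sup>2" if "norm x < 1" for i n x
    unfolding abs_le_square_iff[symmetric] using U(3)[OF that] M0 by simp
  have Wb: "\<bar>W (U n x)\<bar> \<le> 1" "\<bar>deriv W (U n x)\<bar> \<le> 2" if "norm x < 1" for n x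
  proof -
    have a: "\<bar>U n x\<bar> \<le> 1" using U(2)[OF that, of n] by (auto simp: abs_le_iff)
    then have s: "(U n x)\<^sup>2 \<le> 1" by (simp add: abs_square_le_1)
    then have "(1 - (U n x)\<^sup>2)\<^sup>2 \<le> 1" by (intro power_le_one) auto
    then show "\<bar>W (U n x)\<bar> \<le> 1" by (simp add: W_def)
    have "\<bar>U n x ^ 3\<bar> \<le> 1" using a by (simp add: power_abs power_le_one)
    then show "\<bar>deriv W (U n x)\<bar> \<le> 2" using a by (simp add: deriv_W)
  qed
  have db: "\<bar>interface_density \<epsilon> (U n) x\<bar> \<le> \<epsilon> / 2 * (M\<^sup>2 + M\<^sup>2) + 1 / \<epsilon> * 1" if "norm x < 1" for n x
  proof -
    have "0 \<le> W (U n x)" by (simp add: W_def)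
    then have "\<bar>interface_density \<epsilon> (U n) x\<bar> = interface_density \<epsilon> (U n) x"
      using \<epsilon> by (simp add: interface_density_2)
    also have "\<dots> \<le> \<epsilon> / 2 * (M\<^sup>2 + M\<^sup>2) + 1 / \<epsilon> * 1"
      unfolding interface_density_2 using \<epsilon> sq[OF that] Wb[OF that, of n]
      by (intro add_mono mult_left_mono) auto
    finally show ?thesis .
  qed
  define C where "C = \<epsilon> * (M + M) + 1 / \<epsilon> * 2"
  have C0: "C \<ge> 0" using \<epsilon> M0 by (simp add: C_def)
  have cb: "\<bar>chem_pot \<epsilon> (U n) x\<bar> \<le> C" if "norm x < 1" for n x
  proof -
    have "\<bar>chem_pot \<epsilon> (U n) x\<bar> \<le> \<bar>\<epsilon> * laplacian (U n) x\<bar> + \<bar>1 / \<epsilon> * deriv W (U n x)\<bar>"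
      unfolding chem_pot_def using abs_triangle_ineq[of "- \<epsilon> * laplacian (U n) x" "1 / \<epsilon> * deriv W (U n x)"] by simp
    also have "\<dots> \<le> \<epsilon> * (M + M) + 1 / \<epsilon> * 2"
    proof (rule add_mono)
      have "\<bar>laplacian (U n) x\<bar> \<le> M + M" unfolding laplacian_2 using U(4)[OF that, of 1 n] U(4)[OF that, of 2 n] by linarith
      then show "\<bar>\<epsilon> * laplacian (U n) x\<bar> \<le> \<epsilon> * (M + M)" using \<epsilon> by (simp add: abs_mult)
      show "\<bar>1 / \<epsilon> * deriv W (U n x)\<bar> \<le> 1 / \<epsilon> * 2"
        using \<epsilon> Wb(2)[OF that, of n] unfolding abs_mult by (intro mult_mono) auto
    qed
    finally show ?thesis by (simp add: C_def)
  qed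
  have gb: "norm (grad (U n) x) \<le> sqrt (M\<^sup>2 + M\<^sup>2)" if "norm x < 1" for n x
    unfolding norm_grad_2 using sq[OF that] by (intro real_sqrt_le_mono add_mono) auto
  have dlim: "(\<lambda>n. interface_density \<epsilon> (U n) x) \<longlonglongrightarrow> dens \<epsilon> x" if "norm x < 1" for x
    unfolding interface_density_2 dens_def W_def by (intro tendsto_intros U(5,6)[OF that])
  have clim: "(\<lambda>n. chem_pot \<epsilon> (U n) x) \<longlonglongrightarrow> pot \<epsilon> x" if "norm x < 1" for x
    unfolding chem_pot_def pot_def deriv_W laplacian_2 by (intro tendsto_intros U(5,7)[OF that])
  have glim: "(\<lambda>n. norm (grad (U n) x)) \<longlonglongrightarrow> slope x" if "norm x < 1" for x
    unfolding norm_grad_2 slope_def by (intro tendsto_intros U(6)[OF that])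
  have "(\<lambda>n. LINT x:ball 0 1|lborel. \<bar>interface_density \<epsilon> (U n) x - dens \<epsilon> x\<bar>) \<longlonglongrightarrow> 0"
    by (rule ball_dominated_convergence(1)[OF continuous_densities(1)[OF U(1)] continuous_dens dlim db])
  then have e1: "\<forall>\<^sub>F n in sequentially. (LINT x:ball 0 1|lborel. \<bar>interface_density \<epsilon> (U n) x - dens \<epsilon> x\<bar>) < \<eta>"
    using \<eta> by (rule order_tendstoD(2))
  have "(\<lambda>n. LINT x:ball 0 1|lborel. turning_density \<epsilon> (U n) x) \<longlonglongrightarrow> (LINT x:ball 0 1|lborel. pot \<epsilon> x * slope x)"
  proof (rule ball_dominated_convergence(2)[OF continuous_densities(4)[OF U(1)]])
    show "continuous_on UNIV (\<lambda>x. pot \<epsilon> x * slope x)" by (intro continuous_intros continuous_pot continuous_slope)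
    show "(\<lambda>n. turning_density \<epsilon> (U n) x) \<longlonglongrightarrow> pot \<epsilon> x * slope x" if "norm x < 1" for x
      unfolding turning_density_def by (intro tendsto_intros clim[OF that] glim[OF that])
    show "\<bar>turning_density \<epsilon> (U n) x\<bar> \<le> C * sqrt (M\<^sup>2 + M\<^sup>2)" if "norm x < 1" for n x
      unfolding turning_density_def abs_mult using cb[OF that] gb[OF that] C0 by (intro mult_mono) auto
  qed
  then have e2: "\<forall>\<^sub>F n in sequentially. dist (LINT x:ball 0 1|lborel. turning_density \<epsilon> (U n) x)
      (LINT x:ball 0 1|lborel. pot \<epsilon> x * slope x) < \<eta>"
    using \<eta> by (rule tendstoD)
  have "(\<lambda>n. LINT x:ball 0 1|lborel. bending_density \<epsilon> (U n) x) \<longlonglongrightarrow> (LINT x:ball 0 1|lborel. 1 / \<epsilon> * (pot \<epsilon> x)\<^sup>2)"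
  proof (rule ball_dominated_convergence(2)[OF continuous_densities(3)[OF U(1)]])
    show "continuous_on UNIV (\<lambda>x. 1 / \<epsilon> * (pot \<epsilon> x)\<^sup>2)" by (intro continuous_intros continuous_pot)
    show "(\<lambda>n. bending_density \<epsilon> (U n) x) \<longlonglongrightarrow> 1 / \<epsilon> * (pot \<epsilon> x)\<^sup>2" if "norm x < 1" for x
      unfolding bending_density_def by (intro tendsto_intros clim[OF that])
    show "\<bar>bending_density \<epsilon> (U n) x\<bar> \<le> 1 / \<epsilon> * C\<^sup>2" if "norm x < 1" for n x
    proof -
      have "(chem_pot \<epsilon> (U n) x)\<^sup>2 \<le> C\<^sup>2"
        unfolding abs_le_square_iff[symmetric] using cb[OF that, of n] C0 by simp
      then show ?thesis unfolding bending_density_def abs_mult using \<epsilon> by (intro mult_mono) auto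
    qed
  qed
  then have e3: "\<forall>\<^sub>F n in sequentially. dist (LINT x:ball 0 1|lborel. bending_density \<epsilon> (U n) x)
      (LINT x:ball 0 1|lborel. 1 / \<epsilon> * (pot \<epsilon> x)\<^sup>2) < \<eta>"
    using \<eta> by (rule tendstoD)
  from eventually_conj[OF e1 eventually_conj[OF e2 e3]]
  obtain n where n: "(LINT x:ball 0 1|lborel. \<bar>interface_density \<epsilon> (U n) x - dens \<epsilon> x\<bar>) < \<eta>"
    "dist (LINT x:ball 0 1|lborel. turning_density \<epsilon> (U n) x) (LINT x:ball 0 1|lborel. pot \<epsilon> x * slope x) < \<eta>"
    "dist (LINT x:ball 0 1|lborel. bending_density \<epsilon> (U n) x) (LINT x:ball 0 1|lborel. 1 / \<epsilon> * (pot \<epsilon> x)\<^sup>2) < \<eta>"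
    using eventually_happens'[OF sequentially_bot] by blast
  show ?thesis
  proof (rule that[of "U n"])
    show "U n ` ball 0 1 \<subseteq> {-1..1}" using U(2) by auto
  qed (use U(1) n in \<open>simp_all add: dist_real_def less_imp_le\<close>)
qed

end

lemma integral_interface_measure:
  fixes u \<phi> :: "real^2 \<Rightarrow> real"
  assumes u: "real_polynomial_function u" and \<epsilon>: "\<epsilon> > 0" and \<phi>: "continuous_on UNIV \<phi>"
  shows "(\<integral>x. \<phi> x \<partial>interface_measure \<epsilon> u) = 1 / c0 * (LINT x:ball 0 1|lborel. \<phi> x * interface_density \<epsilon> u x)"
proof -
  have [measurable]: "interface_density \<epsilon> u \<in> borel_measurable borel" "\<phi> \<in> borel_measurable borel"
    using continuous_densities(1)[OF u] \<phi> by (auto intro: borel_measurable_continuous_onI)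
  have nn: "interface_density \<epsilon> u x \<ge> 0" for x using \<epsilon> by (simp add: interface_density_def W_def)
  have "(\<integral>x. \<phi> x \<partial>interface_measure \<epsilon> u) =
      (\<integral>x. (indicator (ball 0 1) x * (1 / c0 * interface_density \<epsilon> u x)) *\<^sub>R \<phi> x \<partial>lborel)"
    unfolding interface_measure_def
    by (rule integral_density) (use nn c0_pos in \<open>auto intro!: borel_measurable_divide borel_measurable_times borel_measurable_indicator\<close>)
  also have "\<dots> = (\<integral>x. 1 / c0 * (indicator (ball 0 1) x *\<^sub>R (\<phi> x * interface_density \<epsilon> u x)) \<partial>lborel)"
    by (intro Bochner_Integration.integral_cong) (auto simp: indicator_def)
  also have "\<dots> = 1 / c0 * (LINT x:ball 0 1|lborel. \<phi> x * interface_density \<epsilon> u x)"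
    unfolding set_lebesgue_integral_def by (rule integral_mult_right_zero)
  finally show ?thesis .
qed

lemma radon_interface_measure:
  fixes u :: "real^2 \<Rightarrow> real"
  assumes u: "real_polynomial_function u"
  shows "radon_measure (interface_measure \<epsilon> u)"
  unfolding radon_measure_def
proof (intro conjI allI impI)
  show "sets (interface_measure \<epsilon> u) = sets borel" by (simp add: interface_measure_def)
  fix K :: "(real^2) set" assume "compact K"
  then have K: "K \<in> sets lborel" by (simp add: compact_imp_closed borel_closed)
  let ?h = "\<lambda>x. indicator (ball 0 1) x * (1 / c0 * interface_density \<epsilon> u x)"
  have [measurable]: "interface_density \<epsilon> u \<in> borel_measurable borel"
    using continuous_densities(1)[OF u] by (auto intro: borel_measurable_continuous_onI)
  have "integrable lborel ?h"
    using set_integrable_ball_continuous[OF continuous_on_mult_left[OF continuous_densities(1)[OF u], of "1 / c0"]]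
    by (simp add: set_integrable_def)
  then have fin: "(\<integral>\<^sup>+x. ennreal (norm (?h x)) \<partial>lborel) < \<infinity>" by (simp add: integrable_iff_bounded)
  have "emeasure (interface_measure \<epsilon> u) K = (\<integral>\<^sup>+x. ennreal (?h x) * indicator K x \<partial>lborel)"
    unfolding interface_measure_def by (rule emeasure_density[OF _ K])
      (intro measurable_compose[OF _ measurable_ennreal] borel_measurable_times borel_measurable_indicator; simp)
  also have "\<dots> \<le> (\<integral>\<^sup>+x. ennreal (norm (?h x)) \<partial>lborel)"
  proof (rule nn_integral_mono)
    fix x
    have "ennreal (?h x) \<le> ennreal (norm (?h x))" by (intro ennreal_leI) (simp only: real_norm_def abs_ge_self)
    then show "ennreal (?h x) * indicator K x \<le> ennreal (norm (?h x))" by (auto simp: indicator_def)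
  qed
  finally show "emeasure (interface_measure \<epsilon> u) K < \<infinity>" using fin by (rule le_less_trans)
qed

section \<open>The recovery family\<close>

context optimal
begin

lemma test_difference:
  fixes u \<phi> :: "real^2 \<Rightarrow> real"
  assumes u: "real_polynomial_function u" and \<phi>: "continuous_on UNIV \<phi>" "\<And>x. \<bar>\<phi> x\<bar> \<le> M"
    and \<eta>: "(LINT x:ball 0 1|lborel. \<bar>interface_density \<epsilon> u x - dens \<epsilon> x\<bar>) \<le> \<eta>"
  shows "\<bar>(LINT x:ball 0 1|lborel. \<phi> x * interface_density \<epsilon> u x) - (LINT x:ball 0 1|lborel. \<phi> x * dens \<epsilon> x)\<bar> \<le> M * \<eta>"
proof -
  note c = continuous_densities(1)[OF u, of \<epsilon>] continuous_dens[of \<epsilon>] \<phi>(1)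
  note si = set_integrable_ball_continuous
  have M0: "M \<ge> 0" using \<phi>(2)[of 0] by linarith
  have int: "set_integrable lborel (ball 0 1) (\<lambda>x. \<phi> x * interface_density \<epsilon> u x - \<phi> x * dens \<epsilon> x)"
    by (intro si continuous_intros c)
  have eq: "(LINT x:ball 0 1|lborel. \<phi> x * interface_density \<epsilon> u x) - (LINT x:ball 0 1|lborel. \<phi> x * dens \<epsilon> x)
      = (LINT x:ball 0 1|lborel. \<phi> x * interface_density \<epsilon> u x - \<phi> x * dens \<epsilon> x)"
    by (intro set_integral_diff(2)[symmetric] si continuous_intros c)
  have le: "\<bar>LINT x:ball 0 1|lborel. \<phi> x * interface_density \<epsilon> u x - \<phi> x * dens \<epsilon> x\<bar> \<le>
      (LINT x:ball 0 1|lborel. norm (\<phi> x * interface_density \<epsilon> u x - \<phi> x * dens \<epsilon> x))"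
    unfolding real_norm_def[symmetric] by (rule set_integral_norm_bound[OF int])
  also have "\<dots> \<le> (LINT x:ball 0 1|lborel. M * \<bar>interface_density \<epsilon> u x - dens \<epsilon> x\<bar>)"
  proof (rule set_integral_mono)
    fix x :: "real^2"
    show "norm (\<phi> x * interface_density \<epsilon> u x - \<phi> x * dens \<epsilon> x) \<le> M * \<bar>interface_density \<epsilon> u x - dens \<epsilon> x\<bar>"
      unfolding right_diff_distrib[symmetric] real_norm_def abs_mult by (rule mult_right_mono[OF \<phi>(2)]) simp
  qed (intro si continuous_intros c)+
  also have "\<dots> = M * (LINT x:ball 0 1|lborel. \<bar>interface_density \<epsilon> u x - dens \<epsilon> x\<bar>)"
    by (rule set_integral_mult_right)
  also have "\<dots> \<le> M * \<eta>" by (rule mult_left_mono[OF \<eta> M0])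
  finally show ?thesis unfolding eq .
qed

text \<open>The estimate for test functions stands inside the existential quantifier, with bound and
  modulus of continuity left open: \<open>u\<close> is fixed for each \<open>\<epsilon>\<close>
  before any test function is known.\<close>

lemma recovery:
  assumes out: "- ball 0 1 \<subseteq> P \<or> - ball 0 1 \<subseteq> Q" and \<eta>: "\<eta> > 0"
    and \<sigma>: "\<sigma> = 1 \<or> \<sigma> = (-1::real)" and tot: "integral {0..L} curv = 2 * pi * \<sigma>" and s: "\<And>r. \<sigma> * f1 r \<ge> 0"
  shows "\<exists>u. real_polynomial_function u \<and> u ` ball 0 1 \<subseteq> {-1..1} \<and>
    \<bar>L_eps \<epsilon> u - L\<bar> \<le> L / c0 * X + 1 / c0 * \<eta> \<and>
    \<bar>T_eps \<epsilon> u - 2 * pi\<bar> \<le> 2 * pi / c0 * ((1 + 2 * \<delta>) * X) + 1 / c0 * \<eta> \<and>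
    \<bar>B_eps \<epsilon> u - integral {0..L} (\<lambda>s. (curv s)\<^sup>2)\<bar> \<le>
      L / c0 * (3 * \<delta> * (X * X / \<epsilon>) + 4 * K * X + 2 * K ^ 4 * (16 * \<epsilon>\<^sup>2 + X) + K\<^sup>2 * X) + 1 / c0 * \<eta> \<and>
    (\<forall>\<phi> M \<rho> \<kappa>. continuous_on UNIV \<phi> \<longrightarrow> (\<forall>x. \<bar>\<phi> x\<bar> \<le> M) \<longrightarrow> \<rho> > 0 \<longrightarrow> \<kappa> \<ge> 0 \<longrightarrow>
      (\<forall>x y. dist x y \<le> \<rho> \<longrightarrow> \<bar>\<phi> x - \<phi> y\<bar> \<le> \<kappa>) \<longrightarrow>
      \<bar>(\<integral>x. \<phi> x \<partial>interface_measure \<epsilon> u) - integral {0..L} (\<lambda>s. \<phi> (g s))\<bar> \<le>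
        1 / c0 * (L * (M * X + (3 / 2 * \<kappa> * (c0 + X) + 3 * M / \<rho>\<^sup>2 * (16 * \<epsilon>\<^sup>2 + X + 2 * \<delta> ^ 3 * X)))) + 1 / c0 * (M * \<eta>))"
proof -
  have tri: "\<bar>1 / c0 * a - z\<bar> \<le> B + 1 / c0 * D" if "\<bar>1 / c0 * b - z\<bar> \<le> B" "\<bar>a - b\<bar> \<le> D" for a b z B D
  proof -
    have "\<bar>1 / c0 * a - 1 / c0 * b\<bar> = 1 / c0 * \<bar>a - b\<bar>" using c0_pos by (simp add: diff_divide_distrib[symmetric] abs_divide)
    also have "\<dots> \<le> 1 / c0 * D" using that(2) c0_pos by (intro mult_left_mono) auto
    finally show ?thesis using that(1) by linarith
  qed
  obtain u where u: "real_polynomial_function u" "u ` ball 0 1 \<subseteq> {-1..1}"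
    "(LINT x:ball 0 1|lborel. \<bar>interface_density \<epsilon> u x - dens \<epsilon> x\<bar>) \<le> \<eta>"
    "\<bar>(LINT x:ball 0 1|lborel. turning_density \<epsilon> u x) - (LINT x:ball 0 1|lborel. pot \<epsilon> x * slope x)\<bar> \<le> \<eta>"
    "\<bar>(LINT x:ball 0 1|lborel. bending_density \<epsilon> u x) - (LINT x:ball 0 1|lborel. 1 / \<epsilon> * (pot \<epsilon> x)\<^sup>2)\<bar> \<le> \<eta>"
    using smooth_approximation[OF out \<eta>] by blast
  show ?thesis
  proof (intro exI[of _ u] conjI allI impI)
    \<comment> \<open>The length is the case of the test function \<open>1\<close>.\<close>
    have "\<bar>(LINT x:ball 0 1|lborel. interface_density \<epsilon> u x) - (LINT x:ball 0 1|lborel. dens \<epsilon> x)\<bar> \<le> \<eta>"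
      using test_difference[OF u(1) continuous_on_const[of _ 1] _ u(3), of 1] by simp
    then show "\<bar>L_eps \<epsilon> u - L\<bar> \<le> L / c0 * X + 1 / c0 * \<eta>"
      unfolding L_eps_def by (rule tri[OF length_estimate])
    show "\<bar>T_eps \<epsilon> u - 2 * pi\<bar> \<le> 2 * pi / c0 * ((1 + 2 * \<delta>) * X) + 1 / c0 * \<eta>"
      unfolding T_eps_def by (rule tri[OF turning_estimate[OF \<sigma> tot s] u(4)])
    show "\<bar>B_eps \<epsilon> u - integral {0..L} (\<lambda>s. (curv s)\<^sup>2)\<bar> \<le>
      L / c0 * (3 * \<delta> * (X * X / \<epsilon>) + 4 * K * X + 2 * K ^ 4 * (16 * \<epsilon>\<^sup>2 + X) + K\<^sup>2 * X) + 1 / c0 * \<eta>"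
      unfolding B_eps_def by (rule tri[OF bending_estimate u(5)])
  next
    fix \<phi> :: "real^2 \<Rightarrow> real" and M \<rho> \<kappa>
    assume h: "continuous_on UNIV \<phi>" "\<forall>x. \<bar>\<phi> x\<bar> \<le> M" "\<rho> > 0" "\<kappa> \<ge> 0"
      "\<forall>x y. dist x y \<le> \<rho> \<longrightarrow> \<bar>\<phi> x - \<phi> y\<bar> \<le> \<kappa>"
    define Z where "Z = L * (M * X + (3 / 2 * \<kappa> * (c0 + X) + 3 * M / \<rho>\<^sup>2 * (16 * \<epsilon>\<^sup>2 + X + 2 * \<delta> ^ 3 * X)))"
    have M: "\<And>x. \<bar>\<phi> x\<bar> \<le> M" and uc: "\<And>x y. dist x y \<le> \<rho> \<Longrightarrow> \<bar>\<phi> x - \<phi> y\<bar> \<le> \<kappa>" using h by auto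
    have "\<bar>(LINT x:ball 0 1|lborel. \<phi> x * dens \<epsilon> x) - c0 * integral {0..L} (\<lambda>s. \<phi> (g s))\<bar> \<le> Z"
      unfolding Z_def by (rule test_estimate[OF h(1) M h(3,4) uc])
    then have "1 / c0 * \<bar>(LINT x:ball 0 1|lborel. \<phi> x * dens \<epsilon> x) - c0 * integral {0..L} (\<lambda>s. \<phi> (g s))\<bar> \<le> 1 / c0 * Z"
      using c0_pos by (intro mult_left_mono) auto
    moreover have "\<bar>1 / c0 * b - z\<bar> = 1 / c0 * \<bar>b - c0 * z\<bar>" for b z
    proof -
      have "1 / c0 * b - z = (b - c0 * z) / c0" using c0_pos by (simp add: field_simps)
      then show ?thesis using c0_pos by (simp add: abs_divide)
    qed
    ultimately have "\<bar>1 / c0 * (LINT x:ball 0 1|lborel. \<phi> x * dens \<epsilon> x) - integral {0..L} (\<lambda>s. \<phi> (g s))\<bar> \<le> 1 / c0 * Z"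
      by simp
    from tri[OF this test_difference[OF u(1) h(1) M u(3)]]
    show "\<bar>(\<integral>x. \<phi> x \<partial>interface_measure \<epsilon> u) - integral {0..L} (\<lambda>s. \<phi> (g s))\<bar> \<le>
        1 / c0 * (L * (M * X + (3 / 2 * \<kappa> * (c0 + X) + 3 * M / \<rho>\<^sup>2 * (16 * \<epsilon>\<^sup>2 + X + 2 * \<delta> ^ 3 * X)))) + 1 / c0 * (M * \<eta>)"
      unfolding integral_interface_measure[OF u(1) \<epsilon> h(1)] Z_def .
  qed (use u in auto)
qed

end

section \<open>Total curvature, limit measure and the family\<close>

context simple_closed_C2_curve
begin

text \<open>In complex notation \<open>g2 = i \<kappa> g1\<close>, so the integrand of the
  Umlaufsatz is \<open>i \<kappa>\<close>.\<close>

lemma total_curvature: obtains \<sigma> where "\<sigma> = 1 \<or> \<sigma> = (-1::real)" "integral {0..L} curv = 2 * pi * \<sigma>"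
proof -
  define cx where "cx w = Complex (w$1) (w$2)" for w :: "real^2"
  have bl: "bounded_linear cx"
    unfolding linear_conv_bounded_linear[symmetric]
    by (rule linearI) (simp_all add: cx_def complex_eq_iff)
  have rot: "cx (rot w) = \<i> * cx w" for w by (simp add: cx_def complex_eq_iff)
  have sc: "cx (a *\<^sub>R w) = of_real a * cx w" for a w by (simp add: cx_def complex_eq_iff)
  have inj_cx: "w = w'" if "cx w = cx w'" for w w' using that by (auto simp: cx_def intro: vec2_eqI)
  have nz: "cx (g1 t) \<noteq> 0" for t
  proof
    assume "cx (g1 t) = 0"
    then have "g1 t = 0" by (intro inj_cx) (simp add: cx_def complex_eq_iff)
    then show False using unit[of t] by simp
  qed
  have "\<exists>\<sigma>\<in>{1, -1 :: real}. ((\<lambda>t. cx (g2 t) / cx (g1 t)) has_integral (2 * pi * \<sigma> * \<i>)) {0..L}"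
  proof (rule umlaufsatz[where c = "\<lambda>t. cx (g t)"])
    show "continuous_on UNIV (\<lambda>t. cx (g2 t))"
      by (rule continuous_on_compose2[OF linear_continuous_on[OF bl] cont_g2]) auto
    show "\<exists>k::int. t = s + of_int k * L" if "cx (g s) = cx (g t)" for s t
      using inj_mod[OF inj_cx[OF that]] by blast
  qed (auto simp: L_pos per per1 per2 nz intro!: bounded_linear.has_vector_derivative[OF bl] deriv_g deriv_g1)
  then obtain \<sigma> :: real where \<sigma>: "\<sigma> = 1 \<or> \<sigma> = -1"
    "((\<lambda>t. cx (g2 t) / cx (g1 t)) has_integral (2 * pi * \<sigma> * \<i>)) {0..L}" by blast
  have cx_g2: "cx (g2 t) = of_real (curv t) * \<i> * cx (g1 t)" for t
    by (simp only: g2_eq[of t] sc nrm_def rot mult.assoc)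
  have "(\<lambda>t. cx (g2 t) / cx (g1 t)) = (\<lambda>t. of_real (curv t) * \<i>)"
    by (rule ext, subst cx_g2) (rule nonzero_mult_div_cancel_right[OF nz])
  with \<sigma>(2) have "((\<lambda>t. of_real (curv t) * \<i>) has_integral (2 * pi * \<sigma> * \<i>)) {0..L}"
    by (rule subst[rotated, where P = "\<lambda>h. (h has_integral (2 * pi * \<sigma> * \<i>)) {0..L}"])
  from has_integral_linear[OF this bounded_linear_Im]
  have "((Im \<circ> (\<lambda>t. of_real (curv t) * \<i>)) has_integral Im (2 * pi * \<sigma> * \<i>)) {0..L}" .
  moreover have "Im (of_real a * \<i>) = a" for a :: real by simp
  then have "Im \<circ> (\<lambda>t. of_real (curv t) * \<i>) = curv" by (intro ext) (simp only: o_apply)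
  moreover have "Im (2 * pi * \<sigma> * \<i>) = 2 * pi * \<sigma>" by simp
  ultimately have "(curv has_integral 2 * pi * \<sigma>) {0..L}" by (simp only:)
  then show ?thesis by (rule that[OF \<sigma>(1) integral_unique])
qed

lemma hausdorff_curve: "restrict_measure hausdorff1 (g ` {0..L}) = distr (restrict_space lborel {0..<L}) borel g"
  by (rule restrict_hausdorff1_simple_closed_curve[OF L_pos lipschitz_g inj _ locally_bilipschitz]) (use per[of 0] in auto)

lemma measurable_g: "g \<in> measurable (restrict_space lborel {0..<L}) borel"
  by (rule measurable_restrict_space1) (use borel_measurable_continuous_onI[OF cont_g] in simp)

text \<open>Push-forward turns the integral into one over the arc length; \<open>{0..<L}\<close> and
  \<open>{0..L}\<close> differ by a point.\<close>

lemma integral_hausdorff_curve: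
  fixes \<phi> :: "real^2 \<Rightarrow> real"
  assumes \<phi>: "continuous_on UNIV \<phi>"
  shows "(\<integral>x. \<phi> x \<partial>restrict_measure hausdorff1 (g ` {0..L})) = integral {0..L} (\<lambda>s. \<phi> (g s))"
proof -
  have cont: "continuous_on A (\<lambda>s. \<phi> (g s))" for A
    by (rule continuous_on_compose2[OF \<phi> cont_g]) auto
  have "(\<integral>x. \<phi> x \<partial>restrict_measure hausdorff1 (g ` {0..L})) = (LINT s:{0..<L}|lborel. \<phi> (g s))"
    unfolding hausdorff_curve set_lebesgue_integral_def
    by (subst integral_distr[OF measurable_g borel_measurable_continuous_onI[OF \<phi>]], subst integral_restrict_space) auto
  also have "\<dots> = integral {0..<L} (\<lambda>s. \<phi> (g s))"
  proof (rule set_borel_integral_eq_integral(2))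
    have "set_integrable lborel {0..L} (\<lambda>s. \<phi> (g s))"
      unfolding set_integrable_def by (rule borel_integrable_compact) (auto intro: cont)
    then show "set_integrable lborel {0..<L} (\<lambda>s. \<phi> (g s))" by (rule set_integrable_subset) auto
  qed
  also have "\<dots> = integral {0..L} (\<lambda>s. \<phi> (g s))"
  proof (rule integral_spike_set)
    have "{s \<in> {0..<L} - {0..L}. \<phi> (g s) \<noteq> 0} \<subseteq> {L}" "{s \<in> {0..L} - {0..<L}. \<phi> (g s) \<noteq> 0} \<subseteq> {L}" by auto
    then show "negligible {s \<in> {0..<L} - {0..L}. \<phi> (g s) \<noteq> 0}" "negligible {s \<in> {0..L} - {0..<L}. \<phi> (g s) \<noteq> 0}"
      by (meson negligible_sing negligible_subset)+
  qed
  finally show ?thesis .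
qed

lemma radon_hausdorff_curve: "radon_measure (restrict_measure hausdorff1 (g ` {0..L}))"
  unfolding radon_measure_def hausdorff_curve
proof (intro conjI allI impI)
  fix A :: "(real^2) set"
  let ?M = "distr (restrict_space lborel {0..<L}) borel g"
  have "emeasure ?M A \<le> emeasure ?M (space ?M)" by (rule emeasure_space)
  also have "\<dots> = emeasure (restrict_space lborel {0..<L}) (space (restrict_space lborel {0..<L}))"
    using emeasure_distr[OF measurable_g, of UNIV] by simp
  also have "\<dots> = emeasure lborel {0..<L}" by (subst emeasure_restrict_space) auto
  also have "\<dots> < \<infinity>" using L_pos by simp
  finally show "emeasure ?M A < \<infinity>" .
qed simp

text \<open>Convergence is obtained for bounded uniformly continuous test functions, the class on
  which the estimate in \<open>recovery\<close> can be made small.\<close>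

lemma recovery_family:
  assumes ball: "\<And>t. g t \<in> ball 0 1"
  obtains u :: "real \<Rightarrow> real^2 \<Rightarrow> real" and Y1 Y2 Y3 :: "real \<Rightarrow> real" and C :: real where
    "\<And>\<epsilon>. \<epsilon> > 0 \<Longrightarrow> real_polynomial_function (u \<epsilon>)" "\<And>\<epsilon>. \<epsilon> > 0 \<Longrightarrow> u \<epsilon> ` ball 0 1 \<subseteq> {-1..1}"
    "exponentially_small Y1" "exponentially_small Y2" "exponentially_small Y3"
    "\<And>\<epsilon>. \<epsilon> > 0 \<Longrightarrow> \<bar>L_eps \<epsilon> (u \<epsilon>) - L\<bar> \<le> Y1 \<epsilon>" "\<And>\<epsilon>. \<epsilon> > 0 \<Longrightarrow> \<bar>T_eps \<epsilon> (u \<epsilon>) - 2 * pi\<bar> \<le> Y2 \<epsilon>"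
    "\<And>\<epsilon>. \<epsilon> > 0 \<Longrightarrow> \<bar>B_eps \<epsilon> (u \<epsilon>) - integral {0..L} (\<lambda>s. (curv s)\<^sup>2)\<bar> \<le> C * \<epsilon>\<^sup>2 + Y3 \<epsilon>"
    "\<And>\<phi> :: real^2 \<Rightarrow> real. uniformly_continuous_on UNIV \<phi> \<Longrightarrow> bounded (range \<phi>) \<Longrightarrow>
      ((\<lambda>\<epsilon>. \<integral>x. \<phi> x \<partial>interface_measure \<epsilon> (u \<epsilon>)) \<longlongrightarrow> integral {0..L} (\<lambda>s. \<phi> (g s))) (at_right 0)"
proof -
  obtain \<delta> K where tube: "\<delta> > 0" "\<And>t. \<bar>curv t\<bar> \<le> K" "K * \<delta> \<le> 1 / 2"
    "\<And>s t r r'. \<bar>r\<bar> \<le> \<delta> \<Longrightarrow> \<bar>r'\<bar> \<le> \<delta> \<Longrightarrow> g s + r *\<^sub>R nrm s = g t + r' *\<^sub>R nrm t \<Longrightarrow>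
       r = r' \<and> (\<exists>k::int. t = s + of_int k * L)"
    "\<And>s r. \<bar>r\<bar> \<le> \<delta> \<Longrightarrow> norm (g s + r *\<^sub>R nrm s) < 1"
    using tube_exists[OF ball] by blast
  interpret tube L g g1 g2 \<delta> K by unfold_locales (fact tube)+
  obtain P Q where PQ: "open P" "open Q" "P \<inter> Q = {}" "P \<union> Q = - range g"
    "\<And>p. p \<in> strip \<Longrightarrow> p$2 > 0 \<Longrightarrow> Phi p \<in> P" "\<And>p. p \<in> strip \<Longrightarrow> p$2 < 0 \<Longrightarrow> Phi p \<in> Q"
    and out: "- ball 0 1 \<subseteq> P \<or> - ball 0 1 \<subseteq> Q"
    using sides by blast
  obtain \<sigma> where \<sigma>: "\<sigma> = 1 \<or> \<sigma> = (-1::real)" and tot: "integral {0..L} curv = 2 * pi * \<sigma>"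
    by (rule total_curvature)
  obtain q q1 q2 :: "real \<Rightarrow> real \<Rightarrow> real" and X :: "real \<Rightarrow> real"
    where X: "exponentially_small X" "\<And>\<epsilon>. \<epsilon> > 0 \<Longrightarrow> X \<epsilon> \<ge> 0"
    and dq: "\<And>\<epsilon> r. \<epsilon> > 0 \<Longrightarrow> (q \<epsilon> has_real_derivative q1 \<epsilon> r) (at r)"
      "\<And>\<epsilon> r. \<epsilon> > 0 \<Longrightarrow> (q1 \<epsilon> has_real_derivative q2 \<epsilon> r) (at r)"
      "\<And>\<epsilon>. \<epsilon> > 0 \<Longrightarrow> continuous_on UNIV (q2 \<epsilon>)"
    and q1: "\<And>\<epsilon> r. \<epsilon> > 0 \<Longrightarrow> \<bar>q \<epsilon> r\<bar> \<le> 1" "\<And>\<epsilon> r. \<epsilon> > 0 \<Longrightarrow> q1 \<epsilon> r \<ge> 0"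
    and qc: "\<And>\<epsilon> r. \<epsilon> > 0 \<Longrightarrow> r \<ge> 4 * \<delta> / 5 \<Longrightarrow> q \<epsilon> r = 1"
      "\<And>\<epsilon> r. \<epsilon> > 0 \<Longrightarrow> r \<le> - (4 * \<delta> / 5) \<Longrightarrow> q \<epsilon> r = - 1"
      "\<And>\<epsilon> r. \<epsilon> > 0 \<Longrightarrow> \<bar>r\<bar> \<ge> 4 * \<delta> / 5 \<Longrightarrow> q1 \<epsilon> r = 0"
      "\<And>\<epsilon> r. \<epsilon> > 0 \<Longrightarrow> \<bar>r\<bar> \<ge> 4 * \<delta> / 5 \<Longrightarrow> q2 \<epsilon> r = 0"
    and qo: "\<And>\<epsilon> r. \<epsilon> > 0 \<Longrightarrow> q \<epsilon> (- r) = - q \<epsilon> r" "\<And>\<epsilon> r. \<epsilon> > 0 \<Longrightarrow> q1 \<epsilon> (- r) = q1 \<epsilon> r"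
      "\<And>\<epsilon> r. \<epsilon> > 0 \<Longrightarrow> q2 \<epsilon> (- r) = - q2 \<epsilon> r"
    and qe: "\<And>\<epsilon> r. \<epsilon> > 0 \<Longrightarrow> \<bar>- \<epsilon> * q2 \<epsilon> r + deriv W (q \<epsilon> r) / \<epsilon>\<bar> \<le> X \<epsilon>"
      "\<And>\<epsilon> r. \<epsilon> > 0 \<Longrightarrow> \<bar>(\<epsilon> / 2 * (q1 \<epsilon> r)\<^sup>2 + W (q \<epsilon> r) / \<epsilon>) - \<epsilon> * (q1 \<epsilon> r)\<^sup>2\<bar> \<le> X \<epsilon>"
      "\<And>\<epsilon>. \<epsilon> > 0 \<Longrightarrow> \<bar>integral {-\<delta>..\<delta>} (\<lambda>r. \<epsilon> / 2 * (q1 \<epsilon> r)\<^sup>2 + W (q \<epsilon> r) / \<epsilon>) - c0\<bar> \<le> X \<epsilon>"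
      "\<And>\<epsilon>. \<epsilon> > 0 \<Longrightarrow> \<bar>integral {-\<delta>..\<delta>} (\<lambda>r. \<epsilon> * (q1 \<epsilon> r)\<^sup>2) - c0\<bar> \<le> X \<epsilon>"
      "\<And>\<epsilon>. \<epsilon> > 0 \<Longrightarrow> integral {-\<delta>..\<delta>} (\<lambda>r. \<epsilon> * (q1 \<epsilon> r)\<^sup>2 * r\<^sup>2) \<le> 16 * \<epsilon>\<^sup>2 + X \<epsilon>"
    by (rule optimal_profile[OF tube(1)]) (rule that; assumption)
  have \<sigma>2: "\<sigma>\<^sup>2 = 1" using \<sigma> by auto
  have W\<sigma>: "W (\<sigma> * r) = W r" for r by (simp add: W_def power_mult_distrib \<sigma>2)
  have dW\<sigma>: "- \<epsilon> * (\<sigma> * b) + deriv W (\<sigma> * r) / \<epsilon> = \<sigma> * (- \<epsilon> * b + deriv W r / \<epsilon>)" for r b \<epsilon>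
  proof -
    have "deriv W (\<sigma> * r) = \<sigma> * deriv W r" using \<sigma> by (auto simp: deriv_W)
    then show ?thesis by (simp add: algebra_simps)
  qed
  have \<sigma>abs: "\<bar>\<sigma> * r\<bar> = \<bar>r\<bar>" for r using \<sigma> by auto
  \<comment> \<open>The factor \<open>\<sigma>\<close> exchanges the two phases when the total
    curvature is negative. \<open>W\<close> is even, so every defect keeps its size and only the
    slope changes sign.\<close>
  have opt: "optimal L g g1 g2 \<delta> K (\<lambda>r. \<sigma> * q \<epsilon> r) (\<lambda>r. \<sigma> * q1 \<epsilon> r) (\<lambda>r. \<sigma> * q2 \<epsilon> r) P Q \<epsilon> (X \<epsilon>)"
    if e: "\<epsilon> > 0" for \<epsilon>
  proof (intro optimal.intro phase.intro phase_axioms.intro optimal_axioms.intro tube_axioms PQ)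
    have d: "q \<epsilon> \<delta> = 1" "q \<epsilon> (- \<delta>) = -1" using qc(1,2)[OF e] tube(1) by auto
    show "((\<lambda>r. \<sigma> * q \<epsilon> r) has_real_derivative \<sigma> * q1 \<epsilon> r) (at r)"
      "((\<lambda>r. \<sigma> * q1 \<epsilon> r) has_real_derivative \<sigma> * q2 \<epsilon> r) (at r)" for r
      by (intro DERIV_cmult dq e)+
    show "continuous_on UNIV (\<lambda>r. \<sigma> * q2 \<epsilon> r)" by (intro continuous_intros dq e)
    show "\<sigma> * q \<epsilon> r = \<sigma> * q \<epsilon> \<delta>" if "r \<ge> 4 * \<delta> / 5" for r using qc(1)[OF e that] d by simp
    show "\<sigma> * q \<epsilon> r = \<sigma> * q \<epsilon> (- \<delta>)" if "r \<le> - (4 * \<delta> / 5)" for r using qc(2)[OF e that] d by simp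
    show "\<sigma> * q1 \<epsilon> r = 0" "\<sigma> * q2 \<epsilon> r = 0" if "\<bar>r\<bar> \<ge> 4 * \<delta> / 5" for r using qc(3,4)[OF e that] by simp_all
    show "\<bar>\<sigma> * q \<epsilon> r\<bar> \<le> 1" for r unfolding \<sigma>abs by (rule q1(1)[OF e])
    show "\<bar>\<sigma> * q \<epsilon> \<delta>\<bar> = 1" unfolding \<sigma>abs d by simp
    show "(\<forall>r. 0 \<le> \<sigma> * q1 \<epsilon> r) \<or> (\<forall>r. \<sigma> * q1 \<epsilon> r \<le> 0)" using \<sigma> q1(2)[OF e] by auto
    show "\<bar>- \<epsilon> * (\<sigma> * q2 \<epsilon> r) + deriv W (\<sigma> * q \<epsilon> r) / \<epsilon>\<bar> \<le> X \<epsilon>" for r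
      unfolding dW\<sigma> \<sigma>abs by (rule qe(1)[OF e])
  qed (simp_all only: power_mult_distrib \<sigma>2 W\<sigma> mult_1 e X(2) qo(1,2,3)[OF e] qe[OF e] minus_mult_right)
  \<comment> \<open>\<open>A\<close>, \<open>B\<close>, \<open>Y1\<close> and \<open>Y2\<close> are
    the bounds of \<open>recovery\<close> for the smoothing tolerance
    \<open>exp (- 1 / \<epsilon>)\<close>, which is positive and itself exponentially small.\<close>
  define A where "A e = L / c0 * (3 * \<delta> * (X e * X e / e) + 4 * K * X e + 2 * K ^ 4 * (16 * e\<^sup>2 + X e) + K\<^sup>2 * X e) + 1 / c0 * exp (- 1 / e)" for e
  define B where "B M \<kappa> \<rho> e = 1 / c0 * (L * (M * X e + (3 / 2 * \<kappa> * (c0 + X e) + 3 * M / \<rho>\<^sup>2 * (16 * e\<^sup>2 + X e + 2 * \<delta> ^ 3 * X e))))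
     + 1 / c0 * (M * exp (- 1 / e))" for M \<kappa> \<rho> e
  define Y1 where "Y1 e = L / c0 * X e + 1 / c0 * exp (- 1 / e)" for e
  define Y2 where "Y2 e = 2 * pi / c0 * ((1 + 2 * \<delta>) * X e) + 1 / c0 * exp (- 1 / e)" for e
  define G where "G \<epsilon> u \<longleftrightarrow> real_polynomial_function u \<and> u ` ball 0 1 \<subseteq> {-1..1} \<and>
    \<bar>L_eps \<epsilon> u - L\<bar> \<le> Y1 \<epsilon> \<and> \<bar>T_eps \<epsilon> u - 2 * pi\<bar> \<le> Y2 \<epsilon> \<and>
    \<bar>B_eps \<epsilon> u - integral {0..L} (\<lambda>s. (curv s)\<^sup>2)\<bar> \<le> A \<epsilon> \<and>
    (\<forall>\<phi> M \<rho> \<kappa>. continuous_on UNIV \<phi> \<longrightarrow> (\<forall>x. \<bar>\<phi> x\<bar> \<le> M) \<longrightarrow> \<rho> > 0 \<longrightarrow> \<kappa> \<ge> 0 \<longrightarrow>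
      (\<forall>x y. dist x y \<le> \<rho> \<longrightarrow> \<bar>\<phi> x - \<phi> y\<bar> \<le> \<kappa>) \<longrightarrow>
      \<bar>(\<integral>x. \<phi> x \<partial>interface_measure \<epsilon> u) - integral {0..L} (\<lambda>s. \<phi> (g s))\<bar> \<le> B M \<kappa> \<rho> \<epsilon>)" for \<epsilon> u
  have G: "\<exists>u. G \<epsilon> u" if e: "\<epsilon> > 0" for \<epsilon>
  proof -
    have "\<sigma> * (\<sigma> * q1 \<epsilon> r) \<ge> 0" for r using \<sigma> q1(2)[OF e, of r] by auto
    then show ?thesis
      unfolding G_def A_def B_def Y1_def Y2_def by (rule optimal.recovery[OF opt[OF e] out exp_gt_zero \<sigma> tot])
  qed
  obtain u where uG: "\<And>\<epsilon>. \<epsilon> > 0 \<Longrightarrow> G \<epsilon> (u \<epsilon>)" using G by metis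
  have u: "\<And>\<epsilon>. \<epsilon> > 0 \<Longrightarrow> real_polynomial_function (u \<epsilon>)" "\<And>\<epsilon>. \<epsilon> > 0 \<Longrightarrow> u \<epsilon> ` ball 0 1 \<subseteq> {-1..1}"
    "\<And>\<epsilon>. \<epsilon> > 0 \<Longrightarrow> \<bar>L_eps \<epsilon> (u \<epsilon>) - L\<bar> \<le> Y1 \<epsilon>" "\<And>\<epsilon>. \<epsilon> > 0 \<Longrightarrow> \<bar>T_eps \<epsilon> (u \<epsilon>) - 2 * pi\<bar> \<le> Y2 \<epsilon>"
    "\<And>\<epsilon>. \<epsilon> > 0 \<Longrightarrow> \<bar>B_eps \<epsilon> (u \<epsilon>) - integral {0..L} (\<lambda>s. (curv s)\<^sup>2)\<bar> \<le> A \<epsilon>"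
    "\<And>\<epsilon> \<phi> M \<rho> \<kappa>. \<epsilon> > 0 \<Longrightarrow> continuous_on UNIV \<phi> \<Longrightarrow> \<forall>x. \<bar>\<phi> x\<bar> \<le> M \<Longrightarrow> \<rho> > 0 \<Longrightarrow> \<kappa> \<ge> 0 \<Longrightarrow>
      \<forall>x y. dist x y \<le> \<rho> \<longrightarrow> \<bar>\<phi> x - \<phi> y\<bar> \<le> \<kappa> \<Longrightarrow>
      \<bar>(\<integral>x. \<phi> x \<partial>interface_measure \<epsilon> (u \<epsilon>)) - integral {0..L} (\<lambda>s. \<phi> (g s))\<bar> \<le> B M \<kappa> \<rho> \<epsilon>"
    using uG unfolding G_def by blast+
  have ex: "exponentially_small (\<lambda>e. exp (- 1 / e))" using exponentially_small_exp[of 1] by simp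
  note es = exponentially_small_intros X(1) ex
  define Y3 where "Y3 e = L / c0 * (3 * \<delta> * (X e * X e / e) + 4 * K * X e + 2 * K ^ 4 * X e + K\<^sup>2 * X e) + 1 / c0 * exp (- 1 / e)" for e
  \<comment> \<open>Here \<open>32 = 2 * 16\<close>: the moment bound
    \<open>16 * \<epsilon>^2\<close> weighted by \<open>2 * K ^ 4\<close>, the one part of
    \<open>A\<close> that is not exponentially small.\<close>
  define C where "C = L / c0 * (32 * K ^ 4)"
  have A: "A e = C * e\<^sup>2 + Y3 e" for e unfolding A_def C_def Y3_def by (simp add: algebra_simps)
  show ?thesis
  proof (rule that[of u Y1 Y2 Y3 C])
    show "exponentially_small Y1" unfolding Y1_def[abs_def] by (intro es)
    show "exponentially_small Y2" unfolding Y2_def[abs_def] by (intro es)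
    show "exponentially_small Y3" unfolding Y3_def[abs_def] by (intro es)
    fix \<phi> :: "real^2 \<Rightarrow> real" assume \<phi>: "uniformly_continuous_on UNIV \<phi>" "bounded (range \<phi>)"
    obtain M where M: "\<forall>x. \<bar>\<phi> x\<bar> \<le> M" using \<phi>(2) by (auto simp: bounded_iff)
    show "((\<lambda>\<epsilon>. \<integral>x. \<phi> x \<partial>interface_measure \<epsilon> (u \<epsilon>)) \<longlongrightarrow> integral {0..L} (\<lambda>s. \<phi> (g s))) (at_right 0)"
    proof (rule tendstoI)
      fix e :: real assume e: "e > 0"
      \<comment> \<open>As \<open>\<epsilon>\<close> tends to \<open>0\<close> the bound
        \<open>B\<close> tends to \<open>3 / 2 * L * \<kappa>\<close>, which for this choice is
        \<open>e / 2\<close>.\<close>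
      define \<kappa> where "\<kappa> = e / (3 * L)"
      have \<kappa>: "\<kappa> > 0" "3 / 2 * L * \<kappa> < e" using e L_pos by (auto simp: \<kappa>_def)
      obtain \<rho>' where \<rho>': "\<rho>' > 0" "\<And>x y. dist x y < \<rho>' \<Longrightarrow> dist (\<phi> x) (\<phi> y) < \<kappa>"
        using \<phi>(1) \<kappa>(1) by (metis UNIV_I uniformly_continuous_on_def)
      \<comment> \<open>Halving turns the strict inequality of uniform continuity into the
        non-strict one used in \<open>recovery\<close>.\<close>
      define \<rho> where "\<rho> = \<rho>' / 2"
      have \<rho>: "\<rho> > 0" "\<forall>x y. dist x y \<le> \<rho> \<longrightarrow> \<bar>\<phi> x - \<phi> y\<bar> \<le> \<kappa>"
      proof -
        show "\<rho> > 0" using \<rho>' by (simp add: \<rho>_def)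
        show "\<forall>x y. dist x y \<le> \<rho> \<longrightarrow> \<bar>\<phi> x - \<phi> y\<bar> \<le> \<kappa>"
        proof (intro allI impI)
          fix x y :: "real^2" assume "dist x y \<le> \<rho>"
          then have "dist x y < \<rho>'" using \<rho>'(1) by (simp add: \<rho>_def)
          from \<rho>'(2)[OF this] show "\<bar>\<phi> x - \<phi> y\<bar> \<le> \<kappa>" by (simp add: dist_real_def)
        qed
      qed
      have lim: "(X \<longlongrightarrow> 0) (at_right 0)" "((\<lambda>e. exp (- 1 / e)) \<longlongrightarrow> 0) (at_right (0::real))"
        using exponentially_small_tendsto_0 X(1) ex by blast+
      have "(B M \<kappa> \<rho> \<longlongrightarrow> 1 / c0 * (L * (M * 0 + (3 / 2 * \<kappa> * (c0 + 0) + 3 * M / \<rho>\<^sup>2 * (16 * 0\<^sup>2 + 0 + 2 * \<delta> ^ 3 * 0))))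
          + 1 / c0 * (M * 0)) (at_right 0)"
        unfolding B_def[abs_def] by (intro tendsto_const tendsto_add tendsto_mult tendsto_power tendsto_ident_at lim)
      then have "(B M \<kappa> \<rho> \<longlongrightarrow> 3 / 2 * L * \<kappa>) (at_right 0)" using c0_pos by (simp add: mult_ac)
      from order_tendstoD(2)[OF this \<kappa>(2)]
      show "\<forall>\<^sub>F x in at_right 0. dist (\<integral>y. \<phi> y \<partial>interface_measure x (u x)) (integral {0..L} (\<lambda>s. \<phi> (g s))) < e"
        using eventually_at_right_less[of "0::real"]
      proof eventually_elim
        case (elim x)
        have "continuous_on UNIV \<phi>" using \<phi>(1) by (rule uniformly_continuous_imp_continuous)
        from u(6)[OF elim(2) this M \<rho>(1) less_imp_le[OF \<kappa>(1)] \<rho>(2)] elim(1)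
        show ?case by (simp add: dist_real_def)
      qed
    qed
  qed (use u A in auto)
qed

end

section \<open>From the given curve to its periodic extension\<close>

lemma curve_deriv_eq:
  assumes L: "L > 0" and d: "(g has_vector_derivative d) (at s)" and eq: "\<And>t. t \<in> {0..L} \<Longrightarrow> g t = \<gamma> t" and s: "s \<in> {0..L}"
  shows "curve_deriv L \<gamma> s = d"
proof -
  have "(g has_vector_derivative d) (at s within {0..L})" using d by (rule has_vector_derivative_at_within)
  then have "(\<gamma> has_vector_derivative d) (at s within {0..L})"
    by (rule has_vector_derivative_transform[OF s, rotated]) (use eq in auto)
  then show ?thesis
    unfolding curve_deriv_def using vector_derivative_within_cbox[of 0 L s \<gamma> d] L s by (simp add: cbox_interval)
qed

text \<open>The curve is given on \<open>{0..L}\<close> only. Its extension turns the one-sided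
  derivatives at the ends into two-sided ones, and periodicity spreads unit speed and the inclusion
  in the disk to all parameters.\<close>

lemma M_curves_parametrization:
  assumes L: "L > 0" and \<gamma>: "\<gamma> \<in> M_curves L"
  obtains g g1 g2 where "simple_closed_C2_curve L g g1 g2" "\<And>t. t \<in> {0..L} \<Longrightarrow> g t = \<gamma> t"
    "\<And>t. g t \<in> ball 0 1" "elastica_energy L \<gamma> = integral {0..L} (\<lambda>s. (simple_closed_C2_curve.curv g1 g2 s)\<^sup>2)"
proof -
  obtain g g1 g2 where g: "\<And>t. (g has_vector_derivative g1 t) (at t)"
    "\<And>t. (g1 has_vector_derivative g2 t) (at t)" "continuous_on UNIV g2" "\<And>t. g (t + L) = g t"
    "\<And>t. t \<in> {0..L} \<Longrightarrow> g t = \<gamma> t"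
    using \<gamma> unfolding M_curves_def closed_C2_curve_def C2_curve_def by blast
  have per1: "g1 (t + L) = g1 t" for t by (rule has_vector_derivative_periodic[OF g(1,4)])
  have d1: "curve_deriv L \<gamma> s = g1 s" if "s \<in> {0..L}" for s by (rule curve_deriv_eq[OF L g(1,5) that])
  have d2: "curve_deriv L (curve_deriv L \<gamma>) s = g2 s" if "s \<in> {0..L}" for s
    by (rule curve_deriv_eq[OF L g(2) d1[symmetric] that])
  have red: "\<exists>k::int. t + of_int k * L \<in> {0..L}" for t
  proof -
    obtain k :: int where "0 \<le> t + of_int k * L" "t + of_int k * L < 0 + L" by (rule shift_into_period[OF L])
    then show ?thesis by (intro exI[of _ k]) simp
  qed
  have unit: "norm (g1 t) = 1" for t
  proof -
    obtain k :: int where k: "t + of_int k * L \<in> {0..L}" using red by blast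
    have "norm (g1 (t + of_int k * L)) = 1"
      unfolding d1[OF k, symmetric] using \<gamma> k unfolding M_curves_def by blast
    then show ?thesis by (simp only: periodic_int[of g1, OF per1])
  qed
  have ball: "g t \<in> ball 0 1" for t
  proof -
    obtain k :: int where k: "t + of_int k * L \<in> {0..L}" using red by blast
    have "g (t + of_int k * L) \<in> ball 0 1"
      unfolding g(5)[OF k] using \<gamma> k unfolding M_curves_def by blast
    then show ?thesis by (simp only: periodic_int[of g, OF g(4)])
  qed
  have "inj_on g {0..<L}" using \<gamma> g(5) by (auto simp: M_curves_def inj_on_def)
  then interpret simple_closed_C2_curve L g g1 g2 by unfold_locales (use L g unit in auto)
  have "elastica_energy L \<gamma> = (LINT s:{0..L}|lborel. (curv s)\<^sup>2)"
    unfolding elastica_energy_def by (intro set_lebesgue_integral_cong) (simp_all add: d2 norm_g2)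
  also have "\<dots> = integral {0..L} (\<lambda>s. (curv s)\<^sup>2)"
  proof (rule set_borel_integral_eq_integral(2))
    show "set_integrable lborel {0..L} (\<lambda>s. (curv s)\<^sup>2)"
      unfolding set_integrable_def by (rule borel_integrable_compact) (auto intro!: continuous_intros cont_curv)
  qed
  finally show ?thesis using that g(5) ball simple_closed_C2_curve_axioms by blast
qed

lemma compact_support_uniformly_continuous:
  fixes \<phi> :: "'a::euclidean_space \<Rightarrow> real"
  assumes cont: "continuous_on UNIV \<phi>" and supp: "compact (closure {x. \<phi> x \<noteq> 0})"
  shows "uniformly_continuous_on UNIV \<phi>" "bounded (range \<phi>)"
proof -
  obtain R where "\<And>x. x \<in> closure {x. \<phi> x \<noteq> 0} \<Longrightarrow> norm x \<le> R"
    using compact_imp_bounded[OF supp] by (auto simp: bounded_iff)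
  then have R: "\<phi> x = 0" if "norm x > R" for x
    using that closure_subset[of "{x. \<phi> x \<noteq> 0}"] by (metis (mono_tags) linorder_not_less mem_Collect_eq subsetD)
  have c: "continuous_on A \<phi>" for A using cont by (rule continuous_on_subset) simp
  \<comment> \<open>The margin \<open>1\<close> in the radius: two points closer than
    \<open>1\<close> either both lie in this ball or both lie beyond \<open>R\<close>, where
    \<open>\<phi>\<close> vanishes.\<close>
  have "uniformly_continuous_on (cball 0 (R + 1)) \<phi>" by (rule compact_uniformly_continuous[OF c compact_cball])
  note uc = this[unfolded uniformly_continuous_on_def, rule_format]
  show "uniformly_continuous_on UNIV \<phi>"
    unfolding uniformly_continuous_on_def
  proof (intro allI impI)
    fix e :: real assume e: "e > 0"
    from uc[OF e] obtain d where d: "d > 0"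
      "\<And>x y. x \<in> cball 0 (R + 1) \<Longrightarrow> y \<in> cball 0 (R + 1) \<Longrightarrow> dist y x < d \<Longrightarrow> dist (\<phi> y) (\<phi> x) < e" by blast
    have "dist (\<phi> y) (\<phi> x) < e" if "dist y x < min d 1" for x y
    proof (cases "norm x \<le> R + 1 \<and> norm y \<le> R + 1")
      case True
      then show ?thesis using d(2)[of x y] that by simp
    next
      case False
      have "\<bar>norm y - norm x\<bar> < 1" using norm_triangle_ineq3[of y x] that by (simp add: dist_norm)
      then have "norm x > R" "norm y > R" using False by linarith+
      then show ?thesis using R e by simp
    qed
    then show "\<exists>d>0. \<forall>x\<in>UNIV. \<forall>y\<in>UNIV. dist y x < d \<longrightarrow> dist (\<phi> y) (\<phi> x) < e"
      using d(1) by (intro exI[of _ "min d 1"]) auto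
  qed
  have "range \<phi> \<subseteq> insert 0 (\<phi> ` cball 0 R)"
  proof
    fix y assume "y \<in> range \<phi>"
    then obtain x where "y = \<phi> x" by blast
    then show "y \<in> insert 0 (\<phi> ` cball 0 R)" using R[of x] by (cases "norm x > R") auto
  qed
  moreover have "bounded (insert 0 (\<phi> ` cball 0 R))"
    unfolding bounded_insert by (intro compact_imp_bounded compact_continuous_image c compact_cball)
  ultimately show "bounded (range \<phi>)" using bounded_subset by blast
qed

theorem lemma4p1:
  fixes L :: real and \<gamma> :: "real \<Rightarrow> real^2"
  assumes "L > 0" and "\<gamma> \<in> M_curves L"
  shows "\<exists>u :: real \<Rightarrow> real^2 \<Rightarrow> real. \<exists>R_L R_T R_B :: real \<Rightarrow> real.
    (\<forall>\<epsilon>>0. smooth_on (ball 0 1) (u \<epsilon>) \<and> u \<epsilon> ` ball 0 1 \<subseteq> {-1..1} \<and>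
       finite_energies \<epsilon> (u \<epsilon>)) \<and>
    radon_converges (\<lambda>\<epsilon>. interface_measure \<epsilon> (u \<epsilon>))
      (restrict_measure hausdorff1 (\<gamma> ` {0..L})) (at_right 0) \<and>
    (\<forall>\<epsilon>>0. L_eps \<epsilon> (u \<epsilon>) = L + R_L \<epsilon> \<and>
       T_eps \<epsilon> (u \<epsilon>) = 2 * pi + R_T \<epsilon> \<and>
       B_eps \<epsilon> (u \<epsilon>) = elastica_energy L \<gamma> + R_B \<epsilon>) \<and>
    exponentially_small R_L \<and> exponentially_small R_T \<and>
    R_B \<in> O[at_right 0](\<lambda>\<epsilon>. \<epsilon>\<^sup>2) \<and>
    (\<forall>\<alpha>>0. \<forall>\<beta>>0.
       ((\<lambda>\<epsilon>. F_eps \<alpha> \<beta> L \<epsilon> (u \<epsilon>)) \<longlongrightarrow> elastica_energy L \<gamma>) (at_right 0))"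
proof -
  obtain g g1 g2 where curve: "simple_closed_C2_curve L g g1 g2" and g: "\<And>t. t \<in> {0..L} \<Longrightarrow> g t = \<gamma> t"
    and ball: "\<And>t. g t \<in> ball 0 1"
    and E: "elastica_energy L \<gamma> = integral {0..L} (\<lambda>s. (simple_closed_C2_curve.curv g1 g2 s)\<^sup>2)"
    using M_curves_parametrization[OF assms] by blast
  interpret simple_closed_C2_curve L g g1 g2 by (fact curve)
  obtain u :: "real \<Rightarrow> real^2 \<Rightarrow> real" and Y1 Y2 Y3 :: "real \<Rightarrow> real" and C :: real where
    u: "\<And>\<epsilon>. \<epsilon> > 0 \<Longrightarrow> real_polynomial_function (u \<epsilon>)" "\<And>\<epsilon>. \<epsilon> > 0 \<Longrightarrow> u \<epsilon> ` ball 0 1 \<subseteq> {-1..1}"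
    and Y: "exponentially_small Y1" "exponentially_small Y2" "exponentially_small Y3"
    and est: "\<And>\<epsilon>. \<epsilon> > 0 \<Longrightarrow> \<bar>L_eps \<epsilon> (u \<epsilon>) - L\<bar> \<le> Y1 \<epsilon>" "\<And>\<epsilon>. \<epsilon> > 0 \<Longrightarrow> \<bar>T_eps \<epsilon> (u \<epsilon>) - 2 * pi\<bar> \<le> Y2 \<epsilon>"
      "\<And>\<epsilon>. \<epsilon> > 0 \<Longrightarrow> \<bar>B_eps \<epsilon> (u \<epsilon>) - integral {0..L} (\<lambda>s. (curv s)\<^sup>2)\<bar> \<le> C * \<epsilon>\<^sup>2 + Y3 \<epsilon>"
    and conv: "\<And>\<phi> :: real^2 \<Rightarrow> real. uniformly_continuous_on UNIV \<phi> \<Longrightarrow> bounded (range \<phi>) \<Longrightarrow>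
      ((\<lambda>\<epsilon>. \<integral>x. \<phi> x \<partial>interface_measure \<epsilon> (u \<epsilon>)) \<longlongrightarrow> integral {0..L} (\<lambda>s. \<phi> (g s))) (at_right 0)"
    by (rule recovery_family[OF ball]) (rule that; assumption)
  define R_L R_T R_B where "R_L \<epsilon> = L_eps \<epsilon> (u \<epsilon>) - L" and "R_T \<epsilon> = T_eps \<epsilon> (u \<epsilon>) - 2 * pi"
    and "R_B \<epsilon> = B_eps \<epsilon> (u \<epsilon>) - elastica_energy L \<gamma>" for \<epsilon>
  have RL: "exponentially_small R_L" and RT: "exponentially_small R_T"
    using est by (auto intro: exponentially_small_le_pos[OF Y(1)] exponentially_small_le_pos[OF Y(2)] simp: R_L_def R_T_def)
  have RB: "R_B \<in> O[at_right 0](\<lambda>\<epsilon>. \<epsilon>\<^sup>2)"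
  proof -
    have "(\<lambda>\<epsilon>. C * \<epsilon>\<^sup>2 + Y3 \<epsilon>) \<in> O[at_right 0](\<lambda>\<epsilon>. \<epsilon>\<^sup>2)"
      by (intro sum_in_bigo exponentially_small_bigo[OF Y(3)]) simp
    moreover have "R_B \<in> O[at_right 0](\<lambda>\<epsilon>. C * \<epsilon>\<^sup>2 + Y3 \<epsilon>)"
    proof (rule bigoI[of _ 1])
      show "\<forall>\<^sub>F \<epsilon> in at_right 0. norm (R_B \<epsilon>) \<le> 1 * norm (C * \<epsilon>\<^sup>2 + Y3 \<epsilon>)"
        using eventually_at_right_less[of "0::real"]
      proof eventually_elim
        case (elim \<epsilon>)
        from est(3)[OF elim] show ?case by (simp add: R_B_def E)
      qed
    qed
    ultimately show ?thesis by (rule landau_o.big_trans[rotated])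
  qed
  \<comment> \<open>The bending part converges by its \<open>\<epsilon>^2\<close> bound; each
    penalty is a power of \<open>\<epsilon>\<close> times the square of an exponentially small
    defect.\<close>
  have F: "((\<lambda>\<epsilon>. F_eps \<alpha> \<beta> L \<epsilon> (u \<epsilon>)) \<longlongrightarrow> elastica_energy L \<gamma>) (at_right 0)" for \<alpha> \<beta>
  proof -
    obtain c where c: "\<forall>\<^sub>F \<epsilon> in at_right 0. norm (R_B \<epsilon>) \<le> c * norm (\<epsilon>\<^sup>2)" using RB by (rule landau_o.bigE)
    have "((\<lambda>\<epsilon>::real. c * norm (\<epsilon>\<^sup>2)) \<longlongrightarrow> 0) (at_right 0)" by (auto intro!: tendsto_eq_intros)
    with c have "(R_B \<longlongrightarrow> 0) (at_right 0)" by (rule Lim_null_comparison)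
    then have "((\<lambda>\<epsilon>. (elastica_energy L \<gamma> + R_B \<epsilon>) + \<epsilon> powr (- \<alpha>) * (R_L \<epsilon>)\<^sup>2 + \<epsilon> powr (- \<beta>) * (R_T \<epsilon>)\<^sup>2)
        \<longlongrightarrow> (elastica_energy L \<gamma> + 0) + 0 + 0) (at_right 0)"
      by (intro tendsto_add tendsto_const exponentially_small_powr RL RT)
    then show ?thesis by (simp add: F_eps_def R_L_def R_T_def R_B_def)
  qed
  have "g ` {0..L} = \<gamma> ` {0..L}" using g by auto
  then have "radon_converges (\<lambda>\<epsilon>. interface_measure \<epsilon> (u \<epsilon>)) (restrict_measure hausdorff1 (\<gamma> ` {0..L})) (at_right 0)"
  proof (elim subst, unfold radon_converges_def, intro conjI allI impI)
    show "\<forall>\<^sub>F \<epsilon> in at_right 0. radon_measure (interface_measure \<epsilon> (u \<epsilon>))"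
      using eventually_at_right_less[of "0::real"] by (elim eventually_mono) (intro radon_interface_measure u)
    show "radon_measure (restrict_measure hausdorff1 (g ` {0..L}))" by (rule radon_hausdorff_curve)
    fix \<phi> :: "real^2 \<Rightarrow> real" assume "continuous_on UNIV \<phi> \<and> compact (closure {x. \<phi> x \<noteq> 0})"
    then have \<phi>: "continuous_on UNIV \<phi>" "compact (closure {x. \<phi> x \<noteq> 0})" by auto
    show "((\<lambda>\<epsilon>. \<integral>x. \<phi> x \<partial>interface_measure \<epsilon> (u \<epsilon>)) \<longlongrightarrow> (\<integral>x. \<phi> x \<partial>restrict_measure hausdorff1 (g ` {0..L}))) (at_right 0)"
      unfolding integral_hausdorff_curve[OF \<phi>(1)]
      by (rule conv[OF compact_support_uniformly_continuous[OF \<phi>]])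
  qed
  moreover have "smooth_on (ball 0 1) (u \<epsilon>)" "finite_energies \<epsilon> (u \<epsilon>)" if "\<epsilon> > 0" for \<epsilon>
    using u(1)[OF that] by (auto intro: smooth_on_real_polynomial_function finite_energies_polynomial)
  ultimately show ?thesis
    by (intro exI[of _ u] exI[of _ R_L] exI[of _ R_T] exI[of _ R_B] conjI allI impI RL RT RB F u(2))
      (simp_all add: R_L_def R_T_def R_B_def)
qed

end
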